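(* Let $X=(X_t)_{t\in[0,T]}$ be a zero-mean continuous Gaussian process with $X_0=0$, whose law on $C_0([0,T])$ has full support and which has a covariance measure $\mu$. Let $f\in C^2(\mathbb{R})$ be such that $f''$ is bounded, and set $\gamma(t)=\mathrm{Var}(X_t)$, $t\in[0,T]$. Then, for every $t\in[0,T]$, $$f(X_t)=f(X_0)+\int_0^t f'(X_s)\,\delta X_s+\frac12\int_0^t f''(X_s)\,d\gamma(s),$$ where $\int_0^t\cdot\,\delta X$ is the Skorohod integral with respect to $X$.
   Context: Fix $T>0$. $C_0([0,T])$ is the space of continuous functions on $[0,T]$ vanishing at $0$; the underlying probability space is $\Omega=C_0([0,T])$ with $X$ the canonical process and the (completed) $\sigma$-field generated by $X$. Let $R(s,t)=\mathrm{Cov}(X_s,X_t)$. For a rectangle $I=]a_1,b_1]\times]a_2,b_2]\subset[0,T]^2$ put $\Delta_IR=R(b_1,b_2)+R(a_1,a_2)-R(a_1,b_2)-R(b_1,a_2)$. $X$ has covariance measure $\mu$ if $I\mapsto\Delta_IR$ extends to a signed ($\sigma$-finite) measure $\mu$ on $\mathcal{B}([0,T]^2)$; thus $\mu([0,s]\times[0,t])=R(s,t)$. The function $\gamma$ is then of bounded variation. Skorohod integral. $L_\mu$ is the space of Borel functions $\varphi:[0,T]\to\mathbb{R}$ with $\|\varphi\|_{|\mathcal H|}^2:=\int_{[0,T]^2}|\varphi(u)||\varphi(v)|\,d|\mu|(u,v)<\infty$, with semiscalar product $\langle\varphi,\phi\rangle_{\mathcal H}=\int_{[0,T]^2}\varphi(u)\phi(v)\,d\mu(u,v)$.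 The Wiener integral $\varphi\mapsto\int_0^T\varphi\,dX$ is the linear map $L_\mu\to L^2(\Omega)$, continuous for $\|\cdot\|_{\mathcal H}$, with $\int 1_{[0,t]}dX=X_t$; it satisfies $E(\int_0^T\varphi dX)^2=\|\varphi\|_{\mathcal H}^2$. $Cyl$ is the set of random variables $F=f(\int\phi_1dX,\dots,\int\phi_ndX)$, $n\ge1$, $f\in C_b^\infty(\mathbb{R}^n)$, $\phi_i\in L_\mu$, and $DF=\sum_i\partial_if(\int\phi_1dX,\dots,\int\phi_ndX)\phi_i$. A process $u$ with $E\|u\|_{|\mathcal H|}^2<\infty$ belongs to $Dom(\delta)$ if there is a zero-mean $Z\in L^2(\Omega)$ with $E(FZ)=E\langle DF,u\rangle_{\mathcal H}$ for every $F\in Cyl$; such $Z$ is unique and $\int_0^Tu\,\delta X:=Z$. Moreover $\int_0^tu_s\,\delta X_s:=\int_0^Tu_s1_{[0,t]}(s)\,\delta X_s$ when $u1_{[0,t]}\in Dom(\delta)$. *)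

theory Defs
  imports "HOL-Probability.Probability"
begin

section \<open>Signed measures\<close>

text \<open>
  The values are extended reals, and only one of the two infinities may be taken. Sets outside
  \<open>sets M\<close> are irrelevant.
\<close>

definition signed_measure :: "'a measure \<Rightarrow> ('a set \<Rightarrow> ereal) \<Rightarrow> bool" where
  "signed_measure M \<mu> \<longleftrightarrow>
     \<mu> {} = 0 \<and>
     ((\<forall>A\<in>sets M. \<mu> A \<noteq> \<infinity>) \<or> (\<forall>A\<in>sets M. \<mu> A \<noteq> -\<infinity>)) \<and>
     (\<forall>A :: nat \<Rightarrow> 'a set. range A \<subseteq> sets M \<longrightarrow> disjoint_family A \<longrightarrow>
        (\<lambda>i. \<mu> (A i)) sums \<mu> (\<Union>i. A i))"

text \<open>
  Jordan decomposition: the positive part of \<open>\<mu>\<close> is \<open>A \<mapsto> sup {\<mu> B | B \<subseteq> A}\<close>, and the negative part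
  is the positive part of \<open>-\<mu>\<close>.
\<close>

definition jordan_pos :: "'a measure \<Rightarrow> ('a set \<Rightarrow> ereal) \<Rightarrow> 'a measure" where
  "jordan_pos M \<mu> =
     measure_of (space M) (sets M) (\<lambda>A. SUP B\<in>{B \<in> sets M. B \<subseteq> A}. e2ennreal (\<mu> B))"

definition jordan_neg :: "'a measure \<Rightarrow> ('a set \<Rightarrow> ereal) \<Rightarrow> 'a measure" where
  "jordan_neg M \<mu> = jordan_pos M (\<lambda>A. - \<mu> A)"

definition variation :: "'a measure \<Rightarrow> ('a set \<Rightarrow> ereal) \<Rightarrow> 'a measure" where
  "variation M \<mu> =
     measure_of (space M) (sets M) (\<lambda>A. emeasure (jordan_pos M \<mu>) A + emeasure (jordan_neg M \<mu>) A)"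

definition signed_integral :: "'a measure \<Rightarrow> ('a set \<Rightarrow> ereal) \<Rightarrow> ('a \<Rightarrow> real) \<Rightarrow> real" where
  "signed_integral M \<mu> h = integral\<^sup>L (jordan_pos M \<mu>) h - integral\<^sup>L (jordan_neg M \<mu>) h"

text \<open>
  The Lebesgue-Stieltjes signed measure of a right-continuous function \<open>g\<close> of bounded variation
  on \<open>[0,T]\<close>, without mass at \<open>0\<close>. It is unique on the Borel sets of \<open>[0,T]\<close>.
\<close>

definition stieltjes_measure :: "real \<Rightarrow> (real \<Rightarrow> real) \<Rightarrow> real set \<Rightarrow> ereal" where
  "stieltjes_measure T g =
     (SOME \<nu>. signed_measure (restrict_space borel {0..T}) \<nu> \<and> \<nu> {0} = 0 \<and>
        (\<forall>a b. 0 \<le> a \<and> a \<le> b \<and> b \<le> T \<longrightarrow> \<nu> {a<..b} = ereal (g b - g a)))"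

definition stieltjes_integral :: "real \<Rightarrow> (real \<Rightarrow> real) \<Rightarrow> (real \<Rightarrow> real) \<Rightarrow> real \<Rightarrow> real" where
  "stieltjes_integral T g h t =
     signed_integral (restrict_space borel {0..T}) (stieltjes_measure T g)
       (\<lambda>s. h s * indicator {0..t} s)"


section \<open>The canonical process on \<open>C\<^sub>0([0,T])\<close>\<close>

text \<open>
  Paths are functions on the whole line that are \<open>undefined\<close> outside \<open>[0,T]\<close> (this is built into
  \<^const>\<open>cfunspace\<close>); the metric is the sup distance. The canonical process is \<open>X\<^sub>t w = w t\<close>.
\<close>

definition C0_metric :: "real \<Rightarrow> (real \<Rightarrow> real) metric" where
  "C0_metric T = submetric (cfunspace (top_of_set {0..T}) euclidean_metric) {w. w 0 = 0}"

definition C0_algebra :: "real \<Rightarrow> (real \<Rightarrow> real) measure" where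
  "C0_algebra T = sigma (mspace (C0_metric T))
     {{w \<in> mspace (C0_metric T). w t \<in> B} | t B. t \<in> {0..T} \<and> B \<in> sets borel}"

definition full_support :: "real \<Rightarrow> (real \<Rightarrow> real) measure \<Rightarrow> bool" where
  "full_support T P \<longleftrightarrow>
     (\<forall>U. openin (mtopology_of (C0_metric T)) U \<longrightarrow> U \<noteq> {} \<longrightarrow> emeasure P U > 0)"

text \<open>Constants count as (degenerate) Gaussian random variables.\<close>

definition gaussian_rv :: "'a measure \<Rightarrow> ('a \<Rightarrow> real) \<Rightarrow> bool" where
  "gaussian_rv P Y \<longleftrightarrow> Y \<in> borel_measurable P \<and>
     ((\<exists>m. AE w in P. Y w = m) \<or>
      (\<exists>m s. s > 0 \<and> distributed P lborel Y (normal_density m s)))"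

definition gaussian_process :: "real \<Rightarrow> (real \<Rightarrow> real) measure \<Rightarrow> bool" where
  "gaussian_process T P \<longleftrightarrow>
     (\<forall>I (c :: real \<Rightarrow> real). finite I \<longrightarrow> I \<subseteq> {0..T} \<longrightarrow> gaussian_rv P (\<lambda>w. \<Sum>t\<in>I. c t * w t))"

definition covariance_fun :: "(real \<Rightarrow> real) measure \<Rightarrow> real \<Rightarrow> real \<Rightarrow> real" where
  "covariance_fun P s t =
     integral\<^sup>L P (\<lambda>w. (w s - integral\<^sup>L P (\<lambda>v. v s)) * (w t - integral\<^sup>L P (\<lambda>v. v t)))"


section \<open>Covariance measure and Wiener integral\<close>

abbreviation interval_borel :: "real \<Rightarrow> real measure" where
  "interval_borel T \<equiv> restrict_space borel {0..T}"

abbreviation square_borel :: "real \<Rightarrow> (real \<times> real) measure" where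
  "square_borel T \<equiv> restrict_space borel ({0..T} \<times> {0..T})"

definition rect_increment :: "(real \<Rightarrow> real \<Rightarrow> real) \<Rightarrow> real \<Rightarrow> real \<Rightarrow> real \<Rightarrow> real \<Rightarrow> real" where
  "rect_increment R a1 b1 a2 b2 = R b1 b2 + R a1 a2 - R a1 b2 - R b1 a2"

text \<open>
  The half-open rectangles do not meet the two axes, where the process vanishes. The last
  clause says that \<open>\<mu>\<close> does not charge the axes.
\<close>

definition covariance_measure ::
    "real \<Rightarrow> (real \<Rightarrow> real) measure \<Rightarrow> ((real \<times> real) set \<Rightarrow> ereal) \<Rightarrow> bool" where
  "covariance_measure T P \<mu> \<longleftrightarrow>
     signed_measure (square_borel T) \<mu> \<and>
     sigma_finite_measure (variation (square_borel T) \<mu>) \<and>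
     (\<forall>a1 b1 a2 b2. 0 \<le> a1 \<and> a1 \<le> b1 \<and> b1 \<le> T \<and> 0 \<le> a2 \<and> a2 \<le> b2 \<and> b2 \<le> T \<longrightarrow>
        \<mu> ({a1<..b1} \<times> {a2<..b2}) = ereal (rect_increment (covariance_fun P) a1 b1 a2 b2)) \<and>
     (\<forall>s\<in>{0..T}. \<forall>t\<in>{0..T}. \<mu> ({0..s} \<times> {0..t}) = ereal (covariance_fun P s t))"

definition abs_H_norm_sq :: "real \<Rightarrow> ((real \<times> real) set \<Rightarrow> ereal) \<Rightarrow> (real \<Rightarrow> real) \<Rightarrow> ennreal" where
  "abs_H_norm_sq T \<mu> \<phi> =
     (\<integral>\<^sup>+(a, b). ennreal (\<bar>\<phi> a\<bar> * \<bar>\<phi> b\<bar>) \<partial>variation (square_borel T) \<mu>)"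

definition L_mu :: "real \<Rightarrow> ((real \<times> real) set \<Rightarrow> ereal) \<Rightarrow> (real \<Rightarrow> real) set" where
  "L_mu T \<mu> = {\<phi> \<in> borel_measurable (interval_borel T). abs_H_norm_sq T \<mu> \<phi> < \<infinity>}"

definition H_inner ::
    "real \<Rightarrow> ((real \<times> real) set \<Rightarrow> ereal) \<Rightarrow> (real \<Rightarrow> real) \<Rightarrow> (real \<Rightarrow> real) \<Rightarrow> real" where
  "H_inner T \<mu> \<phi> \<psi> = signed_integral (square_borel T) \<mu> (\<lambda>(a, b). \<phi> a * \<psi> b)"

definition H_norm :: "real \<Rightarrow> ((real \<times> real) set \<Rightarrow> ereal) \<Rightarrow> (real \<Rightarrow> real) \<Rightarrow> real" where
  "H_norm T \<mu> \<phi> = sqrt (H_inner T \<mu> \<phi> \<phi>)"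

text \<open>
  \<open>H_inner\<close> is given by an absolutely convergent integral only if the following holds. For
  arbitrary \<open>\<phi>\<close>, \<open>\<psi>\<close> in \<open>L_mu\<close> it may fail, since \<open>|\<mu>|\<close> need not be positive semidefinite.
\<close>

definition H_inner_defined ::
    "real \<Rightarrow> ((real \<times> real) set \<Rightarrow> ereal) \<Rightarrow> (real \<Rightarrow> real) \<Rightarrow> (real \<Rightarrow> real) \<Rightarrow> bool" where
  "H_inner_defined T \<mu> \<phi> \<psi> \<longleftrightarrow>
     integrable (variation (square_borel T) \<mu>) (\<lambda>(a, b). \<phi> a * \<psi> b)"

definition L2_rv :: "'a measure \<Rightarrow> ('a \<Rightarrow> real) set" where
  "L2_rv M = {Y \<in> borel_measurable M. integrable M (\<lambda>w. (Y w)\<^sup>2)}"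

text \<open>
  These properties determine \<open>W \<phi>\<close> up to null sets. Linearity and continuity are stated for
  those combinations that stay in \<open>L_mu\<close>.
\<close>

definition is_wiener_integral ::
    "(real \<Rightarrow> real) measure \<Rightarrow> real \<Rightarrow> ((real \<times> real) set \<Rightarrow> ereal) \<Rightarrow>
     ((real \<Rightarrow> real) \<Rightarrow> (real \<Rightarrow> real) \<Rightarrow> real) \<Rightarrow> bool" where
  "is_wiener_integral \<Omega> T \<mu> W \<longleftrightarrow>
     (\<forall>\<phi>\<in>L_mu T \<mu>. W \<phi> \<in> L2_rv \<Omega>) \<and>
     (\<forall>\<phi>\<in>L_mu T \<mu>. \<forall>\<psi>\<in>L_mu T \<mu>. \<forall>c d. (\<lambda>s. c * \<phi> s + d * \<psi> s) \<in> L_mu T \<mu> \<longrightarrow>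
        (AE w in \<Omega>. W (\<lambda>s. c * \<phi> s + d * \<psi> s) w = c * W \<phi> w + d * W \<psi> w)) \<and>
     (\<forall>\<phi>\<in>L_mu T \<mu>. \<forall>\<psi>::nat \<Rightarrow> real \<Rightarrow> real.
        (\<forall>k. \<psi> k \<in> L_mu T \<mu> \<and> (\<lambda>s. \<psi> k s - \<phi> s) \<in> L_mu T \<mu>) \<longrightarrow>
        (\<lambda>k. H_norm T \<mu> (\<lambda>s. \<psi> k s - \<phi> s)) \<longlonglongrightarrow> 0 \<longrightarrow>
        (\<lambda>k. integral\<^sup>L \<Omega> (\<lambda>w. (W (\<psi> k) w - W \<phi> w)\<^sup>2)) \<longlonglongrightarrow> 0) \<and>
     (\<forall>t\<in>{0..T}. AE w in \<Omega>. W (indicator {0..t}) w = w t)"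


section \<open>Cylindrical random variables and the Skorohod integral\<close>

text \<open>
  A function on \<open>\<real>\<^sup>n\<close> is represented by a function of sequences that depends on the first \<open>n\<close>
  coordinates only; for such functions, continuity in the product topology on sequences is
  continuity on \<open>\<real>\<^sup>n\<close>.
\<close>

definition partial_deriv :: "nat \<Rightarrow> ((nat \<Rightarrow> real) \<Rightarrow> real) \<Rightarrow> (nat \<Rightarrow> real) \<Rightarrow> real" where
  "partial_deriv i g x = deriv (\<lambda>h. g (x(i := h))) (x i)"

definition Cb_infinity :: "nat \<Rightarrow> ((nat \<Rightarrow> real) \<Rightarrow> real) set" where
  "Cb_infinity n = {g.
     (\<forall>x y. (\<forall>i<n. x i = y i) \<longrightarrow> g x = g y) \<and>
     (\<forall>is. set is \<subseteq> {..<n} \<longrightarrow>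
        continuous_on UNIV (foldr partial_deriv is g) \<and>
        bounded (range (foldr partial_deriv is g)) \<and>
        (\<forall>i<n. \<forall>x. (\<lambda>h. foldr partial_deriv is g (x(i := h))) differentiable at (x i)))}"

definition cyl_rv ::
    "((real \<Rightarrow> real) \<Rightarrow> (real \<Rightarrow> real) \<Rightarrow> real) \<Rightarrow> ((nat \<Rightarrow> real) \<Rightarrow> real) \<Rightarrow> (nat \<Rightarrow> real \<Rightarrow> real) \<Rightarrow>
     (real \<Rightarrow> real) \<Rightarrow> real" where
  "cyl_rv W g \<phi> w = g (\<lambda>j. W (\<phi> j) w)"

definition cyl_deriv ::
    "((real \<Rightarrow> real) \<Rightarrow> (real \<Rightarrow> real) \<Rightarrow> real) \<Rightarrow> nat \<Rightarrow> ((nat \<Rightarrow> real) \<Rightarrow> real) \<Rightarrow>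
     (nat \<Rightarrow> real \<Rightarrow> real) \<Rightarrow> (real \<Rightarrow> real) \<Rightarrow> real \<Rightarrow> real" where
  "cyl_deriv W n g \<phi> w s = (\<Sum>i<n. partial_deriv i g (\<lambda>j. W (\<phi> j) w) * \<phi> i s)"

text \<open>
  \<open>has_skorohod_integral \<Omega> T \<mu> W u Z\<close>: the process \<open>u\<close> is in \<open>Dom(\<delta>)\<close> and \<open>Z\<close> is its Skorohod
  integral. The duality relation is required for every \<open>F\<close> in \<open>Cyl\<close> (in every representation)
  for which \<open>E\<langle>DF, u\<rangle>\<close> is meaningful. Whenever the semiscalar product is given by convergent
  integrals on all of \<open>L_mu\<close> and \<open>L_mu\<close> is a linear space, this holds for every \<open>F\<close> in \<open>Cyl\<close>;
  without the two guards, the library's value \<open>0\<close> for divergent integrals would enter.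
\<close>

definition has_skorohod_integral ::
    "(real \<Rightarrow> real) measure \<Rightarrow> real \<Rightarrow> ((real \<times> real) set \<Rightarrow> ereal) \<Rightarrow>
     ((real \<Rightarrow> real) \<Rightarrow> (real \<Rightarrow> real) \<Rightarrow> real) \<Rightarrow>
     ((real \<Rightarrow> real) \<Rightarrow> real \<Rightarrow> real) \<Rightarrow> ((real \<Rightarrow> real) \<Rightarrow> real) \<Rightarrow> bool" where
  "has_skorohod_integral \<Omega> T \<mu> W u Z \<longleftrightarrow>
     (\<lambda>(w, s). u w s) \<in> borel_measurable (\<Omega> \<Otimes>\<^sub>M interval_borel T) \<and>
     (\<integral>\<^sup>+w. abs_H_norm_sq T \<mu> (u w) \<partial>\<Omega>) < \<infinity> \<and>
     Z \<in> L2_rv \<Omega> \<and> integral\<^sup>L \<Omega> Z = 0 \<and>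
     (\<forall>n\<ge>1. \<forall>g\<in>Cb_infinity n. \<forall>\<phi>. (\<forall>i<n. \<phi> i \<in> L_mu T \<mu>) \<longrightarrow>
        (AE w in \<Omega>. H_inner_defined T \<mu> (cyl_deriv W n g \<phi> w) (u w)) \<longrightarrow>
        integrable \<Omega> (\<lambda>w. H_inner T \<mu> (cyl_deriv W n g \<phi> w) (u w)) \<longrightarrow>
        integral\<^sup>L \<Omega> (\<lambda>w. cyl_rv W g \<phi> w * Z w) =
        integral\<^sup>L \<Omega> (\<lambda>w. H_inner T \<mu> (cyl_deriv W n g \<phi> w) (u w)))"

end

theory Submission
  imports Defs
begin

text \<open>
  A covariance measure has finite mass, since its value on the whole square is \<open>Var X\<^sub>T\<close>; hence its
  Jordan parts are finite, and \<open>d\<gamma>\<close> is the image of \<open>\<mu>\<close> under \<open>(x, y) \<mapsto> max x y\<close>.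
  For a cylindrical \<open>F\<close> over step functions, expand \<open>f(X\<^sub>b) - f(X\<^sub>a)\<close> along a mesh by the trapezoidal
  rule. The Taylor remainder is \<open>o\<close> of \<open>Var(X\<^sub>b - X\<^sub>a)\<close>, and these variances have sum at most
  \<open>|\<mu>|\<close>. Gaussian integration by parts turns \<open>E[F (f'(X\<^sub>a) + f'(X\<^sub>b))/2 (X\<^sub>b - X\<^sub>a)]\<close> into a
  Riemann sum for \<open>E\<langle>DF, u\<rangle>\<close> with \<open>u\<^sub>s = f'(X\<^sub>s)\<close> plus \<open>E[F f''(X)] / 2\<close> times
  \<open>Cov(X\<^sub>a + X\<^sub>b, X\<^sub>b - X\<^sub>a) = \<gamma>(b) - \<gamma>(a)\<close>; this is the duality relation.

  Bounded integrands follow by \<open>L\<^sup>2\<close>-approximation. A general element of \<open>L\<^sub>\<mu>\<close> is truncated: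
  the Cauchy-Schwarz inequality of the semiscalar product lets \<open>\<langle>\<phi>\<^sup>k, u\<rangle>\<close> converge, and absolute
  convergence of \<open>\<langle>DF, u\<rangle>\<close> identifies the limit.
\<close>

section \<open>Real-valued signed measures\<close>

text \<open>Averaging \<open>f'\<close> over both ends of a mesh cell is what avoids quadratic
  variation: a one-sided expansion would leave \<open>f''(X_a) (X_b - X_a)^2 / 2\<close>, which is
  not negligible when \<open>\<mu>\<close> charges the diagonal. With the average this term cancels
  up to the stated error, and the diagonal gets no separate treatment.

  Gaussian calculus is confined to finite linear combinations of coordinates, because the law of a
  Wiener integral is accessible only through limits. Covariance matrices may be singular, so
  independence of uncorrelated variables is derived from Fourier transforms.

  The obstacle in the limits is that \<open>|\<mu>|\<close> need not be positive semidefinite, so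
  the norm of \<open>L_mu\<close> obeys no Cauchy-Schwarz inequality. Two quantities replace it: for
  bounded functions the mean square norm for the sum of both marginals of \<open>|\<mu>|\<close>, in
  which step functions approximate them; for truncated elements of \<open>L_mu\<close> the
  semiscalar square, which is nonnegative as a limit of variances.\<close>

definition add_measure :: "'a measure \<Rightarrow> 'a measure \<Rightarrow> 'a measure" where
  "add_measure M N = measure_of (space M) (sets M) (\<lambda>A. emeasure M A + emeasure N A)"

lemma space_add_measure [simp]: "space (add_measure M N) = space M"
  and sets_add_measure [simp, measurable_cong]: "sets (add_measure M N) = sets M"
  by (simp_all add: add_measure_def)

lemma emeasure_add_measure:
  assumes "sets N = sets M" "A \<in> sets M"
  shows "emeasure (add_measure M N) A = emeasure M A + emeasure N A"
proof (rule emeasure_measure_of[OF add_measure_def])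
  show "countably_additive (sets (add_measure M N)) (\<lambda>A. emeasure M A + emeasure N A)"
    using assms(1)
    by (auto simp: countably_additive_def suminf_add[symmetric] suminf_emeasure)
qed (use assms sets.space_closed in \<open>auto simp: positive_def\<close>)

lemma measurable_add_measure [simp]: "measurable (add_measure M N) K = measurable M K"
  by (rule measurable_cong_sets) simp_all

lemma nn_integral_add_measure:
  assumes N: "sets N = sets M" and h: "h \<in> borel_measurable M"
  shows "(\<integral>\<^sup>+x. h x \<partial>add_measure M N) = (\<integral>\<^sup>+x. h x \<partial>M) + (\<integral>\<^sup>+x. h x \<partial>N)"
  using h
proof (induction rule: borel_measurable_induct)
  case (cong f g)
  have "(\<integral>\<^sup>+x. f x \<partial>K) = (\<integral>\<^sup>+x. g x \<partial>K)" if "space K = space M" for K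
    using cong(3) that by (auto intro!: nn_integral_cong)
  then show ?case
    using sets_eq_imp_space_eq[OF N] cong(4) by simp
next
  case (set A)
  then show ?case using N by (simp add: emeasure_add_measure)
next
  case (mult u c)
  then show ?case using N by (simp add: nn_integral_cmult distrib_left cong: measurable_cong_sets)
next
  case (add u v)
  then show ?case using N by (simp add: nn_integral_add ac_simps cong: measurable_cong_sets)
next
  case (seq U)
  have [measurable]: "U i \<in> borel_measurable M" "U i \<in> borel_measurable N" for i
    using seq(1) N by (simp_all cong: measurable_cong_sets)
  have eq: "(\<integral>\<^sup>+x. (SUP i. U i) x \<partial>K) = (SUP i. \<integral>\<^sup>+x. U i x \<partial>K)"
    if "\<And>i. U i \<in> borel_measurable K" for K
    unfolding SUP_apply using nn_integral_monotone_convergence_SUP[OF \<open>incseq U\<close>] that by simp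
  have inc: "incseq (\<lambda>i. \<integral>\<^sup>+x. U i x \<partial>K)" for K
    using \<open>incseq U\<close> by (auto simp: incseq_def le_fun_def intro!: nn_integral_mono)
  show ?case
    using N by (simp only: eq[of M] eq[of N] eq[of "add_measure M N"] measurable_add_measure \<open>\<And>i. U i \<in> borel_measurable M\<close>
        \<open>\<And>i. U i \<in> borel_measurable N\<close> seq.IH ennreal_SUP_add[OF inc inc])
qed

lemma integrable_add_measure_iff:
  fixes h :: "'a \<Rightarrow> real"
  assumes "sets N = sets M" 
  shows "integrable (add_measure M N) h \<longleftrightarrow> integrable M h \<and> integrable N h"
proof -
  have "h \<in> borel_measurable N \<longleftrightarrow> h \<in> borel_measurable M"
    using assms by (simp cong: measurable_cong_sets)
  then show ?thesis
    by (auto simp: integrable_iff_bounded nn_integral_add_measure[OF assms] ennreal_add_less_top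
        cong: measurable_cong_sets)
qed

lemma integral_add_measure:
  fixes h :: "'a \<Rightarrow> real"
  assumes "sets N = sets M" "integrable M h" "integrable N h"
  shows "integral\<^sup>L (add_measure M N) h = integral\<^sup>L M h + integral\<^sup>L N h"
proof -
  have [measurable]: "h \<in> borel_measurable M" using assms by simp
  \<comment> \<open>\<open>enn2real\<close> is additive only on finite values, so all four one-sided
    integrals are first shown to be finite.\<close>
  have fin: "(\<integral>\<^sup>+x. ennreal (h x) \<partial>M) < \<infinity>" "(\<integral>\<^sup>+x. ennreal (h x) \<partial>N) < \<infinity>"
       "(\<integral>\<^sup>+x. ennreal (- h x) \<partial>M) < \<infinity>" "(\<integral>\<^sup>+x. ennreal (- h x) \<partial>N) < \<infinity>"
    using assms(2,3) unfolding real_integrable_def by (auto simp: less_top)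
  show ?thesis
    using assms fin
    by (simp add: real_lebesgue_integral_def integrable_add_measure_iff nn_integral_add_measure
        enn2real_plus less_top)
qed

lemma finite_add_measure:
  assumes "finite_measure M" "finite_measure N" "sets N = sets M"
  shows "finite_measure (add_measure M N)"
  using assms sets_eq_imp_space_eq[OF assms(3)]
  by (intro finite_measureI) (simp add: emeasure_add_measure finite_measure.emeasure_finite ennreal_add_eq_top)

text \<open>The real version \<open>m\<close> of the values travels with \<open>\<mu>\<close>, so
  that differences and series are ordinary real arithmetic; \<open>\<mu>\<close> itself stays
  because the Jordan parts and the signed integral are formulated for it.\<close>

locale real_signed_measure =
  fixes M :: "'a measure" and \<mu> :: "'a set \<Rightarrow> ereal" and m :: "'a set \<Rightarrow> real"
  assumes \<mu>_eq: "\<And>A. A \<in> sets M \<Longrightarrow> \<mu> A = ereal (m A)"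
    and m_empty: "m {} = 0"
    and m_sums: "\<And>A :: nat \<Rightarrow> 'a set. range A \<subseteq> sets M \<Longrightarrow> disjoint_family A \<Longrightarrow>
      (\<lambda>i. m (A i)) sums m (\<Union>i. A i)"
begin

lemma m_Un:
  assumes "A \<in> sets M" "B \<in> sets M" "A \<inter> B = {}"
  shows "m (A \<union> B) = m A + m B"
proof -
  have "(\<lambda>i. m (binaryset A B i)) sums m (\<Union>i. binaryset A B i)"
    using assms by (intro m_sums) (auto simp: range_binaryset_eq disjoint_family_on_def binaryset_def)
  moreover have "(\<lambda>i. m (binaryset A B i)) sums (m A + m B)"
    using sums_finite[of "{0,1}" "\<lambda>i. m (binaryset A B i)"] m_empty
    by (auto simp: binaryset_def)
  ultimately show ?thesis using sums_unique2 by (force simp: UN_binaryset_eq)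
qed

lemma m_Diff:
  assumes "A \<in> sets M" "B \<in> sets M" "B \<subseteq> A"
  shows "m (A - B) = m A - m B"
  using m_Un[of "A - B" B] assms by (simp add: Diff_Int_distrib2 Un_absorb2 Int_commute)

lemma uminus: "real_signed_measure M (\<lambda>A. - \<mu> A) (\<lambda>A. - m A)"
  using \<mu>_eq m_empty sums_minus[OF m_sums] by unfold_locales auto

text \<open>The mass of the positive part. \<open>ennreal\<close> sends negative reals to 0, so sets
  of negative measure do not affect the supremum.\<close>

definition pos :: "'a set \<Rightarrow> ennreal" where
  "pos A = (SUP B\<in>{B \<in> sets M. B \<subseteq> A}. ennreal (m B))"

lemma pos_upper: "B \<in> sets M \<Longrightarrow> B \<subseteq> A \<Longrightarrow> ennreal (m B) \<le> pos A"
  unfolding pos_def by (intro SUP_upper) auto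

lemma pos_mono: "A \<subseteq> B \<Longrightarrow> pos A \<le> pos B"
  unfolding pos_def by (rule SUP_subset_mono) auto

lemma pos_least: "(\<And>B. B \<in> sets M \<Longrightarrow> B \<subseteq> A \<Longrightarrow> ennreal (m B) \<le> c) \<Longrightarrow> pos A \<le> c"
  unfolding pos_def by (intro SUP_least) auto

lemma pos_empty: "pos {} = 0"
  using pos_least[of "{}" 0] m_empty by auto

text \<open>If \<open>pos A\<close> is 0, the empty set will do. Otherwise some set beats
  \<open>pos A - e\<close>, which lies strictly below the finite \<open>pos A\<close>, and such a
  set cannot have negative measure, because \<open>ennreal\<close> would turn that into 0.\<close>

lemma pos_approx:
  assumes "A \<in> sets M" "pos A \<noteq> \<infinity>" "e > 0"
  obtains B where "B \<in> sets M" "B \<subseteq> A" "0 \<le> m B" "pos A \<le> ennreal (m B + e)"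
proof (cases "pos A = 0")
  case True
  then show ?thesis using that[of "{}"] m_empty by auto
next
  case False
  have "pos A - ennreal e < pos A"
    using False assms by (intro ennreal_between) (auto simp: less_top zero_less_iff_neq_zero)
  then obtain B where B: "B \<in> sets M" "B \<subseteq> A" "pos A - ennreal e < ennreal (m B)"
    unfolding pos_def less_SUP_iff by auto
  have "m B \<ge> 0"
  proof (rule ccontr)
    assume "\<not> 0 \<le> m B"
    then show False using B(3) by (simp add: ennreal_neg)
  qed
  moreover have "pos A \<le> ennreal e + ennreal (m B)"
    using less_imp_le[OF B(3)] unfolding ennreal_minus_le_iff by simp
  then have "pos A \<le> ennreal (m B + e)"
    using \<open>m B \<ge> 0\<close> assms(3) by (simp add: ac_simps)
  ultimately show ?thesis using that B by auto
qed

text \<open>This prepares additivity: \<open>ennreal\<close> commutes with sums of nonnegative reals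
  only, so competitors of negative measure have to be discarded first.\<close>

lemma pos_nonneg_upper:
  assumes "A \<in> sets M"
  shows "pos A = (SUP B\<in>{B \<in> sets M. B \<subseteq> A \<and> 0 \<le> m B}. ennreal (m B))" (is "_ = ?r")
proof (rule antisym)
  show "pos A \<le> ?r"
  proof (rule pos_least)
    fix B assume B: "B \<in> sets M" "B \<subseteq> A"
    have "{} \<in> {B \<in> sets M. B \<subseteq> A \<and> 0 \<le> m B}" using m_empty by auto
    then show "ennreal (m B) \<le> ?r"
      using B by (cases "0 \<le> m B") (auto intro!: SUP_upper simp: ennreal_neg)
  qed
  show "?r \<le> pos A" by (intro SUP_least pos_upper) auto
qed

text \<open>Competitors inside two disjoint sets unite to a competitor inside the union.\<close>

lemma pos_add_le:
  assumes "A \<in> sets M" "B \<in> sets M" "A \<inter> B = {}"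
  shows "pos A + pos B \<le> pos (A \<union> B)"
proof -
  have "pos A + pos B = (SUP C\<in>{C \<in> sets M. C \<subseteq> A \<and> 0 \<le> m C}.
      SUP D\<in>{D \<in> sets M. D \<subseteq> B \<and> 0 \<le> m D}. ennreal (m C) + ennreal (m D))"
  proof -
    have "{} \<in> {B \<in> sets M. B \<subseteq> A \<and> 0 \<le> m B}" for A using m_empty by auto
    then have ne: "{B \<in> sets M. B \<subseteq> A \<and> 0 \<le> m B} \<noteq> {}" for A by blast
    show ?thesis
      unfolding pos_nonneg_upper[OF assms(1)] pos_nonneg_upper[OF assms(2)]
      by (subst ennreal_SUP_add_left[OF ne, symmetric])
         (intro SUP_cong refl ennreal_SUP_add_right[OF ne])
  qed
  also have "\<dots> \<le> pos (A \<union> B)"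
  proof (intro SUP_least)
    fix C D assume "C \<in> {C \<in> sets M. C \<subseteq> A \<and> 0 \<le> m C}" "D \<in> {D \<in> sets M. D \<subseteq> B \<and> 0 \<le> m D}"
    moreover from this assms(3) have "C \<inter> D = {}" by auto
    ultimately show "ennreal (m C) + ennreal (m D) \<le> pos (A \<union> B)"
      using pos_upper[of "C \<union> D" "A \<union> B"] m_Un[of C D] by (auto simp flip: ennreal_plus)
  qed
  finally show ?thesis .
qed

text \<open>Superadditivity over finite unions gives one inequality. For the other, a competitor
  \<open>B\<close> of the union is cut along the \<open>A i\<close>, and its measure is the limit of
  the sums over the pieces.\<close>

lemma countably_additive_pos: "countably_additive (sets M) pos"
proof (rule countably_additiveI)
  fix A :: "nat \<Rightarrow> 'a set"
  assume A: "range A \<subseteq> sets M" "disjoint_family A"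
  have part: "(\<Sum>i<n. pos (A i)) \<le> pos (\<Union>i<n. A i)" for n
  proof (induction n)
    case (Suc n)
    have "(\<Sum>i<Suc n. pos (A i)) \<le> pos (\<Union>i<n. A i) + pos (A n)"
      using Suc by (auto intro: add_mono)
    also have "\<dots> \<le> pos ((\<Union>i<n. A i) \<union> A n)"
      using A by (intro pos_add_le) (auto simp: disjoint_family_on_def, metis disjoint_iff_not_equal less_irrefl)
    also have "(\<Union>i<n. A i) \<union> A n = (\<Union>i<Suc n. A i)" by (auto simp: less_Suc_eq)
    finally show ?case .
  qed (simp add: pos_empty)
  show "(\<Sum>i. pos (A i)) = pos (\<Union>i. A i)"
  proof (rule antisym)
    show "(\<Sum>i. pos (A i)) \<le> pos (\<Union>i. A i)"
      by (rule suminf_le_const) (auto intro!: order_trans[OF part] pos_mono)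
    show "pos (\<Union>i. A i) \<le> (\<Sum>i. pos (A i))"
    proof (rule pos_least)
      fix B assume B: "B \<in> sets M" "B \<subseteq> (\<Union>i. A i)"
      have "(\<lambda>i. m (B \<inter> A i)) sums m (\<Union>i. B \<inter> A i)"
        using A B by (intro m_sums) (auto simp: disjoint_family_on_def)
      moreover have "(\<Union>i. B \<inter> A i) = B" using B by auto
      ultimately have "(\<lambda>n. \<Sum>i<n. m (B \<inter> A i)) \<longlonglongrightarrow> m B" by (simp add: sums_def)
      then have lim: "(\<lambda>n. ennreal (\<Sum>i<n. m (B \<inter> A i))) \<longlonglongrightarrow> ennreal (m B)"
        by (rule tendsto_ennrealI)
      have "ennreal (\<Sum>i<n. m (B \<inter> A i)) \<le> (\<Sum>i. pos (A i))" for n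
      proof -
        \<comment> \<open>The pieces may have negative measure; truncation at 0 is subadditive, so
          only an inequality holds here, and it points in the right direction.\<close>
        have "ennreal (\<Sum>i<n. m (B \<inter> A i)) \<le> (\<Sum>i<n. ennreal (m (B \<inter> A i)))"
        proof (induction n)
          case (Suc n)
          have "ennreal ((\<Sum>i<n. m (B \<inter> A i)) + m (B \<inter> A n)) \<le> ennreal (\<Sum>i<n. m (B \<inter> A i)) + ennreal (m (B \<inter> A n))"
            by (cases "0 \<le> (\<Sum>i<n. m (B \<inter> A i))"; cases "0 \<le> m (B \<inter> A n)")
               (auto simp: ennreal_neg simp flip: ennreal_plus intro!: ennreal_leI)
          then show ?case using Suc by (simp add: order.trans add_mono)
        qed simp
        also have "\<dots> \<le> (\<Sum>i<n. pos (A i))"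
          using A B by (intro sum_mono pos_upper) auto
        also have "\<dots> \<le> (\<Sum>i. pos (A i))" by (rule sum_le_suminf) auto
        finally show ?thesis .
      qed
      then show "ennreal (m B) \<le> (\<Sum>i. pos (A i))"
        using LIMSEQ_le_const2[OF lim] by blast
    qed
  qed
qed

lemma sets_jordan_pos [simp, measurable_cong]: "sets (jordan_pos M \<mu>) = sets M"
  and space_jordan_pos [simp]: "space (jordan_pos M \<mu>) = space M"
  by (simp_all add: jordan_pos_def)

lemma emeasure_jordan_pos:
  assumes "A \<in> sets M"
  shows "emeasure (jordan_pos M \<mu>) A = pos A"
proof -
  have eq: "(SUP B\<in>{B \<in> sets M. B \<subseteq> A}. e2ennreal (\<mu> B)) = pos A" for A
    unfolding pos_def by (intro SUP_cong) (auto simp: \<mu>_eq e2ennreal_ereal)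
  have "jordan_pos M \<mu> = measure_of (space M) (sets M) pos"
    unfolding jordan_pos_def eq ..
  then show ?thesis
    by (rule emeasure_measure_of)
       (use assms sets.space_closed countably_additive_pos in
        \<open>auto simp: positive_def pos_empty jordan_pos_def\<close>)
qed

lemma sets_jordan_neg [simp, measurable_cong]: "sets (jordan_neg M \<mu>) = sets M"
  and space_jordan_neg [simp]: "space (jordan_neg M \<mu>) = space M"
  by (simp_all add: jordan_neg_def jordan_pos_def)

text \<open>Complements inside \<open>A\<close> exchange the two suprema:
  \<open>m (A - B) = m A - m B\<close>, hence \<open>- m B \<le> P A - m A\<close> and,
  symmetrically, \<open>m B \<le> N A + m A\<close>. The first bound also shows that the negative
  part is finite as soon as the positive part is.\<close>

lemma jordan_diff:
  assumes fin: "finite_measure (jordan_pos M \<mu>)"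
  shows finite_jordan_neg: "finite_measure (jordan_neg M \<mu>)"
    and measure_jordan_diff:
      "A \<in> sets M \<Longrightarrow> measure (jordan_pos M \<mu>) A - measure (jordan_neg M \<mu>) A = m A"
proof -
  interpret neg: real_signed_measure M "\<lambda>A. - \<mu> A" "\<lambda>A. - m A" by (rule uminus)
  have neg: "emeasure (jordan_neg M \<mu>) A = neg.pos A" if "A \<in> sets M" for A
    using neg.emeasure_jordan_pos[OF that] by (simp add: jordan_neg_def)
  define P where "P A = measure (jordan_pos M \<mu>) A" for A
  have P: "pos A = ennreal (P A)" if "A \<in> sets M" for A
    using finite_measure.emeasure_eq_measure[OF fin] emeasure_jordan_pos[OF that] by (simp add: P_def)
  have P0: "0 \<le> P A" for A by (simp add: P_def)
  have le_P: "m B \<le> P A" if "A \<in> sets M" "B \<in> sets M" "B \<subseteq> A" for A B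
    using pos_upper[OF that(2,3)] P[OF that(1)] P0[of A] by (simp add: ennreal_le_iff)
  have neg_le: "neg.pos A \<le> ennreal (P A - m A)" if A: "A \<in> sets M" for A
  proof (rule neg.pos_least)
    fix B assume B: "B \<in> sets M" "B \<subseteq> A"
    show "ennreal (- m B) \<le> ennreal (P A - m A)"
      using le_P[of A "A - B"] A B by (intro ennreal_leI) (auto simp: m_Diff)
  qed
  show fin': "finite_measure (jordan_neg M \<mu>)"
    using neg_le[of "space M"] neg[of "space M"]
    by (intro finite_measureI) (auto simp: top_unique)
  define N where "N A = measure (jordan_neg M \<mu>) A" for A
  have N: "neg.pos A = ennreal (N A)" if "A \<in> sets M" for A
    using finite_measure.emeasure_eq_measure[OF fin'] neg[OF that] by (simp add: N_def)
  have N0: "0 \<le> N A" for A by (simp add: N_def)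
  have le_N: "- m B \<le> N A" if "A \<in> sets M" "B \<in> sets M" "B \<subseteq> A" for A B
    using neg.pos_upper[OF that(2,3)] N[OF that(1)] N0[of A] by (simp add: ennreal_le_iff)
  show "measure (jordan_pos M \<mu>) A - measure (jordan_neg M \<mu>) A = m A" if A: "A \<in> sets M"
  proof -
    have "pos A \<le> ennreal (N A + m A)"
    proof (rule pos_least)
      fix B assume B: "B \<in> sets M" "B \<subseteq> A"
      show "ennreal (m B) \<le> ennreal (N A + m A)"
        using le_N[of A "A - B"] A B by (intro ennreal_leI) (auto simp: m_Diff)
    qed
    moreover have "0 \<le> N A + m A" using le_N[OF A A] by simp
    ultimately have "P A \<le> N A + m A" using P[OF A] by (simp add: ennreal_le_iff)
    moreover have "N A \<le> P A - m A"
      using neg_le[OF A] N[OF A] le_P[OF A A] by (simp add: ennreal_le_iff)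
    ultimately show ?thesis by (simp add: P_def N_def)
  qed
qed

lemma variation_eq: "variation M \<mu> = add_measure (jordan_pos M \<mu>) (jordan_neg M \<mu>)"
  by (simp add: variation_def add_measure_def)

text \<open>In each of the disjoint pieces \<open>D i\<close> of finite variation a set
  \<open>B i\<close> is chosen that is optimal up to \<open>(1/2)^i\<close>. The \<open>B i\<close>
  are disjoint, so the series of the \<open>m (B i)\<close> converges, its sum being the real value
  of \<open>m\<close> on their union; together with the geometric errors it bounds the positive part
  of the whole space.\<close>

lemma finite_jordan_pos:
  assumes "sigma_finite_measure (variation M \<mu>)"
  shows "finite_measure (jordan_pos M \<mu>)"
proof -
  interpret sigma_finite_measure "variation M \<mu>" by fact
  obtain D :: "nat \<Rightarrow> 'a set" where D: "range D \<subseteq> sets M" "(\<Union>i. D i) = space M"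
      "\<And>i. emeasure (variation M \<mu>) (D i) \<noteq> \<infinity>" "disjoint_family D"
    using sigma_finite_disjoint unfolding variation_eq by (simp, blast)
  have "pos (D i) \<noteq> \<infinity>" for i
    using D(1) D(3)[of i] emeasure_jordan_pos[of "D i"]
    by (auto simp: variation_eq emeasure_add_measure ennreal_add_eq_top)
  then have "\<exists>B. B \<in> sets M \<and> B \<subseteq> D i \<and> 0 \<le> m B \<and> pos (D i) \<le> ennreal (m B + (1/2)^i)" for i
    using D(1) pos_approx[of "D i" "(1/2)^i"]
      by (metis UNIV_I half_gt_zero_iff image_subset_iff zero_less_one zero_less_power)
  then obtain B where B: "\<And>i. B i \<in> sets M" "\<And>i. B i \<subseteq> D i" "\<And>i. 0 \<le> m (B i)"
      "\<And>i. pos (D i) \<le> ennreal (m (B i) + (1/2)^i)" by metis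
  have "disjoint_family B" using D(4) B(2) unfolding disjoint_family_on_def by (meson disjoint_iff subsetD)
  then have "summable (\<lambda>i. m (B i))" using m_sums[of B] B(1) by (auto simp: sums_iff)
  then have sm: "summable (\<lambda>i. m (B i) + (1/2)^i)" by (intro summable_add) (auto simp: summable_geometric)
  have "pos (space M) = (\<Sum>i. pos (D i))"
    using countably_additive_pos D by (auto simp: countably_additive_def)
  also have "\<dots> \<le> (\<Sum>i. ennreal (m (B i) + (1/2)^i))" using B(4) by (intro suminf_le) auto
  also have "\<dots> = ennreal (\<Sum>i. m (B i) + (1/2)^i)" using B(3) sm by (intro suminf_ennreal2) auto
  finally show ?thesis
    using emeasure_jordan_pos[of "space M"] by (intro finite_measureI) (auto simp: top_unique)
qed

end

section \<open>Independence of the decomposition and uniqueness of signed measures\<close>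

lemma real_signed_measure_diff:
  assumes "finite_measure a" "finite_measure b" "sets a = sets M" "sets b = sets M"
    and "\<And>A. A \<in> sets M \<Longrightarrow> \<mu> A = ereal (measure a A - measure b A)"
  shows "real_signed_measure M \<mu> (\<lambda>A. measure a A - measure b A)"
proof unfold_locales
  interpret a: finite_measure a by fact
  interpret b: finite_measure b by fact
  show "(\<lambda>i. measure a (A i) - measure b (A i)) sums (measure a (\<Union>i. A i) - measure b (\<Union>i. A i))"
    if "range A \<subseteq> sets M" "disjoint_family A" for A :: "nat \<Rightarrow> 'a set"
    using that assms(3,4) by (intro sums_diff a.finite_measure_UNION b.finite_measure_UNION) auto
qed (use assms in auto)

text \<open>The Jordan parts lie below the given \<open>a\<close> and \<open>b\<close>, which
  transfers integrability; and the positive part plus \<open>b\<close> equals \<open>a\<close> plus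
  the negative part as measures, so that the integrals can be rearranged. Later integrals can thus
  be computed from image measures instead of the Jordan parts.\<close>

lemma signed_integral_eq_diff:
  assumes "finite_measure a" "finite_measure b" "sets a = sets M" "sets b = sets M"
    and eq: "\<And>A. A \<in> sets M \<Longrightarrow> \<mu> A = ereal (measure a A - measure b A)"
    and h: "integrable a h" "integrable b h"
  shows "signed_integral M \<mu> h = integral\<^sup>L a h - integral\<^sup>L b h"
proof -
  interpret a: finite_measure a by fact
  interpret b: finite_measure b by fact
  interpret real_signed_measure M \<mu> "\<lambda>A. measure a A - measure b A"
    by (rule real_signed_measure_diff) fact+
  interpret neg: real_signed_measure M "\<lambda>A. - \<mu> A" "\<lambda>A. - (measure a A - measure b A)" by (rule uminus)
  let ?p = "jordan_pos M \<mu>" and ?n = "jordan_neg M \<mu>"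
  have p_le: "emeasure ?p A \<le> emeasure a A" if "A \<in> sets M" for A
    unfolding emeasure_jordan_pos[OF that] a.emeasure_eq_measure
    using a.finite_measure_mono that assms(3) by (intro pos_least ennreal_leI) (smt (verit) measure_nonneg)
  have n_le: "emeasure ?n A \<le> emeasure b A" if "A \<in> sets M" for A
    unfolding jordan_neg_def neg.emeasure_jordan_pos[OF that] b.emeasure_eq_measure
    using b.finite_measure_mono that assms(4)
      by (intro neg.pos_least ennreal_leI) (smt (verit) measure_nonneg)
  have fp: "finite_measure ?p"
    using p_le[of "space M"] a.emeasure_finite[of "space M"]
      by (intro finite_measureI) (auto simp: top_unique)
  have fn: "finite_measure ?n" using finite_jordan_neg[OF fp] .
  have mono: "integrable K h" if "integrable L h" "sets L = sets M" "sets K = sets M"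
      "\<And>A. A \<in> sets M \<Longrightarrow> emeasure K A \<le> emeasure L A" for K L
  proof -
    have "(\<integral>\<^sup>+x. ennreal (norm (h x)) \<partial>K) \<le> (\<integral>\<^sup>+x. ennreal (norm (h x)) \<partial>L)"
      using that by (intro nn_integral_mono_measure) (simp_all add: le_measure)
    then show ?thesis
      using that by (auto simp: integrable_iff_bounded cong: measurable_cong_sets)
  qed
  have hp: "integrable ?p h" using mono[OF h(1) assms(3) sets_jordan_pos] p_le by simp
  have hn: "integrable ?n h" using mono[OF h(2) assms(4) sets_jordan_neg] n_le by simp
  have "add_measure ?p b = add_measure a ?n"
  proof (rule measure_eqI)
    fix A assume "A \<in> sets (add_measure ?p b)"
    then have A: "A \<in> sets M" by simp
    show "emeasure (add_measure ?p b) A = emeasure (add_measure a ?n) A"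
      using measure_jordan_diff[OF fp A] A assms(3,4)
      by (simp add: emeasure_add_measure finite_measure.emeasure_eq_measure[OF fp] finite_measure.emeasure_eq_measure[OF fn]
          a.emeasure_eq_measure b.emeasure_eq_measure flip: ennreal_plus)
  qed (use assms in simp)
  then have "integral\<^sup>L ?p h + integral\<^sup>L b h = integral\<^sup>L a h + integral\<^sup>L ?n h"
    using integral_add_measure[of b ?p h] integral_add_measure[of ?n a h] assms hp hn by simp
  then show ?thesis by (simp add: signed_integral_def)
qed

lemma signed_measure_Un:
  assumes \<mu>: "signed_measure M \<mu>" and A: "A \<in> sets M" "B \<in> sets M" "A \<inter> B = {}"
  shows "\<mu> (A \<union> B) = \<mu> A + \<mu> B"
proof -
  have empty: "\<mu> {} = 0"
    and sums: "\<And>A :: nat \<Rightarrow> 'a set. range A \<subseteq> sets M \<Longrightarrow> disjoint_family A \<Longrightarrow> (\<lambda>i. \<mu> (A i)) sums \<mu> (\<Union>i. A i)"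
    using \<mu> unfolding signed_measure_def by auto
  have "(\<lambda>i. \<mu> (binaryset A B i)) sums \<mu> (\<Union>i. binaryset A B i)"
    using A by (intro sums) (auto simp: range_binaryset_eq disjoint_family_on_def binaryset_def)
  moreover have "(\<lambda>i. \<mu> (binaryset A B i)) sums (\<mu> A + \<mu> B)"
    using sums_finite[of "{0,1}" "\<lambda>i. \<mu> (binaryset A B i)"] empty by (auto simp: binaryset_def)
  ultimately show ?thesis using sums_unique2 by (force simp: UN_binaryset_eq)
qed

text \<open>A set and its complement add up to the finite total, which leaves no room for an
  infinite value on either of them.\<close>

lemma real_signed_measureI:
  assumes \<mu>: "signed_measure M \<mu>" and fin: "\<bar>\<mu> (space M)\<bar> \<noteq> \<infinity>"
  shows "real_signed_measure M \<mu> (\<lambda>A. real_of_ereal (\<mu> A))"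
proof -
  have empty: "\<mu> {} = 0"
    and sums: "\<And>A :: nat \<Rightarrow> 'a set. range A \<subseteq> sets M \<Longrightarrow> disjoint_family A \<Longrightarrow> (\<lambda>i. \<mu> (A i)) sums \<mu> (\<Union>i. A i)"
    and one: "(\<forall>A\<in>sets M. \<mu> A \<noteq> \<infinity>) \<or> (\<forall>A\<in>sets M. \<mu> A \<noteq> -\<infinity>)"
    using \<mu> unfolding signed_measure_def by auto
  have eq: "\<mu> A = ereal (real_of_ereal (\<mu> A))" if A: "A \<in> sets M" for A
  proof -
    let ?B = "space M - A"
    have "\<mu> (space M) = \<mu> A + \<mu> ?B"
      using signed_measure_Un[OF \<mu> A, of ?B] A sets.sets_into_space[OF A] by (simp add: Un_absorb1)
    then have "\<bar>\<mu> A\<bar> \<noteq> \<infinity>"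
      using fin one A by (cases "\<mu> A"; cases "\<mu> ?B") (auto dest!: bspec[of _ _ A] bspec[of _ _ ?B])
    then show ?thesis by (simp add: ereal_real)
  qed
  show ?thesis
  proof unfold_locales
    show "(\<lambda>i. real_of_ereal (\<mu> (A i))) sums real_of_ereal (\<mu> (\<Union>i. A i))"
      if A: "range A \<subseteq> sets M" "disjoint_family A" for A :: "nat \<Rightarrow> 'a set"
    proof -
      have "(\<Union>i. A i) \<in> sets M" "\<And>i. A i \<in> sets M" using A by auto
      then show ?thesis
        using sums[OF A] eq by (simp flip: sums_ereal)
    qed
  qed (use eq empty in auto)
qed

text \<open>The sets of agreement form a Dynkin class. Agreement on the whole space is assumed
  separately, since \<open>E\<close> may fail to contain it, and it is what complements call
  for.\<close>

lemma real_signed_measure_unique: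
  assumes "real_signed_measure M \<mu> m" "real_signed_measure M \<nu> k"
    and E: "Int_stable E" "E \<subseteq> Pow (space M)" "sets M = sigma_sets (space M) E"
    and eq: "\<And>A. A \<in> E \<Longrightarrow> m A = k A" "m (space M) = k (space M)"
    and A: "A \<in> sets M"
  shows "m A = k A"
proof -
  interpret m: real_signed_measure M \<mu> m by fact
  interpret k: real_signed_measure M \<nu> k by fact
  have "A \<in> sigma_sets (space M) E" using A E by simp
  from E(1,2) this show ?thesis
  proof (induction rule: sigma_sets_induct_disjoint)
    case (compl A)
    then show ?case using eq(2) E(3) sets.top[of M] m.m_Diff[of "space M" A] k.m_Diff[of "space M" A]
      by (simp add: sets.sets_into_space)
  next
    case (union A)
    then show ?case using sums_unique2[OF m.m_sums[of A]] k.m_sums[of A] E(3) by simp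
  qed (use eq m.m_empty k.m_empty in auto)
qed

lemma sets_restrict_borel_atMost:
  fixes S :: "'a :: ordered_euclidean_space set"
  assumes "S \<in> sets borel"
  shows "sets (restrict_space borel S) = sigma_sets S (range (\<lambda>a. S \<inter> {..a}))"
proof -
  have "sets (restrict_space borel S) = (\<inter>) S ` sigma_sets UNIV (range atMost)"
    unfolding sets_restrict_space borel_eq_atMost by simp
  also have "\<dots> = sigma_sets S ((\<inter>) S ` range atMost)"
    using assms arg_cong[OF borel_eq_atMost, where f=sets] by (intro sigma_sets_Int) auto
  finally show ?thesis by (simp add: image_image)
qed

text \<open>The order-theoretic form serves both for the square, where it gives the symmetry of the
  covariance measure, and for the interval, where it identifies the Stieltjes measure of the
  variance.\<close>

lemma real_signed_measure_unique_atMost: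
  fixes S :: "'a :: ordered_euclidean_space set"
  assumes "real_signed_measure (restrict_space borel S) \<mu> m"
    and "real_signed_measure (restrict_space borel S) \<nu> k"
    and S: "S \<in> sets borel" and eq: "\<And>a. m (S \<inter> {..a}) = k (S \<inter> {..a})" "m S = k S"
    and A: "A \<in> sets (restrict_space borel S)"
  shows "m A = k A"
proof (rule real_signed_measure_unique[OF assms(1,2) _ _ _ _ _ A])
  show "Int_stable (range (\<lambda>a. S \<inter> {..a}))"
  proof (rule Int_stableI_image)
    show "\<exists>c\<in>UNIV. (S \<inter> {..a}) \<inter> (S \<inter> {..b}) = S \<inter> {..c}" for a b
      by (intro bexI[of _ "inf a b"]) auto
  qed
  show "sets (restrict_space borel S) = sigma_sets (space (restrict_space borel S)) (range (\<lambda>a. S \<inter> {..a}))"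
    using sets_restrict_borel_atMost[OF S] by (simp add: space_restrict_space)
qed (use eq in \<open>auto simp: space_restrict_space\<close>)

section \<open>Gaussian integration by parts\<close>

text \<open>The normal density \<open>d\<close> satisfies \<open>d' = - x d\<close>, so the
  integrand times \<open>d\<close> is the derivative of \<open>- \<Phi> d\<close>, which vanishes at
  both infinities because \<open>\<Phi>\<close> grows at most linearly.\<close>

lemma std_normal_stein:
  fixes \<Phi> \<Phi>' :: "real \<Rightarrow> real"
  assumes deriv: "\<And>x. (\<Phi> has_real_derivative \<Phi>' x) (at x)"
    and cont: "continuous_on UNIV \<Phi>'"
    and bnd: "\<And>x. \<bar>\<Phi> x\<bar> \<le> C * (1 + \<bar>x\<bar>)" "\<And>x. \<bar>\<Phi>' x\<bar> \<le> C * (1 + \<bar>x\<bar>)"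
  shows "integrable std_normal_distribution (\<lambda>x. x * \<Phi> x - \<Phi>' x)"
    and "(LINT x|std_normal_distribution. x * \<Phi> x - \<Phi>' x) = 0"
proof -
  have cont\<Phi>: "continuous_on UNIV \<Phi>"
    using deriv by (meson DERIV_isCont continuous_at_imp_continuous_on)
  have [measurable]: "\<Phi> \<in> borel_measurable borel" "\<Phi>' \<in> borel_measurable borel"
    using cont cont\<Phi> by (auto intro: borel_measurable_continuous_onI)
  have bnd0: "0 \<le> C" using bnd(1)[of 0] by simp
  have intb: "integrable std_normal_distribution (\<lambda>x. 2 * C * (1 + x\<^sup>2))"
    using integrable_std_normal_distribution_moment[of 2] integrable_std_normal_distribution_moment[of 0]
      by simp
  have "\<bar>x * \<Phi> x - \<Phi>' x\<bar> \<le> 2 * C * (1 + x\<^sup>2)" for x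
  proof -
    have "\<bar>x * \<Phi> x - \<Phi>' x\<bar> \<le> \<bar>x\<bar> * (C * (1 + \<bar>x\<bar>)) + C * (1 + \<bar>x\<bar>)"
      using bnd(2)[of x] mult_left_mono[OF bnd(1), of "\<bar>x\<bar>" x]
      by (intro order.trans[OF abs_triangle_ineq4]) (auto simp: abs_mult)
    also have "\<dots> = C * (1 + \<bar>x\<bar>)\<^sup>2" by (simp add: power2_eq_square algebra_simps)
    also have "(1 + \<bar>x\<bar>)\<^sup>2 \<le> 2 * (1 + x\<^sup>2)"
      using sum_squares_bound[of 1 "\<bar>x\<bar>"] by (simp add: power2_eq_square algebra_simps)
    finally show ?thesis using bnd0 by (simp add: mult_left_mono mult.assoc mult.left_commute)
  qed
  moreover have "0 \<le> 2 * C * (1 + x\<^sup>2)" for x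
    using bnd0 by simp
  ultimately have AE: "AE x in std_normal_distribution. norm (x * \<Phi> x - \<Phi>' x) \<le> norm (2 * C * (1 + x\<^sup>2))"
    unfolding real_norm_def by (intro AE_I2) (metis abs_of_nonneg)
  have "(\<lambda>x. x * \<Phi> x - \<Phi>' x) \<in> borel_measurable std_normal_distribution" by measurable
  from Bochner_Integration.integrable_bound[OF intb this AE]
  show int: "integrable std_normal_distribution (\<lambda>x. x * \<Phi> x - \<Phi>' x)" .
  let ?d = "std_normal_density"
  have dd: "(?d has_real_derivative - x * ?d x) (at x)" for x
    unfolding std_normal_density_def by (auto intro!: derivative_eq_intros simp: field_simps)
  let ?F = "\<lambda>x. - (\<Phi> x * ?d x)"
  have F': "(?F has_real_derivative (x * \<Phi> x - \<Phi>' x) * ?d x) (at x)" for x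
    by (auto intro!: derivative_eq_intros deriv dd simp: algebra_simps)
  have lim0: "((\<lambda>x. C * ((1 + x) * ?d x)) \<longlongrightarrow> 0) at_top"
  proof -
    have "((\<lambda>x. C * (x^0 / exp x + x^1 / exp x)) \<longlongrightarrow> C * (0 + 0)) at_top"
      by (intro tendsto_intros tendsto_power_div_exp_0)
    then have lim: "((\<lambda>x. C * (x^0 / exp x + x^1 / exp x)) \<longlongrightarrow> 0) at_top" by simp
    have "\<forall>\<^sub>F x in at_top. norm (C * ((1 + x) * ?d x)) \<le> C * (x^0 / exp x + x^1 / exp x)"
      using eventually_ge_at_top[of 2]
    proof eventually_elim
      case (elim x)
      \<comment> \<open>From 2 on, \<open>x\<^sup>2 / 2\<close> is at least \<open>x\<close>, so the
        Gaussian tail is traded for an exponential one with known limits.\<close>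
      have "?d x \<le> exp (- x)"
      proof -
        have "?d x = 1 / sqrt (2 * pi) * exp (- x\<^sup>2 / 2)" by (simp add: std_normal_density_def)
        also have "\<dots> \<le> 1 * exp (- x)"
        proof (rule mult_mono)
          show "1 / sqrt (2 * pi) \<le> 1" using pi_ge_two by (simp add: real_le_rsqrt)
          show "exp (- x\<^sup>2 / 2) \<le> exp (- x)" using elim by (simp add: power2_eq_square)
        qed auto
        finally show ?thesis by simp
      qed
      then have "(1 + x) * ?d x \<le> (1 + x) * exp (- x)" using elim by (intro mult_left_mono) auto
      also have "\<dots> = x^0 / exp x + x^1 / exp x" by (simp add: exp_minus field_simps)
      finally have "C * ((1 + x) * ?d x) \<le> C * (x^0 / exp x + x^1 / exp x)"
        by (rule mult_left_mono[OF _ bnd0])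
      moreover have "0 \<le> C * ((1 + x) * ?d x)" using bnd0 elim by simp
      ultimately show ?case by simp
    qed
    then show ?thesis using lim by (rule Lim_null_comparison)
  qed
  have F_le: "norm (?F x) \<le> C * ((1 + \<bar>x\<bar>) * ?d \<bar>x\<bar>)" for x
  proof -
    have "norm (?F x) = \<bar>\<Phi> x\<bar> * ?d x" by (simp only: real_norm_def abs_minus_cancel abs_mult) simp
    also have "\<dots> \<le> C * (1 + \<bar>x\<bar>) * ?d x" by (rule mult_right_mono[OF bnd(1)]) simp
    also have "\<dots> = C * ((1 + \<bar>x\<bar>) * ?d \<bar>x\<bar>)" by (simp only: std_normal_density_def power2_abs mult.assoc)
    finally show ?thesis .
  qed
  have "\<forall>\<^sub>F x in at_top. norm (?F x) \<le> C * ((1 + x) * ?d x)"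
    using eventually_ge_at_top[of 0]
  proof eventually_elim
    case (elim x)
    then show ?case using F_le[of x] by (simp only: abs_of_nonneg)
  qed
  then have F_top: "(?F \<longlongrightarrow> 0) at_top" by (rule Lim_null_comparison[OF _ lim0])
  have "\<forall>\<^sub>F x in at_top. norm (?F (- x)) \<le> C * ((1 + x) * ?d x)"
    using eventually_ge_at_top[of 0]
  proof eventually_elim
    case (elim x)
    then show ?case using F_le[of "- x"] by (simp only: abs_of_nonneg abs_minus_cancel)
  qed
  then have "((\<lambda>x. ?F (- x)) \<longlongrightarrow> 0) at_top" by (rule Lim_null_comparison[OF _ lim0])
  then have F_bot: "(?F \<longlongrightarrow> 0) at_bot" by (simp add: filterlim_at_bot_mirror)
  have int': "integrable lborel (\<lambda>x. (x * \<Phi> x - \<Phi>' x) * ?d x)"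
    using int by (subst (asm) integrable_density) (auto simp: mult.commute)
  have "(LBINT x=-\<infinity>..\<infinity>. (x * \<Phi> x - \<Phi>' x) * ?d x) = 0 - 0"
  proof (rule interval_integral_FTC_integrable)
    show "(?F has_vector_derivative (x * \<Phi> x - \<Phi>' x) * ?d x) (at x)" for x
      using F' by (simp add: has_real_derivative_iff_has_vector_derivative)
    show "isCont (\<lambda>x. (x * \<Phi> x - \<Phi>' x) * ?d x) x" for x
      using cont cont\<Phi> unfolding std_normal_density_def
      by (auto intro!: continuous_intros simp: continuous_on_eq_continuous_at)
    show "set_integrable lborel (einterval (- \<infinity>) \<infinity>) (\<lambda>x. (x * \<Phi> x - \<Phi>' x) * ?d x)"
      using int' by (simp add: set_integrable_def)
    show "((?F \<circ> real_of_ereal) \<longlongrightarrow> 0) (at_right (- \<infinity>))" "((?F \<circ> real_of_ereal) \<longlongrightarrow> 0) (at_left \<infinity>)"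
      using F_top F_bot by (simp_all add: ereal_tendsto_simps)
  qed simp
  then have "(LBINT x. (x * \<Phi> x - \<Phi>' x) * ?d x) = 0"
    by (simp add: interval_lebesgue_integral_def set_lebesgue_integral_def)
  then show "(LINT x|std_normal_distribution. x * \<Phi> x - \<Phi>' x) = 0"
    by (subst integral_density) (auto simp: mult.commute)
qed

text \<open>Writing the centred normal law as an image of the standard one covers variance \<open>0\<close> as well.\<close>

definition centred_normal :: "real \<Rightarrow> real measure" where
  "centred_normal v = distr std_normal_distribution borel (\<lambda>x. sqrt v * x)"

section \<open>Uncorrelated Gaussian variables are independent\<close>

lemma char_std_normal_cos_sin:
  shows "(LINT x|std_normal_distribution. cos (t * x)) = exp (- t\<^sup>2 / 2)"
    and "(LINT x|std_normal_distribution. sin (t * x)) = 0"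
proof -
  interpret real_distribution std_normal_distribution by (rule real_dist_normal_dist)
  have "integrable std_normal_distribution (\<lambda>x. iexp (t * x))"
    by (rule integrable_iexp) auto
  then have "(LINT x|std_normal_distribution. Re (iexp (t * x))) = Re (char std_normal_distribution t)"
    "(LINT x|std_normal_distribution. Im (iexp (t * x))) = Im (char std_normal_distribution t)"
    unfolding char_def by (simp_all only: integral_Re integral_Im)
  then show "(LINT x|std_normal_distribution. cos (t * x)) = exp (- t\<^sup>2 / 2)"
    "(LINT x|std_normal_distribution. sin (t * x)) = 0"
    by (simp_all add: char_std_normal_distribution Re_exp Im_exp)
qed

text \<open>The signed measure with density \<open>D\<close> is determined by its Fourier transform along \<open>Y\<close>: compare
  the characteristic functions of the laws of \<open>Y\<close> under the normalised positive and negative parts.\<close>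

lemma (in prob_space) zero_law_of_zero_cos_sin:
  fixes D Y :: "'a \<Rightarrow> real"
  assumes D: "integrable M D" and Y[measurable]: "Y \<in> borel_measurable M"
    and c: "\<And>t. expectation (\<lambda>w. D w * cos (t * Y w)) = 0"
    and s: "\<And>t. expectation (\<lambda>w. D w * sin (t * Y w)) = 0"
    and B[measurable]: "B \<in> sets borel"
  shows "expectation (\<lambda>w. D w * indicator B (Y w)) = 0"
proof -
  have [measurable]: "D \<in> borel_measurable M" using D by simp
  define a where "a = expectation (\<lambda>w. max 0 (D w))"
  define P where "P w = max 0 (D w)" for w
  define N where "N w = max 0 (- D w)" for w
  have iP: "integrable M P" "integrable M N" unfolding P_def[abs_def] N_def[abs_def] using D by auto
  have [measurable]: "P \<in> borel_measurable M" "N \<in> borel_measurable M" using iP by auto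
  have nn: "0 \<le> P w" "0 \<le> N w" for w by (auto simp: P_def N_def)
  have PN: "P w - N w = D w" for w by (auto simp: P_def N_def max_def)
  have ib: "integrable M (\<lambda>w. P w * h w)" "integrable M (\<lambda>w. N w * h w)" 
    if "h \<in> borel_measurable M" "\<And>w. \<bar>h w\<bar> \<le> 1" for h :: "'a \<Rightarrow> real"
    using that nn by (auto intro: Bochner_Integration.integrable_bound[OF iP(1)] Bochner_Integration.integrable_bound[OF iP(2)]
      simp: abs_mult mult_left_le)
  have split: "expectation (\<lambda>w. D w * h w) = expectation (\<lambda>w. P w * h w) - expectation (\<lambda>w. N w * h w)"
    if "h \<in> borel_measurable M" "\<And>w. \<bar>h w\<bar> \<le> 1" for h :: "'a \<Rightarrow> real"
    by (subst Bochner_Integration.integral_diff[OF ib[OF that], symmetric]) (simp add: PN flip: left_diff_distrib)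
  \<comment> \<open>The case \<open>t = 0\<close> of the cosine hypothesis says that both parts have
    the same mass \<open>a\<close>; dividing by it makes both of them probability densities.\<close>
  have aP: "a = expectation P" and aN: "a = expectation N"
    using split[of "\<lambda>_. 1"] c[of 0] by (auto simp: a_def P_def[abs_def])
  show ?thesis
  proof (cases "a = 0")
    case True
    then have "AE w in M. P w = 0" "AE w in M. N w = 0"
      using integral_nonneg_eq_0_iff_AE[OF iP(1)] integral_nonneg_eq_0_iff_AE[OF iP(2)] nn aP aN by auto
    then have "AE w in M. D w * indicator B (Y w) = 0" 
      by eventually_elim (use PN in \<open>metis diff_zero mult_zero_left\<close>)
    then show ?thesis by (simp add: integral_eq_zero_AE)
  next
    case False
    then have a: "a > 0" using aP nn by (simp add: less_le)
    let ?K = "\<lambda>Q. density M (\<lambda>w. ennreal (Q w / a))"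
    have prob: "prob_space (?K Q)" if "integrable M Q" "\<And>w. 0 \<le> Q w" "a = expectation Q" for Q
    proof
      have [measurable]: "Q \<in> borel_measurable M" using that by auto
      have "(\<integral>\<^sup>+w. ennreal (Q w / a) \<partial>M) = ennreal (expectation (\<lambda>w. Q w / a))"
        using that a by (intro nn_integral_eq_integral) auto
      then show "emeasure (?K Q) (space (?K Q)) = 1"
        using that a by (simp add: emeasure_density cong: nn_integral_cong)
    qed
    have int: "integral\<^sup>L (distr (?K Q) borel Y) h = expectation (\<lambda>w. Q w * h (Y w)) / a"
      if "Q \<in> borel_measurable M" "\<And>w. 0 \<le> Q w" "h \<in> borel_measurable borel" for Q and h :: "real \<Rightarrow> real"
      using that a by (simp add: integral_distr integral_density)
    interpret KP: prob_space "?K P" by (rule prob[OF iP(1) nn(1) aP])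
    interpret KN: prob_space "?K N" by (rule prob[OF iP(2) nn(2) aN])
    have dP: "real_distribution (distr (?K P) borel Y)" and dN: "real_distribution (distr (?K N) borel Y)"
      by (auto intro!: KP.real_distribution_distr KN.real_distribution_distr)
    have eqc: "integral\<^sup>L (distr (?K P) borel Y) h = integral\<^sup>L (distr (?K N) borel Y) h"
      if [measurable]: "h \<in> borel_measurable borel" and "\<And>x. \<bar>h x\<bar> \<le> 1" "expectation (\<lambda>w. D w * h (Y w)) = 0"
        for h
      using that split[of "\<lambda>w. h (Y w)"] nn by (simp add: int)
    have "char (distr (?K P) borel Y) = char (distr (?K N) borel Y)"
    proof
      fix t
      interpret dP: real_distribution "distr (?K P) borel Y" by (rule dP)
      interpret dN: real_distribution "distr (?K N) borel Y" by (rule dN)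
      have iP': "integrable (distr (?K P) borel Y) (\<lambda>x. iexp (t * x))"
        by (rule dP.integrable_iexp) simp_all
      have iN': "integrable (distr (?K N) borel Y) (\<lambda>x. iexp (t * x))"
        by (rule dN.integrable_iexp) simp_all
      show "char (distr (?K P) borel Y) t = char (distr (?K N) borel Y) t"
        unfolding char_def
        by (rule complex_eqI; simp only: integral_Re[OF iP', symmetric] integral_Re[OF iN', symmetric]
            integral_Im[OF iP', symmetric] integral_Im[OF iN', symmetric])
           (simp_all add: Re_exp Im_exp eqc[of "\<lambda>x. cos (t * x)"] eqc[of "\<lambda>x. sin (t * x)"] c s)
    qed
    then have "distr (?K P) borel Y = distr (?K N) borel Y" by (rule Levy_uniqueness[OF dP dN])
    then have "expectation (\<lambda>w. P w * indicator B (Y w)) = expectation (\<lambda>w. N w * indicator B (Y w))"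
      using int[of P "indicator B"] int[of N "indicator B"] nn a by simp
    then show ?thesis using split[of "\<lambda>w. indicator B (Y w)"] by (simp add: indicator_def)
  qed
qed

text \<open>A phase shift by a quarter period expresses products with sines through cosines, so that
  hypotheses on cosines with arbitrary phase suffice below.\<close>

lemma cos_times_sin_shift:
  "cos a * sin b = (cos (a - pi/2 + b) - cos (a - pi/2 - b)) / (2::real)"
  by (simp add: cos_add cos_diff sin_diff)

text \<open>Induction over the coordinates, trading one trigonometric factor at a time for an
  indicator. With a cosine of the other coordinates absorbed into the density, the one-dimensional
  result applies to \<open>\<eta> i\<close>; then \<open>D\<close> times the new indicator is the
  density for the remaining coordinates, which is why \<open>D\<close> is arbitrary in the
  induction.\<close>

lemma (in prob_space) zero_on_boxes_of_zero_cos: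
  fixes D :: "'a \<Rightarrow> real" and \<eta> :: "'i \<Rightarrow> 'a \<Rightarrow> real"
  assumes "finite J" "integrable M D" "\<And>j. j \<in> J \<Longrightarrow> \<eta> j \<in> borel_measurable M"
    and "\<And>\<phi> c. expectation (\<lambda>w. D w * cos (\<phi> + (\<Sum>j\<in>J. c j * \<eta> j w))) = 0"
    and "\<And>j. j \<in> J \<Longrightarrow> B j \<in> sets borel"
  shows "expectation (\<lambda>w. D w * (\<Prod>j\<in>J. indicator (B j) (\<eta> j w))) = 0"
  using assms
proof (induction J arbitrary: D rule: finite_induct)
  case empty
  show ?case using empty.prems(3)[of 0] by simp
next
  case (insert i J)
  have [measurable]: "D \<in> borel_measurable M" "\<eta> i \<in> borel_measurable M" "\<And>j. j \<in> J \<Longrightarrow> \<eta> j \<in> borel_measurable M"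
    "B i \<in> sets borel"
    using insert.prems by auto
  let ?D = "\<lambda>w. D w * indicator (B i) (\<eta> i w)"
  have bound: "integrable M (\<lambda>w. D w * h w)" if "h \<in> borel_measurable M" "\<And>w. \<bar>h w\<bar> \<le> 1" for h
    using that by (auto intro!: Bochner_Integration.integrable_bound[OF insert.prems(1)] simp: abs_mult mult_left_le)
  have cosS: "expectation (\<lambda>w. D w * cos (\<phi> + (t * \<eta> i w + (\<Sum>j\<in>J. c j * \<eta> j w)))) = 0" for \<phi> t c
  proof -
    have "(\<Sum>j\<in>insert i J. (c(i := t)) j * \<eta> j w) = t * \<eta> i w + (\<Sum>j\<in>J. c j * \<eta> j w)" for w
      using insert.hyps by (auto intro!: sum.cong)
    then show ?thesis using insert.prems(3)[of \<phi> "c(i := t)"] by simp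
  qed
  have "expectation (\<lambda>w. ?D w * (\<Prod>j\<in>J. indicator (B j) (\<eta> j w))) = 0"
  proof (rule insert.IH)
    show "integrable M ?D" by (rule bound) (auto simp: indicator_def)
    fix \<phi> c
    let ?S = "\<lambda>w. \<phi> + (\<Sum>j\<in>J. c j * \<eta> j w)"
    have iS: "integrable M (\<lambda>w. D w * cos (\<psi> + (t * \<eta> i w + (\<Sum>j\<in>J. c j * \<eta> j w))))" for \<psi> t
      by (rule bound) auto
    have "expectation (\<lambda>w. D w * cos (?S w) * cos (t * \<eta> i w)) = 0" for t
    proof -
      have "D w * cos (?S w) * cos (t * \<eta> i w) = (D w * cos (\<phi> + (t * \<eta> i w + (\<Sum>j\<in>J. c j * \<eta> j w)))
          + D w * cos (\<phi> + (- t * \<eta> i w + (\<Sum>j\<in>J. c j * \<eta> j w)))) / 2" for w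
        using cos_times_cos[of "?S w" "t * \<eta> i w"]
        by (simp add: algebra_simps)
      then have "expectation (\<lambda>w. D w * cos (?S w) * cos (t * \<eta> i w)) =
          expectation (\<lambda>w. (D w * cos (\<phi> + (t * \<eta> i w + (\<Sum>j\<in>J. c j * \<eta> j w)))
          + D w * cos (\<phi> + (- t * \<eta> i w + (\<Sum>j\<in>J. c j * \<eta> j w)))) / 2)" by (simp only:)
      also have "\<dots> = 0" using iS[of \<phi> t] iS[of \<phi> "-t"] cosS[of \<phi> t c] cosS[of \<phi> "-t" c] by simp
      finally show ?thesis .
    qed
    moreover have "expectation (\<lambda>w. D w * cos (?S w) * sin (t * \<eta> i w)) = 0" for t
    proof -
      have "D w * cos (?S w) * sin (t * \<eta> i w) = (D w * cos (\<phi> - pi/2 + (t * \<eta> i w + (\<Sum>j\<in>J. c j * \<eta> j w)))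
          - D w * cos (\<phi> - pi/2 + (- t * \<eta> i w + (\<Sum>j\<in>J. c j * \<eta> j w)))) / 2" for w
      proof -
        have "\<phi> - pi/2 + (t * \<eta> i w + (\<Sum>j\<in>J. c j * \<eta> j w)) = ?S w - pi/2 + t * \<eta> i w"
          "\<phi> - pi/2 + (- t * \<eta> i w + (\<Sum>j\<in>J. c j * \<eta> j w)) = ?S w - pi/2 - t * \<eta> i w"
          by simp_all
        then show ?thesis
          using cos_times_sin_shift[of "?S w" "t * \<eta> i w"]
            by (simp only: mult.assoc) (simp add: right_diff_distrib)
      qed
      then have "expectation (\<lambda>w. D w * cos (?S w) * sin (t * \<eta> i w)) =
          expectation (\<lambda>w. (D w * cos (\<phi> - pi/2 + (t * \<eta> i w + (\<Sum>j\<in>J. c j * \<eta> j w)))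
          - D w * cos (\<phi> - pi/2 + (- t * \<eta> i w + (\<Sum>j\<in>J. c j * \<eta> j w)))) / 2)" by (simp only:)
      also have "\<dots> = 0" using iS[of "\<phi> - pi/2" t] iS[of "\<phi> - pi/2" "-t"] cosS[of "\<phi> - pi/2" t c] cosS[of "\<phi> - pi/2" "-t" c] by simp
      finally show ?thesis .
    qed
    moreover have "integrable M (\<lambda>w. D w * cos (?S w))" by (rule bound) auto
    ultimately have "expectation (\<lambda>w. D w * cos (?S w) * indicator (B i) (\<eta> i w)) = 0"
      by (intro zero_law_of_zero_cos_sin) auto
    then show "expectation (\<lambda>w. ?D w * cos (?S w)) = 0" by (simp add: ac_simps)
  qed (use insert.prems in auto)
  then show ?case using insert.hyps by (simp add: ac_simps)
qed

text \<open>Only one-dimensional laws are prescribed; closure under linear combinations makes them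
  determine the joint laws. Degenerate variables are included through variance 0.\<close>

locale gaussian_space = prob_space M for M :: "'a measure" +
  fixes G :: "('a \<Rightarrow> real) set"
  assumes lin: "\<And>X Y a b. X \<in> G \<Longrightarrow> Y \<in> G \<Longrightarrow> (\<lambda>w. a * X w + b * Y w) \<in> G"
    and zero: "(\<lambda>_. 0) \<in> G"
    and meas: "\<And>X. X \<in> G \<Longrightarrow> X \<in> borel_measurable M"
    and law: "\<And>X. X \<in> G \<Longrightarrow> \<exists>v\<ge>0. distr M borel X = centred_normal v"
begin

lemma sum_mem:
  assumes "\<And>j. j \<in> J \<Longrightarrow> X j \<in> G"
  shows "(\<lambda>w. \<Sum>j\<in>J. c j * X j w) \<in> G"
  using assms
proof (induction J rule: infinite_finite_induct)
  case (insert j J)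
  then show ?case using lin[of "X j" "\<lambda>w. \<Sum>j\<in>J. c j * X j w" "c j" 1] by simp
qed (simp_all add: zero)

lemma diff_mem: "X \<in> G \<Longrightarrow> Y \<in> G \<Longrightarrow> (\<lambda>w. X w - Y w) \<in> G"
  using lin[of X Y 1 "-1"] by simp

lemma law_integrals:
  fixes h :: "real \<Rightarrow> real"
  assumes X: "X \<in> G" and v: "distr M borel X = centred_normal v"
    and h[measurable]: "h \<in> borel_measurable borel"
  shows "integrable M (\<lambda>w. h (X w)) \<longleftrightarrow> integrable std_normal_distribution (\<lambda>x. h (sqrt v * x))"
    and "expectation (\<lambda>w. h (X w)) = (LINT x|std_normal_distribution. h (sqrt v * x))"
proof -
  have [measurable]: "X \<in> borel_measurable M" using X by (rule meas)
  show "integrable M (\<lambda>w. h (X w)) \<longleftrightarrow> integrable std_normal_distribution (\<lambda>x. h (sqrt v * x))"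
    using integrable_distr_eq[of X M borel h] integrable_distr_eq[of "\<lambda>x. sqrt v * x" std_normal_distribution borel h] v
    by (simp add: centred_normal_def)
  show "expectation (\<lambda>w. h (X w)) = (LINT x|std_normal_distribution. h (sqrt v * x))"
    using integral_distr[of X M borel h] integral_distr[of "\<lambda>x. sqrt v * x" std_normal_distribution borel h] v
    by (simp add: centred_normal_def)
qed

lemma integrable_power: 
  assumes "X \<in> G" shows "integrable M (\<lambda>w. X w ^ k)"
proof -
  obtain v where v: "v \<ge> 0" "distr M borel X = centred_normal v" using law assms by blast
  show ?thesis
    using law_integrals(1)[OF assms v(2), of "\<lambda>x. x ^ k"] integrable_std_normal_distribution_moment[of k]
    by (simp add: power_mult_distrib)
qed

lemma law_eq:
  assumes "X \<in> G"
  shows "distr M borel X = centred_normal (expectation (\<lambda>w. (X w)\<^sup>2))"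
proof -
  obtain v where v: "v \<ge> 0" "distr M borel X = centred_normal v" using law assms by blast
  have "expectation (\<lambda>w. (X w)\<^sup>2) = v"
    using law_integrals(2)[OF assms v(2), of "\<lambda>x. x\<^sup>2"] std_normal_distribution_even_moments(1)[of 1] v(1)
    by (simp add: power_mult_distrib)
  then show ?thesis using v by simp
qed

lemma integrals:
  fixes h :: "real \<Rightarrow> real"
  assumes "X \<in> G" "h \<in> borel_measurable borel"
  shows "expectation (\<lambda>w. h (X w)) = (LINT x|std_normal_distribution. h (sqrt (expectation (\<lambda>w. (X w)\<^sup>2)) * x))"
  using law_integrals(2)[OF assms(1) law_eq assms(2)] assms by simp

text \<open>The factor is the fourth moment of the standard normal law. The identity turns fourth
  moments of increments into squares of variances.\<close>

lemma expectation_power4: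
  assumes "X \<in> G"
  shows "expectation (\<lambda>w. X w ^ 4) = 3 * (expectation (\<lambda>w. (X w)\<^sup>2))\<^sup>2"
proof -
  let ?s = "expectation (\<lambda>w. (X w)\<^sup>2)"
  have "(sqrt ?s * x) ^ 4 = ?s\<^sup>2 * x ^ 4" for x
  proof -
    have "sqrt ?s ^ 4 = ((sqrt ?s)\<^sup>2)\<^sup>2" by (simp only: power_mult[symmetric]) simp
    also have "(sqrt ?s)\<^sup>2 = ?s" by (rule real_sqrt_pow2) simp
    finally show ?thesis by (simp add: power_mult_distrib)
  qed
  then show ?thesis
    using integrals[OF assms, of "\<lambda>x. x ^ 4"] std_normal_distribution_even_moments(1)[of 2]
    by (simp add: fact_numeral)
qed

lemma expectation_cos: "X \<in> G \<Longrightarrow> expectation (\<lambda>w. cos (t * X w)) = exp (- (t\<^sup>2 * expectation (\<lambda>w. (X w)\<^sup>2)) / 2)"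
  using integrals[of X "\<lambda>x. cos (t * x)"] char_std_normal_cos_sin(1)[of "t * sqrt (expectation (\<lambda>w. (X w)\<^sup>2))"]
  by (simp add: power_mult_distrib mult.assoc)

lemma expectation_sin: "X \<in> G \<Longrightarrow> expectation (\<lambda>w. sin (t * X w)) = 0"
  using integrals[of X "\<lambda>x. sin (t * x)"] char_std_normal_cos_sin(2)[of "t * sqrt (expectation (\<lambda>w. (X w)\<^sup>2))"]
  by (simp add: power_mult_distrib mult.assoc)

lemma integrable_mult: 
  assumes "X \<in> G" "Y \<in> G" shows "integrable M (\<lambda>w. X w * Y w)"
proof (rule Bochner_Integration.integrable_bound)
  show "integrable M (\<lambda>w. (X w)\<^sup>2 + (Y w)\<^sup>2)" using assms integrable_power by auto
  show "AE w in M. norm (X w * Y w) \<le> norm ((X w)\<^sup>2 + (Y w)\<^sup>2)"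
  proof (rule AE_I2)
    fix w
    have "2 * (\<bar>X w\<bar> * \<bar>Y w\<bar>) \<le> (X w)\<^sup>2 + (Y w)\<^sup>2"
      using sum_squares_bound[of "\<bar>X w\<bar>" "\<bar>Y w\<bar>"] by simp
    moreover have "0 \<le> \<bar>X w\<bar> * \<bar>Y w\<bar>" by simp
    ultimately show "norm (X w * Y w) \<le> norm ((X w)\<^sup>2 + (Y w)\<^sup>2)"
      by (simp add: abs_mult) (smt (verit) zero_le_power2)
  qed
qed (use assms meas in measurable)

text \<open>The mean of \<open>cos (\<psi> + Y)\<close> is \<open>cos \<psi>\<close> times
  \<open>exp\<close> of minus half the variance of \<open>Y\<close>, and without correlation the
  variance of \<open>S + t X\<close> is that of \<open>S\<close> plus \<open>t\<^sup>2\<close> times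
  that of \<open>X\<close>. The product formulas of trigonometry then split the expectation.\<close>

lemma cos_uncorrelated:
  assumes S: "S \<in> G" and X: "X \<in> G" and SX: "expectation (\<lambda>w. S w * X w) = 0"
  shows "expectation (\<lambda>w. cos (t * X w) * cos (\<phi> + S w)) = expectation (\<lambda>w. cos (t * X w)) * expectation (\<lambda>w. cos (\<phi> + S w))"
    and "expectation (\<lambda>w. sin (t * X w) * cos (\<phi> + S w)) = 0"
proof -
  have [measurable]: "S \<in> borel_measurable M" "X \<in> borel_measurable M" using S X by (auto intro: meas)
  have ib: "integrable M h" if "h \<in> borel_measurable M" "\<And>w. \<bar>h w\<bar> \<le> 1" for h :: "'a \<Rightarrow> real"
    by (rule integrable_const_bound[where B=1]) (use that in auto)
  have E: "expectation (\<lambda>w. cos (\<psi> + Y w)) = cos \<psi> * exp (- expectation (\<lambda>w. (Y w)\<^sup>2) / 2)" if Y: "Y \<in> G"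
    for \<psi> Y
  proof -
    have [measurable]: "Y \<in> borel_measurable M" using Y by (rule meas)
    have "expectation (\<lambda>w. cos (\<psi> + Y w)) = expectation (\<lambda>w. cos \<psi> * cos (1 * Y w) - sin \<psi> * sin (1 * Y w))"
      by (simp add: cos_add)
    also have "\<dots> = cos \<psi> * expectation (\<lambda>w. cos (1 * Y w)) - sin \<psi> * expectation (\<lambda>w. sin (1 * Y w))"
      using ib[of "\<lambda>w. cos (1 * Y w)"] ib[of "\<lambda>w. sin (1 * Y w)"]
        by (subst Bochner_Integration.integral_diff) auto
    also have "\<dots> = cos \<psi> * exp (- expectation (\<lambda>w. (Y w)\<^sup>2) / 2)"
      unfolding expectation_cos[OF Y] expectation_sin[OF Y] by simp
    finally show ?thesis .
  qed
  have var: "expectation (\<lambda>w. (S w + t * X w)\<^sup>2) = expectation (\<lambda>w. (S w)\<^sup>2) + t\<^sup>2 * expectation (\<lambda>w. (X w)\<^sup>2)"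
    for t
  proof -
    have "(S w + t * X w)\<^sup>2 = (S w)\<^sup>2 + (t\<^sup>2 * (X w)\<^sup>2 + 2 * t * (S w * X w))" for w
      by (simp add: power2_eq_square algebra_simps)
    then show ?thesis using integrable_power[OF S, of 2] integrable_power[OF X, of 2] integrable_mult[OF S X] SX by simp
  qed
  have mem: "(\<lambda>w. S w + t * X w) \<in> G" for t using lin[OF S X, of 1 t] by simp
  have E2: "expectation (\<lambda>w. cos (\<psi> + (S w + t * X w))) = cos \<psi> * exp (- (expectation (\<lambda>w. (S w)\<^sup>2) + t\<^sup>2 * expectation (\<lambda>w. (X w)\<^sup>2)) / 2)" for \<psi> t
    using E[OF mem, of \<psi> t] by (simp add: var)
  have "expectation (\<lambda>w. cos (t * X w) * cos (\<phi> + S w)) = expectation (\<lambda>w. (cos (\<phi> + (S w + t * X w)) + cos (\<phi> + (S w + (-t) * X w))) / 2)"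
    by (intro Bochner_Integration.integral_cong refl) (simp add: cos_times_cos[of "\<phi> + S _"] algebra_simps)
  also have "\<dots> = (expectation (\<lambda>w. cos (\<phi> + (S w + t * X w))) + expectation (\<lambda>w. cos (\<phi> + (S w + (-t) * X w)))) / 2"
    using ib[of "\<lambda>w. cos (\<phi> + (S w + t * X w))"] ib[of "\<lambda>w. cos (\<phi> + (S w + (-t) * X w))"] by simp
  also have "\<dots> = expectation (\<lambda>w. cos (t * X w)) * expectation (\<lambda>w. cos (\<phi> + S w))"
    unfolding E2 expectation_cos[OF X] E[OF S] by (simp add: exp_add[symmetric] add_divide_distrib)
  finally show "expectation (\<lambda>w. cos (t * X w) * cos (\<phi> + S w)) = expectation (\<lambda>w. cos (t * X w)) * expectation (\<lambda>w. cos (\<phi> + S w))" .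
  have *: "sin a * cos b = (cos (b - pi/2 + a) - cos (b - pi/2 - a)) / 2" for a b :: real
    by (simp add: cos_add cos_diff sin_diff)
  have "expectation (\<lambda>w. sin (t * X w) * cos (\<phi> + S w)) = expectation (\<lambda>w. (cos (\<phi> - pi/2 + (S w + t * X w)) - cos (\<phi> - pi/2 + (S w + (-t) * X w))) / 2)"
    unfolding * by (simp add: algebra_simps)
  also have "\<dots> = (expectation (\<lambda>w. cos (\<phi> - pi/2 + (S w + t * X w))) - expectation (\<lambda>w. cos (\<phi> - pi/2 + (S w + (-t) * X w)))) / 2"
    using ib[of "\<lambda>w. cos (\<phi> - pi/2 + (S w + t * X w))"] ib[of "\<lambda>w. cos (\<phi> - pi/2 + (S w + (-t) * X w))"]
      by simp
  also have "\<dots> = 0" unfolding E2 by simp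
  finally show "expectation (\<lambda>w. sin (t * X w) * cos (\<phi> + S w)) = 0" .
qed

text \<open>Fourier uniqueness in two rounds. The centred \<open>cos (t X)\<close> and the
  \<open>sin (t X)\<close> are orthogonal to all cosines of combinations of the
  \<open>\<eta> j\<close>, hence to indicators of boxes; therefore the centred indicator of a box is
  orthogonal to all \<open>cos (t X)\<close> and \<open>sin (t X)\<close>, hence to indicators of
  \<open>X\<close>. This route admits a singular covariance of the \<open>\<eta> j\<close>.\<close>

lemma indep_of_uncorrelated:
  assumes J: "finite J" and \<eta>: "\<And>j. j \<in> J \<Longrightarrow> \<eta> j \<in> G" and X: "X \<in> G"
    and uncorr: "\<And>j. j \<in> J \<Longrightarrow> expectation (\<lambda>w. \<eta> j w * X w) = 0"
  shows "distr M borel X \<Otimes>\<^sub>M distr M (PiM J (\<lambda>_. borel)) (\<lambda>w. \<lambda>j\<in>J. \<eta> j w) =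
    distr M (borel \<Otimes>\<^sub>M PiM J (\<lambda>_. borel)) (\<lambda>w. (X w, \<lambda>j\<in>J. \<eta> j w))"
proof -
  have [measurable]: "X \<in> borel_measurable M" using X by (rule meas)
  have [measurable]: "\<eta> j \<in> borel_measurable M" if "j \<in> J" for j using \<eta> that by (auto intro: meas)
  have ib: "integrable M h" if "h \<in> borel_measurable M" "\<And>w. \<bar>h w\<bar> \<le> 1" for h :: "'a \<Rightarrow> real"
    by (rule integrable_const_bound[where B=1]) (use that in auto)
  let ?S = "\<lambda>c w. \<Sum>j\<in>J. c j * \<eta> j w"
  have S: "?S c \<in> G" for c using \<eta> by (rule sum_mem)
  have SX: "expectation (\<lambda>w. ?S c w * X w) = 0" for c
    using \<eta> X uncorr by (simp add: sum_distrib_right mult.assoc integrable_mult)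
  have prob_eq: "prob (X -` A \<inter> space M \<inter> ((\<lambda>w. \<lambda>j\<in>J. \<eta> j w) -` (Pi\<^sub>E J B) \<inter> space M)) =
      prob (X -` A \<inter> space M) * prob ((\<lambda>w. \<lambda>j\<in>J. \<eta> j w) -` (Pi\<^sub>E J B) \<inter> space M)"
    if A[measurable]: "A \<in> sets borel" and B: "\<And>j. j \<in> J \<Longrightarrow> B j \<in> sets borel" for A B
  proof -
    let ?I = "\<lambda>w. \<Prod>j\<in>J. indicator (B j) (\<eta> j w) :: real"
    have [measurable]: "?I \<in> borel_measurable M" using B by measurable
    have I01: "\<bar>?I w\<bar> \<le> 1" "0 \<le> ?I w" for w
      unfolding abs_prod by (auto intro!: prod_le_1 prod_nonneg simp: indicator_def)
    define p where "p = expectation ?I"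
    have cos0: "expectation (\<lambda>w. (cos (t * X w) - expectation (\<lambda>w. cos (t * X w))) * ?I w) = 0" for t
    proof (rule zero_on_boxes_of_zero_cos[OF J])
      let ?e = "expectation (\<lambda>w. cos (t * X w))"
      show "integrable M (\<lambda>w. cos (t * X w) - ?e)"
        by (rule Bochner_Integration.integrable_diff, rule ib) auto
      show "expectation (\<lambda>w. (cos (t * X w) - ?e) * cos (\<phi> + ?S c w)) = 0" for \<phi> c
      proof -
        have [measurable]: "?S c \<in> borel_measurable M" using S by (rule meas)
        have "integrable M (\<lambda>w. cos (t * X w) * cos (\<phi> + ?S c w))"
          by (rule ib) (auto simp: abs_mult mult_le_one)
        moreover have "integrable M (\<lambda>w. ?e * cos (\<phi> + ?S c w))"
          by (rule integrable_mult_right, rule ib) auto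
        ultimately show ?thesis using cos_uncorrelated(1)[OF S X SX, of t \<phi> c]
          by (simp add: left_diff_distrib)
      qed
    qed (use B in auto)
    have sin0: "expectation (\<lambda>w. sin (t * X w) * ?I w) = 0" for t
      by (rule zero_on_boxes_of_zero_cos[OF J])
         (use B cos_uncorrelated(2)[OF S X SX] in \<open>auto intro!: ib\<close>)
    have iI: "integrable M ?I" using I01 by (intro ib) auto
    have cos0': "expectation (\<lambda>w. cos (t * X w) * ?I w) = expectation (\<lambda>w. cos (t * X w)) * expectation ?I"
      for t
    proof -
      have "integrable M (\<lambda>w. cos (t * X w) * ?I w)" using I01 by (auto intro!: ib simp: abs_mult mult_le_one)
      then show ?thesis using cos0[of t] iI by (simp add: left_diff_distrib)
    qed
    \<comment> \<open>Second round: the roles are exchanged, and the indicator of the box, centred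
      by its probability \<open>p\<close>, acts as the density.\<close>
    have "expectation (\<lambda>w. (?I w - p) * indicator A (X w)) = 0"
    proof (rule zero_law_of_zero_cos_sin)
      fix t
      have i1: "integrable M (\<lambda>w. cos (t * X w) * ?I w)" "integrable M (\<lambda>w. sin (t * X w) * ?I w)" 
        using I01 by (auto intro!: ib simp: abs_mult mult_le_one)
      have i2: "integrable M (\<lambda>w. cos (t * X w))" "integrable M (\<lambda>w. sin (t * X w))" by (auto intro!: ib)
      have "(?I w - p) * cos (t * X w) = cos (t * X w) * ?I w - p * cos (t * X w)" for w
        by (simp add: algebra_simps)
      then have "expectation (\<lambda>w. (?I w - p) * cos (t * X w)) = expectation (\<lambda>w. cos (t * X w) * ?I w - p * cos (t * X w))" by (simp only:)
      then show "expectation (\<lambda>w. (?I w - p) * cos (t * X w)) = 0"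
        using cos0'[of t] i1 i2 iI by (simp add: p_def)
      have "(?I w - p) * sin (t * X w) = sin (t * X w) * ?I w - p * sin (t * X w)" for w
        by (simp add: algebra_simps)
      then have "expectation (\<lambda>w. (?I w - p) * sin (t * X w)) = expectation (\<lambda>w. sin (t * X w) * ?I w - p * sin (t * X w))" by (simp only:)
      then show "expectation (\<lambda>w. (?I w - p) * sin (t * X w)) = 0"
        using sin0[of t] i1 i2 expectation_sin[OF X] by simp
    qed (use iI in auto)
    moreover have mA: "(\<lambda>w. ?I w * indicator A (X w)) \<in> borel_measurable M" by measurable
    then have "integrable M (\<lambda>w. ?I w * indicator A (X w))"
      by (rule ib) (use I01 in \<open>simp add: indicator_def\<close>)
    moreover have "integrable M (\<lambda>w. indicator A (X w) :: real)" by (intro ib) (auto simp: indicator_def)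
    ultimately have e1: "expectation (\<lambda>w. ?I w * indicator A (X w)) = p * expectation (\<lambda>w. indicator A (X w))"
      by (simp add: left_diff_distrib)
    have ind: "expectation h = prob C" if "C \<in> events" "\<And>w. w \<in> space M \<Longrightarrow> h w = indicator C w"
      for h :: "'a \<Rightarrow> real" and C
    proof -
      have "expectation h = expectation (indicator C)" using that(2)
        by (intro Bochner_Integration.integral_cong) auto
      then show ?thesis using that(1) by (simp add: Int_absorb2 sets.sets_into_space)
    qed
    have I_eq: "?I w = indicator ((\<lambda>w. \<lambda>j\<in>J. \<eta> j w) -` (Pi\<^sub>E J B) \<inter> space M) w" if "w \<in> space M" for w
    proof (cases "\<forall>j\<in>J. \<eta> j w \<in> B j")
      case True
      then have "?I w = 1" by (intro prod.neutral) (simp add: indicator_def)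
      then show ?thesis using True that by (auto simp: indicator_def)
    next
      case False
      then have "?I w = 0" using J by (intro prod_zero) (auto simp: indicator_def)
      then show ?thesis using False by (auto simp: indicator_def)
    qed
    have sI: "(\<lambda>w. \<lambda>j\<in>J. \<eta> j w) -` (Pi\<^sub>E J B) \<inter> space M \<in> events"
    proof -
      have "Pi\<^sub>E J B \<in> sets (PiM J (\<lambda>_. borel))" using J B by (intro sets_PiM_I_finite) auto
      then show ?thesis by (intro measurable_sets[of _ M "PiM J (\<lambda>_. borel)"]) auto
    qed
    have sA: "X -` A \<inter> space M \<in> events" using A by measurable
    have "expectation (\<lambda>w. indicator A (X w)) = prob (X -` A \<inter> space M)"
      by (rule ind[OF sA]) (auto simp: indicator_def)
    moreover have "p = prob ((\<lambda>w. \<lambda>j\<in>J. \<eta> j w) -` (Pi\<^sub>E J B) \<inter> space M)"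
      unfolding p_def by (rule ind[OF sI I_eq])
    moreover have "expectation (\<lambda>w. ?I w * indicator A (X w)) =
        prob (X -` A \<inter> space M \<inter> ((\<lambda>w. \<lambda>j\<in>J. \<eta> j w) -` (Pi\<^sub>E J B) \<inter> space M))"
      by (rule ind[OF sets.Int[OF sA sI]], subst I_eq) (auto simp: indicator_def)
    ultimately show ?thesis using e1 by (simp add: mult.commute)
  qed
  let ?\<eta> = "\<lambda>w. \<lambda>j\<in>J. \<eta> j w"
  \<comment> \<open>The boxes form a \<pi>-system that generates the product; the product formula on
    them extends to all measurable sets.\<close>
  let ?E = "{Pi\<^sub>E J B | B. B \<in> (\<Pi> j\<in>J. sets (borel :: real measure))}"
  have setsE: "sets (PiM J (\<lambda>_. borel :: real measure)) = sigma_sets (space (PiM J (\<lambda>_. borel :: real measure))) ?E"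
    using J by (simp add: sets_PiM prod_algebra_eq_finite space_PiM)
  have m\<eta>: "?\<eta> \<in> measurable M (PiM J (\<lambda>_. borel))" by simp
  have eqY: "{?\<eta> -` A \<inter> space M | A. A \<in> sets (PiM J (\<lambda>_. borel))} = sigma_sets (space M) {?\<eta> -` A \<inter> space M | A. A \<in> ?E}"
    unfolding setsE by (rule sigma_sets_vimage_commute) (use measurable_space[OF m\<eta>] in auto)
  have "indep_set {X -` A \<inter> space M | A. A \<in> sets borel} {?\<eta> -` A \<inter> space M | A. A \<in> ?E}"
  proof (rule indep_setI)
    show "{?\<eta> -` A \<inter> space M | A. A \<in> ?E} \<subseteq> events"
      using measurable_sets[OF m\<eta> sets_PiM_I_finite[OF J]] by auto
  qed (use prob_eq in auto)
  moreover have "Int_stable {X -` A \<inter> space M | A. A \<in> sets borel}"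
  proof (rule Int_stableI)
    fix a b assume "a \<in> {X -` A \<inter> space M | A. A \<in> sets borel}" "b \<in> {X -` A \<inter> space M | A. A \<in> sets borel}"
    then obtain A B where "a = X -` A \<inter> space M" "b = X -` B \<inter> space M" "A \<in> sets borel" "B \<in> sets borel"
      by blast
    then have "a \<inter> b = X -` (A \<inter> B) \<inter> space M" "A \<inter> B \<in> sets borel" by auto
    then show "a \<inter> b \<in> {X -` A \<inter> space M | A. A \<in> sets borel}" by blast
  qed
  moreover have "Int_stable {?\<eta> -` A \<inter> space M | A. A \<in> ?E}"
  proof (rule Int_stableI)
    fix a b assume "a \<in> {?\<eta> -` A \<inter> space M | A. A \<in> ?E}" "b \<in> {?\<eta> -` A \<inter> space M | A. A \<in> ?E}"
    then obtain A B where "a = ?\<eta> -` Pi\<^sub>E J A \<inter> space M" "b = ?\<eta> -` Pi\<^sub>E J B \<inter> space M"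
      "A \<in> (\<Pi> j\<in>J. sets borel)" "B \<in> (\<Pi> j\<in>J. sets borel)" by auto
    then have "a \<inter> b = ?\<eta> -` Pi\<^sub>E J (\<lambda>j. A j \<inter> B j) \<inter> space M" "(\<lambda>j. A j \<inter> B j) \<in> (\<Pi> j\<in>J. sets borel)"
      by (auto simp: PiE_Int[symmetric])
    then show "a \<inter> b \<in> {?\<eta> -` A \<inter> space M | A. A \<in> ?E}" by blast
  qed
  ultimately have "indep_set (sigma_sets (space M) {X -` A \<inter> space M | A. A \<in> sets borel})
      {?\<eta> -` A \<inter> space M | A. A \<in> sets (PiM J (\<lambda>_. borel))}"
    unfolding eqY by (rule indep_set_sigma_sets)
  then have *: "prob (X -` A \<inter> space M \<inter> (?\<eta> -` B \<inter> space M)) = prob (X -` A \<inter> space M) * prob (?\<eta> -` B \<inter> space M)"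
    if "A \<in> sets borel" "B \<in> sets (PiM J (\<lambda>_. borel))" for A B
    using that by (intro indep_setD) (auto intro!: sigma_sets.Basic)
  interpret PX: prob_space "distr M borel X" by (rule prob_space_distr) simp
  interpret PN: prob_space "distr M (PiM J (\<lambda>_. borel)) ?\<eta>" by (rule prob_space_distr) simp
  show ?thesis
  proof (rule pair_measure_eqI)
    fix A B assume AB: "A \<in> sets (distr M borel X)" "B \<in> sets (distr M (PiM J (\<lambda>_. borel)) ?\<eta>)"
    then have "A \<times> B \<in> sets (borel \<Otimes>\<^sub>M PiM J (\<lambda>_. borel))" by auto
    moreover have "(\<lambda>w. (X w, ?\<eta> w)) -` (A \<times> B) \<inter> space M = X -` A \<inter> space M \<inter> (?\<eta> -` B \<inter> space M)" by auto
    ultimately show "emeasure (distr M borel X) A * emeasure (distr M (PiM J (\<lambda>_. borel)) ?\<eta>) B =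
        emeasure (distr M (borel \<Otimes>\<^sub>M PiM J (\<lambda>_. borel)) (\<lambda>w. (X w, ?\<eta> w))) (A \<times> B)"
      using AB *[of A B] m\<eta> by (simp add: emeasure_distr emeasure_eq_measure ennreal_mult'')
  qed (simp_all add: PX.sigma_finite_measure_axioms PN.sigma_finite_measure_axioms cong: sets_pair_measure_cong)
qed

text \<open>\<open>X\<close> is independent of the vector of the \<open>\<eta> j\<close>, so by
  Fubini the latter can be frozen at a value \<open>e\<close>, and what remains is the
  one-dimensional identity. The growth constant may depend on \<open>e\<close>, because
  integrability of the whole is a separate hypothesis.\<close>

lemma integration_by_parts:
  assumes J: "finite J" and \<eta>: "\<And>j. j \<in> J \<Longrightarrow> \<eta> j \<in> G" and X: "X \<in> G"
    and uncorr: "\<And>j. j \<in> J \<Longrightarrow> expectation (\<lambda>w. \<eta> j w * X w) = 0"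
    and [measurable]: "case_prod \<Phi> \<in> borel_measurable (borel \<Otimes>\<^sub>M PiM J (\<lambda>_. borel))"
      "case_prod \<Phi>' \<in> borel_measurable (borel \<Otimes>\<^sub>M PiM J (\<lambda>_. borel))"
    and deriv: "\<And>x e. ((\<lambda>x. \<Phi> x e) has_real_derivative \<Phi>' x e) (at x)"
    and cont: "\<And>e. continuous_on UNIV (\<lambda>x. \<Phi>' x e)"
    and bnd: "\<And>e. \<exists>C. \<forall>x. \<bar>\<Phi> x e\<bar> \<le> C * (1 + \<bar>x\<bar>) \<and> \<bar>\<Phi>' x e\<bar> \<le> C * (1 + \<bar>x\<bar>)"
    and int: "integrable M (\<lambda>w. X w * \<Phi> (X w) (\<lambda>j\<in>J. \<eta> j w))"
      "integrable M (\<lambda>w. \<Phi>' (X w) (\<lambda>j\<in>J. \<eta> j w))"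
  shows "expectation (\<lambda>w. X w * \<Phi> (X w) (\<lambda>j\<in>J. \<eta> j w)) =
    expectation (\<lambda>w. (X w)\<^sup>2) * expectation (\<lambda>w. \<Phi>' (X w) (\<lambda>j\<in>J. \<eta> j w))"
proof -
  define v where "v = expectation (\<lambda>w. (X w)\<^sup>2)"
  have v0: "0 \<le> v" by (simp add: v_def)
  let ?\<eta> = "\<lambda>w. \<lambda>j\<in>J. \<eta> j w"
  have [measurable]: "X \<in> borel_measurable M" using X by (rule meas)
  have [measurable]: "\<eta> j \<in> borel_measurable M" if "j \<in> J" for j using \<eta> that by (auto intro: meas)
  have m\<eta>[measurable]: "?\<eta> \<in> measurable M (PiM J (\<lambda>_. borel))" by simp
  have prod: "distr M (borel \<Otimes>\<^sub>M PiM J (\<lambda>_. borel)) (\<lambda>w. (X w, ?\<eta> w)) = distr M borel X \<Otimes>\<^sub>M distr M (PiM J (\<lambda>_. borel)) ?\<eta>"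
    using indep_of_uncorrelated[of J \<eta> X] J \<eta> X uncorr by simp
  let ?h = "\<lambda>x e. x * \<Phi> x e - v * \<Phi>' x e"
  interpret PX: prob_space "distr M borel X" by (rule prob_space_distr) simp
  interpret PN: prob_space "distr M (PiM J (\<lambda>_. borel)) ?\<eta>" by (rule prob_space_distr) simp
  interpret pair_sigma_finite "distr M borel X" "distr M (PiM J (\<lambda>_. borel)) ?\<eta>" ..
  have "integrable M (\<lambda>w. ?h (X w) (?\<eta> w))" using int by simp
  then have "integrable (distr M (borel \<Otimes>\<^sub>M PiM J (\<lambda>_. borel)) (\<lambda>w. (X w, ?\<eta> w))) (case_prod ?h)"
    by (subst integrable_distr_eq) (simp_all add: split_beta')
  then have "(\<integral>e. (\<integral>x. ?h x e \<partial>distr M borel X) \<partial>distr M (PiM J (\<lambda>_. borel)) ?\<eta>) =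
      integral\<^sup>L (distr M (borel \<Otimes>\<^sub>M PiM J (\<lambda>_. borel)) (\<lambda>w. (X w, ?\<eta> w))) (case_prod ?h)"
    unfolding prod by (rule integral_snd)
  also have "\<dots> = expectation (\<lambda>w. ?h (X w) (?\<eta> w))" by (subst integral_distr) (simp_all add: split_beta')
  finally have fub: "(\<integral>e. (\<integral>x. ?h x e \<partial>distr M borel X) \<partial>distr M (PiM J (\<lambda>_. borel)) ?\<eta>) = expectation (\<lambda>w. ?h (X w) (?\<eta> w))" .
  have "(\<integral>x. ?h x e \<partial>distr M borel X) = 0" for e
  proof -
    obtain C where C: "\<And>x. \<bar>\<Phi> x e\<bar> \<le> C * (1 + \<bar>x\<bar>)" "\<And>x. \<bar>\<Phi>' x e\<bar> \<le> C * (1 + \<bar>x\<bar>)"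
      using bnd[of e] by blast
    have C0: "0 \<le> C" using C(1)[of 0] by simp
    define r where "r = sqrt v"
    have r: "r * r = v" "0 \<le> r" using v0 by (auto simp: r_def)
    have m[measurable]: "(\<lambda>x. \<Phi> x e) \<in> borel_measurable borel" "(\<lambda>x. \<Phi>' x e) \<in> borel_measurable borel"
      using cont[of e] deriv by (auto intro!: borel_measurable_continuous_onI continuous_at_imp_continuous_on DERIV_isCont)
    define K where "K x = C * (1 + r) * (1 + \<bar>x\<bar>)" for x
    have le: "C * (1 + \<bar>r * x\<bar>) \<le> K x" "0 \<le> C * (1 + \<bar>r * x\<bar>)" for x
      using C0 r(2) mult_left_mono[of "1 + \<bar>r * x\<bar>" "(1 + r) * (1 + \<bar>x\<bar>)" C]
      by (auto simp: abs_mult algebra_simps K_def)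
    have K0: "0 \<le> K x" for x using le[of x] by linarith
    have le2: "C * (1 + \<bar>r * x\<bar>) * r \<le> K x * (1 + r)" for x
      using K0[of x] le[of x] r(2) by (intro mult_mono) auto
    have le3: "K x \<le> K x * (1 + r)" for x
      using K0[of x] r(2) mult_left_mono[of 1 "1 + r" "K x"] by simp
    \<comment> \<open>\<open>X\<close> has the law of \<open>r\<close> times a standard normal
      variable. The chain rule puts one factor \<open>r\<close> before the derivative, the rescaling
      of the first term a second one, and \<open>r * r = v\<close>.\<close>
    have lint0: "(LINT x|std_normal_distribution. x * \<Phi> (r * x) e - \<Phi>' (r * x) e * r) = 0"
    proof (rule std_normal_stein(2))
      show "((\<lambda>x. \<Phi> (r * x) e) has_real_derivative \<Phi>' (r * x) e * r) (at x)" for x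
        by (rule DERIV_chain2[OF deriv]) (auto intro!: derivative_eq_intros)
      show "continuous_on UNIV (\<lambda>x. \<Phi>' (r * x) e * r)"
        by (intro continuous_intros continuous_on_compose2[OF cont[of e]]) auto
      show "\<bar>\<Phi> (r * x) e\<bar> \<le> (C * (1 + r) * (1 + r)) * (1 + \<bar>x\<bar>)" for x
        using C(1)[of "r * x"] le[of x] le3[of x] by (simp add: K_def ac_simps)
      show "\<bar>\<Phi>' (r * x) e * r\<bar> \<le> (C * (1 + r) * (1 + r)) * (1 + \<bar>x\<bar>)" for x
        using mult_right_mono[OF C(2)[of "r * x"] r(2)] le2[of x] r(2) by (simp add: K_def abs_mult ac_simps)
    qed
    have integrand: "r * (x * \<Phi> (r * x) e - \<Phi>' (r * x) e * r) = ?h (r * x) e" for x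
      by (simp add: r(1)[symmetric] algebra_simps)
    have "(\<integral>x. ?h x e \<partial>distr M borel X) = r * (LINT x|std_normal_distribution. x * \<Phi> (r * x) e - \<Phi>' (r * x) e * r)"
      unfolding law_eq[OF X] v_def[symmetric] centred_normal_def
      by (subst integral_distr)
         (simp_all only: r_def[symmetric] integral_mult_right_zero[symmetric] integrand, measurable)
    then show ?thesis using lint0 by simp
  qed
  then have "expectation (\<lambda>w. ?h (X w) (?\<eta> w)) = 0" using fub by simp
  then show ?thesis using int by (simp add: v_def)
qed

end

section \<open>Cylindrical functions\<close>

text \<open>\<open>foldr\<close> applies the last index of the list first, so iterated derivatives
  of the partial derivative are those of \<open>g\<close> along \<open>is @ [i]\<close>.\<close>

lemma Cb_infinity_partial_deriv:
  assumes "g \<in> Cb_infinity n" "i < n"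
  shows "partial_deriv i g \<in> Cb_infinity n"
proof -
  have dep: "\<And>x y. (\<forall>i<n. x i = y i) \<Longrightarrow> g x = g y" using assms(1) by (simp add: Cb_infinity_def)
  have "partial_deriv i g x = partial_deriv i g y" if "\<forall>i<n. x i = y i" for x y
  proof -
    have "(\<lambda>h. g (x(i := h))) = (\<lambda>h. g (y(i := h)))" using that by (auto intro!: dep)
    then show ?thesis using that assms(2) by (simp add: partial_deriv_def)
  qed
  moreover have "continuous_on UNIV (foldr partial_deriv is (partial_deriv i g)) \<and>
        bounded (range (foldr partial_deriv is (partial_deriv i g))) \<and>
        (\<forall>j<n. \<forall>x. (\<lambda>h. foldr partial_deriv is (partial_deriv i g) (x(j := h))) differentiable at (x j))"
    if "set is \<subseteq> {..<n}" for "is"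
  proof -
    have "set (is @ [i]) \<subseteq> {..<n}" using that assms(2) by auto
    from mp[OF spec[OF conjunct2[OF assms(1)[unfolded Cb_infinity_def mem_Collect_eq]], of "is @ [i]"] this]
    show ?thesis unfolding foldr_append foldr.simps comp_def id_def .
  qed
  ultimately show ?thesis unfolding Cb_infinity_def by simp
qed

lemma Cb_infinity_cong: "g \<in> Cb_infinity n \<Longrightarrow> (\<And>i. i < n \<Longrightarrow> x i = y i) \<Longrightarrow> g x = g y"
  by (simp add: Cb_infinity_def)

lemma Cb_infinity_basic:
  assumes "g \<in> Cb_infinity n"
  shows Cb_infinity_continuous: "continuous_on UNIV g"
    and Cb_infinity_bounded: "\<exists>B\<ge>0. \<forall>x. \<bar>g x\<bar> \<le> B"
    and Cb_infinity_differentiable: "\<And>i x. i < n \<Longrightarrow> (\<lambda>h. g (x(i := h))) differentiable at (x i)"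
proof -
  have *: "continuous_on UNIV (foldr partial_deriv [] g) \<and> bounded (range (foldr partial_deriv [] g)) \<and>
      (\<forall>i<n. \<forall>x. (\<lambda>h. foldr partial_deriv [] g (x(i := h))) differentiable at (x i))"
    using assms unfolding Cb_infinity_def by (simp only: mem_Collect_eq) (metis empty_set empty_subsetI)
  then show "continuous_on UNIV g" "\<And>i x. i < n \<Longrightarrow> (\<lambda>h. g (x(i := h))) differentiable at (x i)"
    by auto
  obtain B where "\<forall>x. \<bar>g x\<bar> \<le> B" using * by (auto simp: bounded_iff)
  moreover from this have "0 \<le> B" by (meson abs_ge_zero order.trans)
  ultimately show "\<exists>B\<ge>0. \<forall>x. \<bar>g x\<bar> \<le> B" by blast
qed

lemma partial_deriv_works:
  assumes "g \<in> Cb_infinity n" "i < n"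
  shows "((\<lambda>h. g (x(i := h))) has_real_derivative partial_deriv i g (x(i := t))) (at t)"
  using Cb_infinity_differentiable[OF assms, of "x(i := t)"]
  by (simp add: partial_deriv_def DERIV_deriv_iff_real_differentiable)

lemma partial_mvt:
  assumes "g \<in> Cb_infinity n" "i < n"
  shows "\<exists>z. min s t \<le> z \<and> z \<le> max s t \<and> g (x(i := t)) - g (x(i := s)) = (t - s) * partial_deriv i g (x(i := z))"
proof (cases s t rule: linorder_cases)
  case less
  from MVT2[OF less partial_deriv_works[OF assms]] show ?thesis
    by (metis less_eq_real_def max.absorb4 min.absorb3 less)
next
  case greater
  from MVT2[OF greater partial_deriv_works[OF assms]] obtain z where
    "t < z" "z < s" "g (x(i := s)) - g (x(i := t)) = (s - t) * partial_deriv i g (x(i := z))" by blast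
  then show ?thesis by (intro exI[of _ z]) (auto simp: algebra_simps)
qed (auto intro: exI[of _ t])

text \<open>The coordinates are changed from \<open>x\<close> to \<open>y\<close> one at a time,
  with the mean value theorem on each leg. The intermediate points stay in the box spanned by
  \<open>x\<close> and \<open>y\<close>; the chain rule below relies on this.\<close>

lemma Cb_infinity_increment:
  assumes g: "g \<in> Cb_infinity n"
  shows "\<exists>z. (\<forall>k<n. \<forall>j<n. \<bar>z k j - x j\<bar> \<le> \<bar>y j - x j\<bar>) \<and>
    g y - g x = (\<Sum>k<n. (y k - x k) * partial_deriv k g (z k))"
proof -
  define p where "p k j = (if j < k then y j else x j)" for k j :: nat
  have "\<exists>\<xi>. min (x k) (y k) \<le> \<xi> \<and> \<xi> \<le> max (x k) (y k) \<and>
      g (p (Suc k)) - g (p k) = (y k - x k) * partial_deriv k g ((p k)(k := \<xi>))" if "k < n" for k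
  proof -
    have "(p k)(k := y k) = p (Suc k)" "(p k)(k := x k) = p k" by (auto simp: p_def less_Suc_eq)
    then show ?thesis using partial_mvt[OF g that, of "x k" "y k" "p k"] by simp
  qed
  then obtain \<xi> where \<xi>: "\<And>k. k < n \<Longrightarrow> min (x k) (y k) \<le> \<xi> k \<and> \<xi> k \<le> max (x k) (y k) \<and>
      g (p (Suc k)) - g (p k) = (y k - x k) * partial_deriv k g ((p k)(k := \<xi> k))" by metis
  have "g y - g x = g (p n) - g (p 0)"
    using Cb_infinity_cong[OF g, of y "p n"] Cb_infinity_cong[OF g, of x "p 0"] by (simp add: p_def)
  also have "\<dots> = (\<Sum>k<n. g (p (Suc k)) - g (p k))" by (rule sum_lessThan_telescope[symmetric])
  also have "\<dots> = (\<Sum>k<n. (y k - x k) * partial_deriv k g ((p k)(k := \<xi> k)))"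
    using \<xi> by (intro sum.cong) auto
  finally have "g y - g x = \<dots>" .
  moreover have "\<bar>((p k)(k := \<xi> k)) j - x j\<bar> \<le> \<bar>y j - x j\<bar>" if "k < n" "j < n" for k j
    using \<xi>[OF that(1)] by (auto simp: p_def)
  ultimately show ?thesis by (intro exI[of _ "\<lambda>k. (p k)(k := \<xi> k)"]) blast
qed

lemma Cb_infinity_lipschitz:
  assumes g: "g \<in> Cb_infinity n"
  obtains L where "0 \<le> L" "\<And>x y. \<bar>g y - g x\<bar> \<le> L * (\<Sum>k<n. \<bar>y k - x k\<bar>)"
proof -
  have "\<forall>k\<in>{..<n}. \<exists>B\<ge>0. \<forall>x. \<bar>partial_deriv k g x\<bar> \<le> B"
    using Cb_infinity_bounded[OF Cb_infinity_partial_deriv[OF g]] by blast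
  then obtain B where B: "\<And>k. k < n \<Longrightarrow> 0 \<le> B k" "\<And>k x. k < n \<Longrightarrow> \<bar>partial_deriv k g x\<bar> \<le> B k"
    by (metis lessThan_iff)
  define L where "L = (\<Sum>k<n. B k)"
  have L: "B k \<le> L" if "k < n" for k unfolding L_def using B that by (intro member_le_sum) auto
  have "\<bar>g y - g x\<bar> \<le> L * (\<Sum>k<n. \<bar>y k - x k\<bar>)" for x y
  proof -
    obtain z where "g y - g x = (\<Sum>k<n. (y k - x k) * partial_deriv k g (z k))"
      using Cb_infinity_increment[OF g] by blast
    also have "\<bar>\<dots>\<bar> \<le> (\<Sum>k<n. \<bar>y k - x k\<bar> * L)"
    proof (intro order.trans[OF sum_abs] sum_mono)
      fix k assume "k \<in> {..<n}"
      then have "\<bar>partial_deriv k g (z k)\<bar> \<le> L" using B(2)[of k "z k"] L[of k] by simp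
      then show "\<bar>(y k - x k) * partial_deriv k g (z k)\<bar> \<le> \<bar>y k - x k\<bar> * L"
        by (simp add: abs_mult mult_left_mono)
    qed
    finally show ?thesis by (simp add: sum_distrib_left mult.commute)
  qed
  moreover have "0 \<le> L" unfolding L_def using B by (intro sum_nonneg) auto
  ultimately show ?thesis using that by blast
qed

lemma has_real_derivative_of_quadratic_remainder:
  fixes \<phi> :: "real \<Rightarrow> real"
  assumes "\<And>h. \<bar>\<phi> (t + h) - \<phi> t - h * D\<bar> \<le> C * h\<^sup>2"
  shows "(\<phi> has_real_derivative D) (at t)"
proof -
  have "((\<lambda>h. C * \<bar>h\<bar>) \<longlongrightarrow> C * \<bar>0\<bar>) (at 0)" by (intro tendsto_intros)
  then have lim: "((\<lambda>h. C * \<bar>h\<bar>) \<longlongrightarrow> 0) (at 0)" by simp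
  have "((\<lambda>h. (\<phi> (t + h) - \<phi> t) / h - D) \<longlongrightarrow> 0) (at 0)"
  proof (rule Lim_null_comparison[OF _ lim])
    show "\<forall>\<^sub>F h in at 0. norm ((\<phi> (t + h) - \<phi> t) / h - D) \<le> C * \<bar>h\<bar>"
      unfolding eventually_at_filter
    proof (rule always_eventually, intro allI impI)
      fix h :: real assume h: "h \<noteq> 0"
      have "norm ((\<phi> (t + h) - \<phi> t) / h - D) = \<bar>\<phi> (t + h) - \<phi> t - h * D\<bar> / \<bar>h\<bar>"
        using h by (simp add: field_simps flip: abs_divide)
      also have "\<dots> \<le> C * h\<^sup>2 / \<bar>h\<bar>" using assms by (intro divide_right_mono) auto
      also have "\<dots> = C * \<bar>h\<bar>" using h by (simp add: power2_eq_square field_simps abs_if)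
      finally show "norm ((\<phi> (t + h) - \<phi> t) / h - D) \<le> C * \<bar>h\<bar>" .
    qed
  qed
  then show ?thesis unfolding DERIV_def by (simp add: LIM_zero_iff)
qed

text \<open>A chain rule from partial derivatives alone: these are Lipschitz, because those of
  second order are bounded, so replacing the intermediate points by the base point costs only a
  quadratic error.\<close>

lemma Cb_infinity_line_deriv:
  assumes g: "g \<in> Cb_infinity n"
  shows "((\<lambda>t. g (\<lambda>i. e i + c i * t)) has_real_derivative (\<Sum>k<n. c k * partial_deriv k g (\<lambda>i. e i + c i * t))) (at t)"
proof -
  have "\<forall>k. \<exists>L\<ge>0. k < n \<longrightarrow> (\<forall>x y. \<bar>partial_deriv k g y - partial_deriv k g x\<bar> \<le> L * (\<Sum>k<n. \<bar>y k - x k\<bar>))"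
    using Cb_infinity_lipschitz[OF Cb_infinity_partial_deriv[OF g]] by (metis order_refl)
  then obtain L where L: "\<And>k. 0 \<le> L k"
      "\<And>k x y. k < n \<Longrightarrow> \<bar>partial_deriv k g y - partial_deriv k g x\<bar> \<le> L k * (\<Sum>k<n. \<bar>y k - x k\<bar>)" by metis
  let ?p = "\<lambda>t i. e i + c i * t"
  let ?S = "\<Sum>i<n. \<bar>c i\<bar>"
  show ?thesis
  proof (rule has_real_derivative_of_quadratic_remainder)
    fix h
    obtain z where z: "\<And>k j. k < n \<Longrightarrow> j < n \<Longrightarrow> \<bar>z k j - ?p t j\<bar> \<le> \<bar>?p (t + h) j - ?p t j\<bar>"
      and inc: "g (?p (t + h)) - g (?p t) = (\<Sum>k<n. (?p (t + h) k - ?p t k) * partial_deriv k g (z k))"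
      using Cb_infinity_increment[OF g, of "?p t" "?p (t + h)"] by blast
    have "g (?p (t + h)) - g (?p t) - h * (\<Sum>k<n. c k * partial_deriv k g (?p t))
        = (\<Sum>k<n. h * c k * (partial_deriv k g (z k) - partial_deriv k g (?p t)))"
      unfolding inc sum_distrib_left sum_subtractf[symmetric]
        by (intro sum.cong refl) (simp add: algebra_simps)
    also have "\<bar>\<dots>\<bar> \<le> (\<Sum>k<n. \<bar>h\<bar> * \<bar>c k\<bar> * (L k * (\<bar>h\<bar> * ?S)))"
    proof (intro order.trans[OF sum_abs] sum_mono)
      fix k assume k: "k \<in> {..<n}"
      have "(\<Sum>j<n. \<bar>z k j - ?p t j\<bar>) \<le> (\<Sum>j<n. \<bar>c j\<bar> * \<bar>h\<bar>)"
      proof (rule sum_mono)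
        fix j assume "j \<in> {..<n}"
        then have "\<bar>z k j - ?p t j\<bar> \<le> \<bar>?p (t + h) j - ?p t j\<bar>" using z[of k j] k by simp
        also have "?p (t + h) j - ?p t j = c j * h" by (simp add: distrib_left)
        finally show "\<bar>z k j - ?p t j\<bar> \<le> \<bar>c j\<bar> * \<bar>h\<bar>" by (simp only: abs_mult)
      qed
      also have "\<dots> = \<bar>h\<bar> * ?S" by (simp only: sum_distrib_left mult.commute)
      finally have "L k * (\<Sum>j<n. \<bar>z k j - ?p t j\<bar>) \<le> L k * (\<bar>h\<bar> * ?S)" by (rule mult_left_mono[OF _ L(1)])
      then have "\<bar>partial_deriv k g (z k) - partial_deriv k g (?p t)\<bar> \<le> L k * (\<bar>h\<bar> * ?S)"
        using L(2)[of k "z k" "?p t"] k by simp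
      then show "\<bar>h * c k * (partial_deriv k g (z k) - partial_deriv k g (?p t))\<bar> \<le> \<bar>h\<bar> * \<bar>c k\<bar> * (L k * (\<bar>h\<bar> * ?S))"
        by (simp add: abs_mult mult_left_mono mult.assoc)
    qed
    also have "\<dots> = (\<Sum>k<n. \<bar>c k\<bar> * (L k * ?S)) * h\<^sup>2"
    proof -
      have "h\<^sup>2 = \<bar>h\<bar> * \<bar>h\<bar>" by (simp add: power2_eq_square)
      then show ?thesis unfolding sum_distrib_right[of _ _ "h\<^sup>2"] by (intro sum.cong refl) (simp only: mult_ac)
    qed
    finally show "\<bar>g (?p (t + h)) - g (?p t) - h * (\<Sum>k<n. c k * partial_deriv k g (?p t))\<bar> \<le> (\<Sum>k<n. \<bar>c k\<bar> * (L k * ?S)) * h\<^sup>2" .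
  qed
qed

text \<open>Entries of the sequence beyond \<open>n\<close> may fail to be measurable; they are
  replaced by 0, which \<open>g\<close> does not notice.\<close>

lemma Cb_infinity_measurable:
  assumes g: "g \<in> Cb_infinity n" and Y: "\<And>j. j < n \<Longrightarrow> Y j \<in> borel_measurable M"
  shows "(\<lambda>w. g (\<lambda>j. Y j w)) \<in> borel_measurable M"
proof -
  have [measurable]: "g \<in> borel_measurable borel"
    using Cb_infinity_continuous[OF g] by (rule borel_measurable_continuous_onI)
  have [measurable]: "(\<lambda>w j. if j < n then Y j w else 0) \<in> borel_measurable M"
  proof (rule measurable_coordinatewise_then_product)
    show "(\<lambda>w. if j < n then Y j w else 0) \<in> borel_measurable M" for j using Y by (cases "j < n") auto
  qed
  have "(\<lambda>w. g (\<lambda>j. if j < n then Y j w else 0)) \<in> borel_measurable M" by measurable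
  also have "(\<lambda>w. g (\<lambda>j. if j < n then Y j w else 0)) = (\<lambda>w. g (\<lambda>j. Y j w))"
    by (intro ext Cb_infinity_cong[OF g]) simp
  finally show ?thesis .
qed

section \<open>Square-integrable random variables\<close>

lemma L2_rv_measurable: "Y \<in> L2_rv M \<Longrightarrow> Y \<in> borel_measurable M"
  and L2_rv_power2: "Y \<in> L2_rv M \<Longrightarrow> integrable M (\<lambda>w. (Y w)\<^sup>2)"
  by (simp_all add: L2_rv_def)

lemma L2_rv_mult_integrable:
  assumes "Y \<in> L2_rv M" "Z \<in> L2_rv M"
  shows "integrable M (\<lambda>w. Y w * Z w)"
proof (rule Bochner_Integration.integrable_bound)
  show "integrable M (\<lambda>w. (Y w)\<^sup>2 + (Z w)\<^sup>2)" using assms by (auto simp: L2_rv_def)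
  show "AE w in M. norm (Y w * Z w) \<le> norm ((Y w)\<^sup>2 + (Z w)\<^sup>2)"
  proof (rule AE_I2)
    fix w
    have "2 * (\<bar>Y w\<bar> * \<bar>Z w\<bar>) \<le> (Y w)\<^sup>2 + (Z w)\<^sup>2"
      using sum_squares_bound[of "\<bar>Y w\<bar>" "\<bar>Z w\<bar>"] by simp
    moreover have "0 \<le> \<bar>Y w\<bar> * \<bar>Z w\<bar>" by simp
    ultimately show "norm (Y w * Z w) \<le> norm ((Y w)\<^sup>2 + (Z w)\<^sup>2)"
      by (simp add: abs_mult) (smt (verit) zero_le_power2)
  qed
qed (use assms in \<open>auto simp: L2_rv_def\<close>)

lemma L2_rv_lin:
  assumes "Y \<in> L2_rv M" "Z \<in> L2_rv M"
  shows "(\<lambda>w. a * Y w + b * Z w) \<in> L2_rv M"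
proof -
  have "(a * Y w + b * Z w)\<^sup>2 = a\<^sup>2 * (Y w)\<^sup>2 + b\<^sup>2 * (Z w)\<^sup>2 + 2 * a * b * (Y w * Z w)" for w
    by (simp add: power2_eq_square algebra_simps)
  then show ?thesis using assms L2_rv_mult_integrable[OF assms] by (auto simp: L2_rv_def)
qed

lemma L2_rv_diff: "Y \<in> L2_rv M \<Longrightarrow> Z \<in> L2_rv M \<Longrightarrow> (\<lambda>w. Y w - Z w) \<in> L2_rv M"
  using L2_rv_lin[of Y M Z 1 "-1"] by simp

lemma L2_rv_cmult: "Y \<in> L2_rv M \<Longrightarrow> (\<lambda>w. a * Y w) \<in> L2_rv M"
  using L2_rv_lin[of Y M Y a 0] by simp

lemma L2_rv_bound:
  assumes "Z \<in> L2_rv M" "Y \<in> borel_measurable M" "AE w in M. \<bar>Y w\<bar> \<le> \<bar>Z w\<bar>"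
  shows "Y \<in> L2_rv M"
proof -
  have "AE w in M. norm ((Y w)\<^sup>2) \<le> norm ((Z w)\<^sup>2)"
    using assms(3) by eventually_elim (simp add: abs_le_square_iff)
  then have "integrable M (\<lambda>w. (Y w)\<^sup>2)"
    using assms(1,2) by (intro Bochner_Integration.integrable_bound[OF L2_rv_power2[OF assms(1)]]) auto
  then show ?thesis using assms(2) by (simp add: L2_rv_def)
qed

lemma L2_rv_bounded_mult:
  assumes "Z \<in> L2_rv M" "Y \<in> borel_measurable M" "\<And>w. \<bar>Y w\<bar> \<le> B"
  shows "(\<lambda>w. Y w * Z w) \<in> L2_rv M"
proof (rule L2_rv_bound[OF L2_rv_cmult[OF assms(1), of B]])
  have "\<bar>Y w\<bar> * \<bar>Z w\<bar> \<le> \<bar>B\<bar> * \<bar>Z w\<bar>" for w using assms(3)[of w] by (intro mult_right_mono) auto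
  then show "AE w in M. \<bar>Y w * Z w\<bar> \<le> \<bar>B * Z w\<bar>" by (simp add: abs_mult)
qed (use assms in \<open>auto simp: L2_rv_def\<close>)

lemma (in finite_measure) L2_rv_bounded:
  assumes "Y \<in> borel_measurable M" "\<And>w. \<bar>Y w\<bar> \<le> B"
  shows "Y \<in> L2_rv M"
proof -
  have "(\<lambda>_. 1) \<in> L2_rv M" by (simp add: L2_rv_def)
  from L2_rv_bounded_mult[OF this assms] show ?thesis by simp
qed

lemma (in finite_measure) L2_rv_integrable: 
  assumes "Y \<in> L2_rv M" shows "integrable M Y"
  using L2_rv_mult_integrable[OF assms L2_rv_bounded[of "\<lambda>_. 1" 1]] by simp

lemma L2_cauchy_schwarz:
  assumes Y: "Y \<in> L2_rv M" and Z: "Z \<in> L2_rv M"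
  shows "(LINT w|M. \<bar>Y w * Z w\<bar>) \<le> sqrt (LINT w|M. (Y w)\<^sup>2) * sqrt (LINT w|M. (Z w)\<^sup>2)"
proof -
  define a b c where "a = (LINT w|M. (Y w)\<^sup>2)" and "b = (LINT w|M. (Z w)\<^sup>2)" and "c = (LINT w|M. \<bar>Y w * Z w\<bar>)"
  have q: "0 \<le> t\<^sup>2 * a - 2 * t * c + b" for t
  proof -
    have "0 \<le> (LINT w|M. (t * \<bar>Y w\<bar> - \<bar>Z w\<bar>)\<^sup>2)" by simp
    also have "(LINT w|M. (t * \<bar>Y w\<bar> - \<bar>Z w\<bar>)\<^sup>2) = (LINT w|M. t\<^sup>2 * (Y w)\<^sup>2 - 2 * t * \<bar>Y w * Z w\<bar> + (Z w)\<^sup>2)"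
      by (intro Bochner_Integration.integral_cong refl) (simp add: power2_eq_square algebra_simps abs_mult)
    also have "\<dots> = t\<^sup>2 * a - 2 * t * c + b"
      using L2_rv_mult_integrable[OF Y Z] L2_rv_power2[OF Y] L2_rv_power2[OF Z]
        by (simp add: a_def b_def c_def)
    finally show ?thesis .
  qed
  have nn: "0 \<le> a" "0 \<le> b" "0 \<le> c" by (simp_all add: a_def b_def c_def)
  have "c\<^sup>2 \<le> a * b"
  proof (cases "a = 0")
    case True
    \<comment> \<open>With \<open>a = 0\<close> the quadratic is linear in \<open>t\<close>; at the
      chosen \<open>t\<close> it would equal -1 unless \<open>c = 0\<close>.\<close>
    then have "c = 0" using q[of "(b + 1) / (2 * c)"] nn by (cases "c = 0") auto
    then show ?thesis using nn by simp
  next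
    case False
    then have "0 < a" using nn by simp
    then show ?thesis using q[of "c / a"] by (simp add: field_simps power2_eq_square)
  qed
  then have "c \<le> sqrt (a * b)" by (rule real_le_rsqrt)
  then show ?thesis by (simp add: a_def b_def c_def real_sqrt_mult)
qed

lemma L2_rv_lin_growth:
  assumes "prob_space M" "X \<in> L2_rv M" "k \<in> borel_measurable borel" "\<And>x. \<bar>k x\<bar> \<le> a + b * \<bar>x\<bar>"
  shows "(\<lambda>w. k (X w)) \<in> L2_rv M"
proof (rule L2_rv_bound)
  interpret prob_space M by fact
  have [measurable]: "X \<in> borel_measurable M" "k \<in> borel_measurable borel" using assms
    by (auto simp: L2_rv_def)
  have "(\<lambda>w. \<bar>X w\<bar>) \<in> L2_rv M" using assms(2) by (auto simp: L2_rv_def)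
  from L2_rv_lin[OF _ this, of "\<lambda>_. 1" a b] show "(\<lambda>w. a * 1 + b * \<bar>X w\<bar>) \<in> L2_rv M"
    by (simp add: L2_rv_bounded[where B=1])
  show "AE w in M. \<bar>k (X w)\<bar> \<le> \<bar>a * 1 + b * \<bar>X w\<bar>\<bar>"
    using assms(4) by (auto intro: order.trans[OF _ abs_ge_self])
  show "(\<lambda>w. k (X w)) \<in> borel_measurable M" by measurable
qed

lemma lin_growth_of_bounded_deriv:
  fixes k k' :: "real \<Rightarrow> real"
  assumes "\<And>x. (k has_real_derivative k' x) (at x)" "\<And>x. \<bar>k' x\<bar> \<le> K"
  shows "\<bar>k y - k x\<bar> \<le> K * \<bar>y - x\<bar>"
  using field_differentiable_bound[of UNIV k k' K x y] assms by (simp add: abs_minus_commute)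

section \<open>Gaussian integration by parts for cylindrical functionals\<close>

context gaussian_space
begin

lemma mem_L2: "X \<in> G \<Longrightarrow> X \<in> L2_rv M"
  using meas integrable_power by (simp add: L2_rv_def)

text \<open>Linear regression on \<open>D\<close>: each \<open>Y i\<close>, and \<open>X\<close> as
  well, is a multiple of \<open>D\<close> plus a remainder uncorrelated with \<open>D\<close>. With
  the remainders frozen, the product is a function of \<open>D\<close> whose derivative consists of
  the partial derivatives of \<open>g\<close> and of \<open>k'\<close>, weighted with the regression
  coefficients; the variance of \<open>D\<close> times such a coefficient is a covariance.\<close>

lemma cylindrical_by_parts:
  assumes g: "g \<in> Cb_infinity n" and Y: "\<And>j. j < n \<Longrightarrow> Y j \<in> G" and X: "X \<in> G" and D: "D \<in> G"
    and k: "\<And>x. (k has_real_derivative k' x) (at x)" and k'_cont: "continuous_on UNIV k'"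
    and k'_bnd: "\<And>x. \<bar>k' x\<bar> \<le> K"
  shows "expectation (\<lambda>w. g (\<lambda>j. Y j w) * k (X w) * D w) =
    (\<Sum>i<n. expectation (\<lambda>w. Y i w * D w) * expectation (\<lambda>w. partial_deriv i g (\<lambda>j. Y j w) * k (X w))) +
    expectation (\<lambda>w. X w * D w) * expectation (\<lambda>w. g (\<lambda>j. Y j w) * k' (X w))"
proof -
  have k_cont: "continuous_on UNIV k" using k by (meson DERIV_isCont continuous_at_imp_continuous_on)
  have km[measurable]: "k \<in> borel_measurable borel" "k' \<in> borel_measurable borel"
    using k_cont k'_cont by (auto intro: borel_measurable_continuous_onI)
  have Ym[measurable]: "Y j \<in> borel_measurable M" if "j < n" for j using Y[OF that] by (rule meas)
  have [measurable]: "X \<in> borel_measurable M" "D \<in> borel_measurable M" using X D by (auto intro: meas)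
  have K0: "0 \<le> K" using k'_bnd[of 0] by linarith
  have k_le: "\<bar>k x\<bar> \<le> \<bar>k 0\<bar> + K * \<bar>x\<bar>" for x
    using lin_growth_of_bounded_deriv[OF k k'_bnd, of x 0] by simp
  have kX: "(\<lambda>w. k (X w)) \<in> L2_rv M" by (rule L2_rv_lin_growth[OF prob_space_axioms mem_L2[OF X] km(1) k_le])
  have k'X: "(\<lambda>w. k' (X w)) \<in> L2_rv M" using k'_bnd by (intro L2_rv_bounded[where B=K]) auto
  have hm: "(\<lambda>w. h (\<lambda>j. Y j w)) \<in> borel_measurable M" if "h \<in> Cb_infinity n" for h
    using that Ym by (rule Cb_infinity_measurable)
  have L2: "(\<lambda>w. h (\<lambda>j. Y j w) * Z w) \<in> L2_rv M" if "h \<in> Cb_infinity n" "Z \<in> L2_rv M" for h Z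
    using Cb_infinity_bounded[OF that(1)] L2_rv_bounded_mult[OF that(2) hm[OF that(1)]] by blast
  define v where "v = expectation (\<lambda>w. (D w)\<^sup>2)"
  show ?thesis
  proof (cases "v = 0")
    case True
    \<comment> \<open>Regression on a variable of variance 0 makes no sense, but then
      \<open>D\<close> vanishes almost surely and both sides are 0.\<close>
    then have D0: "AE w in M. D w = 0"
      using integral_nonneg_eq_0_iff_AE[OF integrable_power[OF D, of 2]] by (simp add: v_def)
    have z: "expectation (\<lambda>w. Z w * D w) = 0" for Z
      by (rule integral_eq_zero_AE) (use D0 in eventually_elim, simp)
    show ?thesis by (simp add: z)
  next
    case False
    then have v: "0 < v" by (simp add: v_def less_le)
    define c where "c i = expectation (\<lambda>w. Y i w * D w) / v" for i
    define r where "r = expectation (\<lambda>w. X w * D w) / v"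
    \<comment> \<open>Index \<open>n\<close> holds the remainder of \<open>X\<close>, so that one
      vector over \<open>{..n}\<close> carries all remainders.\<close>
    define \<eta> where "\<eta> i w = (if i < n then Y i w - c i * D w else X w - r * D w)" for i w
    define p where "p x e i = (if i < n then e i + c i * x else 0)" for x :: real and e :: "nat \<Rightarrow> real" and i
    define \<Phi> where "\<Phi> x e = g (p x e) * k (e n + r * x)" for x e
    define \<Phi>' where "\<Phi>' x e = (\<Sum>i<n. c i * partial_deriv i g (p x e)) * k (e n + r * x) + g (p x e) * (k' (e n + r * x) * r)" for x e
    have \<eta>G: "\<eta> j \<in> G" for j
      using lin[OF Y[of j] D, of 1 "- c j"] lin[OF X D, of 1 "- r"]
        by (cases "j < n") (simp_all add: \<eta>_def[abs_def])
    have orth: "expectation (\<lambda>w. \<eta> j w * D w) = 0" for j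
    proof -
      have "expectation (\<lambda>w. (Z w - a * D w) * D w) = expectation (\<lambda>w. Z w * D w) - a * v" if "Z \<in> G" for Z a
      proof -
        have "(Z w - a * D w) * D w = Z w * D w - a * (D w)\<^sup>2" for w
          by (simp add: power2_eq_square algebra_simps)
        then show ?thesis using integrable_mult[OF that D] integrable_power[OF D, of 2] by (simp add: v_def)
      qed
      from this[OF Y, of j "c j"] this[OF X, of r] show ?thesis
        using v by (cases "j < n") (simp_all add: \<eta>_def c_def r_def)
    qed
    let ?\<eta> = "\<lambda>w. \<lambda>j\<in>{..n}. \<eta> j w"
    have p\<eta>: "h (p (D w) (?\<eta> w)) = h (\<lambda>j. Y j w)" if "h \<in> Cb_infinity n" for h w
      by (rule Cb_infinity_cong[OF that]) (simp add: p_def \<eta>_def)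
    have q\<eta>: "?\<eta> w n + r * D w = X w" for w by (simp add: \<eta>_def)
    have pm[measurable]: "(\<lambda>z. p (fst z) (snd z)) \<in> borel_measurable (borel \<Otimes>\<^sub>M PiM {..n} (\<lambda>_. borel))"
    proof (rule measurable_coordinatewise_then_product)
      show "(\<lambda>z. p (fst z) (snd z) i) \<in> borel_measurable (borel \<Otimes>\<^sub>M PiM {..n} (\<lambda>_. borel))" for i
        by (cases "i < n") (simp_all add: p_def)
    qed
    have hpm: "(\<lambda>z. h (p (fst z) (snd z))) \<in> borel_measurable (borel \<Otimes>\<^sub>M PiM {..n} (\<lambda>_. borel))"
      if "h \<in> Cb_infinity n" for h
    proof -
      have [measurable]: "h \<in> borel_measurable borel"
        using Cb_infinity_continuous[OF that] by (rule borel_measurable_continuous_onI)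
      show ?thesis by measurable
    qed
    note [measurable] = hpm[OF g] hpm[OF Cb_infinity_partial_deriv[OF g]]
    have qm[measurable]: "(\<lambda>z. snd z n + r * fst z) \<in> borel_measurable (borel \<Otimes>\<^sub>M PiM {..n} (\<lambda>_. borel))"
      by simp
    have p_line: "p x e = (\<lambda>i. (if i < n then e i else 0) + (if i < n then c i else 0) * x)" for x e
      by (auto simp: p_def)
    have iP: "integrable M (\<lambda>w. partial_deriv i g (\<lambda>j. Y j w) * k (X w))" if "i < n" for i
      using L2_rv_integrable[OF L2[OF Cb_infinity_partial_deriv[OF g that] kX]] .
    have iG: "integrable M (\<lambda>w. g (\<lambda>j. Y j w) * k' (X w))"
      using L2_rv_integrable[OF L2[OF g k'X]] .
    have \<Phi>'_eq: "\<Phi>' (D w) (?\<eta> w) = (\<Sum>i<n. c i * (partial_deriv i g (\<lambda>j. Y j w) * k (X w))) + r * (g (\<lambda>j. Y j w) * k' (X w))" for w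
      unfolding \<Phi>'_def p\<eta>[OF g] q\<eta> sum_distrib_right
      using p\<eta>[OF Cb_infinity_partial_deriv[OF g]] by (simp add: mult_ac)
    have main: "expectation (\<lambda>w. D w * \<Phi> (D w) (?\<eta> w)) = v * expectation (\<lambda>w. \<Phi>' (D w) (?\<eta> w))"
      unfolding v_def
    proof (rule integration_by_parts)
      show "case_prod \<Phi> \<in> borel_measurable (borel \<Otimes>\<^sub>M PiM {..n} (\<lambda>_. borel))"
        unfolding \<Phi>_def split_beta' by measurable
      show "case_prod \<Phi>' \<in> borel_measurable (borel \<Otimes>\<^sub>M PiM {..n} (\<lambda>_. borel))"
        unfolding \<Phi>'_def split_beta'
        by (intro borel_measurable_add borel_measurable_times borel_measurable_sum borel_measurable_const
            hpm[OF g] hpm[OF Cb_infinity_partial_deriv[OF g]] measurable_compose[OF qm km(1)] measurable_compose[OF qm km(2)]) auto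
      show "((\<lambda>x. \<Phi> x e) has_real_derivative \<Phi>' x e) (at x)" for x e
      proof -
        have "((\<lambda>x. g (p x e)) has_real_derivative (\<Sum>i<n. c i * partial_deriv i g (p x e))) (at x)"
          unfolding p_line by (rule DERIV_cong[OF Cb_infinity_line_deriv[OF g]]) (simp cong: sum.cong_simp)
        moreover have "((\<lambda>x. k (e n + r * x)) has_real_derivative k' (e n + r * x) * r) (at x)"
          by (rule DERIV_chain2[OF k]) (auto intro!: derivative_eq_intros)
        ultimately show ?thesis unfolding \<Phi>_def \<Phi>'_def
          by (rule DERIV_cong[OF DERIV_mult]) (simp add: algebra_simps)
      qed
      have contp: "continuous_on UNIV (\<lambda>x. h (p x e))" if "h \<in> Cb_infinity n" for h e
        unfolding p_line
        by (rule continuous_on_compose2[OF Cb_infinity_continuous[OF that]])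
           (auto intro!: continuous_on_coordinatewise_then_product continuous_intros)
      show "continuous_on UNIV (\<lambda>x. \<Phi>' x e)" for e
        unfolding \<Phi>'_def
        by (intro continuous_intros contp[OF g] contp[OF Cb_infinity_partial_deriv[OF g]]
            continuous_on_compose2[OF k_cont] continuous_on_compose2[OF k'_cont]) auto
      show "\<exists>C. \<forall>x. \<bar>\<Phi> x e\<bar> \<le> C * (1 + \<bar>x\<bar>) \<and> \<bar>\<Phi>' x e\<bar> \<le> C * (1 + \<bar>x\<bar>)" for e
      proof -
        obtain B where B: "0 \<le> B" "\<And>x. \<bar>g x\<bar> \<le> B" using Cb_infinity_bounded[OF g] by blast
        have "\<forall>i\<in>{..<n}. \<exists>B\<ge>0. \<forall>x. \<bar>partial_deriv i g x\<bar> \<le> B"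
          using Cb_infinity_bounded[OF Cb_infinity_partial_deriv[OF g]] by blast
        then obtain B' where B': "\<And>i. i < n \<Longrightarrow> 0 \<le> B' i" "\<And>i x. i < n \<Longrightarrow> \<bar>partial_deriv i g x\<bar> \<le> B' i"
          by (metis lessThan_iff)
        define S where "S = (\<Sum>i<n. \<bar>c i\<bar> * B' i)"
        have S0: "0 \<le> S" unfolding S_def using B' by (intro sum_nonneg) auto
        have S: "\<bar>\<Sum>i<n. c i * partial_deriv i g y\<bar> \<le> S" for y
          unfolding S_def using B' by (intro order.trans[OF sum_abs] sum_mono) (auto simp: abs_mult intro!: mult_left_mono)
        define Q where "Q = \<bar>k 0\<bar> + K * \<bar>e n\<bar> + K * \<bar>r\<bar>"
        have Q0: "0 \<le> Q" using K0 by (simp add: Q_def)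
        have Q: "\<bar>k (e n + r * x)\<bar> \<le> Q * (1 + \<bar>x\<bar>)" for x
        proof -
          have "\<bar>k (e n + r * x)\<bar> \<le> \<bar>k 0\<bar> + K * (\<bar>e n\<bar> + \<bar>r\<bar> * \<bar>x\<bar>)"
            using k_le[of "e n + r * x"] mult_left_mono[OF abs_triangle_ineq[of "e n" "r * x"] K0]
              by (simp add: abs_mult)
          also have "\<dots> \<le> (\<bar>k 0\<bar> + K * \<bar>e n\<bar>) * (1 + \<bar>x\<bar>) + K * \<bar>r\<bar> * (1 + \<bar>x\<bar>)"
            using K0 by (simp add: algebra_simps)
          finally show ?thesis by (simp add: Q_def algebra_simps)
        qed
        have 1: "\<bar>\<Phi> x e\<bar> \<le> B * Q * (1 + \<bar>x\<bar>)" for x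
          unfolding \<Phi>_def abs_mult mult.assoc using B Q by (intro mult_mono) auto
        have 2: "\<bar>\<Phi>' x e\<bar> \<le> S * (Q * (1 + \<bar>x\<bar>)) + B * (K * \<bar>r\<bar>)" for x
          unfolding \<Phi>'_def
          by (rule order.trans[OF abs_triangle_ineq], unfold abs_mult)
             (use B Q S S0 k'_bnd K0 in \<open>intro add_mono mult_mono mult_nonneg_nonneg, auto\<close>)
        have 3: "B * (K * \<bar>r\<bar>) \<le> B * (K * \<bar>r\<bar>) * (1 + \<bar>x\<bar>)" for x
          using B(1) K0 mult_left_mono[of 1 "1 + \<bar>x\<bar>" "B * (K * \<bar>r\<bar>)"] by simp
        have nn: "0 \<le> B * Q * (1 + \<bar>x\<bar>)" "0 \<le> S * (Q * (1 + \<bar>x\<bar>))" "0 \<le> B * (K * \<bar>r\<bar>) * (1 + \<bar>x\<bar>)" for x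
          using B(1) Q0 S0 K0 by simp_all
        have "\<bar>\<Phi> x e\<bar> \<le> (B * Q + S * Q + B * (K * \<bar>r\<bar>)) * (1 + \<bar>x\<bar>)"
          "\<bar>\<Phi>' x e\<bar> \<le> (B * Q + S * Q + B * (K * \<bar>r\<bar>)) * (1 + \<bar>x\<bar>)" for x
          using 1[of x] 2[of x] 3[of x] nn[of x] by (auto simp only: distrib_right mult.assoc)
        then show ?thesis by blast
      qed
      have "integrable M (\<lambda>w. g (\<lambda>j. Y j w) * k (X w) * D w)"
        by (intro L2_rv_mult_integrable L2[OF g kX] mem_L2[OF D])
      then show "integrable M (\<lambda>w. D w * \<Phi> (D w) (?\<eta> w))"
        unfolding \<Phi>_def p\<eta>[OF g] q\<eta> by (simp add: mult.commute)
      show "integrable M (\<lambda>w. \<Phi>' (D w) (?\<eta> w))"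
        unfolding \<Phi>'_eq using iP iG
        by (intro Bochner_Integration.integrable_add Bochner_Integration.integrable_sum integrable_mult_right) auto
    qed (use \<eta>G orth D in auto)
    have "expectation (\<lambda>w. \<Phi>' (D w) (?\<eta> w)) = (\<Sum>i<n. c i * expectation (\<lambda>w. partial_deriv i g (\<lambda>j. Y j w) * k (X w)))
        + r * expectation (\<lambda>w. g (\<lambda>j. Y j w) * k' (X w))"
    proof -
      have i: "integrable M (\<lambda>w. c i * (partial_deriv i g (\<lambda>j. Y j w) * k (X w)))" if "i \<in> {..<n}" for i
        using iP that by (intro integrable_mult_right) auto
      show ?thesis unfolding \<Phi>'_eq
        by (subst Bochner_Integration.integral_add[OF Bochner_Integration.integrable_sum[OF i] integrable_mult_right[OF iG]], assumption,
            subst Bochner_Integration.integral_sum[OF i], assumption) simp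
    qed
    moreover have "D w * \<Phi> (D w) (?\<eta> w) = g (\<lambda>j. Y j w) * k (X w) * D w" for w
      unfolding \<Phi>_def p\<eta>[OF g] q\<eta> by simp
    then have "expectation (\<lambda>w. D w * \<Phi> (D w) (?\<eta> w)) = expectation (\<lambda>w. g (\<lambda>j. Y j w) * k (X w) * D w)"
      by (simp only:)
    ultimately show ?thesis using main v
      by (simp add: distrib_left sum_distrib_left c_def r_def)
  qed
qed

end

section \<open>The semiscalar product of a covariance measure\<close>

lemma measurable_fst_square [measurable]: "fst \<in> measurable (square_borel T) (interval_borel T)"
  and measurable_snd_square [measurable]: "snd \<in> measurable (square_borel T) (interval_borel T)"
  by (rule measurable_restrict_space2, force simp: space_restrict_space,
      rule measurable_restrict_space1, rule borel_measurable_continuous_onI, intro continuous_intros)+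

lemma space_square_borel: "space (square_borel T) = {0..T} \<times> {0..T}"
  and space_interval_borel: "space (interval_borel T) = {0..T}"
  by (simp_all add: space_restrict_space)

lemma borel_measurable_interval: "h \<in> borel_measurable borel \<Longrightarrow> h \<in> borel_measurable (interval_borel T)"
  by (rule measurable_restrict_space1)

lemma tensor_measurable:
  fixes \<phi> \<psi> :: "real \<Rightarrow> real"
  assumes "\<phi> \<in> borel_measurable (interval_borel T)" "\<psi> \<in> borel_measurable (interval_borel T)"
  shows "(\<lambda>(x, y). \<phi> x * \<psi> y) \<in> borel_measurable (square_borel T)"
  unfolding split_beta'
  by (rule borel_measurable_times[OF measurable_compose[OF measurable_fst_square assms(1)] measurable_compose[OF measurable_snd_square assms(2)]])

lemma rectangle_sets_square: "A \<in> sets borel \<Longrightarrow> B \<in> sets borel \<Longrightarrow> A \<times> B \<subseteq> {0..T} \<times> {0..T} \<Longrightarrow> A \<times> B \<in> sets (square_borel T)"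
  using sets_restrict_space_iff[of "{0..T} \<times> {0..T} :: (real \<times> real) set" borel]
  by (auto simp: borel_prod[symmetric] closed_Times intro: borel_closed)

text \<open>The two measures will be the Jordan parts of \<open>\<mu>\<close>; then \<open>V\<close>
  is the variation and \<open>I\<close> the signed integral. Ordinary integration theory applies to
  each of the two parts.\<close>

locale signed_pair =
  fixes T :: real and Mp Mn :: "(real \<times> real) measure"
  assumes finite_Mp: "finite_measure Mp" and finite_Mn: "finite_measure Mn"
    and sets_Mp: "sets Mp = sets (square_borel T)" and sets_Mn: "sets Mn = sets (square_borel T)"
begin

sublocale P: finite_measure Mp by (rule finite_Mp)
sublocale N: finite_measure Mn by (rule finite_Mn)

definition V where "V = add_measure Mp Mn"

definition I :: "(real \<times> real \<Rightarrow> real) \<Rightarrow> real" where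
  "I h = integral\<^sup>L Mp h - integral\<^sup>L Mn h"

definition inn :: "(real \<Rightarrow> real) \<Rightarrow> (real \<Rightarrow> real) \<Rightarrow> real" where
  "inn \<phi> \<psi> = I (\<lambda>(x, y). \<phi> x * \<psi> y)"

lemma sets_V: "sets V = sets (square_borel T)" by (simp add: V_def sets_Mp)
lemma space_V: "space V = {0..T} \<times> {0..T}" using sets_eq_imp_space_eq[OF sets_V]
  by (simp add: space_square_borel)
lemma space_Mp: "space Mp = {0..T} \<times> {0..T}" using sets_eq_imp_space_eq[OF sets_Mp]
  by (simp add: space_square_borel)
lemma space_Mn: "space Mn = {0..T} \<times> {0..T}" using sets_eq_imp_space_eq[OF sets_Mn]
  by (simp add: space_square_borel)

lemma meas_eq [simp]: "measurable Mp K = measurable (square_borel T) K" "measurable Mn K = measurable (square_borel T) K"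
  "measurable V K = measurable (square_borel T) K"
  by (rule measurable_cong_sets; simp add: sets_Mp sets_Mn sets_V)+

lemma sets_Mn_Mp: "sets Mn = sets Mp" by (simp add: sets_Mp sets_Mn)

sublocale V: finite_measure V
  unfolding V_def by (rule finite_add_measure[OF finite_Mp finite_Mn sets_Mn_Mp])

lemma integrable_V: "integrable V h \<longleftrightarrow> integrable Mp h \<and> integrable Mn h" for h :: "real \<times> real \<Rightarrow> real"
  unfolding V_def by (rule integrable_add_measure_iff[OF sets_Mn_Mp])

lemma integral_V: "integrable V h \<Longrightarrow> integral\<^sup>L V h = integral\<^sup>L Mp h + integral\<^sup>L Mn h"
  for h :: "real \<times> real \<Rightarrow> real"
  using integrable_V[of h] integral_add_measure[OF sets_Mn_Mp, of h] by (simp add: V_def)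

lemma integrable_bounded:
  fixes h :: "real \<times> real \<Rightarrow> real" and C :: real
  assumes "h \<in> borel_measurable (square_borel T)" "\<And>z. z \<in> {0..T} \<times> {0..T} \<Longrightarrow> \<bar>h z\<bar> \<le> C"
  shows "integrable V h"
  by (rule V.integrable_const_bound[where B=C]) (use assms in \<open>auto simp: space_V intro!: AE_I2\<close>)

lemma I_add: "integrable V h \<Longrightarrow> integrable V k \<Longrightarrow> I (\<lambda>z. h z + k z) = I h + I k"
  by (simp add: I_def integrable_V)

lemma I_diff: "integrable V h \<Longrightarrow> integrable V k \<Longrightarrow> I (\<lambda>z. h z - k z) = I h - I k"
  by (simp add: I_def integrable_V)

lemma I_cmult: "I (\<lambda>z. c * h z) = c * I h"
  by (simp add: I_def right_diff_distrib)

lemma I_sum: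
  assumes "\<And>j. j \<in> J \<Longrightarrow> integrable V (h j)"
  shows "I (\<lambda>z. \<Sum>j\<in>J. h j z) = (\<Sum>j\<in>J. I (h j))"
  using assms by (simp add: I_def integrable_V sum_subtractf)

lemma I_cong: "(\<And>z. z \<in> {0..T} \<times> {0..T} \<Longrightarrow> h z = k z) \<Longrightarrow> I h = I k"
  unfolding I_def by (intro arg_cong2[where f=minus] Bochner_Integration.integral_cong) (auto simp: space_Mp space_Mn)

lemma I_le:
  assumes "integrable V h"
  shows "\<bar>I h\<bar> \<le> (LINT z|V. \<bar>h z\<bar>)"
proof -
  have "\<bar>I h\<bar> \<le> \<bar>integral\<^sup>L Mp h\<bar> + \<bar>integral\<^sup>L Mn h\<bar>" by (simp add: I_def)
  also have "\<dots> \<le> (LINT z|Mp. \<bar>h z\<bar>) + (LINT z|Mn. \<bar>h z\<bar>)" by (intro add_mono integral_abs_bound)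
  also have "\<dots> = (LINT z|V. \<bar>h z\<bar>)" using assms integral_V[of "\<lambda>z. \<bar>h z\<bar>"] by simp
  finally show ?thesis .
qed

lemma I_le_bounded:
  assumes "h \<in> borel_measurable (square_borel T)" "\<And>z. z \<in> {0..T} \<times> {0..T} \<Longrightarrow> \<bar>h z\<bar> \<le> C"
  shows "\<bar>I h\<bar> \<le> C * measure V (space V)"
proof -
  have "\<bar>I h\<bar> \<le> (LINT z|V. \<bar>h z\<bar>)" by (rule I_le[OF integrable_bounded[OF assms]])
  also have "\<dots> \<le> (LINT z|V. C)"
    using integrable_bounded[OF assms] assms(2) by (intro integral_mono_AE AE_I2) (auto simp: space_V)
  finally show ?thesis by (simp add: mult.commute)
qed

lemma I_dominated:
  fixes h :: "nat \<Rightarrow> real \<times> real \<Rightarrow> real"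
  assumes "\<And>k. h k \<in> borel_measurable (square_borel T)" "H \<in> borel_measurable (square_borel T)" "integrable V D"
    and "\<And>k z. z \<in> {0..T} \<times> {0..T} \<Longrightarrow> \<bar>h k z\<bar> \<le> D z"
    and "\<And>z. z \<in> {0..T} \<times> {0..T} \<Longrightarrow> (\<lambda>k. h k z) \<longlonglongrightarrow> H z"
  shows "(\<lambda>k. I (h k)) \<longlonglongrightarrow> I H"
proof -
  have D: "integrable Mp D" "integrable Mn D" using assms(3) by (auto simp: integrable_V)
  show ?thesis unfolding I_def
    by (intro tendsto_diff integral_dominated_convergence[OF _ _ D(1)] integral_dominated_convergence[OF _ _ D(2)])
       (use assms in \<open>auto simp: space_Mp space_Mn intro!: AE_I2\<close>)
qed

lemma I_bounded_limit:
  fixes h :: "nat \<Rightarrow> real \<times> real \<Rightarrow> real"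
  assumes "\<And>k. h k \<in> borel_measurable (square_borel T)" "H \<in> borel_measurable (square_borel T)"
    and "\<And>k z. z \<in> {0..T} \<times> {0..T} \<Longrightarrow> \<bar>h k z\<bar> \<le> C"
    and "\<And>z. z \<in> {0..T} \<times> {0..T} \<Longrightarrow> (\<lambda>k. h k z) \<longlonglongrightarrow> H z"
  shows "(\<lambda>k. I (h k)) \<longlonglongrightarrow> I H"
  by (rule I_dominated[of _ _ "\<lambda>_. C"]) (use assms in auto)

text \<open>The measures on the square are finite, so a bound on absolute first moments that is
  uniform in \<open>z\<close> makes \<open>h\<close> integrable over the product with either
  part.\<close>

lemma I_Fubini:
  assumes "prob_space M"
    and h[measurable]: "case_prod h \<in> borel_measurable (M \<Otimes>\<^sub>M square_borel T)"
    and bnd: "\<And>z. z \<in> {0..T} \<times> {0..T} \<Longrightarrow> (\<integral>\<^sup>+w. ennreal \<bar>h w z\<bar> \<partial>M) \<le> ennreal C"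
  shows I_Fubini_integrable: "integrable M (\<lambda>w. I (h w))"
    and I_Fubini_eq: "(LINT w|M. I (h w)) = I (\<lambda>z. LINT w|M. h w z)"
proof -
  interpret M: prob_space M by fact
  have *: "integrable M (\<lambda>w. integral\<^sup>L K (h w)) \<and> (LINT w|M. integral\<^sup>L K (h w)) = (LINT z|K. LINT w|M. h w z)"
    if K: "finite_measure K" "sets K = sets (square_borel T)" for K
  proof -
    interpret K: finite_measure K by fact
    interpret pair_sigma_finite M K ..
    have sp: "space K = {0..T} \<times> {0..T}" using sets_eq_imp_space_eq[OF K(2)] by (simp add: space_square_borel)
    have hm[measurable]: "case_prod h \<in> borel_measurable (M \<Otimes>\<^sub>M K)"
      using h K(2) by (simp cong: measurable_cong_sets sets_pair_measure_cong)
    have "(\<integral>\<^sup>+p. ennreal (norm (case_prod h p)) \<partial>(M \<Otimes>\<^sub>M K)) = (\<integral>\<^sup>+z. \<integral>\<^sup>+w. ennreal \<bar>h w z\<bar> \<partial>M \<partial>K)"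
      using nn_integral_snd[of "\<lambda>p. ennreal \<bar>h (fst p) (snd p)\<bar>"] hm by (simp add: split_beta')
    also have "\<dots> \<le> (\<integral>\<^sup>+z. ennreal C \<partial>K)" using bnd by (intro nn_integral_mono) (auto simp: sp)
    also have "\<dots> < \<infinity>"
    proof -
      have "emeasure K (space K) < top" using K.emeasure_finite[of "space K"]
        unfolding infinity_ennreal_def less_top .
      then show ?thesis by (auto simp: ennreal_mult_less_top)
    qed
    finally have "integrable (M \<Otimes>\<^sub>M K) (case_prod h)" by (simp add: integrable_iff_bounded)
    then show ?thesis using integrable_fst[of h] Fubini_integral[of h] by simp
  qed
  note p = *[OF finite_Mp sets_Mp] and n = *[OF finite_Mn sets_Mn]
  show "integrable M (\<lambda>w. I (h w))" unfolding I_def using p n by auto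
  show "(LINT w|M. I (h w)) = I (\<lambda>z. LINT w|M. h w z)" unfolding I_def using p n by simp
qed

end

section \<open>Gaussian processes with a covariance measure\<close>

locale gaussian_cov = gaussian_space M G + signed_pair T Mp Mn
  for M :: "'w measure" and G :: "('w \<Rightarrow> real) set" and T :: real and Mp Mn :: "(real \<times> real) measure" +
  fixes X :: "real \<Rightarrow> 'w \<Rightarrow> real"
  assumes T_pos: "0 < T"
    and X_mem: "\<And>t. t \<in> {0..T} \<Longrightarrow> X t \<in> G"
    and X_cont: "\<And>w. w \<in> space M \<Longrightarrow> continuous_on {0..T} (\<lambda>t. X t w)"
    and X_0: "\<And>w. w \<in> space M \<Longrightarrow> X 0 w = 0"
    and cov: "\<And>s t. s \<in> {0..T} \<Longrightarrow> t \<in> {0..T} \<Longrightarrow>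
      measure Mp ({0..s} \<times> {0..t}) - measure Mn ({0..s} \<times> {0..t}) = expectation (\<lambda>w. X s w * X t w)"
begin

lemma X_meas: "t \<in> {0..T} \<Longrightarrow> X t \<in> borel_measurable M"
  by (intro meas X_mem)

text \<open>By path continuity \<open>X s\<close> is the limit of \<open>X\<close> at grid points
  \<open>\<tau> m (j m s)\<close> that do not exceed \<open>s\<close>. For fixed \<open>m\<close>
  the index takes countably many values, so measurability of single coordinates is enough.\<close>

lemma X_joint [measurable]: "(\<lambda>(w, s). X s w) \<in> borel_measurable (M \<Otimes>\<^sub>M interval_borel T)"
proof (rule borel_measurable_LIMSEQ_real)
  \<comment> \<open>The minimum keeps \<open>\<tau> m k\<close> inside the interval for every
    \<open>k\<close>, including indices that no \<open>s\<close> of the interval produces.\<close>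
  define \<tau> where "\<tau> m k = min T (T * real k / real (Suc m))" for m k :: nat
  define j where "j m s = nat \<lfloor>real (Suc m) * s / T\<rfloor>" for m :: nat and s :: real
  have \<tau>_in: "\<tau> m k \<in> {0..T}" for m k using T_pos by (auto simp: \<tau>_def)
  show "(\<lambda>(w, s). X (\<tau> m (j m s)) w) \<in> borel_measurable (M \<Otimes>\<^sub>M interval_borel T)" for m
  proof -
    have "(\<lambda>p. (\<lambda>k p. X (\<tau> m k) (fst p)) (j m (snd p)) p) \<in> borel_measurable (M \<Otimes>\<^sub>M interval_borel T)"
    proof (rule measurable_compose_countable)
      show "(\<lambda>p. X (\<tau> m k) (fst p)) \<in> borel_measurable (M \<Otimes>\<^sub>M interval_borel T)" for k
        using X_meas[OF \<tau>_in] by simp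
      have "j m \<in> measurable borel (count_space UNIV)" unfolding j_def by measurable
      then have "j m \<in> measurable (interval_borel T) (count_space UNIV)" by (rule measurable_restrict_space1)
      then show "(\<lambda>p. j m (snd p)) \<in> measurable (M \<Otimes>\<^sub>M interval_borel T) (count_space UNIV)" by simp
    qed
    then show ?thesis by (simp add: split_beta')
  qed
  fix p assume p: "p \<in> space (M \<Otimes>\<^sub>M interval_borel T)"
  obtain w s where ws: "p = (w, s)" "w \<in> space M" "s \<in> {0..T}"
    using p by (auto simp: space_pair_measure space_interval_borel)
  have lim: "(\<lambda>m. \<tau> m (j m s)) \<longlonglongrightarrow> s"
  proof (rule LIMSEQ_I)
    fix e :: real assume e: "0 < e"
    obtain n0 where n0: "T / e < real n0" using reals_Archimedean2 by blast
    have "norm (\<tau> m (j m s) - s) < e" if "m \<ge> n0" for m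
    proof -
      let ?y = "real (Suc m) * s / T"
      have y0: "0 \<le> ?y" using ws T_pos by simp
      have r: "real (j m s) = of_int \<lfloor>?y\<rfloor>" using y0 by (simp add: j_def)
      have "T * real (j m s) / real (Suc m) \<le> T * ?y / real (Suc m)"
        unfolding r using T_pos by (intro divide_right_mono mult_left_mono) auto
      also have "\<dots> = s" using T_pos by simp
      finally have le: "T * real (j m s) / real (Suc m) \<le> s" .
      have "T * (?y - 1) / real (Suc m) < T * real (j m s) / real (Suc m)"
        unfolding r using T_pos by (intro divide_strict_right_mono mult_strict_left_mono) linarith+
      moreover have "T * (?y - 1) / real (Suc m) = s - T / real (Suc m)"
      proof -
        have "T * (?y - 1) = real (Suc m) * s - T" using T_pos by (simp add: right_diff_distrib)
        then show ?thesis by (simp only: diff_divide_distrib) simp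
      qed
      ultimately have ge: "s - T / real (Suc m) < T * real (j m s) / real (Suc m)" by simp
      have "T / e < real (Suc m)" using n0 that by simp
      then have "T / real (Suc m) < e" using e by (simp add: field_simps)
      then show ?thesis using le ge ws by (simp add: \<tau>_def min_def)
    qed
    then show "\<exists>n0. \<forall>m\<ge>n0. norm (\<tau> m (j m s) - s) < e" by blast
  qed
  have "(\<lambda>m. X (\<tau> m (j m s)) w) \<longlonglongrightarrow> X s w"
    using continuous_on_tendsto_compose[OF X_cont[OF ws(2)] lim ws(3)] \<tau>_in by simp
  then show "(\<lambda>m. case p of (w, s) \<Rightarrow> X (\<tau> m (j m s)) w) \<longlonglongrightarrow> (case p of (w, s) \<Rightarrow> X s w)"
    using ws by simp
qed

lemma I_rectangle:
  assumes "s \<in> {0..T}" "t \<in> {0..T}"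
  shows "I (indicator ({0..s} \<times> {0..t})) = expectation (\<lambda>w. X s w * X t w)"
proof -
  have *: "{0..s} \<times> {0..t} \<in> sets (square_borel T)" using assms by (intro rectangle_sets_square) auto
  have "{0..s} \<times> {0..t} \<subseteq> {0..T} \<times> {0..T}" using assms by auto
  then show ?thesis using cov[OF assms] * by (simp add: I_def sets_Mp sets_Mn space_Mp space_Mn Int_absorb2)
qed

lemma inn_indicator:
  assumes "s \<in> {0..T}" "t \<in> {0..T}"
  shows "inn (indicator {0..s}) (indicator {0..t}) = expectation (\<lambda>w. X s w * X t w)"
  unfolding inn_def I_rectangle[OF assms, symmetric] by (intro I_cong) (auto simp: indicator_def)

text \<open>The image of \<open>Mp - Mn\<close> under the exchange of coordinates agrees with
  \<open>Mp - Mn\<close> on rectangles at the origin, because covariances are symmetric; uniqueness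
  extends this to all Borel sets.\<close>

lemma I_swap:
  assumes h: "h \<in> borel_measurable (square_borel T)" and bnd: "\<And>z. z \<in> {0..T} \<times> {0..T} \<Longrightarrow> \<bar>h z\<bar> \<le> C"
  shows "I (\<lambda>z. h (snd z, fst z)) = I h"
proof -
  let ?sw = "\<lambda>z::real \<times> real. (snd z, fst z)"
  have sw[measurable]: "?sw \<in> measurable (square_borel T) (square_borel T)"
    by (rule measurable_restrict_space2, force simp: space_restrict_space,
      rule measurable_restrict_space1, rule borel_measurable_continuous_onI, intro continuous_intros)
  let ?A = "distr Mp (square_borel T) ?sw" and ?B = "distr Mn (square_borel T) ?sw"
  have fA: "finite_measure ?A" and fB: "finite_measure ?B"
    by (auto intro!: P.finite_measure_distr N.finite_measure_distr)
  have mA: "measure ?A E - measure ?B E = measure Mp E - measure Mn E" if E: "E \<in> sets (square_borel T)" for E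
  proof (rule real_signed_measure_unique_atMost[OF _ _ _ _ _ E])
    show "real_signed_measure (square_borel T) (\<lambda>E. ereal (measure ?A E - measure ?B E)) (\<lambda>E. measure ?A E - measure ?B E)"
      by (rule real_signed_measure_diff[OF fA fB]) auto
    show "real_signed_measure (square_borel T) (\<lambda>E. ereal (measure Mp E - measure Mn E)) (\<lambda>E. measure Mp E - measure Mn E)"
      by (rule real_signed_measure_diff[OF finite_Mp finite_Mn sets_Mp sets_Mn]) auto
    show "{0..T} \<times> {0..T} \<in> sets (borel :: (real \<times> real) measure)" by (intro borel_closed closed_Times) auto
    have pre: "measure ?A E - measure ?B E = measure Mp (?sw -` E \<inter> {0..T} \<times> {0..T}) - measure Mn (?sw -` E \<inter> {0..T} \<times> {0..T})"
      if "E \<in> sets (square_borel T)" for E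
      using that by (simp add: measure_distr space_Mp space_Mn)
    have rect: "measure ?A ({0..s} \<times> {0..t}) - measure ?B ({0..s} \<times> {0..t}) = measure Mp ({0..s} \<times> {0..t}) - measure Mn ({0..s} \<times> {0..t})"
      if st: "s \<in> {0..T}" "t \<in> {0..T}" for s t
    proof -
      have "{0..s} \<times> {0..t} \<in> sets (square_borel T)" using st by (intro rectangle_sets_square) auto
      moreover have "?sw -` ({0..s} \<times> {0..t}) \<inter> {0..T} \<times> {0..T} = {0..t} \<times> {0..s}" using st by auto
      ultimately show ?thesis using pre[of "{0..s} \<times> {0..t}"] cov[OF st] cov[OF st(2,1)]
        by (simp add: mult.commute)
    qed
    show "measure ?A ({0..T} \<times> {0..T} \<inter> {..a}) - measure ?B ({0..T} \<times> {0..T} \<inter> {..a}) =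
        measure Mp ({0..T} \<times> {0..T} \<inter> {..a}) - measure Mn ({0..T} \<times> {0..T} \<inter> {..a})" for a :: "real \<times> real"
    proof (cases "0 \<le> fst a \<and> 0 \<le> snd a")
      case True
      have "{0..T} \<times> {0..T} \<inter> {..a} = {0..min T (fst a)} \<times> {0..min T (snd a)}"
        by (auto simp: less_eq_prod_def)
      then show ?thesis using True T_pos rect[of "min T (fst a)" "min T (snd a)"] by auto
    next
      case False
      then have "{0..T} \<times> {0..T} \<inter> {..a} = {}" by (auto simp: less_eq_prod_def)
      then show ?thesis by simp
    qed
    show "measure ?A ({0..T} \<times> {0..T}) - measure ?B ({0..T} \<times> {0..T}) = measure Mp ({0..T} \<times> {0..T}) - measure Mn ({0..T} \<times> {0..T})"
      using rect[of T T] T_pos by simp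
  qed
  have int: "integrable K h" if "finite_measure K" "sets K = sets (square_borel T)" for K
  proof (rule finite_measure.integrable_const_bound[OF that(1)])
    show "AE z in K. norm (h z) \<le> C" 
      using bnd sets_eq_imp_space_eq[OF that(2)] by (auto simp: space_square_borel intro!: AE_I2)
    show "h \<in> borel_measurable K" using h that(2) by (simp cong: measurable_cong_sets)
  qed
  have "I (\<lambda>z. h (snd z, fst z)) = integral\<^sup>L ?A h - integral\<^sup>L ?B h"
    using h by (simp add: I_def integral_distr)
  also have "\<dots> = signed_integral (square_borel T) (\<lambda>E. ereal (measure Mp E - measure Mn E)) h"
    using mA fA fB int[OF fA] int[OF fB] by (intro signed_integral_eq_diff[symmetric]) auto
  also have "\<dots> = I h"
    unfolding I_def using int[OF finite_Mp sets_Mp] int[OF finite_Mn sets_Mn] 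
    by (intro signed_integral_eq_diff finite_Mp finite_Mn sets_Mp sets_Mn) auto
  finally show ?thesis .
qed

text \<open>Path continuity and dominated convergence give convergence of the means of the cosines,
  and the mean of the cosine of a centred Gaussian variable is \<open>exp\<close> of minus half its
  variance. Both time points may move, as the increments over a mesh require.\<close>

lemma expectation_diff_sq_tendsto:
  assumes s: "\<And>k. s k \<in> {0..T}" and t: "\<And>k. t k \<in> {0..T}" and st: "(\<lambda>k. s k - t k) \<longlonglongrightarrow> 0"
  shows "(\<lambda>k. expectation (\<lambda>w. (X (s k) w - X (t k) w)\<^sup>2)) \<longlonglongrightarrow> 0"
proof -
  let ?d = "\<lambda>k. expectation (\<lambda>w. (X (s k) w - X (t k) w)\<^sup>2)"
  have [measurable]: "X (s k) \<in> borel_measurable M" "X (t k) \<in> borel_measurable M" for k using X_meas s t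
    by auto
  have "(\<lambda>k. expectation (\<lambda>w. cos (X (s k) w - X (t k) w))) \<longlonglongrightarrow> expectation (\<lambda>_. 1)"
  proof (rule integral_dominated_convergence[where w="\<lambda>_. 1"])
    show "AE w in M. (\<lambda>k. cos (X (s k) w - X (t k) w)) \<longlonglongrightarrow> 1"
    proof (rule AE_I2)
      fix w assume w: "w \<in> space M"
      have uc: "uniformly_continuous_on {0..T} (\<lambda>t. X t w)"
        using X_cont[OF w] by (intro compact_uniformly_continuous) auto
      have "(\<lambda>k. X (s k) w - X (t k) w) \<longlonglongrightarrow> 0"
      proof (rule LIMSEQ_I)
        fix e :: real assume "0 < e"
        then obtain d where d: "0 < d" "\<And>a b. a \<in> {0..T} \<Longrightarrow> b \<in> {0..T} \<Longrightarrow> dist b a < d \<Longrightarrow> dist (X b w) (X a w) < e"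
          using uc unfolding uniformly_continuous_on_def by meson
        obtain n0 where "\<And>k. k \<ge> n0 \<Longrightarrow> norm (s k - t k - 0) < d" using LIMSEQ_D[OF st d(1)] by blast
        then show "\<exists>n0. \<forall>k\<ge>n0. norm (X (s k) w - X (t k) w - 0) < e"
          using d(2)[OF t s] by (auto simp: dist_real_def)
      qed
      then have "(\<lambda>k. cos (X (s k) w - X (t k) w)) \<longlonglongrightarrow> cos 0" by (intro tendsto_cos)
      then show "(\<lambda>k. cos (X (s k) w - X (t k) w)) \<longlonglongrightarrow> 1" by simp
    qed
  qed auto
  moreover have "expectation (\<lambda>w. cos (X (s k) w - X (t k) w)) = exp (- (?d k) / 2)" for k
    using expectation_cos[OF diff_mem[OF X_mem[OF s] X_mem[OF t]], of 1 k k] by simp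
  ultimately have "(\<lambda>k. exp (- (?d k) / 2)) \<longlonglongrightarrow> 1" by (simp add: prob_space)
  then have "(\<lambda>k. - 2 * ln (exp (- (?d k) / 2))) \<longlonglongrightarrow> - 2 * ln 1" by (intro tendsto_intros) auto
  then show ?thesis by simp
qed

definition mass where "mass = measure V (space V)"

lemma mass_nonneg: "0 \<le> mass" by (simp add: mass_def)

lemma increment_cov:
  assumes "0 \<le> a" "a \<le> b" "b \<le> T" "r \<in> {0..T}"
  shows "expectation (\<lambda>w. X r w * (X b w - X a w)) = I (\<lambda>(x, y). indicator {0..r} x * indicator {a<..b} y)"
proof -
  have mem: "a \<in> {0..T}" "b \<in> {0..T}" using assms by auto
  have i: "integrable V (\<lambda>(x, y). indicator {0..r} x * indicator {0..c} y :: real)" for c :: real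
    by (rule integrable_bounded[where C=1], rule tensor_measurable) (auto simp: indicator_def intro!: borel_measurable_interval)
  have "expectation (\<lambda>w. X r w * (X b w - X a w)) = inn (indicator {0..r}) (indicator {0..b}) - inn (indicator {0..r}) (indicator {0..a})"
    using integrable_mult[OF X_mem[OF assms(4)] X_mem[OF mem(1)]] integrable_mult[OF X_mem[OF assms(4)] X_mem[OF mem(2)]]
    unfolding inn_indicator[OF assms(4) mem(1)] inn_indicator[OF assms(4) mem(2)]
      by (simp add: right_diff_distrib)
  also have "\<dots> = I (\<lambda>z. (case z of (x, y) \<Rightarrow> indicator {0..r} x * indicator {0..b} y) - (case z of (x, y) \<Rightarrow> indicator {0..r} x * indicator {0..a} y))"
    unfolding inn_def by (rule I_diff[symmetric]) (rule i)+
  also have "\<dots> = I (\<lambda>(x, y). indicator {0..r} x * indicator {a<..b} y)"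
    using assms by (intro I_cong) (auto simp: indicator_def)
  finally show ?thesis .
qed

text \<open>The variance of the increment is the value of \<open>Mp - Mn\<close> on the square over
  \<open>{a<..b}\<close>. Summed over disjoint intervals such bounds stay below the total
  mass.\<close>

lemma increment_var:
  assumes "0 \<le> a" "a \<le> b" "b \<le> T"
  shows "expectation (\<lambda>w. (X b w - X a w)\<^sup>2) \<le> measure V ({a<..b} \<times> {a<..b})"
proof -
  have mem: "a \<in> {0..T}" "b \<in> {0..T}" using assms by auto
  have i: "integrable V (\<lambda>(x, y). indicator {0..r} x * indicator {a<..b} y :: real)" for r :: real
    by (rule integrable_bounded[where C=1], rule tensor_measurable) (auto simp: indicator_def intro!: borel_measurable_interval)
  have "(X b w - X a w)\<^sup>2 = X b w * (X b w - X a w) - X a w * (X b w - X a w)" for w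
    by (simp add: power2_eq_square algebra_simps)
  then have "expectation (\<lambda>w. (X b w - X a w)\<^sup>2) = expectation (\<lambda>w. X b w * (X b w - X a w)) - expectation (\<lambda>w. X a w * (X b w - X a w))"
    using integrable_mult[OF X_mem[OF mem(2)] diff_mem[OF X_mem[OF mem(2)] X_mem[OF mem(1)]]]
      integrable_mult[OF X_mem[OF mem(1)] diff_mem[OF X_mem[OF mem(2)] X_mem[OF mem(1)]]] by simp
  also have "\<dots> = I (\<lambda>z. (case z of (x, y) \<Rightarrow> indicator {0..b} x * indicator {a<..b} y) - (case z of (x, y) \<Rightarrow> indicator {0..a} x * indicator {a<..b} y))"
    unfolding increment_cov[OF assms mem(2)] increment_cov[OF assms mem(1)]
      by (rule I_diff[symmetric]) (rule i)+
  also have "\<dots> = I (indicator ({a<..b} \<times> {a<..b}))"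
    using assms by (intro I_cong) (auto simp: indicator_def of_bool_def split: if_splits)
  also have "\<dots> \<le> measure V ({a<..b} \<times> {a<..b})"
  proof -
    have S: "{a<..b} \<times> {a<..b} \<in> sets (square_borel T)" using assms by (intro rectangle_sets_square) auto
    have "I (indicator ({a<..b} \<times> {a<..b})) \<le> (LINT z|V. \<bar>indicator ({a<..b} \<times> {a<..b}) z\<bar>)"
      using S by (intro order.trans[OF abs_ge_self I_le] integrable_bounded[where C=1]) (auto simp: indicator_def)
    also have "\<dots> = measure V ({a<..b} \<times> {a<..b})"
      using S sets.sets_into_space[of "{a<..b} \<times> {a<..b}" V] by (simp add: sets_V Int_absorb2)
    finally show ?thesis .
  qed
  finally show ?thesis .
qed

lemma var_le_mass:
  assumes "r \<in> {0..T}"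
  shows "expectation (\<lambda>w. (X r w)\<^sup>2) \<le> mass"
proof -
  have "expectation (\<lambda>w. (X r w)\<^sup>2) = expectation (\<lambda>w. (X r w - X 0 w)\<^sup>2)"
    using X_0 by (intro Bochner_Integration.integral_cong) auto
  also have "\<dots> \<le> measure V ({0<..r} \<times> {0<..r})" using assms by (intro increment_var) auto
  also have "\<dots> \<le> mass"
    unfolding mass_def using assms sets.top[of V] by (intro V.finite_measure_mono) (auto simp: space_V)
  finally show ?thesis .
qed

end

section \<open>The duality relation for step functions\<close>

text \<open>As a function of the right endpoint \<open>z\<close> the remainder has derivative
  \<open>(f' z - f' x - f'' z * (z - x)) / 2\<close>, which is at most the oscillation of
  \<open>f''\<close> on the segment times \<open>|z - x|\<close>. Since \<open>f''\<close> may fail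
  to be uniformly continuous on the line, the oscillation is bounded by three terms:
  \<open>e\<close> on a compact interval, \<open>e * |x|\<close> far out, and
  \<open>C * |y - x|\<close> for long steps.\<close>

lemma trapezoid_remainder:
  fixes f f' f'' :: "real \<Rightarrow> real"
  assumes f: "\<And>x. (f has_real_derivative f' x) (at x)" and f': "\<And>x. (f' has_real_derivative f'' x) (at x)"
    and cont: "continuous_on UNIV f''" and K: "\<And>x. \<bar>f'' x\<bar> \<le> K" and e: "0 < e"
  obtains C where "0 \<le> C"
    "\<And>x y. \<bar>f y - f x - (f' x + f' y) / 2 * (y - x)\<bar> \<le> (y - x)\<^sup>2 * (e + e * \<bar>x\<bar> + C * \<bar>y - x\<bar>)"
proof -
  have K0: "0 \<le> K" using K[of 0] by linarith
  \<comment> \<open>Beyond \<open>k\<close> the term \<open>e * |x|\<close> exceeds the trivial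
    bound \<open>2 * K\<close> on the oscillation.\<close>
  define k where "k = 2 * K / e + 1"
  have "uniformly_continuous_on {-k-1..k+1} f''"
    using cont by (intro compact_uniformly_continuous) (auto intro: continuous_on_subset)
  then obtain d0 where d0: "0 < d0" "\<And>u z. u \<in> {-k-1..k+1} \<Longrightarrow> z \<in> {-k-1..k+1} \<Longrightarrow> dist z u < d0 \<Longrightarrow> dist (f'' z) (f'' u) < e"
    unfolding uniformly_continuous_on_def using e by meson
  define d where "d = min d0 1"
  have d: "0 < d" "d \<le> d0" "d \<le> 1" using d0 by (auto simp: d_def)
  \<comment> \<open>Steps of length at least \<open>d\<close> make \<open>C * |y - x|\<close> at
    least \<open>2 * K\<close>. The cap \<open>d \<le> 1\<close> keeps shorter steps from
    \<open>|x| \<le> k\<close> inside the compact interval.\<close>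
  define C where "C = 2 * K / d"
  have C0: "0 \<le> C" using K0 d by (simp add: C_def)
  have "\<bar>f y - f x - (f' x + f' y) / 2 * (y - x)\<bar> \<le> (y - x)\<^sup>2 * (e + e * \<bar>x\<bar> + C * \<bar>y - x\<bar>)" for x y
  proof -
    define Q where "Q = e + e * \<bar>x\<bar> + C * \<bar>y - x\<bar>"
    have Q0: "0 \<le> Q" using e C0 by (simp add: Q_def)
    have seg: "\<bar>u - x\<bar> \<le> \<bar>y - x\<bar>" if "u \<in> closed_segment x y" for u
      using that by (auto simp: closed_segment_eq_real_ivl split: if_splits)
    have seg2: "\<bar>u - z\<bar> \<le> \<bar>y - x\<bar>" if "u \<in> closed_segment x y" "z \<in> closed_segment x y" for u z
      using that by (auto simp: closed_segment_eq_real_ivl split: if_splits)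
    have osc: "\<bar>f'' u - f'' z\<bar> \<le> Q" if uz: "u \<in> closed_segment x y" "z \<in> closed_segment x y" for u z
    proof -
      have 2: "\<bar>f'' u - f'' z\<bar> \<le> 2 * K" using K[of u] K[of z] by linarith
      have nn: "0 \<le> e * \<bar>x\<bar>" "0 \<le> C * \<bar>y - x\<bar>" using e C0 by auto
      consider "\<bar>y - x\<bar> \<ge> d" | "\<bar>x\<bar> > k" | "\<bar>y - x\<bar> < d" "\<bar>x\<bar> \<le> k" by linarith
      then show ?thesis
      proof cases
        case 1
        then have "2 * K \<le> C * \<bar>y - x\<bar>" using d(1) K0 mult_left_mono[OF 1, of "2 * K"]
          by (simp add: C_def field_simps)
        then show ?thesis using 2 nn e unfolding Q_def by linarith
      next
        case 2
        have "2 * K \<le> e * k" using e by (simp add: k_def distrib_left)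
        also have "\<dots> \<le> e * \<bar>x\<bar>" using 2 e by simp
        finally show ?thesis using \<open>\<bar>f'' u - f'' z\<bar> \<le> 2 * K\<close> nn e unfolding Q_def by linarith
      next
        case 3
        have "u \<in> {-k-1..k+1}" "z \<in> {-k-1..k+1}" using 3 d seg[OF uz(1)] seg[OF uz(2)] by auto
        moreover have "dist u z < d0" using seg2[OF uz] 3 d by (simp add: dist_real_def)
        ultimately have "\<bar>f'' u - f'' z\<bar> < e" using d0(2)[of z u] by (simp add: dist_real_def)
        then show ?thesis using nn unfolding Q_def by linarith
      qed
    qed
    have xs: "x \<in> closed_segment x y" "y \<in> closed_segment x y" by auto
    have f'_inc: "\<bar>(f' z - z * f'' z) - (f' x - x * f'' z)\<bar> \<le> Q * \<bar>z - x\<bar>" if z: "z \<in> closed_segment x y"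
      for z
    proof -
      have "norm ((f' z - z * f'' z) - (f' x - x * f'' z)) \<le> Q * norm (z - x)"
      proof (rule field_differentiable_bound[of "closed_segment x y" "\<lambda>u. f' u - u * f'' z" "\<lambda>u. f'' u - f'' z"])
        show "((\<lambda>u. f' u - u * f'' z) has_field_derivative f'' u - f'' z) (at u within closed_segment x y)"
          for u
          by (auto intro!: derivative_eq_intros DERIV_subset[OF f'])
      qed (use osc z xs in auto)
      then show ?thesis by simp
    qed
    let ?\<rho> = "\<lambda>z. f z - f x - (f' x + f' z) / 2 * (z - x)"
    have "norm (?\<rho> y - ?\<rho> x) \<le> (Q * \<bar>y - x\<bar>) * norm (y - x)"
    proof (rule field_differentiable_bound[of "closed_segment x y" ?\<rho> "\<lambda>z. f' z - (f'' z / 2 * (z - x) + (f' x + f' z) / 2)"])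
      show "(?\<rho> has_field_derivative f' z - (f'' z / 2 * (z - x) + (f' x + f' z) / 2)) (at z within closed_segment x y)" for z
        by (rule DERIV_subset[OF _ subset_UNIV]) (auto intro!: derivative_eq_intros f f' simp: field_simps)
      fix z assume z: "z \<in> closed_segment x y"
      have "f' z - (f'' z / 2 * (z - x) + (f' x + f' z) / 2) = ((f' z - z * f'' z) - (f' x - x * f'' z)) / 2"
        by (simp add: field_simps)
      then have "norm (f' z - (f'' z / 2 * (z - x) + (f' x + f' z) / 2)) \<le> Q * \<bar>z - x\<bar> / 2"
        using f'_inc[OF z] by (simp only: real_norm_def abs_divide) simp
      also have "\<dots> \<le> Q * \<bar>z - x\<bar>" using Q0 by simp
      also have "\<dots> \<le> Q * \<bar>y - x\<bar>" using seg[OF z] Q0 by (rule mult_left_mono)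
      finally show "norm (f' z - (f'' z / 2 * (z - x) + (f' x + f' z) / 2)) \<le> Q * \<bar>y - x\<bar>" .
    qed (use xs in auto)
    then have "\<bar>?\<rho> y\<bar> \<le> Q * (\<bar>y - x\<bar> * \<bar>y - x\<bar>)" by (simp add: mult.assoc)
    also have "\<bar>y - x\<bar> * \<bar>y - x\<bar> = (y - x)\<^sup>2" by (simp only: abs_mult_self_eq power2_eq_square)
    finally show ?thesis by (simp only: Q_def mult.commute)
  qed
  with C0 show ?thesis using that by blast
qed

text \<open>There are \<open>N + 1\<close> cells, so every \<open>N\<close> gives a partition and no
  denominator vanishes.\<close>

definition mesh :: "real \<Rightarrow> nat \<Rightarrow> nat \<Rightarrow> real" where
  "mesh t N k = t * real k / real (Suc N)"

text \<open>The index \<open>k\<close> for which \<open>y\<close> lies in \<open>]mesh t N k, mesh t N (k + 1)]\<close>.\<close>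

definition mesh_index :: "real \<Rightarrow> nat \<Rightarrow> real \<Rightarrow> nat" where
  "mesh_index t N y = nat (\<lceil>y * real (Suc N) / t\<rceil> - 1)"

lemma mesh_bounds: "0 \<le> t \<Longrightarrow> k \<le> Suc N \<Longrightarrow> 0 \<le> mesh t N k \<and> mesh t N k \<le> t"
  by (simp add: mesh_def divide_le_eq mult_left_mono)

lemma mesh_mono: "0 \<le> t \<Longrightarrow> mesh t N k \<le> mesh t N (Suc k)"
  unfolding mesh_def by (intro divide_right_mono mult_left_mono) auto

lemma mesh_ends: "mesh t N 0 = 0" "mesh t N (Suc N) = t"
  by (simp_all add: mesh_def)

lemma mesh_step: "mesh t N (Suc k) - mesh t N k = t / real (Suc N)"
  unfolding mesh_def diff_divide_distrib[symmetric] right_diff_distrib[symmetric] by simp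

lemma mesh_mem_iff:
  assumes "0 < t" "0 < y"
  shows "y \<in> {mesh t N k<..mesh t N (Suc k)} \<longleftrightarrow> k = mesh_index t N y"
proof -
  define z where "z = y * real (Suc N) / t"
  have 1: "mesh t N k < y \<longleftrightarrow> real k < z"
    using assms by (simp add: z_def mesh_def divide_less_eq less_divide_eq mult.commute)
  have 2: "y \<le> mesh t N (Suc k) \<longleftrightarrow> z \<le> real (Suc k)"
    using assms by (simp add: z_def mesh_def divide_le_eq le_divide_eq mult.commute)
  have "0 < z" using assms by (simp add: z_def)
  then have 3: "1 \<le> \<lceil>z\<rceil>" by linarith
  have "y \<in> {mesh t N k<..mesh t N (Suc k)} \<longleftrightarrow> real k < z \<and> z \<le> real (Suc k)" using 1 2 by simp
  also have "\<dots> \<longleftrightarrow> \<lceil>z\<rceil> = int k + 1" unfolding ceiling_eq_iff by (simp add: add.commute)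
  also have "\<dots> \<longleftrightarrow> k = nat (\<lceil>z\<rceil> - 1)" using 3 by arith
  finally show ?thesis by (simp only: mesh_index_def z_def)
qed

lemma mesh_index_less:
  assumes "0 < t" "0 < y" "y \<le> t"
  shows "mesh_index t N y < Suc N"
proof -
  have "y * real (Suc N) / t \<le> real (Suc N)" using assms
    by (simp add: divide_le_eq mult_right_mono mult.commute)
  then have "\<lceil>y * real (Suc N) / t\<rceil> \<le> int (Suc N)" by (simp add: ceiling_le_iff)
  then show ?thesis unfolding mesh_index_def by linarith
qed

text \<open>At most one cell contains \<open>y\<close>. The half-open cells miss the origin, which
  is why limits of mesh sums carry \<open>{0<..t}\<close> rather than \<open>{0..t}\<close>.\<close>

lemma mesh_sum:
  fixes c :: "nat \<Rightarrow> real"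
  assumes t: "0 \<le> t"
  shows "(\<Sum>k<Suc N. indicator {mesh t N k<..mesh t N (Suc k)} y * c k) =
    (if 0 < y \<and> y \<le> t then c (mesh_index t N y) else 0)"
proof (cases "0 < y \<and> y \<le> t")
  case True
  then have "(\<Sum>k<Suc N. indicator {mesh t N k<..mesh t N (Suc k)} y * c k) = (\<Sum>k<Suc N. if k = mesh_index t N y then c k else 0)"
    using mesh_mem_iff[of t y N] t by (intro sum.cong) (auto simp: indicator_def)
  then show ?thesis using True mesh_index_less[of t y N] t by (simp add: sum.delta')
next
  case False
  have "indicator {mesh t N k<..mesh t N (Suc k)} y * c k = 0" if "k < Suc N" for k
    using mesh_bounds[OF t, of k N] mesh_bounds[OF t, of "Suc k" N] that False by (auto simp: indicator_def)
  then have "(\<Sum>k<Suc N. indicator {mesh t N k<..mesh t N (Suc k)} y * c k) = 0" by (intro sum.neutral) auto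
  then show ?thesis using False by (simp only: if_False)
qed

text \<open>The strict inequality on the left and the weak one on the right decide how the diagonal
  is counted in the second-order limit.\<close>

lemma mesh_index_tendsto:
  assumes "0 < y" "y \<le> t"
  shows "(\<lambda>N. mesh t N (mesh_index t N y)) \<longlonglongrightarrow> y" "(\<lambda>N. mesh t N (Suc (mesh_index t N y))) \<longlonglongrightarrow> y"
    and "mesh t N (mesh_index t N y) < y" "y \<le> mesh t N (Suc (mesh_index t N y))"
proof -
  have m: "y \<in> {mesh t N (mesh_index t N y)<..mesh t N (Suc (mesh_index t N y))}" for N
    using mesh_mem_iff[of t y N] assms by auto
  then show "mesh t N (mesh_index t N y) < y" "y \<le> mesh t N (Suc (mesh_index t N y))" by auto
  have "(\<lambda>N. t * inverse (real (Suc N))) \<longlonglongrightarrow> t * 0"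
    by (intro tendsto_intros LIMSEQ_inverse_real_of_nat)
  then have lim: "(\<lambda>N. t / real (Suc N)) \<longlonglongrightarrow> 0" by (simp add: divide_inverse)
  have le: "\<bar>mesh t N (mesh_index t N y) - y\<bar> \<le> t / real (Suc N)" "\<bar>mesh t N (Suc (mesh_index t N y)) - y\<bar> \<le> t / real (Suc N)" for N
    using m[of N] mesh_step[of t N "mesh_index t N y"] by auto
  show "(\<lambda>N. mesh t N (mesh_index t N y)) \<longlonglongrightarrow> y"
    by (rule Lim_null_comparison[OF _ lim, THEN LIM_zero_cancel]) (use le in auto)
  show "(\<lambda>N. mesh t N (Suc (mesh_index t N y))) \<longlonglongrightarrow> y"
    by (rule Lim_null_comparison[OF _ lim, THEN LIM_zero_cancel]) (use le in auto)
qed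

section \<open>Remainders and variances along a mesh\<close>

context gaussian_cov
begin

text \<open>\<open>Y\<close> behaves like the Wiener integral of the bounded function \<open>\<phi>\<close> as far as covariances with \<open>X\<close> are concerned.\<close>

definition represents :: "(real \<Rightarrow> real) \<Rightarrow> ('w \<Rightarrow> real) \<Rightarrow> bool" where
  "represents \<phi> Y \<longleftrightarrow> Y \<in> G \<and> \<phi> \<in> borel_measurable (interval_borel T) \<and> (\<exists>C. \<forall>x\<in>{0..T}. \<bar>\<phi> x\<bar> \<le> C) \<and>
    (\<forall>s\<in>{0..T}. expectation (\<lambda>w. Y w * X s w) = inn \<phi> (indicator {0..s}))"

lemma represents_indicator: "t \<in> {0..T} \<Longrightarrow> represents (indicator {0..t}) (X t)"
  unfolding represents_def
  by (auto simp: X_mem inn_indicator indicator_def intro!: borel_measurable_interval exI[of _ 1])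

lemma integrable_tensor:
  fixes \<phi> \<psi> :: "real \<Rightarrow> real"
  assumes "\<phi> \<in> borel_measurable (interval_borel T)" "\<psi> \<in> borel_measurable (interval_borel T)"
    and "\<And>x. x \<in> {0..T} \<Longrightarrow> \<bar>\<phi> x\<bar> \<le> C" "\<And>x. x \<in> {0..T} \<Longrightarrow> \<bar>\<psi> x\<bar> \<le> D"
  shows "integrable V (\<lambda>(x, y). \<phi> x * \<psi> y)"
proof (rule integrable_bounded[OF tensor_measurable[OF assms(1,2)]])
  fix z assume "z \<in> {0..T} \<times> {0..T}"
  then have z: "fst z \<in> {0..T}" "snd z \<in> {0..T}" by auto
  then have "0 \<le> C" using assms(3)[of "fst z"] by linarith
  then have "\<bar>\<phi> (fst z)\<bar> * \<bar>\<psi> (snd z)\<bar> \<le> C * D" using assms(3,4) z by (intro mult_mono) auto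
  then show "\<bar>case z of (x, y) \<Rightarrow> \<phi> x * \<psi> y\<bar> \<le> C * D" by (simp add: split_beta abs_mult)
qed

lemma indicator_interval_measurable [simp]:
  "A \<in> sets borel \<Longrightarrow> (indicator A :: real \<Rightarrow> real) \<in> borel_measurable (interval_borel T)"
  by (intro borel_measurable_interval borel_measurable_indicator)

lemma represents_increment:
  assumes \<phi>: "represents \<phi> Y" and ab: "0 \<le> a" "a \<le> b" "b \<le> T"
  shows "expectation (\<lambda>w. Y w * (X b w - X a w)) = inn \<phi> (indicator {a<..b})"
proof -
  have mem: "a \<in> {0..T}" "b \<in> {0..T}" using ab by auto
  obtain C where C: "\<And>x. x \<in> {0..T} \<Longrightarrow> \<bar>\<phi> x\<bar> \<le> C" and \<phi>m: "\<phi> \<in> borel_measurable (interval_borel T)"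
    and Y: "Y \<in> G"
    using \<phi> unfolding represents_def by blast
  have e: "expectation (\<lambda>w. Y w * X s w) = inn \<phi> (indicator {0..s})" if "s \<in> {0..T}" for s
    using \<phi> that by (auto simp: represents_def)
  have i: "integrable V (\<lambda>(x, y). \<phi> x * indicator {0..s} y)" for s
    by (rule integrable_tensor[OF \<phi>m indicator_interval_measurable, where C=C
      and D=1]) (use C in \<open>auto simp: indicator_def\<close>)
  have "expectation (\<lambda>w. Y w * (X b w - X a w)) = inn \<phi> (indicator {0..b}) - inn \<phi> (indicator {0..a})"
    unfolding e[OF mem(1), symmetric] e[OF mem(2), symmetric]
    using integrable_mult[OF Y X_mem[OF mem(1)]] integrable_mult[OF Y X_mem[OF mem(2)]]
      by (simp add: right_diff_distrib)
  also have "\<dots> = I (\<lambda>z. (case z of (x, y) \<Rightarrow> \<phi> x * indicator {0..b} y) - (case z of (x, y) \<Rightarrow> \<phi> x * indicator {0..a} y))"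
    unfolding inn_def by (rule I_diff[symmetric]) (rule i)+
  also have "\<dots> = inn \<phi> (indicator {a<..b})"
    unfolding inn_def using ab by (intro I_cong) (auto simp: indicator_def)
  finally show ?thesis .
qed

text \<open>The square of the increment is paired with 1, with \<open>|X a|\<close> and with the
  absolute increment. By Cauchy-Schwarz and the fourth moment \<open>3 * v^2\<close> each pairing
  yields a factor \<open>v\<close>, which can be summed over a mesh, times a quantity that is small
  either through \<open>e\<close> or through \<open>v\<close> itself. The factors
  \<open>sqrt 3\<close> are the root of the fourth moment of the standard normal law.\<close>

lemma remainder_bound:
  assumes f: "\<And>x. (f has_real_derivative f' x) (at x)" and f': "\<And>x. (f' has_real_derivative f'' x) (at x)"
    and r: "\<And>x y. \<bar>f y - f x - (f' x + f' y) / 2 * (y - x)\<bar> \<le> (y - x)\<^sup>2 * (e + e * \<bar>x\<bar> + C * \<bar>y - x\<bar>)"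
    and e: "0 \<le> e" and C: "0 \<le> C" and ab: "0 \<le> a" "a \<le> b" "b \<le> T"
  defines "v \<equiv> expectation (\<lambda>w. (X b w - X a w)\<^sup>2)"
  shows "integrable M (\<lambda>w. f (X b w) - f (X a w) - (f' (X a w) + f' (X b w)) / 2 * (X b w - X a w))"
    and "expectation (\<lambda>w. \<bar>f (X b w) - f (X a w) - (f' (X a w) + f' (X b w)) / 2 * (X b w - X a w)\<bar>) \<le>
      v * (e + e * (sqrt 3 * sqrt mass) + C * (sqrt 3 * sqrt v))"
proof -
  have mem: "a \<in> {0..T}" "b \<in> {0..T}" using ab by auto
  define D where "D w = X b w - X a w" for w
  have DG: "D \<in> G" unfolding D_def[abs_def] by (intro diff_mem X_mem mem)
  have [measurable]: "X a \<in> borel_measurable M" "X b \<in> borel_measurable M" using X_meas mem by auto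
  have "continuous_on UNIV f" "continuous_on UNIV f'"
    using f f' by (meson DERIV_isCont continuous_at_imp_continuous_on)+
  then have [measurable]: "f \<in> borel_measurable borel" "f' \<in> borel_measurable borel"
    by (auto intro: borel_measurable_continuous_onI)
  have v: "v = expectation (\<lambda>w. (D w)\<^sup>2)" by (simp add: v_def D_def)
  have v0: "0 \<le> v" by (simp add: v)
  have p4: "((D w)\<^sup>2)\<^sup>2 = D w ^ 4" for w by (simp flip: power_mult)
  have D2: "(\<lambda>w. (D w)\<^sup>2) \<in> L2_rv M"
    using meas[OF DG] integrable_power[OF DG, of 4] by (simp add: L2_rv_def p4)
  have cs: "expectation (\<lambda>w. (D w)\<^sup>2 * \<bar>Z w\<bar>) \<le> v * (sqrt 3 * sqrt (expectation (\<lambda>w. (Z w)\<^sup>2)))"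
    and ics: "integrable M (\<lambda>w. (D w)\<^sup>2 * \<bar>Z w\<bar>)" if Z: "Z \<in> G" for Z
  proof -
    have "expectation (\<lambda>w. (D w)\<^sup>2 * \<bar>Z w\<bar>) = expectation (\<lambda>w. \<bar>(D w)\<^sup>2 * Z w\<bar>)" by (simp add: abs_mult)
    also have "\<dots> \<le> sqrt (expectation (\<lambda>w. ((D w)\<^sup>2)\<^sup>2)) * sqrt (expectation (\<lambda>w. (Z w)\<^sup>2))"
      by (rule L2_cauchy_schwarz[OF D2 mem_L2[OF Z]])
    also have "sqrt (expectation (\<lambda>w. ((D w)\<^sup>2)\<^sup>2)) = sqrt 3 * v"
      unfolding p4 expectation_power4[OF DG] v[symmetric] using v0 by (simp add: real_sqrt_mult)
    finally show "expectation (\<lambda>w. (D w)\<^sup>2 * \<bar>Z w\<bar>) \<le> v * (sqrt 3 * sqrt (expectation (\<lambda>w. (Z w)\<^sup>2)))"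
      by (simp add: mult_ac)
    show "integrable M (\<lambda>w. (D w)\<^sup>2 * \<bar>Z w\<bar>)"
      using integrable_abs[OF L2_rv_mult_integrable[OF D2 mem_L2[OF Z]]] by (simp add: abs_mult)
  qed
  define B where "B w = e * (D w)\<^sup>2 + e * ((D w)\<^sup>2 * \<bar>X a w\<bar>) + C * ((D w)\<^sup>2 * \<bar>D w\<bar>)" for w
  have B0: "0 \<le> B w" for w using e C by (simp add: B_def)
  let ?R = "\<lambda>w. f (X b w) - f (X a w) - (f' (X a w) + f' (X b w)) / 2 * (X b w - X a w)"
  have RB: "\<bar>?R w\<bar> \<le> B w" for w using r[of "X b w" "X a w"] by (simp add: B_def D_def algebra_simps)
  have iB: "integrable M B" unfolding B_def[abs_def]
    using integrable_power[OF DG, of 2] ics[OF X_mem[OF mem(1)]] ics[OF DG] by auto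
  show iR: "integrable M ?R"
    by (rule Bochner_Integration.integrable_bound[OF iB]) (use RB B0 in \<open>auto\<close>)
  have "expectation (\<lambda>w. \<bar>?R w\<bar>) \<le> expectation B"
    using iR iB RB by (intro integral_mono) auto
  also have "\<dots> = e * v + e * expectation (\<lambda>w. (D w)\<^sup>2 * \<bar>X a w\<bar>) + C * expectation (\<lambda>w. (D w)\<^sup>2 * \<bar>D w\<bar>)"
    unfolding B_def[abs_def] using integrable_power[OF DG, of 2] ics[OF X_mem[OF mem(1)]] ics[OF DG]
      by (simp add: v)
  also have "\<dots> \<le> e * v + e * (v * (sqrt 3 * sqrt mass)) + C * (v * (sqrt 3 * sqrt v))"
  proof (intro add_mono mult_left_mono order_refl e C)
    show "expectation (\<lambda>w. (D w)\<^sup>2 * \<bar>X a w\<bar>) \<le> v * (sqrt 3 * sqrt mass)"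
      using v0 var_le_mass[OF mem(1)] by (intro order.trans[OF cs[OF X_mem[OF mem(1)]]] mult_left_mono) auto
    show "expectation (\<lambda>w. (D w)\<^sup>2 * \<bar>D w\<bar>) \<le> v * (sqrt 3 * sqrt v)"
      using cs[OF DG] by (simp only: v)
  qed
  also have "\<dots> = v * (e + e * (sqrt 3 * sqrt mass) + C * (sqrt 3 * sqrt v))" by (simp add: algebra_simps)
  finally show "expectation (\<lambda>w. \<bar>?R w\<bar>) \<le> v * (e + e * (sqrt 3 * sqrt mass) + C * (sqrt 3 * sqrt v))" .
qed

lemma mesh_mem: "t \<in> {0..T} \<Longrightarrow> k \<le> Suc N \<Longrightarrow> mesh t N k \<in> {0..T}"
  using mesh_bounds[of t k N] by auto

text \<open>The diagonal squares over distinct cells are disjoint, so their variations add up to at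
  most the whole.\<close>

lemma sum_var_le_mass:
  assumes t: "t \<in> {0..T}"
  shows "(\<Sum>k<Suc N. expectation (\<lambda>w. (X (mesh t N (Suc k)) w - X (mesh t N k) w)\<^sup>2)) \<le> mass"
proof -
  let ?S = "\<lambda>k. {mesh t N k<..mesh t N (Suc k)} \<times> {mesh t N k<..mesh t N (Suc k)}"
  have S: "?S k \<in> sets (square_borel T)" if "k < Suc N" for k
    using mesh_mem[OF t, of k N] mesh_mem[OF t, of "Suc k" N] that by (intro rectangle_sets_square) auto
  have mono: "mesh t N i \<le> mesh t N j" if "i \<le> j" for i j
    using t that unfolding mesh_def by (intro divide_right_mono mult_left_mono) auto
  have disj: "?S i \<inter> ?S j = {}" if "i \<noteq> j" for i j
  proof -
    have "{mesh t N i<..mesh t N (Suc i)} \<inter> {mesh t N j<..mesh t N (Suc j)} = {}"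
      using mono[of "Suc i" j] mono[of "Suc j" i] that by (cases i j rule: linorder_cases) auto
    then show ?thesis by blast
  qed
  have "(\<Sum>k<Suc N. expectation (\<lambda>w. (X (mesh t N (Suc k)) w - X (mesh t N k) w)\<^sup>2)) \<le> (\<Sum>k<Suc N. measure V (?S k))"
    using mesh_mem[OF t, of _ N] mesh_mono[of t N] t by (intro sum_mono increment_var) auto
  also have "\<dots> = measure V (\<Union>k<Suc N. ?S k)"
    using S disj by (intro V.finite_measure_finite_Union[symmetric]) (auto simp: sets_V disjoint_family_on_def)
  also have "\<dots> \<le> mass"
  proof -
    have "(\<Union>k<Suc N. ?S k) \<in> sets V" unfolding sets_V using S by (intro sets.finite_UN) auto
    from V.finite_measure_mono[OF sets.sets_into_space[OF this] sets.top] show ?thesis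
      by (simp only: mass_def)
  qed
  finally show ?thesis .
qed

text \<open>Uniformity over the cells: infinitely many bad cells would give endpoints that approach
  each other while the variances stay above \<open>e\<close>.\<close>

lemma mesh_var_small:
  assumes t: "t \<in> {0..T}" and e: "0 < e"
  shows "\<exists>N0. \<forall>N\<ge>N0. \<forall>k<Suc N. expectation (\<lambda>w. (X (mesh t N (Suc k)) w - X (mesh t N k) w)\<^sup>2) < e"
proof (rule ccontr)
  define E where "E N k = expectation (\<lambda>w. (X (mesh t N (Suc k)) w - X (mesh t N k) w)\<^sup>2)" for N k
  assume "\<not> ?thesis"
  then have "\<forall>N0. \<exists>N k. N0 \<le> N \<and> k < Suc N \<and> e \<le> E N k"
    unfolding E_def[symmetric] not_ex not_all not_imp not_less by blast
  then obtain N k where Nk: "\<And>m. m \<le> N m" "\<And>m. k m < Suc (N m)" "\<And>m. e \<le> E (N m) (k m)"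
    by metis
  have "(\<lambda>m. mesh t (N m) (Suc (k m)) - mesh t (N m) (k m)) \<longlonglongrightarrow> 0"
  proof (rule Lim_null_comparison)
    have "(\<lambda>N. t * inverse (real (Suc N))) \<longlonglongrightarrow> t * 0"
      by (intro tendsto_intros LIMSEQ_inverse_real_of_nat)
    then show "(\<lambda>N. t / real (Suc N)) \<longlonglongrightarrow> 0" by (simp add: divide_inverse)
    show "\<forall>\<^sub>F m in sequentially. norm (mesh t (N m) (Suc (k m)) - mesh t (N m) (k m)) \<le> t / real (Suc m)"
      unfolding mesh_step using t Nk(1) by (intro always_eventually allI) (auto intro!: divide_left_mono)
  qed
  then have "(\<lambda>m. expectation (\<lambda>w. (X (mesh t (N m) (Suc (k m))) w - X (mesh t (N m) (k m)) w)\<^sup>2)) \<longlonglongrightarrow> 0"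
    by (intro expectation_diff_sq_tendsto mesh_mem[OF t]) (use Nk(2) in \<open>auto simp: less_Suc_eq_le intro: le_SucI\<close>)
  from LIMSEQ_le_const[OF this, of e] Nk(3)[unfolded E_def] have "e \<le> 0" by blast
  then show False using e by simp
qed

lemma max_measurable_square [measurable]: "(\<lambda>z. max (fst z) (snd z)) \<in> measurable (square_borel T) (interval_borel T)"
  by (rule measurable_restrict_space2, force simp: space_restrict_space max_def,
      rule measurable_restrict_space1, rule borel_measurable_continuous_onI, intro continuous_intros)

lemma representsD:
  assumes "represents \<phi> Y"
  shows "Y \<in> G" "\<phi> \<in> borel_measurable (interval_borel T)"
    "\<And>s. s \<in> {0..T} \<Longrightarrow> expectation (\<lambda>w. Y w * X s w) = inn \<phi> (indicator {0..s})"
    "\<exists>C. \<forall>x\<in>{0..T}. \<bar>\<phi> x\<bar> \<le> C"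
  using assms unfolding represents_def by blast+

lemma inn_sum_right:
  assumes \<phi>: "\<phi> \<in> borel_measurable (interval_borel T)" "\<exists>C. \<forall>x\<in>{0..T}. \<bar>\<phi> x\<bar> \<le> C"
    and A: "\<And>k. k \<in> J \<Longrightarrow> A k \<in> sets borel"
  shows "(\<Sum>k\<in>J. inn \<phi> (indicator (A k)) * c k) = inn \<phi> (\<lambda>y. \<Sum>k\<in>J. indicator (A k) y * c k)"
proof -
  obtain C where C: "\<And>x. x \<in> {0..T} \<Longrightarrow> \<bar>\<phi> x\<bar> \<le> C" using \<phi>(2) by blast
  have i: "integrable V (\<lambda>(x, y). \<phi> x * indicator (A k) y)" if "k \<in> J" for k
    by (rule integrable_tensor[OF \<phi>(1) indicator_interval_measurable, where C=C and D=1])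
       (use C A[OF that] in \<open>auto simp: indicator_def\<close>)
  have i2: "integrable V (\<lambda>z. c k * (case z of (x, y) \<Rightarrow> \<phi> x * indicator (A k) y))" if "k \<in> J" for k
    by (rule integrable_mult_right, rule i[OF that])
  have "(\<Sum>k\<in>J. inn \<phi> (indicator (A k)) * c k) = (\<Sum>k\<in>J. I (\<lambda>z. c k * (case z of (x, y) \<Rightarrow> \<phi> x * indicator (A k) y)))"
    unfolding I_cmult inn_def by (simp add: mult.commute)
  also have "\<dots> = I (\<lambda>z. \<Sum>k\<in>J. c k * (case z of (x, y) \<Rightarrow> \<phi> x * indicator (A k) y))"
    using i2 by (rule I_sum[symmetric])
  also have "\<dots> = inn \<phi> (\<lambda>y. \<Sum>k\<in>J. indicator (A k) y * c k)"
    unfolding inn_def by (intro I_cong) (auto simp: sum_distrib_left mult_ac)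
  finally show ?thesis .
qed

text \<open>\<open>k\<close> may be unbounded, so convergence along paths is not enough; the
  Lipschitz bound reduces the question to mean square continuity of \<open>X\<close>.\<close>

lemma continuous_expectation_lipschitz:
  fixes H :: "'w \<Rightarrow> real" and k :: "real \<Rightarrow> real"
  assumes H: "H \<in> borel_measurable M" "\<And>w. \<bar>H w\<bar> \<le> B" "0 \<le> B"
    and k: "\<And>x. (k has_real_derivative k' x) (at x)" "\<And>x. \<bar>k' x\<bar> \<le> K"
  shows "continuous_on {0..T} (\<lambda>s. expectation (\<lambda>w. H w * k (X s w)))"
  unfolding continuous_on_sequentially
proof (intro allI ballI impI, elim conjE)
  fix r :: "nat \<Rightarrow> real" and s assume s: "s \<in> {0..T}" and r: "\<forall>n. r n \<in> {0..T}" and rs: "r \<longlonglongrightarrow> s"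
  have K0: "0 \<le> K" using k(2)[of 0] by linarith
  have "continuous_on UNIV k" using k(1) by (meson DERIV_isCont continuous_at_imp_continuous_on)
  then have km: "k \<in> borel_measurable borel" by (rule borel_measurable_continuous_onI)
  have k_le: "\<bar>k x\<bar> \<le> \<bar>k 0\<bar> + K * \<bar>x\<bar>" for x
    using lin_growth_of_bounded_deriv[OF k, of x 0] by simp
  have L2: "(\<lambda>w. H w * k (X u w)) \<in> L2_rv M" if "u \<in> {0..T}" for u
    using L2_rv_bounded_mult[OF L2_rv_lin_growth[OF prob_space_axioms mem_L2[OF X_mem[OF that]] km k_le] H(1,2)] .
  let ?a = "\<lambda>s. expectation (\<lambda>w. H w * k (X s w))"
  let ?d = "\<lambda>n. expectation (\<lambda>w. (X (r n) w - X s w)\<^sup>2)"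
  have "(\<lambda>n. r n - s) \<longlonglongrightarrow> s - s" by (intro tendsto_intros rs)
  then have "?d \<longlonglongrightarrow> 0" using r s by (intro expectation_diff_sq_tendsto) auto
  then have "(\<lambda>n. B * K * sqrt (?d n)) \<longlonglongrightarrow> B * K * sqrt 0" by (intro tendsto_intros)
  then have lim: "(\<lambda>n. B * K * sqrt (?d n)) \<longlonglongrightarrow> 0" by simp
  have "norm (?a (r n) - ?a s) \<le> B * K * sqrt (?d n)" for n
  proof -
    have rn: "r n \<in> {0..T}" using r by simp
    have D: "(\<lambda>w. X (r n) w - X s w) \<in> L2_rv M" by (intro mem_L2 diff_mem X_mem rn s)
    have "?a (r n) - ?a s = expectation (\<lambda>w. H w * k (X (r n) w) - H w * k (X s w))"
      using L2_rv_integrable[OF L2[OF rn]] L2_rv_integrable[OF L2[OF s]] by simp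
    also have "\<bar>\<dots>\<bar> \<le> expectation (\<lambda>w. \<bar>H w * k (X (r n) w) - H w * k (X s w)\<bar>)" by (rule integral_abs_bound)
    also have "\<dots> \<le> expectation (\<lambda>w. B * K * \<bar>(X (r n) w - X s w) * 1\<bar>)"
    proof (rule integral_mono)
      show "integrable M (\<lambda>w. \<bar>H w * k (X (r n) w) - H w * k (X s w)\<bar>)"
        using L2_rv_integrable[OF L2[OF rn]] L2_rv_integrable[OF L2[OF s]] by simp
      show "integrable M (\<lambda>w. B * K * \<bar>(X (r n) w - X s w) * 1\<bar>)" using L2_rv_integrable[OF D] by simp
      fix w
      have "\<bar>H w * (k (X (r n) w) - k (X s w))\<bar> \<le> B * (K * \<bar>X (r n) w - X s w\<bar>)"
        unfolding abs_mult using H lin_growth_of_bounded_deriv[OF k] by (intro mult_mono) auto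
      then show "\<bar>H w * k (X (r n) w) - H w * k (X s w)\<bar> \<le> B * K * \<bar>(X (r n) w - X s w) * 1\<bar>"
        by (simp add: right_diff_distrib)
    qed
    also have "\<dots> = B * K * expectation (\<lambda>w. \<bar>(X (r n) w - X s w) * 1\<bar>)" by (rule integral_mult_right_zero)
    also have "\<dots> \<le> B * K * (sqrt (?d n) * sqrt (expectation (\<lambda>w. 1\<^sup>2)))"
      using H(3) K0 by (intro mult_left_mono L2_cauchy_schwarz[OF D] L2_rv_bounded[where B=1]) auto
    finally show ?thesis by (simp add: prob_space)
  qed
  then have "(\<lambda>n. ?a (r n) - ?a s) \<longlonglongrightarrow> 0" by (intro Lim_null_comparison[OF _ lim] always_eventually allI)
  then show "(?a \<circ> r) \<longlonglongrightarrow> ?a s" by (simp add: LIM_zero_iff comp_def)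
qed

text \<open>The version for \<open>f''\<close>, which is bounded but has no Lipschitz bound:
  dominated convergence along the continuous paths.\<close>

lemma continuous_expectation_bounded:
  fixes H :: "'w \<Rightarrow> real" and k :: "real \<Rightarrow> real"
  assumes H: "H \<in> borel_measurable M" "\<And>w. \<bar>H w\<bar> \<le> B"
    and k: "continuous_on UNIV k" "\<And>x. \<bar>k x\<bar> \<le> K"
  shows "continuous_on {0..T} (\<lambda>s. expectation (\<lambda>w. H w * k (X s w)))"
  unfolding continuous_on_sequentially comp_def
proof (intro allI ballI impI, elim conjE)
  fix r :: "nat \<Rightarrow> real" and s assume s: "s \<in> {0..T}" and r: "\<forall>n. r n \<in> {0..T}" and rs: "r \<longlonglongrightarrow> s"
  have km: "k \<in> borel_measurable borel" using k(1) by (rule borel_measurable_continuous_onI)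
  have m: "(\<lambda>w. H w * k (X u w)) \<in> borel_measurable M" if "u \<in> {0..T}" for u
    using borel_measurable_times[OF H(1) measurable_compose[OF X_meas[OF that] km]] .
  show "(\<lambda>n. expectation (\<lambda>w. H w * k (X (r n) w))) \<longlonglongrightarrow> expectation (\<lambda>w. H w * k (X s w))"
  proof (rule integral_dominated_convergence[where w="\<lambda>_. B * K"])
    show "AE w in M. (\<lambda>n. H w * k (X (r n) w)) \<longlonglongrightarrow> H w * k (X s w)"
    proof (rule AE_I2)
      fix w assume w: "w \<in> space M"
      have "(\<lambda>n. X (r n) w) \<longlonglongrightarrow> X s w"
        using continuous_on_tendsto_compose[OF X_cont[OF w] rs s] r by simp
      then have "(\<lambda>n. k (X (r n) w)) \<longlonglongrightarrow> k (X s w)"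
        using continuous_on_tendsto_compose[OF k(1), of "\<lambda>n. X (r n) w" "X s w" sequentially] by simp
      then show "(\<lambda>n. H w * k (X (r n) w)) \<longlonglongrightarrow> H w * k (X s w)" by (rule tendsto_mult_left)
    qed
    show "AE w in M. norm (H w * k (X (r n) w)) \<le> B * K" for n
      using H(2) k(2) by (auto simp: abs_mult intro!: mult_mono order.trans[OF abs_ge_zero])
  qed (use m r s in auto)
qed

section \<open>Limits of the mesh sums\<close>

lemma continuous_interval_facts:
  assumes "continuous_on {0..T} (h :: real \<Rightarrow> real)"
  shows "h \<in> borel_measurable (interval_borel T)" "\<exists>A. 0 \<le> A \<and> (\<forall>s\<in>{0..T}. \<bar>h s\<bar> \<le> A)"
proof -
  show "h \<in> borel_measurable (interval_borel T)"
    by (rule borel_measurable_continuous_on_restrict[OF assms])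
  have "bounded (h ` {0..T})" using assms by (intro compact_imp_bounded compact_continuous_image) auto
  then obtain A where "\<forall>s\<in>{0..T}. \<bar>h s\<bar> \<le> A" by (auto simp: bounded_iff)
  moreover from this have "0 \<le> A" using T_pos by (force intro: order.trans[OF abs_ge_zero])
  ultimately show "\<exists>A. 0 \<le> A \<and> (\<forall>s\<in>{0..T}. \<bar>h s\<bar> \<le> A)" by blast
qed

text \<open>The sum is the semiscalar product of \<open>\<phi>\<close> with a step function that
  averages \<open>a\<close> over the ends of each cell. These step functions stay bounded and
  converge pointwise to \<open>a\<close> on \<open>{0<..t}\<close>, and the measures are
  finite.\<close>

lemma mesh_limit_first_order:
  assumes \<phi>: "represents \<phi> Y" and t: "t \<in> {0..T}" and a: "continuous_on {0..T} a"
  shows "(\<lambda>N. \<Sum>k<Suc N. inn \<phi> (indicator {mesh t N k<..mesh t N (Suc k)}) * ((a (mesh t N k) + a (mesh t N (Suc k))) / 2))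
     \<longlonglongrightarrow> inn \<phi> (\<lambda>y. indicator {0<..t} y * a y)"
proof -
  have t0: "0 \<le> t" using t by simp
  obtain C where C: "\<And>x. x \<in> {0..T} \<Longrightarrow> \<bar>\<phi> x\<bar> \<le> C" using representsD(4)[OF \<phi>] by blast
  have C0: "0 \<le> C" using C[of 0] T_pos by (smt (verit) atLeastAtMost_iff)
  obtain A where A: "0 \<le> A" "\<And>s. s \<in> {0..T} \<Longrightarrow> \<bar>a s\<bar> \<le> A" using continuous_interval_facts(2)[OF a] by blast
  let ?c = "\<lambda>N k. (a (mesh t N k) + a (mesh t N (Suc k))) / 2"
  let ?e = "\<lambda>N y. \<Sum>k<Suc N. indicator {mesh t N k<..mesh t N (Suc k)} y * ?c N k"
  have eq: "(\<Sum>k<Suc N. inn \<phi> (indicator {mesh t N k<..mesh t N (Suc k)}) * ?c N k) = I (\<lambda>(x, y). \<phi> x * ?e N y)" for N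
    unfolding inn_def[symmetric] by (rule inn_sum_right[OF representsD(2,4)[OF \<phi>]]) auto
  have c_le: "\<bar>?c N k\<bar> \<le> A" if "k < Suc N" for N k
    using A(2)[OF mesh_mem[OF t, of k N]] A(2)[OF mesh_mem[OF t, of "Suc k" N]] that by auto
  have e_le: "\<bar>?e N y\<bar> \<le> A" for N y
    unfolding mesh_sum[OF t0] using A(1) c_le[OF mesh_index_less[of t y N]] by auto
  have e_lim: "(\<lambda>N. ?e N y) \<longlonglongrightarrow> indicator {0<..t} y * a y" if y: "y \<in> {0..T}" for y
  proof (cases "0 < y \<and> y \<le> t")
    case True
    have idx: "mesh_index t N y < Suc N" for N using True by (intro mesh_index_less) auto
    have m1: "mesh t N (mesh_index t N y) \<in> {0..T}" "mesh t N (Suc (mesh_index t N y)) \<in> {0..T}" for N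
      using idx[of N] by (auto intro!: mesh_mem[OF t, simplified])
    have "(\<lambda>N. ?c N (mesh_index t N y)) \<longlonglongrightarrow> (a y + a y) / 2"
      using True y m1
      by (intro tendsto_intros continuous_on_tendsto_compose[OF a] mesh_index_tendsto always_eventually allI) auto
    then show ?thesis unfolding mesh_sum[OF t0] using True by (simp add: indicator_def)
  next
    case False
    then have "indicator {0<..t} y * a y = 0" by (auto simp: indicator_def)
    then show ?thesis unfolding mesh_sum[OF t0] using False by (simp only: if_False tendsto_const)
  qed
  have em: "?e N \<in> borel_measurable (interval_borel T)" for N
    by (intro borel_measurable_sum borel_measurable_times indicator_interval_measurable) auto
  show ?thesis unfolding eq unfolding inn_def
  proof (rule I_bounded_limit[where C="C * A"])
    show "(\<lambda>(x, y). \<phi> x * ?e N y) \<in> borel_measurable (square_borel T)" for N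
      by (rule tensor_measurable[OF representsD(2)[OF \<phi>] em])
    show "(\<lambda>(x, y). \<phi> x * (indicator {0<..t} y * a y)) \<in> borel_measurable (square_borel T)"
      by (rule tensor_measurable[OF representsD(2)[OF \<phi>]])
         (intro borel_measurable_times indicator_interval_measurable continuous_interval_facts[OF a], simp)
    show "\<bar>case z of (x, y) \<Rightarrow> \<phi> x * ?e N y\<bar> \<le> C * A" if "z \<in> {0..T} \<times> {0..T}" for N z
    proof -
      have "\<bar>\<phi> (fst z)\<bar> * \<bar>?e N (snd z)\<bar> \<le> C * A" using that C C0 by (intro mult_mono e_le) auto
      then show ?thesis by (simp add: split_beta abs_mult)
    qed
    show "(\<lambda>N. case z of (x, y) \<Rightarrow> \<phi> x * ?e N y) \<longlonglongrightarrow> (case z of (x, y) \<Rightarrow> \<phi> x * (indicator {0<..t} y * a y))"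
      if "z \<in> {0..T} \<times> {0..T}" for z
      using tendsto_mult_left[OF e_lim[of "snd z"], of "\<phi> (fst z)"] that
        by (simp only: split_beta mem_Times_iff)
  qed
qed

text \<open>In the limit the left endpoints count the points with \<open>x < y\<close> and the right
  endpoints those with \<open>x \<le> y\<close>, both with weight \<open>a y\<close>. By symmetry
  the strict part may be reflected to \<open>y < x\<close> with weight \<open>a x\<close>. The two
  regions then partition the square, the diagonal is counted once, and the weight is
  \<open>a\<close> at the maximum.\<close>

lemma mesh_limit_second_order:
  assumes t: "t \<in> {0..T}" and a: "continuous_on {0..T} a"
  shows "(\<lambda>N. \<Sum>k<Suc N. inn (indicator {0..mesh t N k}) (indicator {mesh t N k<..mesh t N (Suc k)}) * a (mesh t N k)
       + inn (indicator {0..mesh t N (Suc k)}) (indicator {mesh t N k<..mesh t N (Suc k)}) * a (mesh t N (Suc k)))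
     \<longlonglongrightarrow> I (\<lambda>z. indicator {0<..t} (max (fst z) (snd z)) * a (max (fst z) (snd z)))"
proof -
  have t0: "0 \<le> t" using t by simp
  obtain A where A: "0 \<le> A" "\<And>s. s \<in> {0..T} \<Longrightarrow> \<bar>a s\<bar> \<le> A" using continuous_interval_facts(2)[OF a] by blast
  let ?J = "\<lambda>N k. {mesh t N k<..mesh t N (Suc k)}"
  let ?c = "\<lambda>x N k. indicator {0..mesh t N k} x * a (mesh t N k) + indicator {0..mesh t N (Suc k)} x * a (mesh t N (Suc k))"
  let ?q = "\<lambda>N z. \<Sum>k<Suc N. indicator (?J N k) (snd z) * ?c (fst z) N k"
  let ?q' = "\<lambda>z. indicator {0<..t} (snd z) * a (snd z) * ((if fst z < snd z then 1 else 0) + (if fst z \<le> snd z then 1 else 0))"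
  have am: "a \<in> borel_measurable (interval_borel T)" by (rule continuous_interval_facts[OF a])
  have i: "integrable V (\<lambda>z. b * (case z of (x, y) \<Rightarrow> (indicator {0..r} x :: real) * indicator (?J N k) y))"
    for b r N k
    by (rule integrable_mult_right, rule integrable_tensor[OF indicator_interval_measurable indicator_interval_measurable, where C=1 and D=1])
       (auto simp: indicator_def)
  have eq: "(\<Sum>k<Suc N. inn (indicator {0..mesh t N k}) (indicator (?J N k)) * a (mesh t N k)
       + inn (indicator {0..mesh t N (Suc k)}) (indicator (?J N k)) * a (mesh t N (Suc k))) = I (?q N)" for N
  proof -
    have "inn (indicator {0..r}) (indicator (?J N k)) * b = I (\<lambda>z. b * (case z of (x, y) \<Rightarrow> indicator {0..r} x * indicator (?J N k) y))" for r k b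
      unfolding inn_def I_cmult by simp
    then have "(\<Sum>k<Suc N. inn (indicator {0..mesh t N k}) (indicator (?J N k)) * a (mesh t N k)
       + inn (indicator {0..mesh t N (Suc k)}) (indicator (?J N k)) * a (mesh t N (Suc k))) =
       (\<Sum>k<Suc N. I (\<lambda>z. a (mesh t N k) * (case z of (x, y) \<Rightarrow> indicator {0..mesh t N k} x * indicator (?J N k) y)
         + a (mesh t N (Suc k)) * (case z of (x, y) \<Rightarrow> indicator {0..mesh t N (Suc k)} x * indicator (?J N k) y)))"
      by (simp only: I_add[OF i i])
    also have "\<dots> = I (\<lambda>z. \<Sum>k<Suc N. a (mesh t N k) * (case z of (x, y) \<Rightarrow> indicator {0..mesh t N k} x * indicator (?J N k) y)
         + a (mesh t N (Suc k)) * (case z of (x, y) \<Rightarrow> indicator {0..mesh t N (Suc k)} x * indicator (?J N k) y))"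
      by (intro I_sum[symmetric] Bochner_Integration.integrable_add i)
    also have "\<dots> = I (?q N)"
      by (intro I_cong sum.cong refl) (simp add: split_beta distrib_left mult_ac)
    finally show ?thesis .
  qed
  have c_le: "\<bar>?c x N k\<bar> \<le> A + A" if "k < Suc N" for x N k
  proof -
    have "\<bar>indicator S x * a r\<bar> \<le> A" if "r \<in> {0..T}" for S r
      using A that by (cases "x \<in> S") auto
    from this[OF mesh_mem[OF t, of k N]] this[OF mesh_mem[OF t, of "Suc k" N]] show ?thesis
      using that by (intro order.trans[OF abs_triangle_ineq] add_mono) auto
  qed
  have q_le: "\<bar>?q N z\<bar> \<le> A + A" for N z
    unfolding mesh_sum[OF t0] using A(1) c_le[OF mesh_index_less[of t "snd z" N], of "fst z"] by auto
  have q_lim: "(\<lambda>N. ?q N z) \<longlonglongrightarrow> ?q' z" if z: "z \<in> {0..T} \<times> {0..T}" for z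
  proof (cases "0 < snd z \<and> snd z \<le> t")
    case True
    define x y where "x = fst z" and "y = snd z"
    have y: "0 < y" "y \<le> t" "y \<in> {0..T}" and x: "x \<in> {0..T}" using True z by (auto simp: x_def y_def)
    have idx: "mesh_index t N y < Suc N" for N using y by (intro mesh_index_less) auto
    have m1: "mesh t N (mesh_index t N y) \<in> {0..T}" "mesh t N (Suc (mesh_index t N y)) \<in> {0..T}" for N
      using idx[of N] by (auto intro!: mesh_mem[OF t, simplified])
    note lims = mesh_index_tendsto[OF y(1,2)]
    have a1: "(\<lambda>N. a (mesh t N (mesh_index t N y))) \<longlonglongrightarrow> a y" "(\<lambda>N. a (mesh t N (Suc (mesh_index t N y)))) \<longlonglongrightarrow> a y"
      using m1 y(3) by (auto intro!: continuous_on_tendsto_compose[OF a] lims(1,2) always_eventually)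
    have "(\<lambda>N. indicator {0..mesh t N (mesh_index t N y)} x :: real) \<longlonglongrightarrow> (if x < y then 1 else 0)"
    proof (rule tendsto_eventually)
      show "\<forall>\<^sub>F N in sequentially. indicator {0..mesh t N (mesh_index t N y)} x = (if x < y then 1 else 0 :: real)"
      proof (cases "x < y")
        case True
        from order_tendstoD(1)[OF lims(1) True] show ?thesis
          by eventually_elim (use x True in \<open>auto simp: indicator_def\<close>)
      next
        case False
        then have "\<not> x \<le> mesh t N (mesh_index t N y)" for N using lims(3)[of N] by linarith
        then show ?thesis using False by (auto simp: indicator_def)
      qed
    qed
    moreover have "(\<lambda>N. indicator {0..mesh t N (Suc (mesh_index t N y))} x :: real) \<longlonglongrightarrow> (if x \<le> y then 1 else 0)"
    proof (rule tendsto_eventually)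
      show "\<forall>\<^sub>F N in sequentially. indicator {0..mesh t N (Suc (mesh_index t N y))} x = (if x \<le> y then 1 else 0 :: real)"
      proof (cases "x \<le> y")
        case False
        then have "y < x" by simp
        from order_tendstoD(2)[OF lims(2) this] show ?thesis
          by eventually_elim (use False in \<open>auto simp: indicator_def\<close>)
      next
        case True
        then have "x \<le> mesh t N (Suc (mesh_index t N y))" for N using lims(4)[of N] by linarith
        then show ?thesis using True x by (auto simp: indicator_def)
      qed
    qed
    ultimately have "(\<lambda>N. ?c x N (mesh_index t N y)) \<longlonglongrightarrow> (if x < y then 1 else 0) * a y + (if x \<le> y then 1 else 0) * a y"
      by (intro tendsto_add tendsto_mult a1)
    then show ?thesis unfolding mesh_sum[OF t0] using True
      by (simp add: indicator_def x_def[symmetric] y_def[symmetric] algebra_simps)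
  next
    case False
    then have "?q' z = 0" by (auto simp: indicator_def)
    then show ?thesis unfolding mesh_sum[OF t0] using False by (simp only: if_False tendsto_const)
  qed
  have qm: "?q N \<in> borel_measurable (square_borel T)" for N
    by (intro borel_measurable_sum borel_measurable_times borel_measurable_add borel_measurable_const
        measurable_compose[OF measurable_fst_square indicator_interval_measurable]
        measurable_compose[OF measurable_snd_square indicator_interval_measurable]) auto
  have bm: "(\<lambda>z. indicator {0<..t} (snd z) * a (snd z)) \<in> borel_measurable (square_borel T)"
    by (intro borel_measurable_times measurable_compose[OF measurable_snd_square am]
        measurable_compose[OF measurable_snd_square indicator_interval_measurable]) auto
  have lm: "(\<lambda>z. if fst z < snd z then 1 else 0 :: real) \<in> borel_measurable (square_borel T)"
    "(\<lambda>z. if fst z \<le> snd z then 1 else 0 :: real) \<in> borel_measurable (square_borel T)"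
  proof -
    have fs[measurable]: "fst \<in> borel_measurable (square_borel T)" "snd \<in> borel_measurable (square_borel T)"
      by (auto intro!: measurable_restrict_space1 borel_measurable_continuous_onI continuous_intros)
    show "(\<lambda>z. if fst z < snd z then 1 else 0 :: real) \<in> borel_measurable (square_borel T)"
      "(\<lambda>z. if fst z \<le> snd z then 1 else 0 :: real) \<in> borel_measurable (square_borel T)" by measurable
  qed
  let ?L = "\<lambda>z. indicator {0<..t} (snd z) * a (snd z) * (if fst z < snd z then 1 else 0)"
  let ?E = "\<lambda>z. indicator {0<..t} (snd z) * a (snd z) * (if fst z \<le> snd z then 1 else 0)"
  have Lm: "?L \<in> borel_measurable (square_borel T)" "?E \<in> borel_measurable (square_borel T)"
    by (intro borel_measurable_times[OF bm lm(1)] borel_measurable_times[OF bm lm(2)])+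
  have LE_le: "\<bar>?L z\<bar> \<le> A" "\<bar>?E z\<bar> \<le> A" if "z \<in> {0..T} \<times> {0..T}" for z
    using A(1) A(2)[of "snd z"] that by (auto simp: indicator_def)
  have sw_m: "(\<lambda>z. ?L (snd z, fst z)) \<in> borel_measurable (square_borel T)"
  proof -
    have "(\<lambda>z. (snd z, fst z)) \<in> measurable (square_borel T) (square_borel T)"
      by (rule measurable_restrict_space2, force simp: space_restrict_space,
        rule measurable_restrict_space1, rule borel_measurable_continuous_onI, intro continuous_intros)
    from measurable_compose[OF this Lm(1)] show ?thesis by simp
  qed
  have "(\<lambda>N. I (?q N)) \<longlonglongrightarrow> I ?q'"
  proof (rule I_bounded_limit[OF qm _ q_le q_lim])
    show "?q' \<in> borel_measurable (square_borel T)"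
      by (rule borel_measurable_times[OF bm borel_measurable_add[OF lm]])
  qed
  also have "I ?q' = I (\<lambda>z. ?L z + ?E z)" by (intro I_cong) (simp add: distrib_left)
  also have "\<dots> = I ?L + I ?E"
    by (intro I_add integrable_bounded[OF Lm(1) LE_le(1)] integrable_bounded[OF Lm(2) LE_le(2)])
  \<comment> \<open>Only the strict part is reflected; the part that contains the diagonal stays in
    place.\<close>
  also have "I ?L = I (\<lambda>z. ?L (snd z, fst z))" by (rule I_swap[OF Lm(1) LE_le(1), symmetric])
  also have "\<dots> + I ?E = I (\<lambda>z. ?L (snd z, fst z) + ?E z)"
    by (rule I_add[symmetric], rule integrable_bounded[OF sw_m], rule LE_le(1), force, rule integrable_bounded[OF Lm(2) LE_le(2)])
  also have "\<dots> = I (\<lambda>z. indicator {0<..t} (max (fst z) (snd z)) * a (max (fst z) (snd z)))"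
    by (intro I_cong) (auto simp: max_def)
  finally show ?thesis unfolding eq .
qed

text \<open>For every \<open>N\<close> the left side equals, exactly, the first-order sum plus half
  the second-order sum plus the expected remainders. Only the remainders call for an estimate; the
  two sums have limits of their own, and uniqueness of limits gives the identity.\<close>

lemma duality_expectation:
  assumes g: "g \<in> Cb_infinity n" and rep: "\<And>i. i < n \<Longrightarrow> represents (\<phi> i) (Y i)"
    and f: "\<And>x. (f has_real_derivative f' x) (at x)" and f': "\<And>x. (f' has_real_derivative f'' x) (at x)"
    and cont: "continuous_on UNIV f''" and K: "\<And>x. \<bar>f'' x\<bar> \<le> K" and t: "t \<in> {0..T}"
  shows "expectation (\<lambda>w. g (\<lambda>j. Y j w) * (f (X t w) - f (X 0 w))) =
    (\<Sum>i<n. inn (\<phi> i) (\<lambda>y. indicator {0<..t} y * expectation (\<lambda>w. partial_deriv i g (\<lambda>j. Y j w) * f' (X y w)))) +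
    1 / 2 * I (\<lambda>z. indicator {0<..t} (max (fst z) (snd z)) * expectation (\<lambda>w. g (\<lambda>j. Y j w) * f'' (X (max (fst z) (snd z)) w)))"
proof -
  define F where "F w = g (\<lambda>j. Y j w)" for w
  define F' where "F' i w = partial_deriv i g (\<lambda>j. Y j w)" for i w
  define \<alpha> where "\<alpha> i s = expectation (\<lambda>w. F' i w * f' (X s w))" for i s
  define \<kappa> where "\<kappa> s = expectation (\<lambda>w. F w * f'' (X s w))" for s
  have Y: "Y i \<in> G" if "i < n" for i using representsD(1)[OF rep[OF that]] .
  have Fm[measurable]: "F \<in> borel_measurable M"
    unfolding F_def[abs_def] using Y by (intro Cb_infinity_measurable[OF g] meas)
  have F'm: "F' i \<in> borel_measurable M" if "i < n" for i
    unfolding F'_def[abs_def] using Y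
      by (intro Cb_infinity_measurable[OF Cb_infinity_partial_deriv[OF g that]] meas)
  obtain B where B: "0 \<le> B" "\<And>x. \<bar>g x\<bar> \<le> B" using Cb_infinity_bounded[OF g] by blast
  have FB: "\<bar>F w\<bar> \<le> B" for w by (simp add: F_def B)
  have \<kappa>_cont: "continuous_on {0..T} \<kappa>"
    unfolding \<kappa>_def[abs_def] by (rule continuous_expectation_bounded[OF Fm FB cont K])
  have \<alpha>_cont: "continuous_on {0..T} (\<alpha> i)" if i: "i < n" for i
  proof -
    obtain B' where "0 \<le> B'" "\<And>x. \<bar>partial_deriv i g x\<bar> \<le> B'"
      using Cb_infinity_bounded[OF Cb_infinity_partial_deriv[OF g i]] by blast
    then show ?thesis unfolding \<alpha>_def[abs_def]
      by (intro continuous_expectation_lipschitz[OF F'm[OF i] _ _ f' K]) (auto simp: F'_def)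
  qed
  have t0: "0 \<le> t" using t by simp
  have cf: "continuous_on UNIV f" "continuous_on UNIV f'"
    using f f' by (meson DERIV_isCont continuous_at_imp_continuous_on)+
  then have fm: "f \<in> borel_measurable borel" "f' \<in> borel_measurable borel"
    by (auto intro: borel_measurable_continuous_onI)
  define R where "R a b w = f (X b w) - f (X a w) - (f' (X a w) + f' (X b w)) / 2 * (X b w - X a w)" for a b w
  have step: "expectation (\<lambda>w. F w * (f (X b w) - f (X a w))) = expectation (\<lambda>w. F w * R a b w) +
      (\<Sum>i<n. inn (\<phi> i) (indicator {a<..b}) * ((\<alpha> i a + \<alpha> i b) / 2)) +
      1 / 2 * (inn (indicator {0..a}) (indicator {a<..b}) * \<kappa> a + inn (indicator {0..b}) (indicator {a<..b}) * \<kappa> b)"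
    and stepi: "integrable M (\<lambda>w. F w * (f (X b w) - f (X a w)))" "integrable M (\<lambda>w. F w * R a b w)"
      "integrable M (R a b)"
    if ab: "0 \<le> a" "a \<le> b" "b \<le> T" for a b
  proof -
    have mem: "a \<in> {0..T}" "b \<in> {0..T}" using ab by auto
    define D where "D w = X b w - X a w" for w
    have DG: "D \<in> G" unfolding D_def[abs_def] by (intro diff_mem X_mem mem)
    have parts: "expectation (\<lambda>w. F w * f' (X r w) * D w) = (\<Sum>i<n. inn (\<phi> i) (indicator {a<..b}) * \<alpha> i r) +
        inn (indicator {0..r}) (indicator {a<..b}) * \<kappa> r" and parts_i: "integrable M (\<lambda>w. F w * f' (X r w) * D w)"
      if r: "r \<in> {0..T}" for r
    proof -
      have "expectation (\<lambda>w. F w * f' (X r w) * D w) =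
        (\<Sum>i<n. expectation (\<lambda>w. Y i w * D w) * \<alpha> i r) + expectation (\<lambda>w. X r w * D w) * \<kappa> r"
        unfolding F_def F'_def \<alpha>_def \<kappa>_def
        by (rule cylindrical_by_parts[OF g Y X_mem[OF r] DG f' cont K])
      moreover have "expectation (\<lambda>w. Y i w * D w) = inn (\<phi> i) (indicator {a<..b})" if "i < n" for i
        unfolding D_def by (rule represents_increment[OF rep[OF that] ab])
      moreover have "expectation (\<lambda>w. X r w * D w) = inn (indicator {0..r}) (indicator {a<..b})"
        unfolding D_def by (rule represents_increment[OF represents_indicator[OF r] ab])
      ultimately show "expectation (\<lambda>w. F w * f' (X r w) * D w) = (\<Sum>i<n. inn (\<phi> i) (indicator {a<..b}) * \<alpha> i r) +
        inn (indicator {0..r}) (indicator {a<..b}) * \<kappa> r" by simp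
      have "\<bar>f' x\<bar> \<le> \<bar>f' 0\<bar> + K * \<bar>x\<bar>" for x using lin_growth_of_bounded_deriv[OF f' K, of x 0] by simp
      from L2_rv_mult_integrable[OF L2_rv_bounded_mult[OF L2_rv_lin_growth[OF prob_space_axioms mem_L2[OF X_mem[OF r]] fm(2) this] Fm FB] mem_L2[OF DG]]
      show "integrable M (\<lambda>w. F w * f' (X r w) * D w)" .
    qed
    \<comment> \<open>For mere integrability the accuracy is irrelevant, so it is set to 1.\<close>
    obtain C where C: "0 \<le> C"
      "\<And>x y. \<bar>f y - f x - (f' x + f' y) / 2 * (y - x)\<bar> \<le> (y - x)\<^sup>2 * (1 + 1 * \<bar>x\<bar> + C * \<bar>y - x\<bar>)"
      using trapezoid_remainder[OF f f' cont K zero_less_one] by blast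
    show iR: "integrable M (R a b)" unfolding R_def[abs_def]
      by (rule remainder_bound(1)[OF f f' C(2) zero_le_one C(1) ab])
    have "integrable M (\<lambda>w. B * R a b w)" using iR by simp
    then show iFR: "integrable M (\<lambda>w. F w * R a b w)"
      by (rule Bochner_Integration.integrable_bound)
         (use FB iR B(1) in \<open>auto simp: abs_mult intro!: mult_right_mono\<close>)
    have eq: "F w * (f (X b w) - f (X a w)) = F w * R a b w + (F w * f' (X a w) * D w + F w * f' (X b w) * D w) / 2" for w
      unfolding R_def D_def by (simp add: field_simps)
    show "integrable M (\<lambda>w. F w * (f (X b w) - f (X a w)))"
      unfolding eq using iFR parts_i[OF mem(1)] parts_i[OF mem(2)] by simp
    have "expectation (\<lambda>w. F w * (f (X b w) - f (X a w))) = expectation (\<lambda>w. F w * R a b w) +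
        (expectation (\<lambda>w. F w * f' (X a w) * D w) + expectation (\<lambda>w. F w * f' (X b w) * D w)) / 2"
      unfolding eq using iFR parts_i[OF mem(1)] parts_i[OF mem(2)] by simp
    also have "\<dots> = expectation (\<lambda>w. F w * R a b w) +
      (\<Sum>i<n. inn (\<phi> i) (indicator {a<..b}) * ((\<alpha> i a + \<alpha> i b) / 2)) +
      1 / 2 * (inn (indicator {0..a}) (indicator {a<..b}) * \<kappa> a + inn (indicator {0..b}) (indicator {a<..b}) * \<kappa> b)"
      unfolding parts[OF mem(1)] parts[OF mem(2)]
      by (simp add: distrib_left add_divide_distrib sum.distrib sum_divide_distrib)
    finally show "expectation (\<lambda>w. F w * (f (X b w) - f (X a w))) = expectation (\<lambda>w. F w * R a b w) +
      (\<Sum>i<n. inn (\<phi> i) (indicator {a<..b}) * ((\<alpha> i a + \<alpha> i b) / 2)) +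
      1 / 2 * (inn (indicator {0..a}) (indicator {a<..b}) * \<kappa> a + inn (indicator {0..b}) (indicator {a<..b}) * \<kappa> b)" .
  qed
  define E where "E = expectation (\<lambda>w. F w * (f (X t w) - f (X 0 w)))"
  define S1 where "S1 N = (\<Sum>i<n. \<Sum>k<Suc N. inn (\<phi> i) (indicator {mesh t N k<..mesh t N (Suc k)}) * ((\<alpha> i (mesh t N k) + \<alpha> i (mesh t N (Suc k))) / 2))" for N
  define S2 where "S2 N = (\<Sum>k<Suc N. inn (indicator {0..mesh t N k}) (indicator {mesh t N k<..mesh t N (Suc k)}) * \<kappa> (mesh t N k)
       + inn (indicator {0..mesh t N (Suc k)}) (indicator {mesh t N k<..mesh t N (Suc k)}) * \<kappa> (mesh t N (Suc k)))" for N
  have mab: "0 \<le> mesh t N k" "mesh t N k \<le> mesh t N (Suc k)" "mesh t N (Suc k) \<le> T" if "k < Suc N" for N k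
    using mesh_mem[OF t, of k N] mesh_mem[OF t, of "Suc k" N] mesh_mono[OF t0] that by auto
  have ER: "E = (\<Sum>k<Suc N. expectation (\<lambda>w. F w * R (mesh t N k) (mesh t N (Suc k)) w)) + S1 N + 1 / 2 * S2 N"
    for N
  proof -
    have "f (X t w) - f (X 0 w) = (\<Sum>k<Suc N. f (X (mesh t N (Suc k)) w) - f (X (mesh t N k) w))" for w
      using sum_lessThan_telescope[of "\<lambda>k. f (X (mesh t N k) w)" "Suc N"] by (simp only: mesh_ends)
    then have "E = expectation (\<lambda>w. \<Sum>k<Suc N. F w * (f (X (mesh t N (Suc k)) w) - f (X (mesh t N k) w)))"
      unfolding E_def by (simp only: sum_distrib_left)
    also have "\<dots> = (\<Sum>k<Suc N. expectation (\<lambda>w. F w * (f (X (mesh t N (Suc k)) w) - f (X (mesh t N k) w))))"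
      using stepi(1)[OF mab] by (intro Bochner_Integration.integral_sum) auto
    also have "\<dots> = (\<Sum>k<Suc N. expectation (\<lambda>w. F w * R (mesh t N k) (mesh t N (Suc k)) w) +
        (\<Sum>i<n. inn (\<phi> i) (indicator {mesh t N k<..mesh t N (Suc k)}) * ((\<alpha> i (mesh t N k) + \<alpha> i (mesh t N (Suc k))) / 2)) +
        1 / 2 * (inn (indicator {0..mesh t N k}) (indicator {mesh t N k<..mesh t N (Suc k)}) * \<kappa> (mesh t N k) +
          inn (indicator {0..mesh t N (Suc k)}) (indicator {mesh t N k<..mesh t N (Suc k)}) * \<kappa> (mesh t N (Suc k))))"
      using step[OF mab] by (intro sum.cong refl) auto
    also have "\<dots> = (\<Sum>k<Suc N. expectation (\<lambda>w. F w * R (mesh t N k) (mesh t N (Suc k)) w)) + S1 N + 1 / 2 * S2 N"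
      unfolding S1_def S2_def sum.distrib sum_distrib_left[symmetric]
        by (simp only: sum.swap[of _ "{..<n}" "{..<Suc N}"])
    finally show ?thesis .
  qed
  have "(\<lambda>N. E - (S1 N + 1 / 2 * S2 N)) \<longlonglongrightarrow> 0"
  proof (rule LIMSEQ_I)
    fix \<epsilon> :: real assume \<epsilon>: "0 < \<epsilon>"
    \<comment> \<open>The order of choices matters: \<open>e\<close> comes first and fixes
      \<open>C\<close>, hence \<open>d\<close>; only then is \<open>h\<close> chosen and the mesh
      refined until all standard deviations of increments fall below \<open>h\<close>. The total
      remainder is at most \<open>c * e + d * h\<close>.\<close>
    define c where "c = B * mass * (1 + sqrt 3 * sqrt mass)"
    have c0: "0 \<le> c" using B(1) mass_nonneg by (simp add: c_def)
    define e where "e = \<epsilon> / (2 * (c + 1))"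
    have e: "0 < e" using c0 \<epsilon> by (simp add: e_def)
    have ce: "c * e < \<epsilon> / 2"
    proof -
      have "c * e < (c + 1) * e" using e by simp
      also have "(c + 1) * e = \<epsilon> / 2" using c0 by (simp add: e_def field_simps)
      finally show ?thesis .
    qed
    obtain C where C: "0 \<le> C"
      "\<And>x y. \<bar>f y - f x - (f' x + f' y) / 2 * (y - x)\<bar> \<le> (y - x)\<^sup>2 * (e + e * \<bar>x\<bar> + C * \<bar>y - x\<bar>)"
      using trapezoid_remainder[OF f f' cont K e] by blast
    define d where "d = B * mass * (C * sqrt 3)"
    have d0: "0 \<le> d" using B(1) C(1) mass_nonneg by (simp add: d_def)
    define h where "h = \<epsilon> / (2 * (d + 1))"
    have h: "0 < h" using d0 \<epsilon> by (simp add: h_def)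
    have dh: "d * h < \<epsilon> / 2"
    proof -
      have "d * h < (d + 1) * h" using h by simp
      also have "(d + 1) * h = \<epsilon> / 2" using d0 by (simp add: h_def field_simps)
      finally show ?thesis .
    qed
    obtain N0 where N0: "\<And>N k. N0 \<le> N \<Longrightarrow> k < Suc N \<Longrightarrow> expectation (\<lambda>w. (X (mesh t N (Suc k)) w - X (mesh t N k) w)\<^sup>2) < h\<^sup>2"
      using mesh_var_small[OF t, of "h\<^sup>2"] h by auto
    have "norm (E - (S1 N + 1 / 2 * S2 N) - 0) < \<epsilon>" if N: "N0 \<le> N" for N
    proof -
      define v where "v k = expectation (\<lambda>w. (X (mesh t N (Suc k)) w - X (mesh t N k) w)\<^sup>2)" for k
      define L where "L = e + e * (sqrt 3 * sqrt mass) + C * (sqrt 3 * h)"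
      have L0: "0 \<le> L" using e C(1) h mass_nonneg by (simp add: L_def)
      have v0: "0 \<le> v k" for k by (simp add: v_def)
      have one: "\<bar>expectation (\<lambda>w. F w * R (mesh t N k) (mesh t N (Suc k)) w)\<bar> \<le> B * (v k * L)"
        if k: "k < Suc N" for k
      proof -
        let ?R = "R (mesh t N k) (mesh t N (Suc k))"
        have "\<bar>expectation (\<lambda>w. F w * ?R w)\<bar> \<le> expectation (\<lambda>w. \<bar>F w * ?R w\<bar>)" by (rule integral_abs_bound)
        also have "\<dots> \<le> expectation (\<lambda>w. B * \<bar>?R w\<bar>)"
        proof (rule integral_mono)
          show "integrable M (\<lambda>w. \<bar>F w * ?R w\<bar>)" by (rule integrable_abs[OF stepi(2)[OF mab[OF k]]])
          show "integrable M (\<lambda>w. B * \<bar>?R w\<bar>)"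
            by (rule integrable_mult_right[OF integrable_abs[OF stepi(3)[OF mab[OF k]]]])
          show "\<bar>F w * ?R w\<bar> \<le> B * \<bar>?R w\<bar>" for w using FB by (simp add: abs_mult mult_right_mono)
        qed
        also have "\<dots> = B * expectation (\<lambda>w. \<bar>?R w\<bar>)" by simp
        also have "expectation (\<lambda>w. \<bar>?R w\<bar>) \<le> v k * (e + e * (sqrt 3 * sqrt mass) + C * (sqrt 3 * sqrt (v k)))"
          unfolding R_def v_def by (rule remainder_bound(2)[OF f f' C(2) less_imp_le[OF e] C(1) mab[OF k]])
        also have "\<dots> \<le> v k * L"
        proof (rule mult_left_mono[OF _ v0])
          have "sqrt (v k) \<le> h" using N0[OF N k] h by (simp add: v_def real_le_lsqrt less_imp_le)
          then have "C * (sqrt 3 * sqrt (v k)) \<le> C * (sqrt 3 * h)" using C(1) by (intro mult_left_mono) auto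
          then show "e + e * (sqrt 3 * sqrt mass) + C * (sqrt 3 * sqrt (v k)) \<le> L" by (simp add: L_def)
        qed
        finally show ?thesis using B(1) by (simp add: mult_left_mono)
      qed
      have "\<bar>E - (S1 N + 1 / 2 * S2 N)\<bar> = \<bar>\<Sum>k<Suc N. expectation (\<lambda>w. F w * R (mesh t N k) (mesh t N (Suc k)) w)\<bar>"
        using ER[of N] by simp
      also have "\<dots> \<le> (\<Sum>k<Suc N. B * (v k * L))"
        using one by (intro order.trans[OF sum_abs] sum_mono) auto
      also have "\<dots> = (\<Sum>k<Suc N. v k) * (B * L)" unfolding sum_distrib_right
        by (intro sum.cong refl) (simp add: mult_ac)
      also have "\<dots> \<le> mass * (B * L)"
        using sum_var_le_mass[OF t, of N] B(1) L0 unfolding v_def by (intro mult_right_mono) auto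
      also have "\<dots> = c * e + d * h" by (simp add: c_def d_def L_def algebra_simps)
      also have "\<dots> < \<epsilon>" using ce dh by simp
      finally show ?thesis by simp
    qed
    then show "\<exists>N0. \<forall>N\<ge>N0. norm (E - (S1 N + 1 / 2 * S2 N) - 0) < \<epsilon>" by blast
  qed
  then have "(\<lambda>N. E - (E - (S1 N + 1 / 2 * S2 N))) \<longlonglongrightarrow> E - 0" by (intro tendsto_diff tendsto_const)
  then have lim1: "(\<lambda>N. S1 N + 1 / 2 * S2 N) \<longlonglongrightarrow> E" by simp
  have lim2: "(\<lambda>N. S1 N + 1 / 2 * S2 N) \<longlonglongrightarrow> (\<Sum>i<n. inn (\<phi> i) (\<lambda>y. indicator {0<..t} y * \<alpha> i y)) +
     1 / 2 * I (\<lambda>z. indicator {0<..t} (max (fst z) (snd z)) * \<kappa> (max (fst z) (snd z)))"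
    unfolding S1_def S2_def
    by (intro tendsto_add tendsto_mult_left tendsto_sum mesh_limit_first_order[OF rep] mesh_limit_second_order \<kappa>_cont \<alpha>_cont t) auto
  show ?thesis
    using LIMSEQ_unique[OF lim1 lim2] by (simp only: E_def F_def F'_def \<alpha>_def \<kappa>_def)
qed

section \<open>Fubini for the correction term and for the integrand\<close>

lemma X_fst_snd_measurable:
  assumes "m \<in> measurable (square_borel T) (interval_borel T)"
  shows "(\<lambda>p. X (m (snd p)) (fst p)) \<in> borel_measurable (M \<Otimes>\<^sub>M square_borel T)"
proof -
  have "(\<lambda>p. (fst p, m (snd p))) \<in> measurable (M \<Otimes>\<^sub>M square_borel T) (M \<Otimes>\<^sub>M interval_borel T)"
    by (intro measurable_Pair measurable_fst measurable_compose[OF measurable_snd assms])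
  from measurable_compose[OF this X_joint] show ?thesis by simp
qed

text \<open>A bounded second derivative allows at most quadratic growth, and the square of a
  Gaussian variable is square integrable by its fourth moment.\<close>

lemma quadratic_growth_L2:
  assumes f: "\<And>x. (f has_real_derivative f' x) (at x)" and f': "\<And>x. (f' has_real_derivative f'' x) (at x)"
    and K: "\<And>x. \<bar>f'' x\<bar> \<le> K" and t: "t \<in> {0..T}"
  shows "(\<lambda>w. f (X t w)) \<in> L2_rv M"
proof -
  have K0: "0 \<le> K" using K[of 0] by linarith
  have "continuous_on UNIV f" using f by (meson DERIV_isCont continuous_at_imp_continuous_on)
  then have fm: "f \<in> borel_measurable borel" by (rule borel_measurable_continuous_onI)
  have f'_le: "\<bar>f' x\<bar> \<le> \<bar>f' 0\<bar> + K * \<bar>x\<bar>" for x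
    using lin_growth_of_bounded_deriv[OF f' K, of x 0] by simp
  have growth: "\<bar>f x\<bar> \<le> \<bar>f 0\<bar> + \<bar>f' 0\<bar> * \<bar>x\<bar> + K * x\<^sup>2" for x
  proof -
    have "norm (f x - f 0) \<le> (\<bar>f' 0\<bar> + K * \<bar>x\<bar>) * norm (x - 0)"
    proof (rule field_differentiable_bound[of "closed_segment 0 x" f f'])
      fix z assume "z \<in> closed_segment 0 x"
      then have "\<bar>z\<bar> \<le> \<bar>x\<bar>" by (auto simp: closed_segment_eq_real_ivl split: if_splits)
      then show "norm (f' z) \<le> \<bar>f' 0\<bar> + K * \<bar>x\<bar>"
        using f'_le[of z] mult_left_mono[of "\<bar>z\<bar>" "\<bar>x\<bar>" K] K0 by simp
    qed (auto intro: DERIV_subset[OF f])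
    moreover have "(\<bar>f' 0\<bar> + K * \<bar>x\<bar>) * \<bar>x\<bar> = \<bar>f' 0\<bar> * \<bar>x\<bar> + K * x\<^sup>2"
      by (simp add: distrib_right power2_eq_square)
    ultimately have "\<bar>f x - f 0\<bar> \<le> \<bar>f' 0\<bar> * \<bar>x\<bar> + K * x\<^sup>2" by simp
    then show ?thesis by linarith
  qed
  have XG: "X t \<in> G" by (rule X_mem[OF t])
  have "\<And>w. ((X t w)\<^sup>2)\<^sup>2 = X t w ^ 4" by (simp flip: power_mult)
  then have X2: "(\<lambda>w. (X t w)\<^sup>2) \<in> L2_rv M"
    using meas[OF XG] integrable_power[OF XG, of 4] by (simp add: L2_rv_def)
  have X1: "(\<lambda>w. \<bar>X t w\<bar>) \<in> L2_rv M" using mem_L2[OF XG] by (auto simp: L2_rv_def)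
  show ?thesis
  proof (rule L2_rv_bound)
    show "(\<lambda>w. 1 * (\<bar>f 0\<bar> * 1 + \<bar>f' 0\<bar> * \<bar>X t w\<bar>) + K * (X t w)\<^sup>2) \<in> L2_rv M"
      by (intro L2_rv_lin X1 X2 L2_rv_bounded[where B=1]) auto
    show "AE w in M. \<bar>f (X t w)\<bar> \<le> \<bar>1 * (\<bar>f 0\<bar> * 1 + \<bar>f' 0\<bar> * \<bar>X t w\<bar>) + K * (X t w)\<^sup>2\<bar>"
      using growth by (auto intro: order.trans[OF _ abs_ge_self])
    show "(\<lambda>w. f (X t w)) \<in> borel_measurable M" by (rule measurable_compose[OF X_meas[OF t] fm])
  qed
qed

text \<open>This is \<open>\<integral>\<^sub>0\<^sup>t k(X\<^sub>s) d\<gamma>(s)\<close>, because \<open>d\<gamma>\<close> is the image of the covariance measure under the maximum.\<close>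

definition correction :: "(real \<Rightarrow> real) \<Rightarrow> real \<Rightarrow> 'w \<Rightarrow> real" where
  "correction k t w = I (\<lambda>z. k (X (max (fst z) (snd z)) w) * indicator {0..t} (max (fst z) (snd z)))"

lemma correction_facts:
  assumes H: "H \<in> borel_measurable M" "\<And>w. \<bar>H w\<bar> \<le> B"
    and k: "continuous_on UNIV k" "\<And>x. \<bar>k x\<bar> \<le> K" and t: "t \<in> {0..T}"
  shows correction_integrable: "integrable M (\<lambda>w. H w * correction k t w)"
    and correction_bound: "\<And>w. w \<in> space M \<Longrightarrow> \<bar>correction k t w\<bar> \<le> K * mass"
    and expectation_correction: "expectation (\<lambda>w. H w * correction k t w) =
      I (\<lambda>z. indicator {0<..t} (max (fst z) (snd z)) * expectation (\<lambda>w. H w * k (X (max (fst z) (snd z)) w)))"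
proof -
  have km: "k \<in> borel_measurable borel" using k(1) by (rule borel_measurable_continuous_onI)
  have K0: "0 \<le> K" using k(2)[of 0] by linarith
  let ?m = "\<lambda>z. max (fst z) (snd z) :: real"
  let ?h = "\<lambda>w z. H w * (k (X (?m z) w) * indicator {0..t} (?m z))"
  have hm: "case_prod ?h \<in> borel_measurable (M \<Otimes>\<^sub>M square_borel T)"
    unfolding split_beta'
    by (intro borel_measurable_times measurable_compose[OF measurable_fst H(1)]
        measurable_compose[OF X_fst_snd_measurable[OF max_measurable_square] km]
        measurable_compose[OF measurable_snd measurable_compose[OF max_measurable_square indicator_interval_measurable]]) auto
  have hb: "\<bar>?h w z\<bar> \<le> B * K" for w z
  proof -
    have "\<bar>H w\<bar> * \<bar>k (X (?m z) w) * indicator {0..t} (?m z)\<bar> \<le> B * K"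
      using H(2)[of w] k(2) K0 by (intro mult_mono) (auto simp: indicator_def)
    then show ?thesis by (simp only: abs_mult)
  qed
  have nb: "(\<integral>\<^sup>+w. ennreal \<bar>?h w z\<bar> \<partial>M) \<le> ennreal (B * K)" for z
  proof -
    have "(\<integral>\<^sup>+w. ennreal \<bar>?h w z\<bar> \<partial>M) \<le> (\<integral>\<^sup>+w. ennreal (B * K) \<partial>M)"
      by (intro nn_integral_mono ennreal_leI hb)
    then show ?thesis by (simp add: emeasure_space_1)
  qed
  have eq: "H w * correction k t w = I (?h w)" for w by (simp add: correction_def I_cmult)
  show "integrable M (\<lambda>w. H w * correction k t w)"
    unfolding eq by (rule I_Fubini_integrable[OF prob_space_axioms hm nb])
  show "\<bar>correction k t w\<bar> \<le> K * mass" if w: "w \<in> space M" for w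
    unfolding correction_def mass_def
  proof (rule I_le_bounded)
    have "(\<lambda>z. (w, z)) \<in> measurable (square_borel T) (M \<Otimes>\<^sub>M square_borel T)"
      using w by (rule measurable_Pair1')
    from measurable_compose[OF this X_fst_snd_measurable[OF max_measurable_square]]
    have "(\<lambda>z. X (?m z) w) \<in> borel_measurable (square_borel T)" by simp
    then show "(\<lambda>z. k (X (?m z) w) * indicator {0..t} (?m z)) \<in> borel_measurable (square_borel T)"
      by (intro borel_measurable_times measurable_compose[OF _ km]
          measurable_compose[OF max_measurable_square indicator_interval_measurable]) auto
    show "\<bar>k (X (?m z) w) * indicator {0..t} (?m z)\<bar> \<le> K" for z using k(2) K0 by (auto simp: indicator_def)
  qed
  let ?a = "\<lambda>s. expectation (\<lambda>w. H w * k (X s w))"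
  have ac: "continuous_on {0..T} ?a" by (rule continuous_expectation_bounded[OF H k])
  obtain A where A: "0 \<le> A" "\<And>s. s \<in> {0..T} \<Longrightarrow> \<bar>?a s\<bar> \<le> A" using continuous_interval_facts(2)[OF ac] by blast
  have mm: "?m z \<in> {0..T}" if "z \<in> {0..T} \<times> {0..T}" for z using that by (auto simp: max_def)
  have i1: "integrable V (\<lambda>z. indicator {0<..t} (?m z) * ?a (?m z))"
    by (rule integrable_bounded[where C=A],
        intro borel_measurable_times measurable_compose[OF max_measurable_square continuous_interval_facts(1)[OF ac]]
        measurable_compose[OF max_measurable_square indicator_interval_measurable])
       (use A mm in \<open>auto simp: indicator_def\<close>)
  have S0: "{0..0} \<times> {0..0} \<in> sets (square_borel T)" using T_pos by (intro rectangle_sets_square) auto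
  have i2: "integrable V (\<lambda>z. ?a 0 * indicator ({0..0} \<times> {0..0}) z)"
    using S0 by (intro integrable_mult_right integrable_bounded[where C=1]) (auto simp: indicator_def)
  have "expectation (\<lambda>w. H w * correction k t w) = I (\<lambda>z. expectation (\<lambda>w. ?h w z))"
    unfolding eq by (rule I_Fubini_eq[OF prob_space_axioms hm nb])
  \<comment> \<open>The correction is taken over \<open>{0..t}\<close>, the mesh limits over
    \<open>{0<..t}\<close>. The maximum is 0 only at the origin, whose covariance mass is the second
    moment of \<open>X 0\<close>, that is 0.\<close>
  also have "\<dots> = I (\<lambda>z. indicator {0<..t} (?m z) * ?a (?m z) + ?a 0 * indicator ({0..0} \<times> {0..0}) z)"
    using t by (intro I_cong) (auto simp: indicator_def max_def)
  also have "\<dots> = I (\<lambda>z. indicator {0<..t} (?m z) * ?a (?m z)) + ?a 0 * I (indicator ({0..0} \<times> {0..0}))"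
    by (subst I_add[OF i1 i2]) (simp add: I_cmult)
  also have "I (indicator ({0..0} \<times> {0..0})) = expectation (\<lambda>w. X 0 w * X 0 w)"
    using T_pos by (intro I_rectangle) auto
  also have "\<dots> = expectation (\<lambda>w. 0)" using X_0 by (intro Bochner_Integration.integral_cong) auto
  finally show "expectation (\<lambda>w. H w * correction k t w) = I (\<lambda>z. indicator {0<..t} (?m z) * ?a (?m z))"
    by simp
qed

text \<open>The mesh limits have the expectation inside the semiscalar product, the duality relation
  has it outside. Since \<open>k\<close> may be unbounded, the bound that Fubini asks for comes from
  the first absolute moments of \<open>X\<close>, which are at most \<open>sqrt mass\<close> at
  every time.\<close>

lemma expectation_inn:
  assumes \<phi>: "represents \<phi> Y" and H: "H \<in> borel_measurable M" "\<And>w. \<bar>H w\<bar> \<le> B" "0 \<le> B"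
    and k: "\<And>x. (k has_real_derivative k' x) (at x)" "\<And>x. \<bar>k' x\<bar> \<le> K" and t: "t \<in> {0..T}"
  shows "expectation (\<lambda>w. H w * inn \<phi> (\<lambda>s. k (X s w) * indicator {0..t} s)) =
      inn \<phi> (\<lambda>y. indicator {0<..t} y * expectation (\<lambda>w. H w * k (X y w)))"
proof -
  have K0: "0 \<le> K" using k(2)[of 0] by linarith
  have "continuous_on UNIV k" using k(1) by (meson DERIV_isCont continuous_at_imp_continuous_on)
  then have km: "k \<in> borel_measurable borel" by (rule borel_measurable_continuous_onI)
  have k_le: "\<bar>k x\<bar> \<le> \<bar>k 0\<bar> + K * \<bar>x\<bar>" for x
    using lin_growth_of_bounded_deriv[OF k, of x 0] by simp
  obtain C where C: "\<And>x. x \<in> {0..T} \<Longrightarrow> \<bar>\<phi> x\<bar> \<le> C" using representsD(4)[OF \<phi>] by blast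
  have C0: "0 \<le> C" using C[of 0] T_pos by (smt (verit) atLeastAtMost_iff)
  let ?h = "\<lambda>w z. H w * (\<phi> (fst z) * (k (X (snd z) w) * indicator {0..t} (snd z)))"
  have hm: "case_prod ?h \<in> borel_measurable (M \<Otimes>\<^sub>M square_borel T)"
    unfolding split_beta'
    by (intro borel_measurable_times measurable_compose[OF measurable_fst H(1)]
        measurable_compose[OF measurable_snd measurable_compose[OF measurable_fst_square representsD(2)[OF \<phi>]]]
        measurable_compose[OF X_fst_snd_measurable[OF measurable_snd_square] km]
        measurable_compose[OF measurable_snd measurable_compose[OF measurable_snd_square indicator_interval_measurable]]) auto
  have kL2: "(\<lambda>w. k (X y w)) \<in> L2_rv M" if "y \<in> {0..T}" for y
    by (rule L2_rv_lin_growth[OF prob_space_axioms mem_L2[OF X_mem[OF that]] km k_le])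
  have EX: "expectation (\<lambda>w. \<bar>X y w\<bar>) \<le> sqrt mass" if y: "y \<in> {0..T}" for y
  proof -
    have "expectation (\<lambda>w. \<bar>X y w * 1\<bar>) \<le> sqrt (expectation (\<lambda>w. (X y w)\<^sup>2)) * sqrt (expectation (\<lambda>w. 1\<^sup>2))"
      by (intro L2_cauchy_schwarz mem_L2 X_mem y L2_rv_bounded[where B=1]) auto
    then have "expectation (\<lambda>w. \<bar>X y w\<bar>) \<le> sqrt (expectation (\<lambda>w. (X y w)\<^sup>2))" by (simp add: prob_space)
    also have "\<dots> \<le> sqrt mass" using var_le_mass[OF y] by simp
    finally show ?thesis .
  qed
  define Q where "Q = B * C * (\<bar>k 0\<bar> + K * sqrt mass)"
  have nb: "(\<integral>\<^sup>+w. ennreal \<bar>?h w z\<bar> \<partial>M) \<le> ennreal Q" if z: "z \<in> {0..T} \<times> {0..T}" for z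
  proof -
    have y: "snd z \<in> {0..T}" using z by auto
    have iX: "integrable M (\<lambda>w. \<bar>X (snd z) w\<bar>)" using L2_rv_integrable[OF mem_L2[OF X_mem[OF y]]] by simp
    have "\<bar>?h w z\<bar> \<le> B * C * (\<bar>k 0\<bar> + K * \<bar>X (snd z) w\<bar>)" for w
    proof -
      have "\<bar>k (X (snd z) w) * indicator {0..t} (snd z)\<bar> \<le> \<bar>k 0\<bar> + K * \<bar>X (snd z) w\<bar>"
        using k_le[of "X (snd z) w"] K0 by (auto simp: indicator_def)
      then have "\<bar>H w\<bar> * (\<bar>\<phi> (fst z)\<bar> * \<bar>k (X (snd z) w) * indicator {0..t} (snd z)\<bar>) \<le> B * (C * (\<bar>k 0\<bar> + K * \<bar>X (snd z) w\<bar>))"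
        using H(2,3) C z C0 by (intro mult_mono mult_nonneg_nonneg) auto
      then show ?thesis by (simp only: abs_mult mult.assoc)
    qed
    then have "(\<integral>\<^sup>+w. ennreal \<bar>?h w z\<bar> \<partial>M) \<le> (\<integral>\<^sup>+w. ennreal (B * C * (\<bar>k 0\<bar> + K * \<bar>X (snd z) w\<bar>)) \<partial>M)"
      by (intro nn_integral_mono ennreal_leI)
    also have "\<dots> = ennreal (expectation (\<lambda>w. B * C * (\<bar>k 0\<bar> + K * \<bar>X (snd z) w\<bar>)))"
      using iX H(3) C0 K0 by (intro nn_integral_eq_integral) auto
    also have "expectation (\<lambda>w. B * C * (\<bar>k 0\<bar> + K * \<bar>X (snd z) w\<bar>)) = B * C * (\<bar>k 0\<bar> + K * expectation (\<lambda>w. \<bar>X (snd z) w\<bar>))"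
      using iX by (simp add: prob_space)
    also have "ennreal \<dots> \<le> ennreal Q"
      unfolding Q_def using EX[OF y] H(3) C0 K0 by (intro ennreal_leI mult_left_mono add_left_mono) auto
    finally show ?thesis .
  qed
  let ?a = "\<lambda>s. expectation (\<lambda>w. H w * k (X s w))"
  have ac: "continuous_on {0..T} ?a" by (rule continuous_expectation_lipschitz[OF H k])
  obtain A where A: "0 \<le> A" "\<And>s. s \<in> {0..T} \<Longrightarrow> \<bar>?a s\<bar> \<le> A" using continuous_interval_facts(2)[OF ac] by blast
  have i1: "integrable V (\<lambda>(x, y). \<phi> x * (indicator {0<..t} y * ?a y))"
    by (rule integrable_tensor[OF representsD(2)[OF \<phi>] borel_measurable_times[OF indicator_interval_measurable continuous_interval_facts(1)[OF ac]] C, where D=A])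
       (use A in \<open>auto simp: indicator_def\<close>)
  have i2: "integrable V (\<lambda>z. ?a 0 * (case z of (x, y) \<Rightarrow> \<phi> x * indicator {0..0} y))"
    by (rule integrable_mult_right, rule integrable_tensor[OF representsD(2)[OF \<phi>] indicator_interval_measurable C, where D=1])
       (auto simp: indicator_def)
  have "H w * inn \<phi> (\<lambda>s. k (X s w) * indicator {0..t} s) = I (?h w)" for w
    unfolding inn_def I_cmult by (simp add: split_beta')
  then have "expectation (\<lambda>w. H w * inn \<phi> (\<lambda>s. k (X s w) * indicator {0..t} s)) = I (\<lambda>z. expectation (\<lambda>w. ?h w z))"
    using I_Fubini_eq[OF prob_space_axioms hm nb] by simp
  also have "\<dots> = I (\<lambda>z. (case z of (x, y) \<Rightarrow> \<phi> x * (indicator {0<..t} y * ?a y)) + ?a 0 * (case z of (x, y) \<Rightarrow> \<phi> x * indicator {0..0} y))"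
  proof (rule I_cong)
    fix z :: "real \<times> real" assume z: "z \<in> {0..T} \<times> {0..T}"
    have "?h w z = (\<phi> (fst z) * indicator {0..t} (snd z)) * (H w * k (X (snd z) w))" for w
      by (simp add: mult_ac)
    then have "expectation (\<lambda>w. ?h w z) = expectation (\<lambda>w. (\<phi> (fst z) * indicator {0..t} (snd z)) * (H w * k (X (snd z) w)))"
      by (simp only:)
    also have "\<dots> = (\<phi> (fst z) * indicator {0..t} (snd z)) * ?a (snd z)" by (rule integral_mult_right_zero)
    finally have "expectation (\<lambda>w. ?h w z) = (\<phi> (fst z) * indicator {0..t} (snd z)) * ?a (snd z)" .
    then show "expectation (\<lambda>w. ?h w z) = (case z of (x, y) \<Rightarrow> \<phi> x * (indicator {0<..t} y * ?a y)) + ?a 0 * (case z of (x, y) \<Rightarrow> \<phi> x * indicator {0..0} y)"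
      using z t by (auto simp: indicator_def split_beta)
  qed
  also have "\<dots> = inn \<phi> (\<lambda>y. indicator {0<..t} y * ?a y) + ?a 0 * inn \<phi> (indicator {0..0})"
    unfolding I_add[OF i1 i2] by (simp add: inn_def I_cmult)
  \<comment> \<open>Passing from \<open>{0<..t}\<close> to \<open>{0..t}\<close> adds a multiple of
    the semiscalar product with the indicator of the single point 0, which vanishes because
    \<open>X 0 = 0\<close>.\<close>
  also have "inn \<phi> (indicator {0..0}) = expectation (\<lambda>w. Y w * X 0 w)"
    using T_pos by (intro representsD(3)[OF \<phi>, symmetric]) auto
  also have "\<dots> = expectation (\<lambda>w. 0)" using X_0 by (intro Bochner_Integration.integral_cong) auto
  finally show ?thesis by simp
qed

text \<open>The second-order limit is half the expectation of \<open>g\<close> times the correction,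
  so subtracting half the correction leaves the first-order terms, and Fubini brings these into the
  form of the duality relation.\<close>

lemma duality_represents:
  assumes g: "g \<in> Cb_infinity n" and rep: "\<And>i. i < n \<Longrightarrow> represents (\<phi> i) (Y i)"
    and f: "\<And>x. (f has_real_derivative f' x) (at x)" and f': "\<And>x. (f' has_real_derivative f'' x) (at x)"
    and cont: "continuous_on UNIV f''" and K: "\<And>x. \<bar>f'' x\<bar> \<le> K" and t: "t \<in> {0..T}"
  shows "expectation (\<lambda>w. g (\<lambda>j. Y j w) * (f (X t w) - f (X 0 w) - 1 / 2 * correction f'' t w)) =
    (\<Sum>i<n. expectation (\<lambda>w. partial_deriv i g (\<lambda>j. Y j w) * inn (\<phi> i) (\<lambda>s. f' (X s w) * indicator {0..t} s)))"
proof -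
  have Y: "Y i \<in> G" if "i < n" for i using representsD(1)[OF rep[OF that]] .
  have hm: "(\<lambda>w. h (\<lambda>j. Y j w)) \<in> borel_measurable M" if "h \<in> Cb_infinity n" for h
    using Y by (intro Cb_infinity_measurable[OF that] meas)
  obtain B where B: "\<And>x. \<bar>g x\<bar> \<le> B" using Cb_infinity_bounded[OF g] by blast
  have z: "0 \<in> {0..T}" using T_pos by simp
  have "(\<lambda>w. f (X t w) - f (X 0 w)) \<in> L2_rv M"
    by (intro L2_rv_diff quadratic_growth_L2[OF f f' K] t z)
  from L2_rv_integrable[OF L2_rv_bounded_mult[OF this hm[OF g] B]]
  have i1: "integrable M (\<lambda>w. g (\<lambda>j. Y j w) * (f (X t w) - f (X 0 w)))" .
  note i2 = correction_integrable[OF hm[OF g] B cont K t]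
  have "expectation (\<lambda>w. g (\<lambda>j. Y j w) * (f (X t w) - f (X 0 w) - 1 / 2 * correction f'' t w)) =
      expectation (\<lambda>w. g (\<lambda>j. Y j w) * (f (X t w) - f (X 0 w)) - 1 / 2 * (g (\<lambda>j. Y j w) * correction f'' t w))"
    by (intro Bochner_Integration.integral_cong refl) (simp add: algebra_simps)
  also have "\<dots> = expectation (\<lambda>w. g (\<lambda>j. Y j w) * (f (X t w) - f (X 0 w))) - 1 / 2 * expectation (\<lambda>w. g (\<lambda>j. Y j w) * correction f'' t w)"
    using i1 i2 by simp
  also have "\<dots> = (\<Sum>i<n. inn (\<phi> i) (\<lambda>y. indicator {0<..t} y * expectation (\<lambda>w. partial_deriv i g (\<lambda>j. Y j w) * f' (X y w))))"
  proof -
    have "expectation (\<lambda>w. g (\<lambda>j. Y j w) * (f (X t w) - f (X 0 w))) =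
      (\<Sum>i<n. inn (\<phi> i) (\<lambda>y. indicator {0<..t} y * expectation (\<lambda>w. partial_deriv i g (\<lambda>j. Y j w) * f' (X y w)))) +
      1 / 2 * I (\<lambda>z. indicator {0<..t} (max (fst z) (snd z)) * expectation (\<lambda>w. g (\<lambda>j. Y j w) * f'' (X (max (fst z) (snd z)) w)))"
      by (rule duality_expectation[OF g rep f f' cont K t])
    then show ?thesis unfolding expectation_correction[OF hm[OF g] B cont K t] by simp
  qed
  also have "\<dots> = (\<Sum>i<n. expectation (\<lambda>w. partial_deriv i g (\<lambda>j. Y j w) * inn (\<phi> i) (\<lambda>s. f' (X s w) * indicator {0..t} s)))"
  proof (intro sum.cong refl)
    fix i assume "i \<in> {..<n}"
    then have i: "i < n" by simp
    obtain B' where "0 \<le> B'" "\<And>x. \<bar>partial_deriv i g x\<bar> \<le> B'"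
      using Cb_infinity_bounded[OF Cb_infinity_partial_deriv[OF g i]] by blast
    then show "inn (\<phi> i) (\<lambda>y. indicator {0<..t} y * expectation (\<lambda>w. partial_deriv i g (\<lambda>j. Y j w) * f' (X y w))) =
        expectation (\<lambda>w. partial_deriv i g (\<lambda>j. Y j w) * inn (\<phi> i) (\<lambda>s. f' (X s w) * indicator {0..t} s))"
      by (intro expectation_inn[OF rep[OF i] hm[OF Cb_infinity_partial_deriv[OF g i]] _ _ f' K t, symmetric]) auto
  qed
  finally show ?thesis .
qed

end

section \<open>Extension by approximation\<close>

text \<open>\<open>g\<close> and its partial derivatives are bounded and Lipschitz, so mean square
  convergence of the arguments and of the factors \<open>Bk\<close> suffices. The limit
  \<open>B i\<close> is left abstract: for truncated elements of \<open>L_mu\<close> it exists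
  without being an absolutely convergent semiscalar product.\<close>

lemma (in prob_space) cylindrical_duality_limit:
  assumes g: "g \<in> Cb_infinity n" and Z: "Z \<in> L2_rv M"
    and Y: "\<And>i. i < n \<Longrightarrow> Y i \<in> L2_rv M" "\<And>i k. i < n \<Longrightarrow> Yk i k \<in> L2_rv M"
    and Y_lim: "\<And>i. i < n \<Longrightarrow> (\<lambda>k. expectation (\<lambda>w. (Yk i k w - Y i w)\<^sup>2)) \<longlonglongrightarrow> 0"
    and B: "\<And>i. i < n \<Longrightarrow> B i \<in> L2_rv M" "\<And>i k. i < n \<Longrightarrow> Bk i k \<in> L2_rv M"
    and B_lim: "\<And>i. i < n \<Longrightarrow> (\<lambda>k. expectation (\<lambda>w. (Bk i k w - B i w)\<^sup>2)) \<longlonglongrightarrow> 0"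
    and eq: "\<And>k. expectation (\<lambda>w. g (\<lambda>j. Yk j k w) * Z w) =
      (\<Sum>i<n. expectation (\<lambda>w. partial_deriv i g (\<lambda>j. Yk j k w) * Bk i k w))"
  shows "expectation (\<lambda>w. g (\<lambda>j. Y j w) * Z w) = (\<Sum>i<n. expectation (\<lambda>w. partial_deriv i g (\<lambda>j. Y j w) * B i w))"
proof -
  have L2: "(\<lambda>w. h (\<lambda>j. V j w) * Q w) \<in> L2_rv M"
    if "h \<in> Cb_infinity n" "\<And>j. j < n \<Longrightarrow> V j \<in> L2_rv M" "Q \<in> L2_rv M" for h V Q
    using Cb_infinity_bounded[OF that(1)] L2_rv_bounded_mult[OF that(3) Cb_infinity_measurable[OF that(1)]]
      L2_rv_measurable[OF that(2)] by blast
  have mult_lim: "(\<lambda>k. expectation (\<lambda>w. h (\<lambda>j. Yk j k w) * Q w)) \<longlonglongrightarrow> expectation (\<lambda>w. h (\<lambda>j. Y j w) * Q w)"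
    if h: "h \<in> Cb_infinity n" and Q: "Q \<in> L2_rv M" for h Q
  proof -
    obtain L where L: "0 \<le> L" "\<And>x y. \<bar>h y - h x\<bar> \<le> L * (\<Sum>k<n. \<bar>y k - x k\<bar>)" using Cb_infinity_lipschitz[OF h]
      by blast
    let ?b = "\<lambda>k. L * (\<Sum>j<n. sqrt (expectation (\<lambda>w. (Yk j k w - Y j w)\<^sup>2)) * sqrt (expectation (\<lambda>w. (Q w)\<^sup>2)))"
    have "?b \<longlonglongrightarrow> L * (\<Sum>j<n. sqrt 0 * sqrt (expectation (\<lambda>w. (Q w)\<^sup>2)))"
      by (intro tendsto_intros Y_lim) auto
    then have lim: "?b \<longlonglongrightarrow> 0" by simp
    have "norm (expectation (\<lambda>w. h (\<lambda>j. Yk j k w) * Q w) - expectation (\<lambda>w. h (\<lambda>j. Y j w) * Q w)) \<le> ?b k"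
      for k
    proof -
      have D: "(\<lambda>w. Yk j k w - Y j w) \<in> L2_rv M" if "j < n" for j using Y that by (intro L2_rv_diff)
      have i1: "integrable M (\<lambda>w. h (\<lambda>j. Yk j k w) * Q w)" "integrable M (\<lambda>w. h (\<lambda>j. Y j w) * Q w)"
        by (intro L2_rv_integrable L2[OF h _ Q] Y; assumption)+
      have i2: "integrable M (\<lambda>w. \<bar>(Yk j k w - Y j w) * Q w\<bar>)" if "j \<in> {..<n}" for j
        using L2_rv_mult_integrable[OF D Q] that by (intro integrable_abs) auto
      have "expectation (\<lambda>w. h (\<lambda>j. Yk j k w) * Q w) - expectation (\<lambda>w. h (\<lambda>j. Y j w) * Q w) =
          expectation (\<lambda>w. h (\<lambda>j. Yk j k w) * Q w - h (\<lambda>j. Y j w) * Q w)" using i1 by simp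
      also have "norm \<dots> \<le> expectation (\<lambda>w. \<bar>h (\<lambda>j. Yk j k w) * Q w - h (\<lambda>j. Y j w) * Q w\<bar>)"
        unfolding real_norm_def by (rule integral_abs_bound)
      also have "\<dots> \<le> expectation (\<lambda>w. L * (\<Sum>j<n. \<bar>(Yk j k w - Y j w) * Q w\<bar>))"
      proof (rule integral_mono)
        show "integrable M (\<lambda>w. \<bar>h (\<lambda>j. Yk j k w) * Q w - h (\<lambda>j. Y j w) * Q w\<bar>)" using i1 by simp
        show "integrable M (\<lambda>w. L * (\<Sum>j<n. \<bar>(Yk j k w - Y j w) * Q w\<bar>))"
          by (intro integrable_mult_right Bochner_Integration.integrable_sum i2)
        fix w
        have "\<bar>(h (\<lambda>j. Yk j k w) - h (\<lambda>j. Y j w)) * Q w\<bar> \<le> (L * (\<Sum>j<n. \<bar>Yk j k w - Y j w\<bar>)) * \<bar>Q w\<bar>"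
          unfolding abs_mult using L(2) by (intro mult_right_mono) auto
        then show "\<bar>h (\<lambda>j. Yk j k w) * Q w - h (\<lambda>j. Y j w) * Q w\<bar> \<le> L * (\<Sum>j<n. \<bar>(Yk j k w - Y j w) * Q w\<bar>)"
          by (simp only: left_diff_distrib[symmetric] abs_mult mult.assoc sum_distrib_right)
      qed
      also have "\<dots> = L * (\<Sum>j<n. expectation (\<lambda>w. \<bar>(Yk j k w - Y j w) * Q w\<bar>))"
        by (subst integral_mult_right_zero, subst Bochner_Integration.integral_sum[OF i2]) auto
      also have "\<dots> \<le> ?b k"
        using D L(1) by (intro mult_left_mono sum_mono L2_cauchy_schwarz[OF _ Q]) auto
      finally show ?thesis .
    qed
    then have "(\<lambda>k. expectation (\<lambda>w. h (\<lambda>j. Yk j k w) * Q w) - expectation (\<lambda>w. h (\<lambda>j. Y j w) * Q w)) \<longlonglongrightarrow> 0"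
      by (intro Lim_null_comparison[OF _ lim] always_eventually allI)
    then show ?thesis by (simp add: LIM_zero_iff)
  qed
  have "(\<lambda>k. expectation (\<lambda>w. partial_deriv i g (\<lambda>j. Yk j k w) * Bk i k w)) \<longlonglongrightarrow>
      expectation (\<lambda>w. partial_deriv i g (\<lambda>j. Y j w) * B i w)" if i: "i < n" for i
  proof -
    note h = Cb_infinity_partial_deriv[OF g i]
    obtain C where C: "0 \<le> C" "\<And>x. \<bar>partial_deriv i g x\<bar> \<le> C" using Cb_infinity_bounded[OF h] by blast
    have D: "(\<lambda>w. Bk i k w - B i w) \<in> L2_rv M" for k using B i by (intro L2_rv_diff)
    have "(\<lambda>k. C * (sqrt (expectation (\<lambda>w. (Bk i k w - B i w)\<^sup>2)) * sqrt (expectation (\<lambda>w. 1\<^sup>2)))) \<longlonglongrightarrow> C * (sqrt 0 * sqrt (expectation (\<lambda>w. 1\<^sup>2)))"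
      by (intro tendsto_intros B_lim i)
    then have lim: "(\<lambda>k. C * (sqrt (expectation (\<lambda>w. (Bk i k w - B i w)\<^sup>2)) * sqrt (expectation (\<lambda>w. 1\<^sup>2)))) \<longlonglongrightarrow> 0" by simp
    \<comment> \<open>Against \<open>Bk - B\<close> the boundedness of the derivative is enough;
      convergence of its arguments is tested only against the fixed factor \<open>B\<close>.\<close>
    have "norm (expectation (\<lambda>w. partial_deriv i g (\<lambda>j. Yk j k w) * (Bk i k w - B i w))) \<le>
        C * (sqrt (expectation (\<lambda>w. (Bk i k w - B i w)\<^sup>2)) * sqrt (expectation (\<lambda>w. 1\<^sup>2)))" for k
    proof -
      have "norm (expectation (\<lambda>w. partial_deriv i g (\<lambda>j. Yk j k w) * (Bk i k w - B i w))) \<le>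
          expectation (\<lambda>w. \<bar>partial_deriv i g (\<lambda>j. Yk j k w) * (Bk i k w - B i w)\<bar>)"
        unfolding real_norm_def by (rule integral_abs_bound)
      also have "\<dots> \<le> expectation (\<lambda>w. C * \<bar>(Bk i k w - B i w) * 1\<bar>)"
      proof (rule integral_mono)
        show "integrable M (\<lambda>w. \<bar>partial_deriv i g (\<lambda>j. Yk j k w) * (Bk i k w - B i w)\<bar>)"
          by (intro integrable_abs L2_rv_integrable L2[OF h _ D] Y) auto
        show "integrable M (\<lambda>w. C * \<bar>(Bk i k w - B i w) * 1\<bar>)"
          using L2_rv_integrable[OF D] by simp
      qed (use C in \<open>simp add: abs_mult mult_right_mono\<close>)
      also have "\<dots> = C * expectation (\<lambda>w. \<bar>(Bk i k w - B i w) * 1\<bar>)" by (rule integral_mult_right_zero)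
      also have "\<dots> \<le> C * (sqrt (expectation (\<lambda>w. (Bk i k w - B i w)\<^sup>2)) * sqrt (expectation (\<lambda>w. 1\<^sup>2)))"
        using C(1) by (intro mult_left_mono L2_cauchy_schwarz[OF D] L2_rv_bounded[where B=1]) auto
      finally show ?thesis .
    qed
    then have "(\<lambda>k. expectation (\<lambda>w. partial_deriv i g (\<lambda>j. Yk j k w) * (Bk i k w - B i w))) \<longlonglongrightarrow> 0"
      by (intro Lim_null_comparison[OF _ lim] always_eventually allI)
    from tendsto_add[OF this mult_lim[OF h B(1)[OF i]]]
    have "(\<lambda>k. expectation (\<lambda>w. partial_deriv i g (\<lambda>j. Yk j k w) * (Bk i k w - B i w)) + expectation (\<lambda>w. partial_deriv i g (\<lambda>j. Yk j k w) * B i w))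
        \<longlonglongrightarrow> expectation (\<lambda>w. partial_deriv i g (\<lambda>j. Y j w) * B i w)" by simp
    moreover have "expectation (\<lambda>w. partial_deriv i g (\<lambda>j. Yk j k w) * (Bk i k w - B i w)) + expectation (\<lambda>w. partial_deriv i g (\<lambda>j. Yk j k w) * B i w)
        = expectation (\<lambda>w. partial_deriv i g (\<lambda>j. Yk j k w) * Bk i k w)" for k
    proof -
      have "integrable M (\<lambda>w. partial_deriv i g (\<lambda>j. Yk j k w) * (Bk i k w - B i w))"
        "integrable M (\<lambda>w. partial_deriv i g (\<lambda>j. Yk j k w) * B i w)"
        by (intro L2_rv_integrable L2[OF h _ D] Y L2[OF h _ B(1)[OF i]]; assumption)+
      then show ?thesis by (subst Bochner_Integration.integral_add[symmetric]) (simp_all add: right_diff_distrib)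
    qed
    ultimately show ?thesis by simp
  qed
  then have "(\<lambda>k. \<Sum>i<n. expectation (\<lambda>w. partial_deriv i g (\<lambda>j. Yk j k w) * Bk i k w)) \<longlonglongrightarrow>
      (\<Sum>i<n. expectation (\<lambda>w. partial_deriv i g (\<lambda>j. Y j w) * B i w))" by (intro tendsto_sum) auto
  then show ?thesis using mult_lim[OF g Z] unfolding eq by (rule LIMSEQ_unique[rotated])
qed

section \<open>The norm of the marginals and the positivity of the semiscalar product\<close>

context gaussian_cov
begin

text \<open>The \<open>L\<^sup>2\<close>-norm of the sum of both marginals of the variation dominates the semiscalar product.\<close>

definition marg :: "real measure" where
  "marg = add_measure (distr V (interval_borel T) fst) (distr V (interval_borel T) snd)"

lemma sets_marg [simp, measurable_cong]: "sets marg = sets (interval_borel T)"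
  and space_marg: "space marg = {0..T}"
  by (simp_all add: marg_def space_interval_borel)

lemma finite_marg: "finite_measure marg"
  unfolding marg_def
  by (intro finite_add_measure V.finite_measure_distr) auto

sublocale marg: finite_measure marg by (rule finite_marg)

lemma meas_marg: "measurable marg K = measurable (interval_borel T) K"
  by (rule measurable_cong_sets) simp_all

lemma L2_marg:
  assumes "\<phi> \<in> L2_rv marg"
  shows L2_marg_fst: "(\<lambda>z. \<phi> (fst z)) \<in> L2_rv V" and L2_marg_snd: "(\<lambda>z. \<phi> (snd z)) \<in> L2_rv V"
    and L2_marg_integral: "(LINT z|V. (\<phi> (fst z))\<^sup>2) + (LINT z|V. (\<phi> (snd z))\<^sup>2) = (LINT x|marg. (\<phi> x)\<^sup>2)"
proof -
  have \<phi>: "\<phi> \<in> borel_measurable (interval_borel T)" "integrable marg (\<lambda>x. (\<phi> x)\<^sup>2)"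
    using assms by (auto simp: L2_rv_def meas_marg)
  have \<phi>2: "(\<lambda>x. (\<phi> x)\<^sup>2) \<in> borel_measurable (interval_borel T)" using \<phi>(1) by simp
  have fs: "fst \<in> measurable V (interval_borel T)" "snd \<in> measurable V (interval_borel T)" by simp_all
  have i: "integrable (distr V (interval_borel T) fst) (\<lambda>x. (\<phi> x)\<^sup>2)" "integrable (distr V (interval_borel T) snd) (\<lambda>x. (\<phi> x)\<^sup>2)"
    using \<phi>(2) by (simp_all add: marg_def integrable_add_measure_iff)
  show "(\<lambda>z. \<phi> (fst z)) \<in> L2_rv V" "(\<lambda>z. \<phi> (snd z)) \<in> L2_rv V"
    using i \<phi>2 measurable_compose[OF measurable_fst_square \<phi>(1)] measurable_compose[OF measurable_snd_square \<phi>(1)]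
    by (auto simp: L2_rv_def integrable_distr_eq[OF fs(1)] integrable_distr_eq[OF fs(2)])
  show "(LINT z|V. (\<phi> (fst z))\<^sup>2) + (LINT z|V. (\<phi> (snd z))\<^sup>2) = (LINT x|marg. (\<phi> x)\<^sup>2)"
    unfolding marg_def using i
      by (subst integral_add_measure) (simp_all add: integral_distr[OF fs(1) \<phi>2] integral_distr[OF fs(2) \<phi>2])
qed

text \<open>Cauchy-Schwarz on the square, applied to a function of the first and a function of the
  second coordinate; each norm belongs to one marginal and is at most the norm for their
  sum.\<close>

lemma inn_le_marg:
  assumes \<phi>: "\<phi> \<in> L2_rv marg" and \<psi>: "\<psi> \<in> L2_rv marg"
  shows integrable_tensor_marg: "integrable V (\<lambda>(x, y). \<phi> x * \<psi> y)"
    and "(LINT z|V. \<bar>\<phi> (fst z) * \<psi> (snd z)\<bar>) \<le> sqrt (LINT x|marg. (\<phi> x)\<^sup>2) * sqrt (LINT x|marg. (\<psi> x)\<^sup>2)"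
    and "\<bar>inn \<phi> \<psi>\<bar> \<le> sqrt (LINT x|marg. (\<phi> x)\<^sup>2) * sqrt (LINT x|marg. (\<psi> x)\<^sup>2)"
proof -
  show i: "integrable V (\<lambda>(x, y). \<phi> x * \<psi> y)"
    using L2_rv_mult_integrable[OF L2_marg_fst[OF \<phi>] L2_marg_snd[OF \<psi>]] by (simp add: split_beta')
  have nn: "0 \<le> (LINT z|V. (\<phi> (fst z))\<^sup>2)" "0 \<le> (LINT z|V. (\<phi> (snd z))\<^sup>2)"
     "0 \<le> (LINT z|V. (\<psi> (fst z))\<^sup>2)" "0 \<le> (LINT z|V. (\<psi> (snd z))\<^sup>2)" by simp_all
  have "(LINT z|V. \<bar>\<phi> (fst z) * \<psi> (snd z)\<bar>) \<le> sqrt (LINT z|V. (\<phi> (fst z))\<^sup>2) * sqrt (LINT z|V. (\<psi> (snd z))\<^sup>2)"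
    by (rule L2_cauchy_schwarz[OF L2_marg_fst[OF \<phi>] L2_marg_snd[OF \<psi>]])
  also have "\<dots> \<le> sqrt (LINT x|marg. (\<phi> x)\<^sup>2) * sqrt (LINT x|marg. (\<psi> x)\<^sup>2)"
    using nn unfolding L2_marg_integral[OF \<phi>, symmetric] L2_marg_integral[OF \<psi>, symmetric]
    by (intro mult_mono real_sqrt_le_mono) auto
  finally show le: "(LINT z|V. \<bar>\<phi> (fst z) * \<psi> (snd z)\<bar>) \<le> sqrt (LINT x|marg. (\<phi> x)\<^sup>2) * sqrt (LINT x|marg. (\<psi> x)\<^sup>2)" .
  show "\<bar>inn \<phi> \<psi>\<bar> \<le> sqrt (LINT x|marg. (\<phi> x)\<^sup>2) * sqrt (LINT x|marg. (\<psi> x)\<^sup>2)"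
    unfolding inn_def using order.trans[OF I_le[OF i]] le by (simp add: split_beta')
qed

lemma bounded_L2_marg:
  assumes "\<phi> \<in> borel_measurable (interval_borel T)" "\<And>x. x \<in> {0..T} \<Longrightarrow> \<bar>\<phi> x\<bar> \<le> C"
  shows "\<phi> \<in> L2_rv marg"
proof -
  have "integrable marg (\<lambda>x. (\<phi> x)\<^sup>2)"
  proof (rule marg.integrable_const_bound[where B="C\<^sup>2"])
    show "AE x in marg. norm ((\<phi> x)\<^sup>2) \<le> C\<^sup>2"
    proof (rule AE_I2)
      fix x assume "x \<in> space marg"
      then have "\<bar>\<phi> x\<bar> \<le> \<bar>C\<bar>" using assms(2)[of x] by (simp add: space_marg)
      then show "norm ((\<phi> x)\<^sup>2) \<le> C\<^sup>2" by (simp add: abs_le_square_iff)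
    qed
  qed (use assms(1) in \<open>simp add: meas_marg\<close>)
  then show ?thesis using assms(1) by (simp add: L2_rv_def meas_marg)
qed

lemma inn_add_left:
  assumes "\<phi> \<in> L2_rv marg" "\<phi>' \<in> L2_rv marg" "\<psi> \<in> L2_rv marg"
  shows "inn (\<lambda>x. a * \<phi> x + b * \<phi>' x) \<psi> = a * inn \<phi> \<psi> + b * inn \<phi>' \<psi>"
proof -
  have "inn (\<lambda>x. a * \<phi> x + b * \<phi>' x) \<psi> = I (\<lambda>z. a * (case z of (x, y) \<Rightarrow> \<phi> x * \<psi> y) + b * (case z of (x, y) \<Rightarrow> \<phi>' x * \<psi> y))"
    unfolding inn_def by (intro I_cong) (auto simp: algebra_simps)
  also have "\<dots> = I (\<lambda>z. a * (case z of (x, y) \<Rightarrow> \<phi> x * \<psi> y)) + I (\<lambda>z. b * (case z of (x, y) \<Rightarrow> \<phi>' x * \<psi> y))"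
    using assms by (intro I_add integrable_mult_right integrable_tensor_marg)
  finally show ?thesis by (simp only: I_cmult inn_def)
qed

lemma inn_diff_left:
  assumes "\<phi> \<in> L2_rv marg" "\<phi>' \<in> L2_rv marg" "\<psi> \<in> L2_rv marg"
  shows "inn (\<lambda>x. \<phi> x - \<phi>' x) \<psi> = inn \<phi> \<psi> - inn \<phi>' \<psi>"
  using inn_add_left[OF assms, of 1 "-1"] by simp

lemma inn_sum_left:
  assumes "\<And>j. j \<in> J \<Longrightarrow> \<phi> j \<in> L2_rv marg" "\<psi> \<in> L2_rv marg"
  shows "inn (\<lambda>x. \<Sum>j\<in>J. a j * \<phi> j x) \<psi> = (\<Sum>j\<in>J. a j * inn (\<phi> j) \<psi>)"
proof -
  have "inn (\<lambda>x. \<Sum>j\<in>J. a j * \<phi> j x) \<psi> = I (\<lambda>z. \<Sum>j\<in>J. a j * (case z of (x, y) \<Rightarrow> \<phi> j x * \<psi> y))"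
    unfolding inn_def by (intro I_cong) (auto simp: sum_distrib_right mult.assoc)
  also have "\<dots> = (\<Sum>j\<in>J. I (\<lambda>z. a j * (case z of (x, y) \<Rightarrow> \<phi> j x * \<psi> y)))"
    using assms by (intro I_sum integrable_mult_right integrable_tensor_marg)
  finally show ?thesis by (simp only: I_cmult inn_def)
qed

text \<open>Symmetry of \<open>I\<close> under the exchange of coordinates is available for bounded
  integrands, hence the two bounds.\<close>

lemma inn_commute:
  assumes \<phi>: "\<phi> \<in> borel_measurable (interval_borel T)" "\<And>x. x \<in> {0..T} \<Longrightarrow> \<bar>\<phi> x\<bar> \<le> C"
    and \<psi>: "\<psi> \<in> borel_measurable (interval_borel T)" "\<And>x. x \<in> {0..T} \<Longrightarrow> \<bar>\<psi> x\<bar> \<le> D"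
  shows "inn \<phi> \<psi> = inn \<psi> \<phi>"
proof -
  have "inn \<psi> \<phi> = I (\<lambda>z. (\<lambda>(x, y). \<phi> x * \<psi> y) (snd z, fst z))"
    unfolding inn_def by (intro I_cong) (auto simp: mult.commute)
  also have "\<dots> = inn \<phi> \<psi>" unfolding inn_def
  proof (rule I_swap[OF tensor_measurable[OF \<phi>(1) \<psi>(1)], where C="C * D"])
    fix z assume z: "z \<in> {0..T} \<times> {0..T}"
    then have "\<bar>\<phi> (fst z)\<bar> * \<bar>\<psi> (snd z)\<bar> \<le> C * D"
      using \<phi>(2)[of "fst z"] \<psi>(2)[of "snd z"] by (intro mult_mono) auto
    then show "\<bar>case z of (x, y) \<Rightarrow> \<phi> x * \<psi> y\<bar> \<le> C * D" by (simp add: split_beta abs_mult)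
  qed
  finally show ?thesis by simp
qed

text \<open>\<open>Y\<close> is the elementary Wiener integral of the step function. Intervals
  starting at 0 are used because the Wiener integral is prescribed on their indicators.\<close>

definition step_rep :: "(real \<Rightarrow> real) \<Rightarrow> ('w \<Rightarrow> real) \<Rightarrow> bool" where
  "step_rep \<psi> Y \<longleftrightarrow> (\<exists>S a. finite S \<and> S \<subseteq> {0..T} \<and> \<psi> = (\<lambda>x. \<Sum>\<tau>\<in>S. a \<tau> * indicator {0..\<tau>} x) \<and>
     Y = (\<lambda>w. \<Sum>\<tau>\<in>S. a \<tau> * X \<tau> w))"

lemma step_rep_bounded:
  assumes "step_rep \<psi> Y"
  shows "\<psi> \<in> borel_measurable (interval_borel T)" "\<exists>C. \<forall>x. \<bar>\<psi> x\<bar> \<le> C" "Y \<in> G"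
proof -
  obtain S a where S: "finite S" "S \<subseteq> {0..T}" "\<psi> = (\<lambda>x. \<Sum>\<tau>\<in>S. a \<tau> * indicator {0..\<tau>} x)" "Y = (\<lambda>w. \<Sum>\<tau>\<in>S. a \<tau> * X \<tau> w)"
    using assms unfolding step_rep_def by blast
  show "\<psi> \<in> borel_measurable (interval_borel T)" unfolding S(3)
    by (intro borel_measurable_sum borel_measurable_times borel_measurable_const indicator_interval_measurable) auto
  have "\<bar>\<psi> x\<bar> \<le> (\<Sum>\<tau>\<in>S. \<bar>a \<tau>\<bar>)" for x
    unfolding S(3) by (intro order.trans[OF sum_abs] sum_mono) (auto simp: indicator_def)
  then show "\<exists>C. \<forall>x. \<bar>\<psi> x\<bar> \<le> C" by blast
  show "Y \<in> G" unfolding S(4) using S(2) by (intro sum_mem X_mem) auto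
qed

lemma step_rep_L2: "step_rep \<psi> Y \<Longrightarrow> \<psi> \<in> L2_rv marg"
  using step_rep_bounded(1,2)[of \<psi> Y] by (auto intro: bounded_L2_marg)

lemma indicator_L2_marg: "(indicator {0..\<tau>} :: real \<Rightarrow> real) \<in> L2_rv marg"
  by (rule bounded_L2_marg[OF indicator_interval_measurable, where C=1]) (auto simp: indicator_def)

lemma step_rep_represents:
  assumes \<psi>: "step_rep \<psi> Y"
  shows "represents \<psi> Y"
proof -
  obtain S a where S: "finite S" "S \<subseteq> {0..T}" "\<psi> = (\<lambda>x. \<Sum>\<tau>\<in>S. a \<tau> * indicator {0..\<tau>} x)" "Y = (\<lambda>w. \<Sum>\<tau>\<in>S. a \<tau> * X \<tau> w)"
    using assms unfolding step_rep_def by blast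
  have "expectation (\<lambda>w. Y w * X s w) = inn \<psi> (indicator {0..s})" if s: "s \<in> {0..T}" for s
  proof -
    have "expectation (\<lambda>w. Y w * X s w) = expectation (\<lambda>w. \<Sum>\<tau>\<in>S. a \<tau> * (X \<tau> w * X s w))"
      unfolding S(4) by (simp add: sum_distrib_right mult.assoc)
    also have "\<dots> = (\<Sum>\<tau>\<in>S. a \<tau> * expectation (\<lambda>w. X \<tau> w * X s w))"
      using S(2) s by (subst Bochner_Integration.integral_sum) (auto intro!: integrable_mult_right integrable_mult X_mem)
    also have "\<dots> = (\<Sum>\<tau>\<in>S. a \<tau> * inn (indicator {0..\<tau>}) (indicator {0..s}))"
      using S(2) s by (intro sum.cong refl) (auto simp: inn_indicator)
    also have "\<dots> = inn \<psi> (indicator {0..s})"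
      unfolding S(3) by (rule inn_sum_left[symmetric]) (rule indicator_L2_marg)+
    finally show ?thesis .
  qed
  then show ?thesis using step_rep_bounded[OF \<psi>] unfolding represents_def by blast
qed

text \<open>The origin of all positivity: on step functions the semiscalar square is a second
  moment. One factor is expanded; the covariances of \<open>Y\<close> with single coordinates are
  already known.\<close>

lemma step_rep_inn_self:
  assumes \<psi>: "step_rep \<psi> Y"
  shows "inn \<psi> \<psi> = expectation (\<lambda>w. (Y w)\<^sup>2)"
proof -
  obtain S a where S: "finite S" "S \<subseteq> {0..T}" "\<psi> = (\<lambda>x. \<Sum>\<tau>\<in>S. a \<tau> * indicator {0..\<tau>} x)" "Y = (\<lambda>w. \<Sum>\<tau>\<in>S. a \<tau> * X \<tau> w)"
    using assms unfolding step_rep_def by blast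
  obtain C where C: "\<And>x. \<bar>\<psi> x\<bar> \<le> C" using step_rep_bounded(2)[OF \<psi>] by blast
  have YG: "Y \<in> G" by (rule step_rep_bounded(3)[OF \<psi>])
  have "inn \<psi> \<psi> = (\<Sum>\<tau>\<in>S. a \<tau> * inn (indicator {0..\<tau>}) \<psi>)"
    by (subst (1) S(3)) (intro inn_sum_left indicator_L2_marg step_rep_L2[OF \<psi>])
  also have "\<dots> = (\<Sum>\<tau>\<in>S. a \<tau> * inn \<psi> (indicator {0..\<tau>}))"
    by (intro sum.cong refl arg_cong2[where f="(*)"] inn_commute[OF indicator_interval_measurable _ step_rep_bounded(1)[OF \<psi>] C, where C=1])
       (auto simp: indicator_def)
  also have "\<dots> = (\<Sum>\<tau>\<in>S. expectation (\<lambda>w. a \<tau> * (Y w * X \<tau> w)))"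
    using S(2) representsD(3)[OF step_rep_represents[OF \<psi>]] by (intro sum.cong refl) (simp add: subset_eq)
  also have "\<dots> = expectation (\<lambda>w. \<Sum>\<tau>\<in>S. a \<tau> * (Y w * X \<tau> w))"
    using S(2) YG by (intro Bochner_Integration.integral_sum[symmetric] integrable_mult_right integrable_mult X_mem) auto
  also have "\<dots> = expectation (\<lambda>w. (Y w)\<^sup>2)"
    by (intro Bochner_Integration.integral_cong refl) (simp add: S(4) power2_eq_square sum_distrib_left mult_ac)
  finally show ?thesis .
qed

lemma step_rep_lin:
  assumes "step_rep \<psi> Y" "step_rep \<psi>' Y'"
  shows "\<exists>Y''. step_rep (\<lambda>x. c * \<psi> x + d * \<psi>' x) Y''"
proof -
  obtain S a where S: "finite S" "S \<subseteq> {0..T}" "\<psi> = (\<lambda>x. \<Sum>\<tau>\<in>S. a \<tau> * indicator {0..\<tau>} x)"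
    using assms(1) unfolding step_rep_def by blast
  obtain S' a' where S': "finite S'" "S' \<subseteq> {0..T}" "\<psi>' = (\<lambda>x. \<Sum>\<tau>\<in>S'. a' \<tau> * indicator {0..\<tau>} x)"
    using assms(2) unfolding step_rep_def by blast
  define b where "b \<tau> = (if \<tau> \<in> S then c * a \<tau> else 0) + (if \<tau> \<in> S' then d * a' \<tau> else 0)" for \<tau>
  have "c * \<psi> x + d * \<psi>' x = (\<Sum>\<tau>\<in>S \<union> S'. b \<tau> * indicator {0..\<tau>} x)" for x
  proof -
    have "(\<Sum>\<tau>\<in>S \<union> S'. (if \<tau> \<in> S then c * a \<tau> else 0) * indicator {0..\<tau>} x) = (\<Sum>\<tau>\<in>S. c * a \<tau> * indicator {0..\<tau>} x)"
      using S(1) S'(1) by (intro sum.mono_neutral_cong_right) auto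
    moreover have "(\<Sum>\<tau>\<in>S \<union> S'. (if \<tau> \<in> S' then d * a' \<tau> else 0) * indicator {0..\<tau>} x) = (\<Sum>\<tau>\<in>S'. d * a' \<tau> * indicator {0..\<tau>} x)"
      using S(1) S'(1) by (intro sum.mono_neutral_cong_right) auto
    ultimately show ?thesis
      unfolding b_def distrib_right sum.distrib S(3) S'(3) sum_distrib_left by (simp only: mult.assoc)
  qed
  then have "step_rep (\<lambda>x. c * \<psi> x + d * \<psi>' x) (\<lambda>w. \<Sum>\<tau>\<in>S \<union> S'. b \<tau> * X \<tau> w)"
    unfolding step_rep_def using S S' by (intro exI[of _ "S \<union> S'"] exI[of _ b]) auto
  then show ?thesis by blast
qed

text \<open>Membership in the closure of the step functions for the norm of \<open>marg\<close>;
  every bounded Borel function will turn out to belong to it.\<close>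

definition approx :: "(real \<Rightarrow> real) \<Rightarrow> bool" where
  "approx \<phi> \<longleftrightarrow> \<phi> \<in> L2_rv marg \<and> (\<forall>e>0. \<exists>\<psi> Y. step_rep \<psi> Y \<and> (LINT x|marg. (\<phi> x - \<psi> x)\<^sup>2) < e)"

lemma marg_triangle:
  assumes "\<phi> \<in> L2_rv marg" "\<psi> \<in> L2_rv marg"
  shows "(LINT x|marg. (c * \<phi> x + d * \<psi> x)\<^sup>2) \<le> 2 * c\<^sup>2 * (LINT x|marg. (\<phi> x)\<^sup>2) + 2 * d\<^sup>2 * (LINT x|marg. (\<psi> x)\<^sup>2)"
proof -
  have "(LINT x|marg. (c * \<phi> x + d * \<psi> x)\<^sup>2) \<le> (LINT x|marg. 2 * c\<^sup>2 * (\<phi> x)\<^sup>2 + 2 * d\<^sup>2 * (\<psi> x)\<^sup>2)"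
  proof (rule integral_mono)
    show "integrable marg (\<lambda>x. (c * \<phi> x + d * \<psi> x)\<^sup>2)" by (intro L2_rv_power2 L2_rv_lin assms)
    show "integrable marg (\<lambda>x. 2 * c\<^sup>2 * (\<phi> x)\<^sup>2 + 2 * d\<^sup>2 * (\<psi> x)\<^sup>2)"
      using L2_rv_power2[OF assms(1)] L2_rv_power2[OF assms(2)] by simp
    fix x
    have "(a + b)\<^sup>2 \<le> 2 * a\<^sup>2 + 2 * b\<^sup>2" for a b :: real
      using sum_squares_bound[of a b] by (simp add: power2_sum)
    from this[of "c * \<phi> x" "d * \<psi> x"] show "(c * \<phi> x + d * \<psi> x)\<^sup>2 \<le> 2 * c\<^sup>2 * (\<phi> x)\<^sup>2 + 2 * d\<^sup>2 * (\<psi> x)\<^sup>2"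
      by (simp add: power_mult_distrib mult.assoc)
  qed
  then show ?thesis using L2_rv_power2[OF assms(1)] L2_rv_power2[OF assms(2)] by simp
qed

section \<open>Density of the step functions\<close>

lemma approx_step: "step_rep \<psi> Y \<Longrightarrow> approx \<psi>"
  unfolding approx_def using step_rep_L2 by force

lemma approx_limit:
  assumes \<phi>: "\<phi> \<in> L2_rv marg" and near: "\<And>e. 0 < e \<Longrightarrow> \<exists>\<phi>'. approx \<phi>' \<and> (LINT x|marg. (\<phi> x - \<phi>' x)\<^sup>2) < e"
  shows "approx \<phi>"
  unfolding approx_def
proof (intro conjI allI impI \<phi>)
  fix e :: real assume e: "0 < e"
  \<comment> \<open>The quarters compensate for the factor 2 that \<open>marg_triangle\<close> puts
    before each of the two errors.\<close>
  obtain \<phi>' where \<phi>': "approx \<phi>'" "(LINT x|marg. (\<phi> x - \<phi>' x)\<^sup>2) < e / 4" using near[of "e / 4"] e by auto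
  obtain \<psi> Y where \<psi>: "step_rep \<psi> Y" "(LINT x|marg. (\<phi>' x - \<psi> x)\<^sup>2) < e / 4"
    using \<phi>'(1) e unfolding approx_def by (meson zero_less_divide_iff zero_less_numeral)
  have m: "\<phi>' \<in> L2_rv marg" using \<phi>'(1) by (simp add: approx_def)
  have "(LINT x|marg. (1 * (\<phi> x - \<phi>' x) + 1 * (\<phi>' x - \<psi> x))\<^sup>2) \<le> 2 * 1\<^sup>2 * (LINT x|marg. (\<phi> x - \<phi>' x)\<^sup>2) + 2 * 1\<^sup>2 * (LINT x|marg. (\<phi>' x - \<psi> x)\<^sup>2)"
    by (intro marg_triangle L2_rv_diff \<phi> m step_rep_L2[OF \<psi>(1)])
  then have "(LINT x|marg. (\<phi> x - \<psi> x)\<^sup>2) < e" using \<phi>'(2) \<psi>(2) by simp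
  then show "\<exists>\<psi> Y. step_rep \<psi> Y \<and> (LINT x|marg. (\<phi> x - \<psi> x)\<^sup>2) < e" using \<psi>(1) by blast
qed

lemma approx_lin:
  assumes \<phi>: "approx \<phi>" and \<phi>': "approx \<phi>'"
  shows "approx (\<lambda>x. c * \<phi> x + d * \<phi>' x)"
  unfolding approx_def
proof (intro conjI allI impI)
  have m: "\<phi> \<in> L2_rv marg" "\<phi>' \<in> L2_rv marg" using \<phi> \<phi>' by (auto simp: approx_def)
  then show "(\<lambda>x. c * \<phi> x + d * \<phi>' x) \<in> L2_rv marg" by (rule L2_rv_lin)
  fix e :: real assume e: "0 < e"
  \<comment> \<open>The two errors enter with factors \<open>2 * c^2\<close> and
    \<open>2 * d^2\<close>; this \<open>q\<close> bounds their sum by \<open>e / 2\<close>, and the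
    extra 1 keeps the denominator positive.\<close>
  define q where "q = e / (4 * (c\<^sup>2 + d\<^sup>2 + 1))"
  have s: "0 < c\<^sup>2 + d\<^sup>2 + 1" by (simp add: add_nonneg_pos)
  have q: "0 < q" using e s by (simp add: q_def)
  obtain \<psi> Y where \<psi>: "step_rep \<psi> Y" "(LINT x|marg. (\<phi> x - \<psi> x)\<^sup>2) < q" using \<phi> q unfolding approx_def by blast
  obtain \<psi>' Y' where \<psi>': "step_rep \<psi>' Y'" "(LINT x|marg. (\<phi>' x - \<psi>' x)\<^sup>2) < q" using \<phi>' q unfolding approx_def
    by blast
  obtain Y'' where Y'': "step_rep (\<lambda>x. c * \<psi> x + d * \<psi>' x) Y''" using step_rep_lin[OF \<psi>(1) \<psi>'(1)] by blast
  have "(LINT x|marg. (c * (\<phi> x - \<psi> x) + d * (\<phi>' x - \<psi>' x))\<^sup>2) \<le>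
      2 * c\<^sup>2 * (LINT x|marg. (\<phi> x - \<psi> x)\<^sup>2) + 2 * d\<^sup>2 * (LINT x|marg. (\<phi>' x - \<psi>' x)\<^sup>2)"
    by (intro marg_triangle L2_rv_diff m step_rep_L2[OF \<psi>(1)] step_rep_L2[OF \<psi>'(1)])
  also have "\<dots> \<le> 2 * c\<^sup>2 * q + 2 * d\<^sup>2 * q" using \<psi>(2) \<psi>'(2) by (intro add_mono mult_left_mono) auto
  also have "\<dots> \<le> 2 * (c\<^sup>2 + d\<^sup>2 + 1) * q" using q by (simp add: algebra_simps)
  also have "\<dots> = e / 2" using s by (simp add: q_def field_simps)
  also have "\<dots> < e" using e by simp
  finally have "(LINT x|marg. ((c * \<phi> x + d * \<phi>' x) - (c * \<psi> x + d * \<psi>' x))\<^sup>2) < e"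
    by (simp add: algebra_simps)
  then show "\<exists>\<psi> Y. step_rep \<psi> Y \<and> (LINT x|marg. ((c * \<phi> x + d * \<phi>' x) - \<psi> x)\<^sup>2) < e" using Y'' by blast
qed

lemma approx_zero: "approx (\<lambda>_. 0)"
  by (rule approx_step[of _ "\<lambda>_. 0"]) (auto simp: step_rep_def intro!: exI[of _ "{}"])

lemma approx_sum:
  assumes "\<And>j. j \<in> J \<Longrightarrow> approx (\<phi> j)"
  shows "approx (\<lambda>x. \<Sum>j\<in>J. a j * \<phi> j x)"
  using assms
proof (induction J rule: infinite_finite_induct)
  case (insert j J)
  then show ?case using approx_lin[of "\<phi> j" "\<lambda>x. \<Sum>j\<in>J. a j * \<phi> j x" "a j" 1] by simp
qed (simp_all add: approx_zero)

text \<open>A Dynkin class argument starting from the intervals \<open>{0..\<tau>}\<close>: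
  complements are subtracted from the indicator of \<open>{0..T}\<close>, itself a step function,
  and disjoint countable unions are limits of their finite parts because \<open>marg\<close> is
  finite.\<close>

lemma approx_indicator:
  assumes "A \<in> sets (interval_borel T)"
  shows "approx (indicator A)"
proof -
  let ?E = "range (\<lambda>a. {0..T} \<inter> {..a})"
  have S: "sets (interval_borel T) = sigma_sets {0..T} ?E"
    by (rule sets_restrict_borel_atMost) simp
  have stable: "Int_stable ?E"
  proof (rule Int_stableI_image)
    show "\<exists>c\<in>UNIV. ({0..T} \<inter> {..a}) \<inter> ({0..T} \<inter> {..b}) = {0..T} \<inter> {..c}" for a b
      by (intro bexI[of _ "min a b"]) auto
  qed
  have ind: "approx (indicator {0..\<tau>})" if "\<tau> \<in> {0..T}" for \<tau>
    by (rule approx_step[of _ "X \<tau>"]) (use that in \<open>auto simp: step_rep_def intro!: exI[of _ "{\<tau>}"] exI[of _ "\<lambda>_. 1"]\<close>)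
  have "?E \<subseteq> Pow {0..T}" by auto
  from stable this assms[unfolded S] show ?thesis
  proof (induction rule: sigma_sets_induct_disjoint)
    case (basic A)
    then obtain a where A: "A = {0..T} \<inter> {..a}" by auto
    show ?case
    proof (cases "0 \<le> a")
      case True
      then have "A = {0..min a T}" using A T_pos by auto
      then show ?thesis using ind[of "min a T"] True T_pos by simp
    next
      case False
      then have "A = {}" using A by auto
      then show ?thesis using approx_zero by simp
    qed
  next
    case empty
    then show ?case using approx_zero by simp
  next
    case (compl A)
    then have "A \<subseteq> {0..T}" using S sets.sets_into_space[of A "interval_borel T"]
      by (simp add: space_interval_borel)
    then have eq: "indicator ({0..T} - A) = (\<lambda>x. 1 * indicator {0..T} x + (-1) * indicator A x :: real)"
      by (auto simp: indicator_def fun_eq_iff)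
    show ?case unfolding eq using compl ind[of T] T_pos by (intro approx_lin) auto
  next
    case (union A)
    have Am: "A i \<in> sets (interval_borel T)" for i using union(2) S by auto
    have mI: "indicator B \<in> borel_measurable (interval_borel T)" if "B \<in> sets (interval_borel T)"
      for B :: "real set"
      using that by simp
    have L2: "indicator B \<in> L2_rv marg" if "B \<in> sets (interval_borel T)" for B :: "real set"
      by (rule bounded_L2_marg[OF mI[OF that], where C=1]) (auto simp: indicator_def)
    let ?s = "\<lambda>n x. \<Sum>i<n. 1 * indicator (A i) x :: real"
    have s_eq: "?s n x = indicator (\<Union>i<n. A i) x" for n x
    proof -
      have "indicator (\<Union>i<n. A i) x = (\<Sum>i<n. indicator (A i) x :: real)"
        using union(1) by (intro indicator_UN_disjoint) (auto simp: disjoint_family_on_def)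
      then show "?s n x = indicator (\<Union>i<n. A i) x" by simp
    qed
    show ?case
    proof (rule approx_limit)
      show "indicator (\<Union> (range A)) \<in> L2_rv marg" using Am by (intro L2) auto
      have UN: "(\<Union>i<n. A i) \<in> sets (interval_borel T)" "\<Union> (range A) \<in> sets (interval_borel T)" for n using Am
        by auto
      have "(\<lambda>n. LINT x|marg. (indicator (\<Union> (range A)) x - indicator (\<Union>i<n. A i) x :: real)\<^sup>2) \<longlonglongrightarrow> (LINT x|marg. 0)"
      proof (rule integral_dominated_convergence[where w="\<lambda>_. 1"])
        show "AE x in marg. (\<lambda>n. (indicator (\<Union> (range A)) x - indicator (\<Union>i<n. A i) x :: real)\<^sup>2) \<longlonglongrightarrow> 0"
        proof (rule AE_I2)
          fix x
          have "(\<lambda>n. indicator (\<Union>i<n. A i) x :: real) \<longlonglongrightarrow> indicator (\<Union> (range A)) x"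
            by (rule LIMSEQ_indicator_UN)
          then have "(\<lambda>n. (indicator (\<Union> (range A)) x - indicator (\<Union>i<n. A i) x :: real)\<^sup>2) \<longlonglongrightarrow> (indicator (\<Union> (range A)) x - indicator (\<Union> (range A)) x)\<^sup>2"
            by (intro tendsto_intros)
          then show "(\<lambda>n. (indicator (\<Union> (range A)) x - indicator (\<Union>i<n. A i) x :: real)\<^sup>2) \<longlonglongrightarrow> 0" by simp
        qed
        show "(\<lambda>x. (indicator (\<Union> (range A)) x - indicator (\<Union>i<n. A i) x :: real)\<^sup>2) \<in> borel_measurable marg"
          for n
          using UN by (intro borel_measurable_power borel_measurable_diff) (simp_all add: meas_marg)
        show "AE x in marg. norm ((indicator (\<Union> (range A)) x - indicator (\<Union>i<n. A i) x :: real)\<^sup>2) \<le> 1" for n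
          by (auto simp: indicator_def)
      qed auto
      then have lim: "(\<lambda>n. LINT x|marg. (indicator (\<Union> (range A)) x - ?s n x :: real)\<^sup>2) \<longlonglongrightarrow> 0"
        unfolding s_eq by (simp only: Bochner_Integration.integral_zero)
      fix e :: real assume "0 < e"
      then obtain n where "(LINT x|marg. (indicator (\<Union> (range A)) x - ?s n x :: real)\<^sup>2) < e"
        using order_tendstoD(2)[OF lim] eventually_happens'[OF sequentially_bot] by blast
      moreover have "approx (?s n)" using union(3) by (intro approx_sum) auto
      ultimately show "\<exists>\<phi>'. approx \<phi>' \<and> (LINT x|marg. (indicator (\<Union> (range A)) x - \<phi>' x)\<^sup>2) < e" by blast
    qed
  qed
qed

text \<open>Rounding the values down to multiples of \<open>1 / n\<close> leaves finitely many level
  sets, and their indicators have been treated.\<close>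

lemma approx_bounded:
  assumes \<phi>: "\<phi> \<in> borel_measurable (interval_borel T)" and C: "\<And>x. x \<in> {0..T} \<Longrightarrow> \<bar>\<phi> x\<bar> \<le> C"
  shows "approx \<phi>"
proof (rule approx_limit)
  show L2: "\<phi> \<in> L2_rv marg" by (rule bounded_L2_marg[OF assms])
  fix e :: real assume e: "0 < e"
  define m where "m = measure marg (space marg)"
  have m0: "0 \<le> m" by (simp add: m_def)
  \<comment> \<open>The rounding error is at most \<open>1 / n \<le> 1\<close>, so its square is at
    most \<open>1 / n\<close> and the integral at most \<open>m / n\<close>, which lies below
    \<open>e\<close> by this choice.\<close>
  obtain n :: nat where "max 1 ((m + 1) / e) < real n" using reals_Archimedean2 by blast
  then have n: "0 < n" "(m + 1) / e < real n" by auto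
  define N where "N = \<lceil>real n * C\<rceil> + 1"
  define A where "A j = {x \<in> {0..T}. \<lfloor>real n * \<phi> x\<rfloor> = j}" for j
  define \<psi> where "\<psi> x = (\<Sum>j\<in>{-N..N}. (of_int j / real n) * indicator (A j) x :: real)" for x
  have "approx \<psi>" unfolding \<psi>_def[abs_def]
  proof (intro approx_sum approx_indicator)
    fix j
    have "(\<lambda>x. \<lfloor>real n * \<phi> x\<rfloor>) \<in> measurable (interval_borel T) (count_space UNIV)"
      using \<phi> by measurable
    then have "(\<lambda>x. \<lfloor>real n * \<phi> x\<rfloor>) -` {j} \<inter> space (interval_borel T) \<in> sets (interval_borel T)"
      by (rule measurable_sets) simp
    moreover have "(\<lambda>x. \<lfloor>real n * \<phi> x\<rfloor>) -` {j} \<inter> space (interval_borel T) = A j"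
      by (auto simp: A_def space_interval_borel)
    ultimately show "A j \<in> sets (interval_borel T)" by simp
  qed
  moreover have "(LINT x|marg. (\<phi> x - \<psi> x)\<^sup>2) < e"
  proof -
    have le: "(\<phi> x - \<psi> x)\<^sup>2 \<le> 1 / real n" if x: "x \<in> {0..T}" for x
    proof -
      define k where "k = \<lfloor>real n * \<phi> x\<rfloor>"
      have "\<bar>real n * \<phi> x\<bar> \<le> real n * C" using C[OF x] by (simp add: abs_mult mult_left_mono)
      then have "k \<in> {-N..N}" unfolding N_def k_def by (simp add: abs_le_iff) linarith
      moreover have "\<psi> x = (\<Sum>j\<in>{-N..N}. if j = k then of_int j / real n else 0)"
        unfolding \<psi>_def using x by (intro sum.cong) (auto simp: A_def k_def)
      ultimately have "\<psi> x = of_int k / real n" by simp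
      then have "\<phi> x - \<psi> x = (real n * \<phi> x - of_int k) / real n" using n by (simp add: field_simps)
      moreover have "0 \<le> real n * \<phi> x - of_int k" "real n * \<phi> x - of_int k \<le> 1" unfolding k_def by linarith+
      ultimately have d: "0 \<le> \<phi> x - \<psi> x" "\<phi> x - \<psi> x \<le> 1 / real n"
        by (auto simp: divide_right_mono)
      have n1: "1 / real n \<le> 1" using n(1) by simp
      have "(\<phi> x - \<psi> x)\<^sup>2 \<le> 1 * (1 / real n)"
        unfolding power2_eq_square using d n1 by (intro mult_mono) auto
      then show ?thesis by simp
    qed
    have "(LINT x|marg. (\<phi> x - \<psi> x)\<^sup>2) \<le> (LINT x|marg. 1 / real n)"
    proof (rule integral_mono_AE)
      show "integrable marg (\<lambda>x. (\<phi> x - \<psi> x)\<^sup>2)"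
        using \<open>approx \<psi>\<close> by (intro L2_rv_power2 L2_rv_diff L2) (simp add: approx_def)
    qed (use le in \<open>auto simp: space_marg intro!: AE_I2\<close>)
    also have "\<dots> = m / real n" by (simp add: m_def)
    also have "\<dots> \<le> (m + 1) / real n" by (simp add: divide_right_mono)
    also have "\<dots> < e" using n e by (simp add: field_simps)
    finally show ?thesis .
  qed
  ultimately show "\<exists>\<phi>'. approx \<phi>' \<and> (LINT x|marg. (\<phi> x - \<phi>' x)\<^sup>2) < e" by blast
qed

text \<open>Positivity passes from step functions to their closure, because the semiscalar product
  is continuous for the norm of \<open>marg\<close>. The estimate comes from expanding
  \<open>inn (\<psi> k) (\<psi> k)\<close> around \<open>\<phi>\<close>.\<close>

lemma inn_nonneg:
  assumes \<phi>: "approx \<phi>"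
  shows "0 \<le> inn \<phi> \<phi>"
proof -
  have L2: "\<phi> \<in> L2_rv marg" using \<phi> by (simp add: approx_def)
  have "\<forall>k. \<exists>\<psi> Y. step_rep \<psi> Y \<and> (LINT x|marg. (\<phi> x - \<psi> x)\<^sup>2) < inverse (real (Suc k))"
    using \<phi> by (auto simp: approx_def)
  then obtain \<psi> Y where \<psi>: "\<And>k. step_rep (\<psi> k) (Y k)" "\<And>k. (LINT x|marg. (\<phi> x - \<psi> k x)\<^sup>2) < inverse (real (Suc k))"
    by metis
  have \<psi>L: "\<psi> k \<in> L2_rv marg" for k by (rule step_rep_L2[OF \<psi>(1)])
  define d where "d k = (LINT x|marg. (\<phi> x - \<psi> k x)\<^sup>2)" for k
  define s where "s = (LINT x|marg. (\<phi> x)\<^sup>2)"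
  have dk: "0 \<le> d k" "d k \<le> inverse (real (Suc k))" for k using \<psi>(2)[of k] by (auto simp: d_def)
  have dlim: "d \<longlonglongrightarrow> 0"
    by (rule Lim_null_comparison[OF _ LIMSEQ_inverse_real_of_nat]) (use dk in auto)
  have DL: "(\<lambda>x. \<phi> x - \<psi> k x) \<in> L2_rv marg" for k by (intro L2_rv_diff L2 \<psi>L)
  have bound: "- inn \<phi> \<phi> \<le> 2 * (sqrt (d k) * sqrt s) + sqrt (d k) * sqrt (d k)" for k
  proof -
    let ?D = "\<lambda>x. \<phi> x - \<psi> k x"
    have r: "inn \<phi>' (\<lambda>x. \<phi> x - \<psi> k x) = inn \<phi>' \<phi> - inn \<phi>' (\<psi> k)" if "\<phi>' \<in> L2_rv marg" for \<phi>'
    proof -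
      have "inn \<phi>' ?D = I (\<lambda>z. (case z of (x, y) \<Rightarrow> \<phi>' x * \<phi> y) - (case z of (x, y) \<Rightarrow> \<phi>' x * \<psi> k y))"
        unfolding inn_def by (intro I_cong) (auto simp: algebra_simps)
      also have "\<dots> = inn \<phi>' \<phi> - inn \<phi>' (\<psi> k)"
        unfolding inn_def by (rule I_diff[OF integrable_tensor_marg[OF that L2] integrable_tensor_marg[OF that \<psi>L]])
      finally show ?thesis .
    qed
    have "inn (\<psi> k) (\<psi> k) = inn \<phi> \<phi> - inn ?D \<phi> - inn \<phi> ?D + inn ?D ?D"
      using inn_diff_left[OF L2 \<psi>L[of k] L2] inn_diff_left[OF L2 \<psi>L[of k] DL[of k]] r[OF L2] r[OF \<psi>L[of k]]
        by simp
    moreover have "0 \<le> inn (\<psi> k) (\<psi> k)" unfolding step_rep_inn_self[OF \<psi>(1)] by simp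
    moreover have "\<bar>inn ?D \<phi>\<bar> \<le> sqrt (d k) * sqrt s" "\<bar>inn \<phi> ?D\<bar> \<le> sqrt (d k) * sqrt s" "\<bar>inn ?D ?D\<bar> \<le> sqrt (d k) * sqrt (d k)"
      unfolding d_def s_def using inn_le_marg(3)[OF DL[of k] L2] inn_le_marg(3)[OF L2 DL[of k]] inn_le_marg(3)[OF DL[of k] DL[of k]]
      by (simp_all add: mult.commute)
    ultimately show ?thesis by linarith
  qed
  have "(\<lambda>k. 2 * (sqrt (d k) * sqrt s) + sqrt (d k) * sqrt (d k)) \<longlonglongrightarrow> 2 * (sqrt 0 * sqrt s) + sqrt 0 * sqrt 0"
    by (intro tendsto_intros dlim)
  then have "- inn \<phi> \<phi> \<le> 0" using LIMSEQ_le_const[of _ "2 * (sqrt 0 * sqrt s) + sqrt 0 * sqrt 0"] bound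
    by fastforce
  then show ?thesis by simp
qed

text \<open>The discriminant argument for a positive semidefinite form; boundedness provides both
  positivity and symmetry. In contrast to the bound through \<open>marg\<close>, only semiscalar
  squares occur on the right, and these remain controlled when elements of \<open>L_mu\<close> are
  truncated.\<close>

lemma inn_cauchy_schwarz:
  assumes \<phi>: "\<phi> \<in> borel_measurable (interval_borel T)" "\<And>x. x \<in> {0..T} \<Longrightarrow> \<bar>\<phi> x\<bar> \<le> C"
    and \<psi>: "\<psi> \<in> borel_measurable (interval_borel T)" "\<And>x. x \<in> {0..T} \<Longrightarrow> \<bar>\<psi> x\<bar> \<le> D"
  shows "(inn \<phi> \<psi>)\<^sup>2 \<le> inn \<phi> \<phi> * inn \<psi> \<psi>"
proof -
  define a b c where "a = inn \<phi> \<phi>" and "b = inn \<psi> \<psi>" and "c = inn \<phi> \<psi>"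
  have L: "\<phi> \<in> L2_rv marg" "\<psi> \<in> L2_rv marg" using bounded_L2_marg[OF \<phi>] bounded_L2_marg[OF \<psi>] by auto
  have ap: "approx \<phi>" "approx \<psi>" using approx_bounded[OF \<phi>] approx_bounded[OF \<psi>] by auto
  have q: "0 \<le> s\<^sup>2 * a + 2 * s * r * c + r\<^sup>2 * b" for s r
  proof -
    have Ls: "(\<lambda>x. s * \<phi> x + r * \<psi> x) \<in> L2_rv marg" by (rule L2_rv_lin[OF L])
    have m: "(\<lambda>x. s * \<phi> x + r * \<psi> x) \<in> borel_measurable (interval_borel T)" using \<phi>(1) \<psi>(1) by simp
    have bd: "\<bar>s * \<phi> x + r * \<psi> x\<bar> \<le> \<bar>s\<bar> * C + \<bar>r\<bar> * D" if "x \<in> {0..T}" for x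
      using \<phi>(2)[OF that] \<psi>(2)[OF that]
        by (intro order.trans[OF abs_triangle_ineq] add_mono) (auto simp: abs_mult mult_left_mono)
    have "0 \<le> inn (\<lambda>x. s * \<phi> x + r * \<psi> x) (\<lambda>x. s * \<phi> x + r * \<psi> x)" by (rule inn_nonneg[OF approx_lin[OF ap]])
    also have "\<dots> = s * inn \<phi> (\<lambda>x. s * \<phi> x + r * \<psi> x) + r * inn \<psi> (\<lambda>x. s * \<phi> x + r * \<psi> x)"
      by (rule inn_add_left[OF L Ls])
    also have "inn \<phi> (\<lambda>x. s * \<phi> x + r * \<psi> x) = inn (\<lambda>x. s * \<phi> x + r * \<psi> x) \<phi>" by (rule inn_commute[OF \<phi> m bd])
    also have "\<dots> = s * a + r * inn \<psi> \<phi>" unfolding a_def by (rule inn_add_left[OF L L(1)])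
    also have "inn \<psi> (\<lambda>x. s * \<phi> x + r * \<psi> x) = inn (\<lambda>x. s * \<phi> x + r * \<psi> x) \<psi>" by (rule inn_commute[OF \<psi> m bd])
    also have "\<dots> = s * c + r * b" unfolding b_def c_def by (rule inn_add_left[OF L L(2)])
    also have "inn \<psi> \<phi> = c" unfolding c_def by (rule inn_commute[OF \<psi> \<phi>])
    finally show ?thesis by (simp add: power2_eq_square algebra_simps)
  qed
  have nn: "0 \<le> a" "0 \<le> b" unfolding a_def b_def using inn_nonneg ap by auto
  have "c\<^sup>2 \<le> a * b"
  proof (cases "a = 0")
    case True
    have "c = 0"
    proof (rule ccontr)
      assume "c \<noteq> 0"
      \<comment> \<open>With \<open>a = 0\<close> and \<open>r = 1\<close> the form is linear in
        \<open>s\<close>; at the chosen value it would equal -1.\<close>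
      then have "2 * (- (b + 1) / (2 * c)) * c = - (b + 1)" by simp
      then show False using q[of "- (b + 1) / (2 * c)" 1] True
        by (simp only: mult_zero_right power_one mult_1 mult_1_right)
    qed
    then show ?thesis using nn by simp
  next
    case False
    then have a: "0 < a" using nn by simp
    have "0 \<le> c\<^sup>2 * a + 2 * (- c) * a * c + a\<^sup>2 * b" using q[of "- c" a] by simp
    also have "\<dots> = a * (a * b - c\<^sup>2)" by (simp add: power2_eq_square algebra_simps)
    finally show ?thesis using a by (simp add: zero_le_mult_iff)
  qed
  then show ?thesis by (simp add: a_def b_def c_def)
qed

text \<open>\<open>L_mu\<close> in terms of \<open>V\<close>; the two sets coincide once
  \<open>V\<close> is known to be the variation of \<open>\<mu>\<close>.\<close>

definition Lmu :: "(real \<Rightarrow> real) set" where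
  "Lmu = {\<phi> \<in> borel_measurable (interval_borel T). (\<integral>\<^sup>+(a, b). ennreal (\<bar>\<phi> a\<bar> * \<bar>\<phi> b\<bar>) \<partial>V) < \<infinity>}"

lemma abs_measurable: "\<phi> \<in> borel_measurable (interval_borel T) \<Longrightarrow> (\<lambda>x. \<bar>\<phi> x\<bar>) \<in> borel_measurable (interval_borel T)"
  for \<phi> :: "real \<Rightarrow> real" by simp

lemma Lmu_iff: "\<phi> \<in> Lmu \<longleftrightarrow> \<phi> \<in> borel_measurable (interval_borel T) \<and> integrable V (\<lambda>(a, b). \<bar>\<phi> a\<bar> * \<bar>\<phi> b\<bar>)"
proof -
  have "(\<lambda>(a, b). \<bar>\<phi> a\<bar> * \<bar>\<phi> b\<bar>) \<in> borel_measurable V" if "\<phi> \<in> borel_measurable (interval_borel T)"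
    unfolding meas_eq by (intro tensor_measurable abs_measurable that)
  then show ?thesis
    by (auto simp: Lmu_def integrable_iff_bounded split_beta' abs_mult)
qed

text \<open>\<open>L_mu\<close> need not be closed under sums, but it is solid. Membership of the
  cut-off parts and of differences is obtained by domination.\<close>

lemma Lmu_mono:
  assumes "\<phi> \<in> Lmu" "\<phi>' \<in> borel_measurable (interval_borel T)" "\<And>x. x \<in> {0..T} \<Longrightarrow> \<bar>\<phi>' x\<bar> \<le> \<bar>\<phi> x\<bar>"
  shows "\<phi>' \<in> Lmu"
proof -
  have i: "integrable V (\<lambda>(a, b). \<bar>\<phi> a\<bar> * \<bar>\<phi> b\<bar>)" using assms(1) by (simp add: Lmu_iff)
  have "integrable V (\<lambda>(a, b). \<bar>\<phi>' a\<bar> * \<bar>\<phi>' b\<bar>)"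
  proof (rule Bochner_Integration.integrable_bound[OF i])
    show "(\<lambda>(a, b). \<bar>\<phi>' a\<bar> * \<bar>\<phi>' b\<bar>) \<in> borel_measurable V"
      unfolding meas_eq by (intro tensor_measurable abs_measurable assms(2))
    have "\<bar>\<phi>' a\<bar> * \<bar>\<phi>' b\<bar> \<le> \<bar>\<phi> a\<bar> * \<bar>\<phi> b\<bar>" if "a \<in> {0..T}" "b \<in> {0..T}" for a b
      using assms(3) that by (intro mult_mono) auto
    then show "AE z in V. norm (case z of (a, b) \<Rightarrow> \<bar>\<phi>' a\<bar> * \<bar>\<phi>' b\<bar>) \<le> norm (case z of (a, b) \<Rightarrow> \<bar>\<phi> a\<bar> * \<bar>\<phi> b\<bar>)"
      by (intro AE_I2) (auto simp: space_V abs_mult)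
  qed
  then show ?thesis using assms(2) by (simp add: Lmu_iff)
qed

lemma L2_marg_abs: "\<phi> \<in> L2_rv marg \<Longrightarrow> (\<lambda>x. \<bar>\<phi> x\<bar>) \<in> L2_rv marg"
  by (auto simp: L2_rv_def)

lemma L2_marg_measurable: "\<phi> \<in> L2_rv marg \<Longrightarrow> \<phi> \<in> borel_measurable (interval_borel T)"
  by (simp add: L2_rv_def meas_marg)

lemma L2_marg_Lmu: "\<phi> \<in> L2_rv marg \<Longrightarrow> \<phi> \<in> Lmu"
  using integrable_tensor_marg[OF L2_marg_abs L2_marg_abs, of \<phi> \<phi>] by (simp add: Lmu_iff L2_marg_measurable)

lemma inn_self_le:
  assumes "\<phi> \<in> L2_rv marg"
  shows "\<bar>inn \<phi> \<phi>\<bar> \<le> (LINT x|marg. (\<phi> x)\<^sup>2)"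
proof -
  have "0 \<le> (LINT x|marg. (\<phi> x)\<^sup>2)" by simp
  then show ?thesis using inn_le_marg(3)[OF assms assms] by (simp only: real_sqrt_mult_self abs_of_nonneg)
qed

end

section \<open>The integrand and its random norm\<close>

locale integrand = gaussian_cov M G T Mp Mn X
  for M :: "'w measure" and G :: "('w \<Rightarrow> real) set" and T :: real and Mp Mn :: "(real \<times> real) measure" and X +
  fixes k k' :: "real \<Rightarrow> real" and K t :: real
  assumes k_deriv: "\<And>x. (k has_real_derivative k' x) (at x)" and k'_le: "\<And>x. \<bar>k' x\<bar> \<le> K"
    and t_mem: "t \<in> {0..T}"
begin

definition u :: "'w \<Rightarrow> real \<Rightarrow> real" where
  "u w s = k (X s w) * indicator {0..t} s"

text \<open>The squared norm of a path of the integrand for \<open>marg\<close>. It controls all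
  pairings \<open>inn \<phi> (u w)\<close> at once: pathwise by Cauchy-Schwarz, and in mean square
  because it is integrable.\<close>

definition U :: "'w \<Rightarrow> real" where
  "U w = (LINT x|marg. (u w x)\<^sup>2)"

lemma k_cont: "continuous_on UNIV k"
  using k_deriv by (meson DERIV_isCont continuous_at_imp_continuous_on)

lemma k_measurable: "k \<in> borel_measurable borel"
  using k_cont by (rule borel_measurable_continuous_onI)

lemma u_joint: "(\<lambda>(w, s). u w s) \<in> borel_measurable (M \<Otimes>\<^sub>M interval_borel T)"
proof -
  have "(\<lambda>p. X (snd p) (fst p)) \<in> borel_measurable (M \<Otimes>\<^sub>M interval_borel T)" using X_joint
    by (simp add: split_beta')
  then show ?thesis unfolding u_def split_beta'
    by (intro borel_measurable_times measurable_compose[OF _ k_measurable]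
        measurable_compose[OF measurable_snd indicator_interval_measurable]) auto
qed

lemma u_measurable: "w \<in> space M \<Longrightarrow> u w \<in> borel_measurable (interval_borel T)"
  using measurable_compose[OF measurable_Pair1' u_joint, of w] by simp

lemma u_bounded:
  assumes w: "w \<in> space M"
  shows "\<exists>C. \<forall>x\<in>{0..T}. \<bar>u w x\<bar> \<le> C"
proof -
  have "continuous_on {0..T} (\<lambda>s. k (X s w))"
    by (rule continuous_on_compose2[OF k_cont X_cont[OF w]]) auto
  then obtain A where A: "0 \<le> A" "\<forall>s\<in>{0..T}. \<bar>k (X s w)\<bar> \<le> A" using continuous_interval_facts(2) by blast
  then show ?thesis by (intro exI[of _ A]) (auto simp: u_def indicator_def)
qed

lemma u_L2: "w \<in> space M \<Longrightarrow> u w \<in> L2_rv marg"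
  using u_bounded u_measurable bounded_L2_marg by meson

lemma U_nonneg: "0 \<le> U w" by (simp add: U_def)

text \<open>Linear growth of \<open>k\<close> bounds the second moment of the integrand at each
  time, uniformly because variances are at most \<open>mass\<close>; the rest is Tonelli with the
  finite measure \<open>marg\<close>.\<close>

lemma U_integrable: "integrable M U"
proof -
  interpret P: pair_sigma_finite M marg ..
  define c where "c = 2 * (k 0)\<^sup>2 + 2 * K\<^sup>2 * mass"
  have hm: "(\<lambda>(w, s). (u w s)\<^sup>2) \<in> borel_measurable (M \<Otimes>\<^sub>M marg)"
    using borel_measurable_power[OF u_joint, of 2]
      by (simp add: split_beta' cong: measurable_cong_sets sets_pair_measure_cong)
  have bnd: "(\<integral>\<^sup>+w. ennreal ((u w s)\<^sup>2) \<partial>M) \<le> ennreal c" if s: "s \<in> {0..T}" for s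
  proof -
    have "(u w s)\<^sup>2 \<le> 2 * (k 0)\<^sup>2 + 2 * K\<^sup>2 * (X s w)\<^sup>2" for w
    proof -
      have "\<bar>u w s\<bar> \<le> \<bar>k 0\<bar> + K * \<bar>X s w\<bar>"
        using lin_growth_of_bounded_deriv[OF k_deriv k'_le, of "X s w" 0] k'_le[of 0]
          by (auto simp: u_def indicator_def)
      then have "(u w s)\<^sup>2 \<le> (\<bar>k 0\<bar> + K * \<bar>X s w\<bar>)\<^sup>2" by (metis abs_ge_zero power2_abs power_mono)
      also have "\<dots> \<le> 2 * \<bar>k 0\<bar>\<^sup>2 + 2 * (K * \<bar>X s w\<bar>)\<^sup>2"
        using sum_squares_bound[of "\<bar>k 0\<bar>" "K * \<bar>X s w\<bar>"] by (simp add: power2_sum)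
      finally show ?thesis by (simp add: power_mult_distrib)
    qed
    then have "(\<integral>\<^sup>+w. ennreal ((u w s)\<^sup>2) \<partial>M) \<le> (\<integral>\<^sup>+w. ennreal (2 * (k 0)\<^sup>2 + 2 * K\<^sup>2 * (X s w)\<^sup>2) \<partial>M)"
      by (intro nn_integral_mono ennreal_leI)
    also have "\<dots> = ennreal (expectation (\<lambda>w. 2 * (k 0)\<^sup>2 + 2 * K\<^sup>2 * (X s w)\<^sup>2))"
      using integrable_power[OF X_mem[OF s], of 2] by (intro nn_integral_eq_integral) auto
    also have "expectation (\<lambda>w. 2 * (k 0)\<^sup>2 + 2 * K\<^sup>2 * (X s w)\<^sup>2) = 2 * (k 0)\<^sup>2 + 2 * K\<^sup>2 * expectation (\<lambda>w. (X s w)\<^sup>2)"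
      using integrable_power[OF X_mem[OF s], of 2] by (simp add: prob_space)
    also have "ennreal \<dots> \<le> ennreal c"
      unfolding c_def using var_le_mass[OF s] by (intro ennreal_leI add_left_mono mult_left_mono) auto
    finally show ?thesis .
  qed
  have "(\<integral>\<^sup>+p. ennreal (norm (case p of (w, s) \<Rightarrow> (u w s)\<^sup>2)) \<partial>(M \<Otimes>\<^sub>M marg)) = (\<integral>\<^sup>+s. \<integral>\<^sup>+w. ennreal ((u w s)\<^sup>2) \<partial>M \<partial>marg)"
    using P.nn_integral_snd[of "\<lambda>p. ennreal ((u (fst p) (snd p))\<^sup>2)"] hm by (simp add: split_beta')
  also have "\<dots> \<le> (\<integral>\<^sup>+s. ennreal c \<partial>marg)" using bnd by (intro nn_integral_mono) (auto simp: space_marg)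
  also have "\<dots> < \<infinity>"
  proof -
    have "emeasure marg (space marg) < top" using marg.emeasure_finite[of "space marg"]
      unfolding infinity_ennreal_def less_top .
    then show ?thesis by (auto simp: ennreal_mult_less_top)
  qed
  finally have "integrable (M \<Otimes>\<^sub>M marg) (\<lambda>(w, s). (u w s)\<^sup>2)" using hm by (simp add: integrable_iff_bounded)
  from P.integrable_fst[OF this] show ?thesis by (simp add: U_def[abs_def])
qed

text \<open>The integrability condition in the definition of the Skorohod integral: by
  Cauchy-Schwarz the inner integral is at most \<open>U w\<close>.\<close>

lemma u_abs_norm: "(\<integral>\<^sup>+w. (\<integral>\<^sup>+(a, b). ennreal (\<bar>u w a\<bar> * \<bar>u w b\<bar>) \<partial>V) \<partial>M) < \<infinity>"
proof -
  have "(\<integral>\<^sup>+(a, b). ennreal (\<bar>u w a\<bar> * \<bar>u w b\<bar>) \<partial>V) \<le> ennreal (U w)" if w: "w \<in> space M" for w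
  proof -
    have i: "integrable V (\<lambda>z. \<bar>u w (fst z) * u w (snd z)\<bar>)"
      using integrable_tensor_marg[OF u_L2[OF w] u_L2[OF w]] by (intro integrable_abs) (simp add: split_beta')
    have "(\<integral>\<^sup>+(a, b). ennreal (\<bar>u w a\<bar> * \<bar>u w b\<bar>) \<partial>V) = (\<integral>\<^sup>+z. ennreal \<bar>u w (fst z) * u w (snd z)\<bar> \<partial>V)"
      by (simp add: split_beta' abs_mult)
    also have "\<dots> = ennreal (LINT z|V. \<bar>u w (fst z) * u w (snd z)\<bar>)"
      using i by (intro nn_integral_eq_integral) auto
    also have "\<dots> \<le> ennreal (U w)"
    proof (rule ennreal_leI)
      show "(LINT z|V. \<bar>u w (fst z) * u w (snd z)\<bar>) \<le> U w"
        using inn_le_marg(2)[OF u_L2[OF w] u_L2[OF w]] U_nonneg[of w]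
        unfolding U_def[symmetric] by (simp only: real_sqrt_mult_self abs_of_nonneg)
    qed
    finally show ?thesis .
  qed
  then have "(\<integral>\<^sup>+w. (\<integral>\<^sup>+(a, b). ennreal (\<bar>u w a\<bar> * \<bar>u w b\<bar>) \<partial>V) \<partial>M) \<le> (\<integral>\<^sup>+w. ennreal (U w) \<partial>M)"
    by (rule nn_integral_mono)
  also have "\<dots> = ennreal (expectation U)" using U_integrable U_nonneg by (intro nn_integral_eq_integral) auto
  finally show ?thesis by (simp add: order_le_less_trans)
qed

lemma inn_u_measurable:
  assumes "\<phi> \<in> borel_measurable (interval_borel T)"
  shows "(\<lambda>w. inn \<phi> (u w)) \<in> borel_measurable M"
proof -
  have "(\<lambda>p. (fst p, snd (snd p))) \<in> measurable (M \<Otimes>\<^sub>M square_borel T) (M \<Otimes>\<^sub>M interval_borel T)"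
    by (intro measurable_Pair measurable_fst measurable_compose[OF measurable_snd measurable_snd_square])
  from measurable_compose[OF this u_joint]
  have um: "(\<lambda>p. u (fst p) (snd (snd p))) \<in> borel_measurable (M \<Otimes>\<^sub>M square_borel T)" by simp
  have h: "(\<lambda>(w, z). \<phi> (fst z) * u w (snd z)) \<in> borel_measurable (M \<Otimes>\<^sub>M square_borel T)"
    unfolding split_beta'
    by (rule borel_measurable_times[OF measurable_compose[OF measurable_snd measurable_compose[OF measurable_fst_square assms]] um])
  have "(\<lambda>w. LINT z|L. \<phi> (fst z) * u w (snd z)) \<in> borel_measurable M"
    if "finite_measure L" "sets L = sets (square_borel T)" for L
  proof -
    interpret L: finite_measure L by fact
    have "(\<lambda>(w, z). \<phi> (fst z) * u w (snd z)) \<in> borel_measurable (M \<Otimes>\<^sub>M L)"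
      using h that(2) by (simp cong: measurable_cong_sets sets_pair_measure_cong)
    then show ?thesis by (rule L.borel_measurable_lebesgue_integral)
  qed
  from this[OF finite_Mp sets_Mp] this[OF finite_Mn sets_Mn] show ?thesis
    unfolding inn_def I_def split_beta' by (rule borel_measurable_diff)
qed

text \<open>The pairing with the integrand is continuous from the norm of \<open>marg\<close> to
  mean square; this is what carries the duality relation from step functions to bounded
  ones.\<close>

lemma inn_u_L2:
  assumes \<phi>: "\<phi> \<in> L2_rv marg"
  shows "(\<lambda>w. inn \<phi> (u w)) \<in> L2_rv M"
    and "expectation (\<lambda>w. (inn \<phi> (u w))\<^sup>2) \<le> (LINT x|marg. (\<phi> x)\<^sup>2) * expectation U"
proof -
  define s where "s = (LINT x|marg. (\<phi> x)\<^sup>2)"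
  have s0: "0 \<le> s" by (simp add: s_def)
  have le: "(inn \<phi> (u w))\<^sup>2 \<le> s * U w" if w: "w \<in> space M" for w
  proof -
    have "\<bar>inn \<phi> (u w)\<bar> \<le> sqrt s * sqrt (U w)" unfolding s_def U_def by (rule inn_le_marg(3)[OF \<phi> u_L2[OF w]])
    then have "(inn \<phi> (u w))\<^sup>2 \<le> (sqrt s * sqrt (U w))\<^sup>2" by (metis abs_ge_zero power2_abs power_mono)
    then show ?thesis using s0 U_nonneg[of w] by (simp add: power_mult_distrib)
  qed
  have m: "(\<lambda>w. inn \<phi> (u w)) \<in> borel_measurable M" by (rule inn_u_measurable[OF L2_marg_measurable[OF \<phi>]])
  have iU: "integrable M (\<lambda>w. s * U w)" using U_integrable by simp
  have i: "integrable M (\<lambda>w. (inn \<phi> (u w))\<^sup>2)"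
    by (rule Bochner_Integration.integrable_bound[OF iU]) (use m le s0 U_nonneg in \<open>auto intro!: AE_I2\<close>)
  then show "(\<lambda>w. inn \<phi> (u w)) \<in> L2_rv M" using m by (simp add: L2_rv_def)
  have "expectation (\<lambda>w. (inn \<phi> (u w))\<^sup>2) \<le> expectation (\<lambda>w. s * U w)"
    using i iU le by (intro integral_mono_AE AE_I2) auto
  then show "expectation (\<lambda>w. (inn \<phi> (u w))\<^sup>2) \<le> (LINT x|marg. (\<phi> x)\<^sup>2) * expectation U" by (simp add: s_def)
qed

end

text \<open>No law of \<open>W \<phi>\<close> is prescribed: besides square integrability, linearity
  and continuity only the values at the indicators of \<open>{0..t}\<close> are given. Continuity is
  expressed with semiscalar squares instead of their roots.\<close>

locale wiener_cov = gaussian_cov M G T Mp Mn X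
  for M :: "'w measure" and G :: "('w \<Rightarrow> real) set" and T :: real and Mp Mn :: "(real \<times> real) measure" and X +
  fixes W :: "(real \<Rightarrow> real) \<Rightarrow> 'w \<Rightarrow> real"
  assumes W_L2: "\<And>\<phi>. \<phi> \<in> Lmu \<Longrightarrow> W \<phi> \<in> L2_rv M"
    and W_lin: "\<And>\<phi> \<psi> c d. \<phi> \<in> Lmu \<Longrightarrow> \<psi> \<in> Lmu \<Longrightarrow> (\<lambda>s. c * \<phi> s + d * \<psi> s) \<in> Lmu \<Longrightarrow>
      AE w in M. W (\<lambda>s. c * \<phi> s + d * \<psi> s) w = c * W \<phi> w + d * W \<psi> w"
    and W_cont: "\<And>\<phi> (\<psi> :: nat \<Rightarrow> real \<Rightarrow> real). \<phi> \<in> Lmu \<Longrightarrow> (\<And>k. \<psi> k \<in> Lmu) \<Longrightarrow> (\<And>k. (\<lambda>s. \<psi> k s - \<phi> s) \<in> Lmu) \<Longrightarrow>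
      (\<lambda>k. inn (\<lambda>s. \<psi> k s - \<phi> s) (\<lambda>s. \<psi> k s - \<phi> s)) \<longlonglongrightarrow> 0 \<Longrightarrow>
      (\<lambda>k. expectation (\<lambda>w. (W (\<psi> k) w - W \<phi> w)\<^sup>2)) \<longlonglongrightarrow> 0"
    and W_ind: "\<And>t. t \<in> {0..T} \<Longrightarrow> AE w in M. W (indicator {0..t}) w = X t w"
begin

text \<open>Linearity is available only for combinations that stay in \<open>L_mu\<close>, so every
  partial sum is first recognised as a step function. The empty sum is a combination with
  coefficients 0, which yields \<open>W\<close> of the zero function.\<close>

lemma W_step:
  assumes "step_rep \<psi> Y"
  shows "AE w in M. W \<psi> w = Y w"
proof -
  obtain S a where S: "finite S" "S \<subseteq> {0..T}" "\<psi> = (\<lambda>x. \<Sum>\<tau>\<in>S. a \<tau> * indicator {0..\<tau>} x)" "Y = (\<lambda>w. \<Sum>\<tau>\<in>S. a \<tau> * X \<tau> w)"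
    using assms unfolding step_rep_def by blast
  have ind: "indicator {0..\<tau>} \<in> Lmu" for \<tau> by (rule L2_marg_Lmu[OF indicator_L2_marg])
  have sum_Lmu: "(\<lambda>x. \<Sum>\<tau>\<in>S. a \<tau> * indicator {0..\<tau>} x) \<in> Lmu" if "finite S" "S \<subseteq> {0..T}" for S a
  proof -
    have "step_rep (\<lambda>x. \<Sum>\<tau>\<in>S. a \<tau> * indicator {0..\<tau>} x) (\<lambda>w. \<Sum>\<tau>\<in>S. a \<tau> * X \<tau> w)"
      using that unfolding step_rep_def by blast
    then show ?thesis by (intro L2_marg_Lmu step_rep_L2)
  qed
  from S(1,2) show ?thesis unfolding S(3,4)
  proof (induction S rule: finite_induct)
    case empty
    have "(\<lambda>s. 0 * indicator {0..0} s + 0 * indicator {0..0} s) = (\<lambda>_. 0 :: real)" by simp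
    then show ?case using W_lin[OF ind[of 0] ind[of 0], of 0 0] sum_Lmu[of "{}" a] by simp
  next
    case (insert \<tau> S)
    have eq: "(\<Sum>\<sigma>\<in>insert \<tau> S. a \<sigma> * indicator {0..\<sigma>} x) = a \<tau> * indicator {0..\<tau>} x + 1 * (\<Sum>\<sigma>\<in>S. a \<sigma> * indicator {0..\<sigma>} x :: real)" for x
      by (simp only: sum.insert[OF insert.hyps(1,2)] mult_1)
    have L: "(\<lambda>x. \<Sum>\<sigma>\<in>S. a \<sigma> * indicator {0..\<sigma>} x) \<in> Lmu" "(\<lambda>x. \<Sum>\<sigma>\<in>insert \<tau> S. a \<sigma> * indicator {0..\<sigma>} x) \<in> Lmu"
      by (rule sum_Lmu; use insert.hyps insert.prems in simp)+
    have "AE w in M. W (\<lambda>x. a \<tau> * indicator {0..\<tau>} x + 1 * (\<Sum>\<sigma>\<in>S. a \<sigma> * indicator {0..\<sigma>} x)) w =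
        a \<tau> * W (indicator {0..\<tau>}) w + 1 * W (\<lambda>x. \<Sum>\<sigma>\<in>S. a \<sigma> * indicator {0..\<sigma>} x) w"
      by (rule W_lin[OF ind L(1) L(2)[unfolded eq]])
    moreover have "AE w in M. W (indicator {0..\<tau>}) w = X \<tau> w" using insert.prems by (intro W_ind) auto
    moreover have "AE w in M. W (\<lambda>x. \<Sum>\<sigma>\<in>S. a \<sigma> * indicator {0..\<sigma>} x) w = (\<Sum>\<sigma>\<in>S. a \<sigma> * X \<sigma> w)"
      using insert.prems by (intro insert.IH) auto
    ultimately show ?case unfolding eq
      by eventually_elim (use insert.hyps in simp)
  qed
qed

text \<open>The norm of \<open>marg\<close> dominates the semiscalar square, so the continuity of
  \<open>W\<close> applies; almost sure equality then replaces \<open>W\<close> of a step function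
  by its elementary integral.\<close>

lemma W_approx:
  assumes \<phi>: "approx \<phi>"
  shows "\<exists>\<psi> Y. (\<forall>k. step_rep (\<psi> k) (Y k)) \<and> (\<lambda>k. LINT x|marg. (\<psi> k x - \<phi> x)\<^sup>2) \<longlonglongrightarrow> 0 \<and>
    (\<lambda>k. expectation (\<lambda>w. (Y k w - W \<phi> w)\<^sup>2)) \<longlonglongrightarrow> 0"
proof -
  have L2: "\<phi> \<in> L2_rv marg" using \<phi> by (simp add: approx_def)
  have "\<forall>k. \<exists>\<psi> Y. step_rep \<psi> Y \<and> (LINT x|marg. (\<phi> x - \<psi> x)\<^sup>2) < inverse (real (Suc k))"
    using \<phi> by (auto simp: approx_def)
  then obtain \<psi> Y where \<psi>: "\<And>k. step_rep (\<psi> k) (Y k)" "\<And>k. (LINT x|marg. (\<phi> x - \<psi> k x)\<^sup>2) < inverse (real (Suc k))"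
    by metis
  have DL: "(\<lambda>x. \<psi> k x - \<phi> x) \<in> L2_rv marg" for k by (intro L2_rv_diff L2 step_rep_L2[OF \<psi>(1)])
  have "norm (LINT x|marg. (\<psi> k x - \<phi> x)\<^sup>2) \<le> inverse (real (Suc k))" for k
    using \<psi>(2)[of k] by (simp add: power2_commute)
  then have lim: "(\<lambda>k. LINT x|marg. (\<psi> k x - \<phi> x)\<^sup>2) \<longlonglongrightarrow> 0"
    by (intro Lim_null_comparison[OF _ LIMSEQ_inverse_real_of_nat] always_eventually allI)
  have "(\<lambda>k. inn (\<lambda>s. \<psi> k s - \<phi> s) (\<lambda>s. \<psi> k s - \<phi> s)) \<longlonglongrightarrow> 0"
    by (rule Lim_null_comparison[OF _ lim]) (use inn_self_le[OF DL] in auto)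
  then have "(\<lambda>k. expectation (\<lambda>w. (W (\<psi> k) w - W \<phi> w)\<^sup>2)) \<longlonglongrightarrow> 0"
    by (intro W_cont L2_marg_Lmu L2 step_rep_L2[OF \<psi>(1)] DL)
  moreover have "expectation (\<lambda>w. (W (\<psi> k) w - W \<phi> w)\<^sup>2) = expectation (\<lambda>w. (Y k w - W \<phi> w)\<^sup>2)" for k
  proof (rule integral_cong_AE)
    have W1: "W \<phi> \<in> borel_measurable M" "W (\<psi> k) \<in> borel_measurable M"
      by (intro L2_rv_measurable W_L2 L2_marg_Lmu L2 step_rep_L2[OF \<psi>(1)])+
    then show "(\<lambda>w. (W (\<psi> k) w - W \<phi> w)\<^sup>2) \<in> borel_measurable M" by simp
    have "Y k \<in> borel_measurable M" by (rule meas[OF step_rep_bounded(3)[OF \<psi>(1)]])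
    then show "(\<lambda>w. (Y k w - W \<phi> w)\<^sup>2) \<in> borel_measurable M" using W1 by simp
    show "AE w in M. (W (\<psi> k) w - W \<phi> w)\<^sup>2 = (Y k w - W \<phi> w)\<^sup>2"
      using W_step[OF \<psi>(1)[of k]] by eventually_elim simp
  qed
  ultimately show ?thesis using \<psi>(1) lim by (intro exI[of _ \<psi>] exI[of _ Y]) simp
qed

end

section \<open>The duality relation for all cylindrical variables\<close>

locale ito_setting = wiener_cov M G T Mp Mn X W + integrand M G T Mp Mn X f' f'' K t
  for M :: "'w measure" and G :: "('w \<Rightarrow> real) set" and T :: real and Mp Mn :: "(real \<times> real) measure" and X
    and W
    and f' f'' :: "real \<Rightarrow> real" and K t :: real +
  fixes f :: "real \<Rightarrow> real"
  assumes f_deriv: "\<And>x. (f has_real_derivative f' x) (at x)" and f''_cont: "continuous_on UNIV f''"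
begin

text \<open>The candidate for the Skorohod integral is read off the formula to be proved; the whole
  content is then that it satisfies the duality relation.\<close>

definition Z :: "'w \<Rightarrow> real" where
  "Z w = f (X t w) - f (X 0 w) - 1 / 2 * correction f'' t w"

lemma Z_L2: "Z \<in> L2_rv M"
proof -
  have 0: "0 \<in> {0..T}" using T_pos by simp
  have "(\<lambda>w. (1 :: real) * correction f'' t w) \<in> borel_measurable M"
    by (rule borel_measurable_integrable[OF correction_integrable[OF _ _ f''_cont k'_le t_mem,
      where B=1]]) auto
  then have cm: "correction f'' t \<in> borel_measurable M" by simp
  have "(\<lambda>_. K * mass) \<in> L2_rv M" by (simp add: L2_rv_def)
  then have "correction f'' t \<in> L2_rv M"
  proof (rule L2_rv_bound[OF _ cm])
    have "\<bar>correction f'' t w\<bar> \<le> K * mass" if "w \<in> space M" for w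
      by (rule correction_bound[OF _ _ f''_cont k'_le t_mem that, where H="\<lambda>_. 1" and B=1]) auto
    then show "AE w in M. \<bar>correction f'' t w\<bar> \<le> \<bar>K * mass\<bar>"
      by (intro AE_I2) (auto intro: order.trans[OF _ abs_ge_self])
  qed
  then show ?thesis unfolding Z_def[abs_def]
    by (intro L2_rv_diff L2_rv_cmult quadratic_growth_L2[OF f_deriv k_deriv k'_le] t_mem 0)
qed

text \<open>Duality with the constant 1, a cylindrical function without arguments: for
  \<open>n = 0\<close> the sum over derivatives is empty, and the \<open>undefined\<close> arguments
  never matter.\<close>

lemma Z_mean: "expectation Z = 0"
proof -
  have "(\<lambda>_. 1) \<in> Cb_infinity 0" by (auto simp: Cb_infinity_def)
  from duality_represents[OF this _ f_deriv k_deriv f''_cont k'_le t_mem, of undefined undefined]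
  show ?thesis by (simp add: Z_def[abs_def])
qed

text \<open>One approximating sequence serves both sides: convergence for \<open>marg\<close> gives
  mean square convergence of the Wiener integrals and, through \<open>U\<close>, of the pairings
  with the integrand.\<close>

lemma duality_approx:
  assumes g: "g \<in> Cb_infinity n" and \<phi>: "\<And>i. i < n \<Longrightarrow> approx (\<phi> i)"
  shows "expectation (\<lambda>w. g (\<lambda>j. W (\<phi> j) w) * Z w) =
    (\<Sum>i<n. expectation (\<lambda>w. partial_deriv i g (\<lambda>j. W (\<phi> j) w) * inn (\<phi> i) (u w)))"
proof -
  define Q where "Q i \<psi> Y \<longleftrightarrow> (\<forall>k. step_rep (\<psi> k) (Y k)) \<and> (\<lambda>k. LINT x|marg. (\<psi> k x - \<phi> i x)\<^sup>2) \<longlonglongrightarrow> 0 \<and>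
    (\<lambda>k. expectation (\<lambda>w. (Y k w - W (\<phi> i) w)\<^sup>2)) \<longlonglongrightarrow> 0" for i \<psi> Y
  have "\<forall>i\<in>{..<n}. \<exists>\<psi> Y. Q i \<psi> Y" unfolding Q_def using W_approx[OF \<phi>] by simp
  then obtain \<psi> Y where Q: "\<And>i. i < n \<Longrightarrow> Q i (\<psi> i) (Y i)" by (metis lessThan_iff)
  have \<psi>: "\<And>i k. i < n \<Longrightarrow> step_rep (\<psi> i k) (Y i k)"
    "\<And>i. i < n \<Longrightarrow> (\<lambda>k. LINT x|marg. (\<psi> i k x - \<phi> i x)\<^sup>2) \<longlonglongrightarrow> 0"
    "\<And>i. i < n \<Longrightarrow> (\<lambda>k. expectation (\<lambda>w. (Y i k w - W (\<phi> i) w)\<^sup>2)) \<longlonglongrightarrow> 0" using Q unfolding Q_def by blast+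
  have L2: "\<phi> i \<in> L2_rv marg" if "i < n" for i using \<phi>[OF that] by (simp add: approx_def)
  have \<psi>L: "\<psi> i k \<in> L2_rv marg" if "i < n" for i k by (rule step_rep_L2[OF \<psi>(1)[OF that]])
  show ?thesis
  proof (rule cylindrical_duality_limit[OF g Z_L2, where Yk=Y and Bk="\<lambda>i k w. inn (\<psi> i k) (u w)"])
    fix i assume i: "i < n"
    show "W (\<phi> i) \<in> L2_rv M" by (intro W_L2 L2_marg_Lmu L2 i)
    show "Y i k \<in> L2_rv M" for k by (rule mem_L2[OF step_rep_bounded(3)[OF \<psi>(1)[OF i]]])
    show "(\<lambda>k. expectation (\<lambda>w. (Y i k w - W (\<phi> i) w)\<^sup>2)) \<longlonglongrightarrow> 0" by (rule \<psi>(3)[OF i])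
    show "(\<lambda>w. inn (\<phi> i) (u w)) \<in> L2_rv M" by (rule inn_u_L2(1)[OF L2[OF i]])
    show "(\<lambda>w. inn (\<psi> i k) (u w)) \<in> L2_rv M" for k by (rule inn_u_L2(1)[OF \<psi>L[OF i]])
    have "(\<lambda>k. (LINT x|marg. (\<psi> i k x - \<phi> i x)\<^sup>2) * expectation U) \<longlonglongrightarrow> 0 * expectation U"
      by (intro tendsto_intros \<psi>(2)[OF i])
    then have lim: "(\<lambda>k. (LINT x|marg. (\<psi> i k x - \<phi> i x)\<^sup>2) * expectation U) \<longlonglongrightarrow> 0" by simp
    have "expectation (\<lambda>w. (inn (\<psi> i k) (u w) - inn (\<phi> i) (u w))\<^sup>2) \<le> (LINT x|marg. (\<psi> i k x - \<phi> i x)\<^sup>2) * expectation U" for k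
    proof -
      have "expectation (\<lambda>w. (inn (\<psi> i k) (u w) - inn (\<phi> i) (u w))\<^sup>2) = expectation (\<lambda>w. (inn (\<lambda>x. \<psi> i k x - \<phi> i x) (u w))\<^sup>2)"
        by (intro Bochner_Integration.integral_cong refl) (simp add: inn_diff_left[OF \<psi>L[OF i] L2[OF i] u_L2])
      then show ?thesis using inn_u_L2(2)[OF L2_rv_diff[OF \<psi>L[OF i] L2[OF i]]] by simp
    qed
    then show "(\<lambda>k. expectation (\<lambda>w. (inn (\<psi> i k) (u w) - inn (\<phi> i) (u w))\<^sup>2)) \<longlonglongrightarrow> 0"
      by (intro Lim_null_comparison[OF _ lim] always_eventually allI) simp
  next
    fix k
    show "expectation (\<lambda>w. g (\<lambda>j. Y j k w) * Z w) =
        (\<Sum>i<n. expectation (\<lambda>w. partial_deriv i g (\<lambda>j. Y j k w) * inn (\<psi> i k) (u w)))"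
      unfolding Z_def u_def
      by (rule duality_represents[OF g step_rep_represents[OF \<psi>(1)] f_deriv k_deriv f''_cont k'_le t_mem])
  qed
qed

text \<open>\<open>L_mu\<close> need not be a linear space, and \<open>inn (\<phi> i) (u w)\<close> need not converge for a single \<open>i\<close>. All
  \<open>\<phi> i\<close> are therefore cut off on the same set \<open>A m\<close>, so that the truncated \<open>DF\<close> is \<open>DF\<close> times an
  indicator and the guard gives dominated convergence.\<close>

lemma duality_Lmu:
  assumes g: "g \<in> Cb_infinity n" and \<phi>: "\<And>i. i < n \<Longrightarrow> \<phi> i \<in> Lmu"
    and guard: "AE w in M. integrable V (\<lambda>(a, b). (\<Sum>i<n. partial_deriv i g (\<lambda>j. W (\<phi> j) w) * \<phi> i a) * u w b)"
    and guard': "integrable M (\<lambda>w. inn (\<lambda>s. \<Sum>i<n. partial_deriv i g (\<lambda>j. W (\<phi> j) w) * \<phi> i s) (u w))"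
  shows "expectation (\<lambda>w. g (\<lambda>j. W (\<phi> j) w) * Z w) =
    expectation (\<lambda>w. inn (\<lambda>s. \<Sum>i<n. partial_deriv i g (\<lambda>j. W (\<phi> j) w) * \<phi> i s) (u w))"
proof -
  define A where "A m x \<longleftrightarrow> (\<Sum>i<n. \<bar>\<phi> i x\<bar>) \<le> real m" for m :: nat and x
  define \<psi> where "\<psi> i m x = (if A m x then \<phi> i x else 0)" for i m x
  define r where "r i m x = (if A m x then 0 else \<phi> i x)" for i m x
  \<comment> \<open>The tail of \<open>\<phi> i\<close> in the norm of \<open>L_mu\<close>. It tends
    to 0 by dominated convergence and bounds the semiscalar square of everything dominated by the
    cut-off part \<open>r i m\<close>.\<close>
  define e where "e i m = (LINT z|V. \<bar>r i m (fst z)\<bar> * \<bar>r i m (snd z)\<bar>)" for i m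
  have \<phi>m: "\<phi> i \<in> borel_measurable (interval_borel T)" if "i < n" for i using \<phi>[OF that]
    by (simp add: Lmu_iff)
  have sum_m[measurable]: "(\<lambda>x. \<Sum>i<n. \<bar>\<phi> i x\<bar>) \<in> borel_measurable (interval_borel T)"
    using \<phi>m by (intro borel_measurable_sum abs_measurable) auto
  have Am: "Measurable.pred (interval_borel T) (A m)" for m unfolding A_def[abs_def] by measurable
  have \<psi>m: "\<psi> i m \<in> borel_measurable (interval_borel T)" "r i m \<in> borel_measurable (interval_borel T)"
    if "i < n" for i m
    unfolding \<psi>_def[abs_def] r_def[abs_def]
    using measurable_If[OF \<phi>m[OF that] measurable_const[of 0] Am[of m, unfolded pred_def]]
      measurable_If[OF measurable_const[of 0] \<phi>m[OF that] Am[of m, unfolded pred_def]] by simp_all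
  have \<psi>_bnd: "\<bar>\<psi> i m x\<bar> \<le> real m" if "i < n" for i m x
    using that member_le_sum[of i "{..<n}" "\<lambda>i. \<bar>\<phi> i x\<bar>"] by (auto simp: \<psi>_def A_def)
  have \<psi>L: "\<psi> i m \<in> L2_rv marg" if "i < n" for i m
    by (rule bounded_L2_marg[OF \<psi>m(1)[OF that] \<psi>_bnd[OF that]])
  have \<psi>ap: "approx (\<psi> i m)" if "i < n" for i m
    by (rule approx_bounded[OF \<psi>m(1)[OF that] \<psi>_bnd[OF that]])
  have rL: "r i m \<in> Lmu" if "i < n" for i m
    by (rule Lmu_mono[OF \<phi>[OF that] \<psi>m(2)[OF that]]) (simp add: r_def)
  have ir: "integrable V (\<lambda>z. \<bar>r i m (fst z)\<bar> * \<bar>r i m (snd z)\<bar>)" if "i < n" for i m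
    using rL[OF that] by (simp add: Lmu_iff split_beta')
  have e0: "0 \<le> e i m" for i m by (simp add: e_def)
  have Aev: "\<forall>\<^sub>F m in sequentially. A m x" for x
  proof -
    obtain N :: nat where N: "(\<Sum>i<n. \<bar>\<phi> i x\<bar>) \<le> real N" using real_arch_simple by blast
    then have "A m x" if "m \<ge> N" for m using that unfolding A_def by (meson of_nat_mono order.trans)
    then show ?thesis by (auto simp: eventually_sequentially)
  qed
  have e_lim: "(\<lambda>m. e i m) \<longlonglongrightarrow> 0" if i: "i < n" for i
  proof -
    have i\<phi>: "integrable V (\<lambda>z. \<bar>\<phi> i (fst z)\<bar> * \<bar>\<phi> i (snd z)\<bar>)" using \<phi>[OF i]
      by (simp add: Lmu_iff split_beta')
    have "(\<lambda>m. e i m) \<longlonglongrightarrow> (LINT z|V. 0)" unfolding e_def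
    proof (rule integral_dominated_convergence[OF _ _ i\<phi>])
      show "AE z in V. (\<lambda>m. \<bar>r i m (fst z)\<bar> * \<bar>r i m (snd z)\<bar>) \<longlonglongrightarrow> 0"
      proof (rule AE_I2)
        fix z
        have "\<forall>\<^sub>F m in sequentially. \<bar>r i m (fst z)\<bar> * \<bar>r i m (snd z)\<bar> = 0"
          using Aev[of "fst z"] by eventually_elim (simp add: r_def)
        then show "(\<lambda>m. \<bar>r i m (fst z)\<bar> * \<bar>r i m (snd z)\<bar>) \<longlonglongrightarrow> 0" by (rule tendsto_eventually)
      qed
      show "AE z in V. norm (\<bar>r i m (fst z)\<bar> * \<bar>r i m (snd z)\<bar>) \<le> \<bar>\<phi> i (fst z)\<bar> * \<bar>\<phi> i (snd z)\<bar>" for m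
        by (intro AE_I2) (auto simp: r_def)
      show "(\<lambda>z. \<bar>r i m (fst z)\<bar> * \<bar>r i m (snd z)\<bar>) \<in> borel_measurable V" for m
        by (rule borel_measurable_integrable[OF ir[OF i]])
    qed simp
    then show ?thesis by simp
  qed
  have inn_small: "\<bar>inn d d\<bar> \<le> e i m" if i: "i < n"
    and d: "d \<in> borel_measurable (interval_borel T)" "\<And>x. \<bar>d x\<bar> \<le> \<bar>r i m x\<bar>" for i m d
  proof -
    have dL: "d \<in> Lmu" by (rule Lmu_mono[OF rL[OF i] d])
    have dm: "(\<lambda>(x, y). d x * d y) \<in> borel_measurable V" unfolding meas_eq by (intro tensor_measurable d(1))
    have id: "integrable V (\<lambda>(x, y). \<bar>d x\<bar> * \<bar>d y\<bar>)" using dL by (simp add: Lmu_iff)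
    have id': "integrable V (\<lambda>(x, y). d x * d y)"
      by (rule Bochner_Integration.integrable_bound[OF id dm]) (auto simp: abs_mult)
    have "\<bar>inn d d\<bar> \<le> (LINT z|V. \<bar>case z of (x, y) \<Rightarrow> d x * d y\<bar>)" unfolding inn_def by (rule I_le[OF id'])
    also have "\<dots> \<le> e i m" unfolding e_def
    proof (rule integral_mono)
      show "integrable V (\<lambda>z. \<bar>case z of (x, y) \<Rightarrow> d x * d y\<bar>)" by (rule integrable_abs[OF id'])
      show "\<bar>case z of (x, y) \<Rightarrow> d x * d y\<bar> \<le> \<bar>r i m (fst z)\<bar> * \<bar>r i m (snd z)\<bar>" for z
        using d(2) by (auto simp: split_beta abs_mult intro!: mult_mono)
    qed (rule ir[OF i])
    finally show ?thesis .
  qed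
  \<comment> \<open>Positivity pays off here: the absolute integral of \<open>r i m\<close> against
    \<open>u w\<close> may diverge, but Cauchy-Schwarz for the bounded difference involves only its
    semiscalar square, which is at most \<open>e i m\<close>.\<close>
  have cauchy: "\<bar>inn (\<psi> i l) (u w) - inn (\<psi> i m) (u w)\<bar> \<le> sqrt (e i m) * sqrt (U w)"
    if i: "i < n" and ml: "m \<le> l" and w: "w \<in> space M" for i m l w
  proof -
    let ?d = "\<lambda>x. \<psi> i l x - \<psi> i m x"
    obtain C where C: "\<And>x. x \<in> {0..T} \<Longrightarrow> \<bar>u w x\<bar> \<le> C" using u_bounded[OF w] by blast
    have dm: "?d \<in> borel_measurable (interval_borel T)" using \<psi>m[OF i] by simp
    have "A l x" if "A m x" for x using that ml unfolding A_def by (meson of_nat_mono order.trans)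
    then have dr: "\<bar>?d x\<bar> \<le> \<bar>r i m x\<bar>" for x by (auto simp: \<psi>_def r_def)
    have db: "\<bar>?d x\<bar> \<le> real l + real m" for x
      using \<psi>_bnd[OF i, of l x] \<psi>_bnd[OF i, of m x] by linarith
    have "(inn ?d (u w))\<^sup>2 \<le> inn ?d ?d * inn (u w) (u w)"
      by (rule inn_cauchy_schwarz[OF dm db u_measurable[OF w] C])
    also have "\<dots> \<le> e i m * U w"
    proof (rule mult_mono)
      show "inn ?d ?d \<le> e i m" using inn_small[OF i dm dr] by linarith
      show "inn (u w) (u w) \<le> U w" using inn_self_le[OF u_L2[OF w]] by (simp add: U_def)
      show "0 \<le> inn (u w) (u w)" by (rule inn_nonneg[OF approx_bounded[OF u_measurable[OF w] C]])
    qed (rule e0)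
    finally have "\<bar>inn ?d (u w)\<bar> \<le> sqrt (e i m * U w)" by (simp add: real_le_rsqrt)
    then show ?thesis by (simp add: inn_diff_left[OF \<psi>L[OF i] \<psi>L[OF i] u_L2[OF w]] real_sqrt_mult)
  qed
  \<comment> \<open>\<open>B i w\<close> stands in for the pairing of \<open>\<phi> i\<close> with
    \<open>u w\<close>, which need not exist as an absolutely convergent integral.\<close>
  define B where "B i w = lim (\<lambda>m. inn (\<psi> i m) (u w))" for i w
  have B_lim: "(\<lambda>m. inn (\<psi> i m) (u w)) \<longlonglongrightarrow> B i w" if i: "i < n" and w: "w \<in> space M" for i w
  proof -
    have "(\<lambda>m. sqrt (e i m) * sqrt (U w)) \<longlonglongrightarrow> sqrt 0 * sqrt (U w)" by (intro tendsto_intros e_lim i)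
    then have lim: "(\<lambda>m. sqrt (e i m) * sqrt (U w)) \<longlonglongrightarrow> 0" by simp
    have "Cauchy (\<lambda>m. inn (\<psi> i m) (u w))"
    proof (rule CauchyI')
      fix \<epsilon> :: real assume "0 < \<epsilon>"
      then obtain N where N: "\<And>m. m \<ge> N \<Longrightarrow> sqrt (e i m) * sqrt (U w) < \<epsilon>"
        using order_tendstoD(2)[OF lim] by (auto simp: eventually_sequentially)
      have "dist (inn (\<psi> i m) (u w)) (inn (\<psi> i l) (u w)) < \<epsilon>" if "m \<ge> N" "l > m" for m l
        using cauchy[OF i less_imp_le[OF that(2)] w] N[OF that(1)]
          by (simp add: dist_real_def abs_minus_commute)
      then show "\<exists>N. \<forall>m\<ge>N. \<forall>l>m. dist (inn (\<psi> i m) (u w)) (inn (\<psi> i l) (u w)) < \<epsilon>" by blast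
    qed
    then show ?thesis unfolding B_def by (simp add: Cauchy_convergent_iff convergent_LIMSEQ_iff)
  qed
  have B_close: "(inn (\<psi> i m) (u w) - B i w)\<^sup>2 \<le> e i m * U w" if i: "i < n" and w: "w \<in> space M" for i m w
  proof -
    have "(\<lambda>l. \<bar>inn (\<psi> i l) (u w) - inn (\<psi> i m) (u w)\<bar>) \<longlonglongrightarrow> \<bar>B i w - inn (\<psi> i m) (u w)\<bar>"
      by (intro tendsto_intros B_lim i w)
    then have "\<bar>B i w - inn (\<psi> i m) (u w)\<bar> \<le> sqrt (e i m) * sqrt (U w)"
      by (rule LIMSEQ_le_const2) (use cauchy[OF i _ w] in blast)
    then have "\<bar>inn (\<psi> i m) (u w) - B i w\<bar> \<le> sqrt (e i m * U w)"
      by (simp add: real_sqrt_mult abs_minus_commute)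
    then have "(inn (\<psi> i m) (u w) - B i w)\<^sup>2 \<le> (sqrt (e i m * U w))\<^sup>2"
      by (metis abs_ge_zero power2_abs power_mono)
    then show ?thesis using e0[of i m] U_nonneg[of w] by simp
  qed
  have Bm: "B i \<in> borel_measurable M" if "i < n" for i
    unfolding B_def[abs_def] using \<psi>m(1)[OF that] by (intro borel_measurable_lim_metric inn_u_measurable)
  have BD: "(\<lambda>w. inn (\<psi> i m) (u w) - B i w) \<in> L2_rv M"
    "expectation (\<lambda>w. (inn (\<psi> i m) (u w) - B i w)\<^sup>2) \<le> e i m * expectation U" if i: "i < n" for i m
  proof -
    have m: "(\<lambda>w. inn (\<psi> i m) (u w) - B i w) \<in> borel_measurable M"
      using Bm[OF i] inn_u_measurable[OF \<psi>m(1)[OF i]] by simp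
    have iU: "integrable M (\<lambda>w. e i m * U w)" using U_integrable by simp
    have i2: "integrable M (\<lambda>w. (inn (\<psi> i m) (u w) - B i w)\<^sup>2)"
    proof (rule Bochner_Integration.integrable_bound[OF iU])
      show "AE w in M. norm ((inn (\<psi> i m) (u w) - B i w)\<^sup>2) \<le> norm (e i m * U w)"
        using B_close[OF i] by (intro AE_I2) (auto intro: order.trans[OF _ abs_ge_self])
    qed (use m in simp)
    then show "(\<lambda>w. inn (\<psi> i m) (u w) - B i w) \<in> L2_rv M" using m by (simp add: L2_rv_def)
    have "expectation (\<lambda>w. (inn (\<psi> i m) (u w) - B i w)\<^sup>2) \<le> expectation (\<lambda>w. e i m * U w)"
      using i2 iU B_close[OF i] by (intro integral_mono_AE AE_I2) auto
    then show "expectation (\<lambda>w. (inn (\<psi> i m) (u w) - B i w)\<^sup>2) \<le> e i m * expectation U" by simp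
  qed
  have \<psi>uL: "(\<lambda>w. inn (\<psi> i m) (u w)) \<in> L2_rv M" if "i < n" for i m by (rule inn_u_L2(1)[OF \<psi>L[OF that]])
  have BL: "B i \<in> L2_rv M" if "i < n" for i
    using L2_rv_diff[OF \<psi>uL[OF that, of 0] BD(1)[OF that, of 0]] by simp
  have main: "expectation (\<lambda>w. g (\<lambda>j. W (\<phi> j) w) * Z w) = (\<Sum>i<n. expectation (\<lambda>w. partial_deriv i g (\<lambda>j. W (\<phi> j) w) * B i w))"
  proof (rule cylindrical_duality_limit[OF g Z_L2, where Yk="\<lambda>i m. W (\<psi> i m)"
    and Bk="\<lambda>i m w. inn (\<psi> i m) (u w)"])
    fix i assume i: "i < n"
    show "W (\<phi> i) \<in> L2_rv M" by (intro W_L2 \<phi> i)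
    show "W (\<psi> i m) \<in> L2_rv M" for m by (intro W_L2 L2_marg_Lmu \<psi>L i)
    show "(\<lambda>m. expectation (\<lambda>w. (W (\<psi> i m) w - W (\<phi> i) w)\<^sup>2)) \<longlonglongrightarrow> 0"
    proof (rule W_cont[OF \<phi>[OF i] L2_marg_Lmu[OF \<psi>L[OF i]]])
      have dm: "(\<lambda>s. \<psi> i m s - \<phi> i s) \<in> borel_measurable (interval_borel T)" for m using \<psi>m(1)[OF i] \<phi>m[OF i]
        by simp
      have dr: "\<bar>\<psi> i m s - \<phi> i s\<bar> \<le> \<bar>r i m s\<bar>" for m s by (auto simp: \<psi>_def r_def)
      show "(\<lambda>s. \<psi> i m s - \<phi> i s) \<in> Lmu" for m by (rule Lmu_mono[OF rL[OF i] dm dr])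
      show "(\<lambda>m. inn (\<lambda>s. \<psi> i m s - \<phi> i s) (\<lambda>s. \<psi> i m s - \<phi> i s)) \<longlonglongrightarrow> 0"
        by (rule Lim_null_comparison[OF _ e_lim[OF i]]) (use inn_small[OF i dm dr] in auto)
    qed
    show "B i \<in> L2_rv M" by (rule BL[OF i])
    show "(\<lambda>w. inn (\<psi> i m) (u w)) \<in> L2_rv M" for m by (rule \<psi>uL[OF i])
    have "(\<lambda>m. e i m * expectation U) \<longlonglongrightarrow> 0 * expectation U" by (intro tendsto_intros e_lim i)
    then have lim: "(\<lambda>m. e i m * expectation U) \<longlonglongrightarrow> 0" by simp
    show "(\<lambda>m. expectation (\<lambda>w. (inn (\<psi> i m) (u w) - B i w)\<^sup>2)) \<longlonglongrightarrow> 0"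
      by (rule Lim_null_comparison[OF _ lim]) (use BD(2)[OF i] in auto)
  next
    show "expectation (\<lambda>w. g (\<lambda>j. W (\<psi> j m) w) * Z w) =
        (\<Sum>i<n. expectation (\<lambda>w. partial_deriv i g (\<lambda>j. W (\<psi> j m) w) * inn (\<psi> i m) (u w)))" for m
      by (rule duality_approx[OF g \<psi>ap])
  qed
  have W\<phi>m: "W (\<phi> i) \<in> borel_measurable M" if "i < n" for i by (intro L2_rv_measurable W_L2 \<phi> that)
  have dBL: "(\<lambda>w. partial_deriv i g (\<lambda>j. W (\<phi> j) w) * B i w) \<in> L2_rv M" if i: "i < n" for i
  proof -
    note h = Cb_infinity_partial_deriv[OF g i]
    obtain C where "\<And>x. \<bar>partial_deriv i g x\<bar> \<le> C" using Cb_infinity_bounded[OF h] by blast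
    then show ?thesis by (intro L2_rv_bounded_mult[OF BL[OF i] Cb_infinity_measurable[OF h W\<phi>m]])
  qed
  have "(\<Sum>i<n. expectation (\<lambda>w. partial_deriv i g (\<lambda>j. W (\<phi> j) w) * B i w)) =
      expectation (\<lambda>w. \<Sum>i<n. partial_deriv i g (\<lambda>j. W (\<phi> j) w) * B i w)"
    using L2_rv_integrable[OF dBL] by (intro Bochner_Integration.integral_sum[symmetric]) auto
  \<comment> \<open>The limits exist for each \<open>i\<close>, but only their weighted sum, for
    which the guard provides absolute convergence, is identified with an integral.\<close>
  also have "\<dots> = expectation (\<lambda>w. inn (\<lambda>s. \<Sum>i<n. partial_deriv i g (\<lambda>j. W (\<phi> j) w) * \<phi> i s) (u w))"
  proof (rule integral_cong_AE)
    show "(\<lambda>w. \<Sum>i<n. partial_deriv i g (\<lambda>j. W (\<phi> j) w) * B i w) \<in> borel_measurable M"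
      using L2_rv_measurable[OF dBL] by (intro borel_measurable_sum) auto
    show "AE w in M. (\<Sum>i<n. partial_deriv i g (\<lambda>j. W (\<phi> j) w) * B i w) = inn (\<lambda>s. \<Sum>i<n. partial_deriv i g (\<lambda>j. W (\<phi> j) w) * \<phi> i s) (u w)"
      using guard AE_space
    proof eventually_elim
      case (elim w)
      define d where "d i = partial_deriv i g (\<lambda>j. W (\<phi> j) w)" for i
      define c where "c a = (\<Sum>i<n. d i * \<phi> i a)" for a
      have w: "w \<in> space M" and int: "integrable V (\<lambda>(a, b). c a * u w b)"
        using elim by (auto simp: c_def d_def)
      have c\<psi>: "(\<Sum>i<n. d i * \<psi> i m x) = (if A m x then c x else 0)" for m x by (simp add: \<psi>_def c_def)
      have "(\<lambda>m. \<Sum>i<n. d i * inn (\<psi> i m) (u w)) \<longlonglongrightarrow> (\<Sum>i<n. d i * B i w)"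
        by (intro tendsto_sum tendsto_mult_left B_lim w) auto
      moreover have "(\<Sum>i<n. d i * inn (\<psi> i m) (u w)) = inn (\<lambda>x. if A m x then c x else 0) (u w)" for m
        unfolding c\<psi>[symmetric] by (rule inn_sum_left[symmetric]) (use \<psi>L u_L2[OF w] in auto)
      moreover have "(\<lambda>m. inn (\<lambda>x. if A m x then c x else 0) (u w)) \<longlonglongrightarrow> inn c (u w)"
        unfolding inn_def
      proof (rule I_dominated[OF _ _ integrable_abs[OF int]])
        have cm: "(\<lambda>x. if A m x then c x else 0) \<in> borel_measurable (interval_borel T)" for m
          unfolding c\<psi>[symmetric] using \<psi>m(1) by (intro borel_measurable_sum borel_measurable_times) auto
        show "(\<lambda>(x, y). (if A m x then c x else 0) * u w y) \<in> borel_measurable (square_borel T)" for m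
          by (rule tensor_measurable[OF cm u_measurable[OF w]])
        show "(\<lambda>(x, y). c x * u w y) \<in> borel_measurable (square_borel T)"
          using borel_measurable_integrable[OF int] by (simp only: meas_eq)
        show "\<bar>case z of (x, y) \<Rightarrow> (if A m x then c x else 0) * u w y\<bar> \<le> \<bar>case z of (a, b) \<Rightarrow> c a * u w b\<bar>"
          for m z
          by (simp add: split_beta)
        show "(\<lambda>m. case z of (x, y) \<Rightarrow> (if A m x then c x else 0) * u w y) \<longlonglongrightarrow> (case z of (x, y) \<Rightarrow> c x * u w y)"
          for z
        proof (rule tendsto_eventually)
          show "\<forall>\<^sub>F m in sequentially. (case z of (x, y) \<Rightarrow> (if A m x then c x else 0) * u w y) = (case z of (x, y) \<Rightarrow> c x * u w y)"
            using Aev[of "fst z"] by eventually_elim (simp add: split_beta)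
        qed
      qed
      ultimately have "(\<Sum>i<n. d i * B i w) = inn c (u w)" using LIMSEQ_unique by simp
      then show ?case by (simp add: c_def[abs_def] d_def)
    qed
  qed (use guard' in simp)
  finally show ?thesis using main by simp
qed

end

section \<open>The canonical process\<close>

lemma (in real_signed_measure) signed_measure: "signed_measure M \<mu>"
proof -
  have "(\<lambda>i. \<mu> (A i)) sums \<mu> (\<Union>i. A i)" if "range A \<subseteq> sets M" "disjoint_family A" for A :: "nat \<Rightarrow> 'a set"
  proof -
    have "A i \<in> sets M" for i using that by auto
    then show ?thesis using m_sums[OF that] \<mu>_eq sets.countable_UN[OF that(1)] by (simp add: sums_ereal)
  qed
  then show ?thesis using \<mu>_eq m_empty by (auto simp: signed_measure_def zero_ereal_def)
qed

context gaussian_cov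
begin

text \<open>The points of the square with maximum at most \<open>s\<close> form the square over
  \<open>{0..s}\<close>, whose covariance mass is \<open>\<gamma> s\<close>. The image under the
  maximum is therefore a Stieltjes measure for \<open>\<gamma>\<close>, and uniqueness identifies it
  with the chosen one.\<close>

lemma stieltjes_integral_variance:
  assumes \<gamma>: "\<And>s. s \<in> {0..T} \<Longrightarrow> \<gamma> s = expectation (\<lambda>w. (X s w)\<^sup>2)"
    and h: "(\<lambda>s. h s * indicator {0..t} s) \<in> borel_measurable (interval_borel T)"
    and C: "\<And>s. s \<in> {0..T} \<Longrightarrow> \<bar>h s * indicator {0..t} s\<bar> \<le> C"
  shows "stieltjes_integral T \<gamma> h t = I (\<lambda>z. h (max (fst z) (snd z)) * indicator {0..t} (max (fst z) (snd z)))"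
proof -
  let ?J = "interval_borel T"
  define mx :: "real \<times> real \<Rightarrow> real" where "mx z = max (fst z) (snd z)" for z
  have mx_m: "mx \<in> measurable (square_borel T) ?J" unfolding mx_def[abs_def] by (rule max_measurable_square)
  define a where "a = distr Mp ?J mx"
  define b where "b = distr Mn ?J mx"
  have fin: "finite_measure a" "finite_measure b"
    unfolding a_def b_def using mx_m by (auto intro!: P.finite_measure_distr N.finite_measure_distr)
  have sets: "sets a = sets ?J" "sets b = sets ?J" by (simp_all add: a_def b_def)
  define m where "m E = measure a E - measure b E" for E
  interpret r: real_signed_measure ?J "\<lambda>E. ereal (m E)" m
    unfolding m_def[abs_def] using real_signed_measure_diff[OF fin sets] by simp
  have J: "{0..s} \<in> sets ?J" if "s \<le> T" for s
    using that by (simp add: sets_restrict_space_iff)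
  have J': "{p<..q} \<in> sets ?J" if "0 \<le> p" "q \<le> T" for p q
    using that by (auto simp: sets_restrict_space_iff)
  have m_le: "m {0..s} = \<gamma> s" if s: "s \<in> {0..T}" for s
  proof -
    have "mx -` {0..s} \<inter> ({0..T} \<times> {0..T}) = {0..s} \<times> {0..s}" 
      using s by (auto simp: mx_def)
    then have "m {0..s} = measure Mp ({0..s} \<times> {0..s}) - measure Mn ({0..s} \<times> {0..s})"
      using J[of s] s mx_m by (simp add: m_def a_def b_def measure_distr space_Mp space_Mn)
    then show ?thesis using cov[OF s s] \<gamma>[OF s] by (simp add: power2_eq_square)
  qed
  have \<gamma>0: "\<gamma> 0 = 0" using \<gamma>[of 0] T_pos X_0 by (simp cong: Bochner_Integration.integral_cong)
  define Q where "Q \<nu> \<longleftrightarrow> signed_measure ?J \<nu> \<and> \<nu> {0} = 0 \<and>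
        (\<forall>a b. 0 \<le> a \<and> a \<le> b \<and> b \<le> T \<longrightarrow> \<nu> {a<..b} = ereal (\<gamma> b - \<gamma> a))" for \<nu>
  \<comment> \<open>Existence comes first: without a witness the choice operator behind
    \<open>stieltjes_measure\<close> would give an unspecified value.\<close>
  have "Q (\<lambda>E. ereal (m E))"
    unfolding Q_def
  proof (intro conjI allI impI)
    show "signed_measure ?J (\<lambda>E. ereal (m E))" by (rule r.signed_measure)
    show "ereal (m {0}) = 0" using m_le[of 0] \<gamma>0 T_pos by simp
    fix p q assume pq: "0 \<le> p \<and> p \<le> q \<and> q \<le> T"
    have "{p<..q} = {0..q} - {0..p}" using pq by auto
    then show "ereal (m {p<..q}) = ereal (\<gamma> q - \<gamma> p)"
      using pq r.m_Diff[OF J[of q] J[of p]] m_le by simp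
  qed
  then have "Q (SOME \<nu>. Q \<nu>)" by (rule someI[of Q])
  moreover have "stieltjes_measure T \<gamma> = (SOME \<nu>. Q \<nu>)"
    by (simp add: stieltjes_measure_def Q_def)
  ultimately have "Q (stieltjes_measure T \<gamma>)" by simp
  then obtain \<nu> where \<nu>: "\<nu> = stieltjes_measure T \<gamma>" "signed_measure ?J \<nu>" "\<nu> {0} = 0"
    "\<And>a b. 0 \<le> a \<Longrightarrow> a \<le> b \<Longrightarrow> b \<le> T \<Longrightarrow> \<nu> {a<..b} = ereal (\<gamma> b - \<gamma> a)" by (auto simp: Q_def)
  \<comment> \<open>The normalisation at the point 0 matches \<open>\<gamma> 0 = 0\<close>, so the
    increments over half-open intervals fix the values on closed ones.\<close>
  have \<nu>_le: "\<nu> {0..s} = ereal (\<gamma> s)" if s: "s \<in> {0..T}" for s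
  proof -
    have "{0..s} = {0} \<union> {0<..s}" using s by auto
    then show ?thesis
      using signed_measure_Un[OF \<nu>(2) J[of 0] J'[of 0 s]] \<nu>(3) \<nu>(4)[of 0 s] \<gamma>0 s by simp
  qed
  have rk: "real_signed_measure ?J \<nu> (\<lambda>A. real_of_ereal (\<nu> A))"
    using \<nu>_le[of T] T_pos by (intro real_signed_measureI[OF \<nu>(2)]) (simp add: space_interval_borel)
  interpret k: real_signed_measure ?J \<nu> "\<lambda>A. real_of_ereal (\<nu> A)" by (rule rk)
  have "real_of_ereal (\<nu> A) = m A" if A: "A \<in> sets ?J" for A
  proof (rule real_signed_measure_unique_atMost[OF rk r.real_signed_measure_axioms _ _ _ A])
    show "real_of_ereal (\<nu> ({0..T} \<inter> {..x})) = m ({0..T} \<inter> {..x})" for x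
    proof (cases "x < 0")
      case True
      then have "{0..T} \<inter> {..x} = {}" by auto
      then show ?thesis using k.m_empty r.m_empty by simp
    next
      case False
      then have "{0..T} \<inter> {..x} = {0..min T x}" by auto
      then show ?thesis using \<nu>_le[of "min T x"] m_le[of "min T x"] False T_pos by simp
    qed
  qed (use \<nu>_le[of T] m_le[of T] T_pos in auto)
  then have eq: "\<nu> A = ereal (measure a A - measure b A)" if "A \<in> sets ?J" for A
    using k.\<mu>_eq[OF that] that by (simp add: m_def)
  let ?h = "\<lambda>s. h s * indicator {0..t} s"
  have hab: "?h \<in> borel_measurable a" "?h \<in> borel_measurable b"
    using h sets by (simp_all cong: measurable_cong_sets)
  have "space a = {0..T}" "space b = {0..T}" by (simp_all add: a_def b_def space_interval_borel)
  then have int: "integrable a ?h" "integrable b ?h"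
    using C hab by (auto intro!: finite_measure.integrable_const_bound[OF fin(1), of _ C]
        finite_measure.integrable_const_bound[OF fin(2), of _ C])
  have "stieltjes_integral T \<gamma> h t = integral\<^sup>L a ?h - integral\<^sup>L b ?h"
    unfolding stieltjes_integral_def \<nu>(1)[symmetric]
    by (rule signed_integral_eq_diff[OF fin sets eq int])
  also have "\<dots> = I (\<lambda>z. ?h (mx z))"
    unfolding a_def b_def I_def using mx_m h by (simp add: integral_distr)
  finally show ?thesis by (simp add: mx_def)
qed

end

section \<open>The Gaussian space of the coordinates\<close>

lemma mspace_C0_metric: "w \<in> mspace (C0_metric T) \<Longrightarrow> continuous_on {0..T} w \<and> w 0 = 0"
  by (auto simp: C0_metric_def mspace_cfunspace)

lemma measurable_canonical:
  assumes "sets P = sets (C0_algebra T)" "t \<in> {0..T}"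
  shows "(\<lambda>w. w t) \<in> borel_measurable P"
proof (rule measurableI)
  fix B :: "real set" assume B: "B \<in> sets borel"
  have sp: "space P = mspace (C0_metric T)"
    using sets_eq_imp_space_eq[OF assms(1)] by (simp add: C0_algebra_def space_measure_of_conv)
  have "{w \<in> mspace (C0_metric T). w t \<in> B} \<in> sets (C0_algebra T)"
    unfolding C0_algebra_def using B assms(2) by (subst sets_measure_of) (auto intro!: sigma_sets.Basic)
  also have "{w \<in> mspace (C0_metric T). w t \<in> B} = (\<lambda>w. w t) -` B \<inter> space P" by (auto simp: sp)
  finally show "(\<lambda>w. w t) -` B \<inter> space P \<in> sets P" by (simp add: assms(1))
qed simp

lemma gaussian_rv_integrable:
  assumes "prob_space P" "gaussian_rv P Y"
  shows "integrable P Y"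
proof -
  interpret prob_space P by fact
  have Y: "Y \<in> borel_measurable P" using assms(2) by (simp add: gaussian_rv_def)
  consider m where "AE w in P. Y w = m" | m s where "s > 0" "distributed P lborel Y (normal_density m s)"
    using assms(2) by (auto simp: gaussian_rv_def)
  then show ?thesis
  proof cases
    case 1
    then show ?thesis using integrable_cong_AE[OF Y, of "\<lambda>_. m"] by simp
  next
    case 2
    show ?thesis 
      using distributed_integrable[OF 2(2), of "\<lambda>x. x"] 2(1) integrable_normal_moment_nz_1[of s m] by simp
  qed
qed

text \<open>A constant with mean 0 is 0, and its law is the image of the standard normal law under
  multiplication by 0; in the other case the affine rule for normal densities rescales the standard
  law.\<close>

lemma centred_gaussian_law:
  assumes "prob_space P" "gaussian_rv P Y" and mean: "integral\<^sup>L P Y = 0"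
  shows "\<exists>v\<ge>0. distr P borel Y = centred_normal v"
proof -
  interpret prob_space P by fact
  have Y: "Y \<in> borel_measurable P" using assms(2) by (simp add: gaussian_rv_def)
  consider m where "AE w in P. Y w = m" | m s where "s > 0" "distributed P lborel Y (normal_density m s)"
    using assms(2) by (auto simp: gaussian_rv_def)
  then show ?thesis
  proof cases
    case 1
    interpret N: prob_space std_normal_distribution by (rule prob_space_normal_density) simp
    have "integral\<^sup>L P Y = m" using integral_cong_AE[OF Y _ 1] prob_space by simp
    then have "AE w in P. Y w = 0" using 1 mean by simp
    then have "distr P borel Y = distr P borel (\<lambda>_. 0)"
      using Y by (intro distr_cong_AE) auto
    also have "\<dots> = return borel 0" by (intro distr_const) simp
    also have "\<dots> = centred_normal 0"
      by (simp add: centred_normal_def N.distr_const)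
    finally show ?thesis by blast
  next
    case 2
    interpret N: prob_space std_normal_distribution by (rule prob_space_normal_density) simp
    have m: "m = 0" using normal_distributed_expectation[OF 2] mean by simp
    have "distr P borel Y = distr P lborel Y" by (rule distr_cong) auto
    also have "\<dots> = density lborel (normal_density 0 s)"
      using distributed_distr_eq_density[OF 2(2)] m by simp
    also have "\<dots> = centred_normal (s\<^sup>2)"
    proof -
      have "distributed std_normal_distribution lborel (\<lambda>x. x) std_normal_density"
        by (auto simp: distributed_def distr_id2 intro!: AE_I2)
      then have "distributed std_normal_distribution lborel (\<lambda>x. 0 + s * x) (normal_density (0 + s * 0) (\<bar>s\<bar> * 1))"
        using 2(1) by (intro N.normal_density_affine) auto
      then have "density lborel (normal_density 0 s) = distr std_normal_distribution lborel (\<lambda>x. s * x)"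
        using 2(1) distributed_distr_eq_density by fastforce
      also have "\<dots> = centred_normal (s\<^sup>2)"
        unfolding centred_normal_def using 2(1) by (intro distr_cong) auto
      finally show ?thesis .
    qed
    finally show ?thesis by (intro exI[of _ "s\<^sup>2"]) simp
  qed
qed

text \<open>Finite combinations without any closure in mean square: their laws are prescribed
  directly by \<open>gaussian_process\<close>.\<close>

definition canonical_span :: "real \<Rightarrow> ((real \<Rightarrow> real) \<Rightarrow> real) set" where
  "canonical_span T = {\<lambda>w. \<Sum>t\<in>I. c t * w t | I c. finite I \<and> I \<subseteq> {0..T}}"

lemma canonical_span_gaussian: "gaussian_process T P \<Longrightarrow> Y \<in> canonical_span T \<Longrightarrow> gaussian_rv P Y"
  by (auto simp: gaussian_process_def canonical_span_def)

lemma canonical_span_coordinate: "t \<in> {0..T} \<Longrightarrow> (\<lambda>w. w t) \<in> canonical_span T"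
  unfolding canonical_span_def by (intro CollectI exI[of _ "{t}"] exI[of _ "\<lambda>_. 1"]) auto

lemma gaussian_space_canonical:
  assumes P: "prob_space P" and gp: "gaussian_process T P"
    and mean: "\<And>t. t \<in> {0..T} \<Longrightarrow> integral\<^sup>L P (\<lambda>w. w t) = 0"
  shows "gaussian_space (completion P) (canonical_span T)"
proof (intro gaussian_space.intro gaussian_space_axioms.intro)
  interpret prob_space P by fact
  show "prob_space (completion P)" by (rule prob_space_completion)
  show "(\<lambda>w. a * X w + b * Y w) \<in> canonical_span T" if XY: "X \<in> canonical_span T" "Y \<in> canonical_span T"
    for X Y a b
  proof -
    obtain I c J d where X: "X = (\<lambda>w. \<Sum>t\<in>I. c t * w t)" "finite I" "I \<subseteq> {0..T}"
      and Y: "Y = (\<lambda>w. \<Sum>t\<in>J. d t * w t)" "finite J" "J \<subseteq> {0..T}"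
      using XY by (auto simp: canonical_span_def)
    have "a * X w + b * Y w =
      (\<Sum>t\<in>I \<union> J. (a * (if t \<in> I then c t else 0) + b * (if t \<in> J then d t else 0)) * w t)" for w
    proof -
      have "X w = (\<Sum>t\<in>I \<union> J. (if t \<in> I then c t else 0) * w t)" "Y w = (\<Sum>t\<in>I \<union> J. (if t \<in> J then d t else 0) * w t)"
        unfolding X Y using X(2) Y(2) by (auto intro!: sum.mono_neutral_cong_left)
      then show ?thesis by (simp add: sum_distrib_left sum.distrib distrib_right mult.assoc)
    qed
    then show ?thesis
      unfolding canonical_span_def using X Y by (intro CollectI exI[of _ "I \<union> J"] exI conjI) auto
  qed
  show "(\<lambda>_. 0) \<in> canonical_span T"
    unfolding canonical_span_def by (intro CollectI exI[of _ "{}"]) auto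
  fix Y assume Y: "Y \<in> canonical_span T"
  have g: "gaussian_rv P Y" using canonical_span_gaussian[OF gp Y] .
  then have Ym: "Y \<in> borel_measurable P" by (simp add: gaussian_rv_def)
  then show "Y \<in> borel_measurable (completion P)" by (rule measurable_completion)
  obtain I c where I: "Y = (\<lambda>w. \<Sum>t\<in>I. c t * w t)" "finite I" "I \<subseteq> {0..T}"
    using Y by (auto simp: canonical_span_def)
  have "integral\<^sup>L P Y = (\<Sum>t\<in>I. integral\<^sup>L P (\<lambda>w. c t * w t))"
    unfolding I using I(3) gaussian_rv_integrable[OF P canonical_span_gaussian[OF gp canonical_span_coordinate]]
    by (intro Bochner_Integration.integral_sum integrable_mult_right) auto
  also have "\<dots> = 0" using I(3) mean by (intro sum.neutral) auto
  finally show "\<exists>v\<ge>0. distr (completion P) borel Y = centred_normal v"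
    unfolding distr_completion[OF Ym] by (rule centred_gaussian_law[OF P g])
qed

theorem corollary8p13:
  fixes T :: real
    and P :: "(real \<Rightarrow> real) measure"
    and \<mu> :: "(real \<times> real) set \<Rightarrow> ereal"
    and W :: "(real \<Rightarrow> real) \<Rightarrow> (real \<Rightarrow> real) \<Rightarrow> real"
    and f f' f'' :: "real \<Rightarrow> real"
  assumes "T > 0"
    and "prob_space P" and "sets P = sets (C0_algebra T)"
    and "gaussian_process T P"
    and "\<And>t. t \<in> {0..T} \<Longrightarrow> integral\<^sup>L P (\<lambda>w. w t) = 0"
    and "full_support T P"
    and "covariance_measure T P \<mu>"
    and "is_wiener_integral (completion P) T \<mu> W"
    and "\<And>x. (f has_real_derivative f' x) (at x)"
    and "\<And>x. (f' has_real_derivative f'' x) (at x)"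
    and "continuous_on UNIV f''" and "bounded (range f'')"
  shows "\<forall>t\<in>{0..T}. \<exists>Z.
    has_skorohod_integral (completion P) T \<mu> W (\<lambda>w s. f' (w s) * indicator {0..t} s) Z \<and>
    (AE w in completion P.
       f (w t) = f (w 0) + Z w
         + 1 / 2 * stieltjes_integral T (\<lambda>s. prob_space.variance P (\<lambda>v. v s)) (\<lambda>s. f'' (w s)) t)"
proof
  fix t assume t: "t \<in> {0..T}"
  note T_pos = assms(1) and P = assms(2) and sets_P = assms(3) and gp = assms(4) and mean = assms(5)
    and covm = assms(7) and wiener = assms(8)
  let ?S = "square_borel T"
  interpret canon: prob_space P by (rule P)
  have path: "continuous_on {0..T} w \<and> w 0 = 0" if "w \<in> space P" for w
    using that sets_eq_imp_space_eq[OF sets_P]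
    by (intro mspace_C0_metric) (simp add: C0_algebra_def space_measure_of_conv)
  have coord: "(\<lambda>w. w s) \<in> borel_measurable P" if "s \<in> {0..T}" for s
    by (rule measurable_canonical[OF sets_P that])
  have cov_eq: "covariance_fun P r s = integral\<^sup>L (completion P) (\<lambda>w. w r * w s)" if "r \<in> {0..T}" "s \<in> {0..T}"
    for r s
    using coord[OF that(1)] coord[OF that(2)] mean that by (simp add: covariance_fun_def integral_completion)
  have \<mu>: "signed_measure ?S \<mu>" "sigma_finite_measure (variation ?S \<mu>)"
      "\<And>r s. r \<in> {0..T} \<Longrightarrow> s \<in> {0..T} \<Longrightarrow> \<mu> ({0..r} \<times> {0..s}) = ereal (covariance_fun P r s)"
    using covm by (auto simp: covariance_measure_def)
  interpret \<mu>: real_signed_measure ?S \<mu> "\<lambda>A. real_of_ereal (\<mu> A)"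
    using \<mu>(3)[of T T] T_pos by (intro real_signed_measureI[OF \<mu>(1)]) (simp add: space_square_borel)
  let ?p = "jordan_pos ?S \<mu>" and ?n = "jordan_neg ?S \<mu>"
  have fin: "finite_measure ?p" "finite_measure ?n"
    using \<mu>.finite_jordan_pos[OF \<mu>(2)] \<mu>.finite_jordan_neg by auto
  interpret gaussian_space "completion P" "canonical_span T"
    by (rule gaussian_space_canonical[OF P gp mean])
  interpret gaussian_cov "completion P" "canonical_span T" T ?p ?n "\<lambda>s w. w s"
  proof (intro gaussian_cov.intro signed_pair.intro gaussian_cov_axioms.intro)
    show "gaussian_space (completion P) (canonical_span T)" by unfold_locales
    show "continuous_on {0..T} (\<lambda>s. w s)" "w 0 = 0" if "w \<in> space (completion P)" for w
      using path[of w] that by auto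
    show "measure ?p ({0..r} \<times> {0..s}) - measure ?n ({0..r} \<times> {0..s}) = integral\<^sup>L (completion P) (\<lambda>w. w r * w s)"
      if "r \<in> {0..T}" "s \<in> {0..T}" for r s
      using \<mu>.measure_jordan_diff[OF fin(1) rectangle_sets_square[of "{0..r}" "{0..s}" T]] that \<mu>(3) cov_eq
        by force
  qed (simp_all add: fin T_pos canonical_span_coordinate)
  \<comment> \<open>From here on \<open>V\<close>, \<open>inn\<close> and \<open>Lmu\<close> are
    translated into the variation, the semiscalar product and \<open>L_mu\<close> of the
    statement.\<close>
  have V_eq: "V = variation ?S \<mu>" by (simp add: V_def \<mu>.variation_eq)
  have inn_eq: "H_inner T \<mu> \<phi> \<psi> = inn \<phi> \<psi>" for \<phi> \<psi>
    by (simp add: H_inner_def inn_def I_def signed_integral_def)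
  have L_eq: "L_mu T \<mu> = Lmu" by (simp add: L_mu_def Lmu_def abs_H_norm_sq_def V_eq)
  obtain K where K: "\<bar>f'' x\<bar> \<le> K" for x
    using assms(12) by (auto simp: bounded_iff)
  interpret ito_setting "completion P" "canonical_span T" T ?p ?n "\<lambda>s w. w s" W f' f'' K t f
  proof (intro ito_setting.intro wiener_cov.intro wiener_cov_axioms.intro integrand.intro integrand_axioms.intro ito_setting_axioms.intro)
    show "gaussian_cov (completion P) (canonical_span T) T ?p ?n (\<lambda>s w. w s)"
      "gaussian_cov (completion P) (canonical_span T) T ?p ?n (\<lambda>s w. w s)" by unfold_locales
    show "(\<lambda>k. integral\<^sup>L (completion P) (\<lambda>w. (W (\<psi> k) w - W \<phi> w)\<^sup>2)) \<longlonglongrightarrow> 0"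
      if \<phi>: "\<phi> \<in> Lmu" and \<psi>: "\<And>k. \<psi> k \<in> Lmu" "\<And>k. (\<lambda>s. \<psi> k s - \<phi> s) \<in> Lmu"
        and lim: "(\<lambda>k. inn (\<lambda>s. \<psi> k s - \<phi> s) (\<lambda>s. \<psi> k s - \<phi> s)) \<longlonglongrightarrow> 0" for \<phi> and \<psi> :: "nat \<Rightarrow> real \<Rightarrow> real"
    proof -
      have "(\<lambda>k. H_norm T \<mu> (\<lambda>s. \<psi> k s - \<phi> s)) \<longlonglongrightarrow> 0"
        using tendsto_real_sqrt[OF lim] by (simp add: H_norm_def inn_eq)
      then show ?thesis using wiener \<phi> \<psi> by (simp add: is_wiener_integral_def L_eq)
    qed
  qed (use wiener in \<open>simp_all add: is_wiener_integral_def L_eq assms(9-11) K t[simplified]\<close>)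
  have u_eq: "(\<lambda>w s. f' (w s) * indicator {0..t} s) = u" by (simp add: u_def fun_eq_iff)
  have "has_skorohod_integral (completion P) T \<mu> W u Z"
    unfolding has_skorohod_integral_def
  proof (intro conjI allI ballI impI)
    show "(\<integral>\<^sup>+w. abs_H_norm_sq T \<mu> (u w) \<partial>completion P) < \<infinity>"
      using u_abs_norm by (simp add: abs_H_norm_sq_def V_eq)
    fix n g \<phi> assume g: "g \<in> Cb_infinity n" and \<phi>: "\<forall>i<n. \<phi> i \<in> L_mu T \<mu>"
      and guard: "AE w in completion P. H_inner_defined T \<mu> (cyl_deriv W n g \<phi> w) (u w)"
        "integrable (completion P) (\<lambda>w. H_inner T \<mu> (cyl_deriv W n g \<phi> w) (u w))"
    have c: "cyl_deriv W n g \<phi> w = (\<lambda>s. \<Sum>i<n. partial_deriv i g (\<lambda>j. W (\<phi> j) w) * \<phi> i s)" for w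
      by (simp add: cyl_deriv_def fun_eq_iff)
    \<comment> \<open>The guards of \<open>has_skorohod_integral\<close> supply the absolute
      convergence and the integrability with which the limit of truncations is identified.\<close>
    show "integral\<^sup>L (completion P) (\<lambda>w. cyl_rv W g \<phi> w * Z w) =
        integral\<^sup>L (completion P) (\<lambda>w. H_inner T \<mu> (cyl_deriv W n g \<phi> w) (u w))"
      using guard \<phi> unfolding cyl_rv_def c inn_eq H_inner_defined_def V_eq[symmetric] L_eq
      by (intro duality_Lmu[OF g]) auto
  qed (use u_joint Z_L2 Z_mean in auto)
  \<comment> \<open>With this \<open>Z\<close> the formula holds for every path of the space, hence
    almost surely.\<close>
  moreover have "f (w t) = f (w 0) + Z w
         + 1 / 2 * stieltjes_integral T (\<lambda>s. canon.variance (\<lambda>v. v s)) (\<lambda>s. f'' (w s)) t" if w: "w \<in> space P" for w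
  proof -
    have "stieltjes_integral T (\<lambda>s. canon.variance (\<lambda>v. v s)) (\<lambda>s. f'' (w s)) t = correction f'' t w"
      unfolding correction_def
    proof (rule stieltjes_integral_variance)
      show "canon.variance (\<lambda>v. v s) = integral\<^sup>L (completion P) (\<lambda>w. (w s)\<^sup>2)" if "s \<in> {0..T}" for s
        using coord[OF that] mean[OF that] by (simp add: integral_completion)
      have "continuous_on {0..T} (\<lambda>s. f'' (w s))"
        using path[OF w] assms(11) by (auto intro: continuous_on_compose2)
      then have "(\<lambda>s. f'' (w s)) \<in> borel_measurable (interval_borel T)"
        by (rule borel_measurable_continuous_on_restrict)
      then show "(\<lambda>s. f'' (w s) * indicator {0..t} s) \<in> borel_measurable (interval_borel T)"
        by (rule borel_measurable_times[OF _ borel_measurable_interval]) auto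
      show "\<bar>f'' (w s) * indicator {0..t} s\<bar> \<le> K" for s
        using K[of "w s"] by (auto simp: indicator_def)
    qed
    then show ?thesis by (simp add: Z_def)
  qed
  ultimately show "\<exists>Z. has_skorohod_integral (completion P) T \<mu> W (\<lambda>w s. f' (w s) * indicator {0..t} s) Z \<and>
    (AE w in completion P. f (w t) = f (w 0) + Z w
         + 1 / 2 * stieltjes_integral T (\<lambda>s. canon.variance (\<lambda>v. v s)) (\<lambda>s. f'' (w s)) t)"
    unfolding u_eq by (intro exI[of _ Z] conjI AE_I2) auto
qed

end
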